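(* Let $M\in\mathrm{mod}(\mathbb CQ)$, let $I$ be an injective $\mathbb CQ$-module, $P=\nu^{-1}(I)$, $m=\underline{\dim}M$, $i=\underline{\dim}I$, $[M,I]=\dim\mathrm{Hom}_{\mathbb CQ}(M,I)$. Then in $\mathcal T_\Lambda$ $$(t^{2[M,I]}-1)\,(g_M*X_M)\cdot X_{I[-1]}=t^{\Lambda({}^*i,{}^*m)}\Big(\sum_{[M'],[I'],\,I'\not\cong I}\Upsilon({}_{M'}\mathrm{Hom}_{\mathbb CQ}(M,I)_{I'})\,g_{M'\oplus I'[-1]}*X_{M'\oplus I'[-1]}$$ $$+\,t^{\langle m,i\rangle}\sum_{[M''],[P'],\,P'\not\cong P}\Upsilon({}_{P'}\mathrm{Hom}_{\mathbb CQ}(P,M)_{M''})\,\tilde g_{M''\oplus P'[1]}*X_{M''\oplus P'[1]}\Big)$$ and $$(t^{2[M,I]}-1)\,X_{I[-1]}\cdot(g_M*X_M)=t^{\Lambda({}^*m,{}^*i)}\Big(\sum_{[M'],[I'],\,I'\not\cong I}\Upsilon({}_{M'}\mathrm{Hom}_{\mathbb CQ}(M,I)_{I'})\,g_{M'\oplus I'[-1]}*X_{M'\oplus I'[-1]}$$ $$+\,t^{-\langle m,i\rangle}\sum_{[M''],[P'],\,P'\not\cong P}\Upsilon({}_{P'}\mathrm{Hom}_{\mathbb CQ}(P,M)_{M''})\,\tilde g_{M''\oplus P'[1]}*X_{M''\oplus P'[1]}\Big).$$ Here, since there may be infinitely many isoclasses, the sums over isoclasses stand for the motivic integrals $\int_{0\neq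 f\in\mathrm{Hom}(M,I)}g_{\ker f\oplus\mathrm{coker}f[-1]}*X_{\ker f\oplus\mathrm{coker}f[-1]}$ and $\int_{0\neq h\in\mathrm{Hom}(P,M)}\tilde g_{\mathrm{coker}h\oplus\ker h[1]}*X_{\mathrm{coker}h\oplus\ker h[1]}$ respectively, with the convention for integrals given in the context.
   Context: **Quiver.** $Q$ is an acyclic quiver with $r$ vertices, with simple modules $S_1,\dots,S_r$. $\langle x,y\rangle=x^{t}Ey$ is the Euler form on $K_0(\mathrm{mod}(\mathbb CQ))=\mathbb Z^r$, $E_{ij}=\dim\mathrm{Hom}(S_i,S_j)-\dim\mathrm{Ext}^1(S_i,S_j)$. Put $B=E-E^{t}$; it is assumed that there is a skew-symmetric integral matrix $\Lambda$ with $-\Lambda B=I_r$. Write $\Lambda(x,y)=x^{t}\Lambda y$, $e^*=E^{t}e$, ${}^*e=Ee$. $\mathcal T_\Lambda$ is the $\mathbb C(t)$-algebra with basis $X^\alpha$ ($\alpha\in\mathbb Z^r$) and $X^\alpha\cdot X^{\alpha'}=t^{\Lambda(\alpha,\alpha')}X^{\alpha+\alpha'}$. $\nu=D\mathrm{Hom}_{\mathbb CQ}(-,\mathbb CQ)$ is the Nakayama functor, an equivalence from projective to injective modules. In the cluster category $\mathcal C(Q)=D^b(\mathrm{mod}(\mathbb CQ))/\tau^{-1}[1]$ one has $I[-1]\cong P[1]$ for $P=\nu^{-1}(I)$. **Virtual Poincaré polynomial and integrals.** $\Upsilon$ is the unique assignment of polynomials in $t$ to locally closed subsets of smooth projective complex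 varieties (extended additively to constructible sets) with $\Upsilon(X)=\sum_{i=0}^{2\dim X}\dim H^i_c(X,\mathbb C)t^i$ for $X$ smooth projective, additive on disjoint unions, and multiplicative on affine fibrations. For a constructible set $Y$ and $\varphi:Y\to\mathcal T_\Lambda$ with finitely many values and constructible level sets, $\int_Y\varphi=\sum_v\Upsilon(\varphi^{-1}(v))v$. An integral over $Y$ of an expression which is itself an integral over quiver Grassmannians attached to $y\in Y$ is the integral over the total space; here the total spaces are $\{(f,M_0):0\ne f\in\mathrm{Hom}(M,I),\ M_0\subseteq\ker f\}$ and $\{(h,L_0):0\neq h\in\mathrm{Hom}(P,M),\ L_0\subseteq\mathrm{coker}\,h\}$ (the latter identified with $\{(h,M_0):\mathrm{Im}\,h\subseteq M_0\subseteq M\}$). **Characters.** $\mathrm{Gr}_e(M)$ is the variety of submodules of $M$ of dimension vector $e$. For a module $M$ with $m=\underline{\dim}M$, an injective module $I$ with $i=\underline{\dim}I$ and a projective module $P$ with $p=\underline{\dim}P$: $$g_{M\oplus I[-1]}*X_{M\oplus I[-1]}=\sum_e\int_{M_0\in\mathrm{Gr}_e(M)}t^{-\langle e,m-i-e\rangle}X^{-e^*-{}^*(m-i-e)},$$ $$\tilde g_{M\oplus P[1]}*X_{M\oplus P[1]}=\sum_e\int_{M_0\in\mathrm{Gr}_e(M)}t^{\langle p-e,m-e\rangle}X^{(p-e)^*-{}^*(m-e)}.$$ In particular $g_M*X_M$ is the case $I=0$ of the first formula, and $X_{I[-1]}=X^{{}^*i}$. **Hom-strata.** ${}_{M'}\mathrm{Hom}_{\mathbb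 CQ}(M,I)_{I'}=\{f:M\to I:\ker f\cong M',\ \mathrm{coker}f\cong I'\}$ ($I'$ is automatically injective) and ${}_{P'}\mathrm{Hom}_{\mathbb CQ}(P,M)_{M''}=\{h:P\to M:\ker h\cong P',\ \mathrm{coker}h\cong M''\}$ ($P'$ is automatically projective). The conditions $I'\not\cong I$ and $P'\not\cong P$ exclude exactly the zero maps. *)

theory Defs
  imports
    "HOL-Analysis.Analysis"
    "HOL-Homology.Simplices"
    "HOL-Library.Function_Algebras"
    "HOL-Library.Poly_Mapping"
    "HOL-Computational_Algebra.Computational_Algebra"
begin

section \<open>Coordinate vector spaces\<close>

text \<open>
  Vectors are functions \<^typ>\<open>'k \<Rightarrow> complex\<close>; a coordinate space consists of the vectors supported
  on a given set of coordinates.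
\<close>

definition cscale :: "complex \<Rightarrow> ('k \<Rightarrow> complex) \<Rightarrow> 'k \<Rightarrow> complex" where
  "cscale c x = (\<lambda>k. c * x k)"

global_interpretation cfun: vector_space "cscale :: complex \<Rightarrow> ('k \<Rightarrow> complex) \<Rightarrow> 'k \<Rightarrow> complex"
  by unfold_locales (auto simp: cscale_def fun_eq_iff algebra_simps)

definition cspace :: "'k set \<Rightarrow> ('k \<Rightarrow> complex) set" where
  "cspace S = {x. \<forall>k. k \<notin> S \<longrightarrow> x k = 0}"

definition lin_app :: "'j set \<Rightarrow> ('i \<Rightarrow> 'j \<Rightarrow> complex) \<Rightarrow> ('j \<Rightarrow> complex) \<Rightarrow> 'i \<Rightarrow> complex" where
  "lin_app S A x = (\<lambda>i. \<Sum>j\<in>S. A i j * x j)"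

text \<open>Dimension of \<open>V/W\<close>: the least number of vectors of \<open>V\<close> spanning \<open>V\<close> modulo \<open>W\<close>
  (only meaningful when \<open>V/W\<close> is finite dimensional).\<close>

definition quot_dim :: "('k \<Rightarrow> complex) set \<Rightarrow> ('k \<Rightarrow> complex) set \<Rightarrow> nat" where
  "quot_dim V W = (LEAST n. \<exists>C. finite C \<and> card C = n \<and> C \<subseteq> V \<and> V \<subseteq> cfun.span (C \<union> W))"

definition dual_space :: "('k \<Rightarrow> complex) set \<Rightarrow> (('k \<Rightarrow> complex) \<Rightarrow> complex) set" where
  "dual_space U = {l. (\<forall>x\<in>U. \<forall>y\<in>U. l (x + y) = l x + l y)
     \<and> (\<forall>c. \<forall>x\<in>U. l (cscale c x) = c * l x) \<and> (\<forall>x. x \<notin> U \<longrightarrow> l x = 0)}"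


section \<open>Quasi-projective varieties\<close>

text \<open>
  A point is a pair of a vector \<open>x\<close> and a family \<open>p\<close> of subspaces.  The smooth variety
  \<open>ambient S n\<close> is the product of the affine space with coordinates \<open>S\<close> and, for each \<open>i\<close>, the
  (disconnected) Grassmannian of all subspaces of \<open>cspace (n i)\<close>; it is quasi-projective, and
  projective for empty \<open>S\<close>.  Subspaces of dimension \<open>1\<close> give projective spaces, so every
  quasi-projective variety embeds.

  Grassmannians carry the structure of quotients of the varieties of frames (linearly
  independent families): \<open>frame d F\<close> says that \<open>F\<close> consists of a vector (coordinates
  \<open>Inl c\<close>) and of \<open>d i\<close> independent vectors for each \<open>i\<close>, the \<open>k\<close>-th coordinate of the \<open>j\<close>-th one
  being \<open>F (Inr (i, j, k))\<close>; \<open>pt d F\<close> is the point it represents.  For \<open>d i = 1\<close> these are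
  the usual homogeneous coordinates.
\<close>

type_synonym ('c, 'i, 'b) point = "('c \<Rightarrow> complex) \<times> ('i \<Rightarrow> ('b \<Rightarrow> complex) set)"
type_synonym ('c, 'i, 'b) coords = "('c + 'i \<times> nat \<times> 'b) \<Rightarrow> complex"

definition ambient :: "'c set \<Rightarrow> ('i::finite \<Rightarrow> 'b set) \<Rightarrow> ('c, 'i, 'b) point set" where
  "ambient S n = {(x, p). x \<in> cspace S \<and> (\<forall>i. cfun.subspace (p i) \<and> p i \<subseteq> cspace (n i))}"

definition frame :: "('i::finite \<Rightarrow> nat) \<Rightarrow> ('c, 'i, 'b) coords \<Rightarrow> bool" where
  "frame d F \<longleftrightarrow> (\<forall>i j k. d i \<le> j \<longrightarrow> F (Inr (i, j, k)) = 0) \<and>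
     (\<forall>i a. (\<forall>k. (\<Sum>j<d i. a j * F (Inr (i, j, k))) = 0) \<longrightarrow> (\<forall>j<d i. a j = 0))"

definition pt :: "('i::finite \<Rightarrow> nat) \<Rightarrow> ('c, 'i, 'b) coords \<Rightarrow> ('c, 'i, 'b) point" where
  "pt d F = (\<lambda>c. F (Inl c), \<lambda>i. cfun.span ((\<lambda>j k. F (Inr (i, j, k))) ` {..<d i}))"

inductive poly_function :: "(('k \<Rightarrow> complex) \<Rightarrow> complex) \<Rightarrow> bool" where
  pf_const: "poly_function (\<lambda>_. c)"
| pf_coord: "poly_function (\<lambda>F. F k)"
| pf_add: "poly_function f \<Longrightarrow> poly_function g \<Longrightarrow> poly_function (\<lambda>F. f F + g F)"
| pf_mult: "poly_function f \<Longrightarrow> poly_function g \<Longrightarrow> poly_function (\<lambda>F. f F * g F)"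

definition zclosed_in :: "'c set \<Rightarrow> ('i::finite \<Rightarrow> 'b set) \<Rightarrow> ('c, 'i, 'b) point set \<Rightarrow> bool" where
  "zclosed_in S n X \<longleftrightarrow> X \<subseteq> ambient S n \<and>
     (\<forall>d. \<exists>\<Phi>. (\<forall>\<phi>\<in>\<Phi>. poly_function \<phi>) \<and>
        (\<forall>F. frame d F \<and> pt d F \<in> ambient S n \<longrightarrow> (pt d F \<in> X \<longleftrightarrow> (\<forall>\<phi>\<in>\<Phi>. \<phi> F = 0))))"

definition zclosed :: "('c, 'i::finite, 'b) point set \<Rightarrow> bool" where
  "zclosed X \<longleftrightarrow> (\<exists>S n. finite S \<and> (\<forall>i. finite (n i)) \<and> zclosed_in S n X)"

definition locally_closed :: "('c, 'i::finite, 'b) point set \<Rightarrow> bool" where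
  "locally_closed X \<longleftrightarrow> (\<exists>A B. zclosed A \<and> zclosed B \<and> X = A - B)"

definition constructible :: "('c, 'i::finite, 'b) point set \<Rightarrow> bool" where
  "constructible X \<longleftrightarrow> (\<exists>\<L>. finite \<L> \<and> (\<forall>L\<in>\<L>. locally_closed L) \<and> X = \<Union>\<L>)"

text \<open>Morphisms are the maps that are given, Zariski locally, by rational functions in frame
  coordinates.\<close>

definition morphism ::
  "('c, 'i::finite, 'b) point set \<Rightarrow> ('c2, 'i2::finite, 'b2) point set
    \<Rightarrow> (('c, 'i, 'b) point \<Rightarrow> ('c2, 'i2, 'b2) point) \<Rightarrow> bool" where
  "morphism X Y \<pi> \<longleftrightarrow> \<pi> ` X \<subseteq> Y \<and>
     (\<forall>d F0. frame d F0 \<and> pt d F0 \<in> X \<longrightarrow>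
        (\<exists>d' g b. (\<forall>k. poly_function (g k)) \<and> poly_function b \<and> b F0 \<noteq> 0 \<and>
           (\<forall>F. frame d F \<and> pt d F \<in> X \<and> b F \<noteq> 0 \<longrightarrow>
              frame d' (\<lambda>k. g k F / b F) \<and> pt d' (\<lambda>k. g k F / b F) = \<pi> (pt d F))))"

definition variety_iso ::
  "('c, 'i::finite, 'b) point set \<Rightarrow> ('c2, 'i2::finite, 'b2) point set
    \<Rightarrow> (('c, 'i, 'b) point \<Rightarrow> ('c2, 'i2, 'b2) point) \<Rightarrow> bool" where
  "variety_iso X Y \<psi> \<longleftrightarrow> bij_betw \<psi> X Y \<and> morphism X Y \<psi> \<and> morphism Y X (inv_into X \<psi>)"

definition affine_space :: "'c set \<Rightarrow> ('c, 'i::finite, 'b) point set" where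
  "affine_space S = {(x, \<lambda>_. {0}) |x. x \<in> cspace S}"

definition times_affine ::
  "('c, 'i::finite, 'b) point set \<Rightarrow> 's set \<Rightarrow> ('c + 's, 'i, 'b) point set" where
  "times_affine U S = {(case_sum x y, p) |x y p. (x, p) \<in> U \<and> y \<in> cspace S}"

text \<open>Zariski locally trivial fibrations with fibre the affine space with coordinates \<open>S\<close>.\<close>

definition affine_fibration ::
  "'s set \<Rightarrow> ('c, 'i::finite, 'b) point set \<Rightarrow> ('c2, 'i2::finite, 'b2) point set
    \<Rightarrow> (('c, 'i, 'b) point \<Rightarrow> ('c2, 'i2, 'b2) point) \<Rightarrow> bool" where
  "affine_fibration S E B \<pi> \<longleftrightarrow> finite S \<and> locally_closed E \<and> locally_closed B \<and> morphism E B \<pi> \<and>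
     (\<forall>b\<in>B. \<exists>C \<psi>. zclosed C \<and> b \<notin> C \<and>
        variety_iso (times_affine (B - C) S) {e \<in> E. \<pi> e \<notin> C} \<psi> \<and>
        (\<forall>x y p. (x, p) \<in> B - C \<and> y \<in> cspace S \<longrightarrow> \<pi> (\<psi> (case_sum x y, p)) = (x, p)))"

text \<open>Smoothness by the Jacobian criterion, tested on frames (the variety of frames over \<open>X\<close> is a
  principal bundle over \<open>X\<close> under a product of general linear groups).\<close>

definition smooth_projective :: "('c, 'i::finite, 'b) point set \<Rightarrow> bool" where
  "smooth_projective X \<longleftrightarrow> (\<exists>n. (\<forall>i. finite (n i)) \<and> zclosed_in {} n X \<and>
     (\<forall>d F0. frame d F0 \<and> pt d F0 \<in> X \<longrightarrow>
        (\<exists>(r::nat) \<phi> g. (\<forall>l<r. poly_function (\<phi> l)) \<and> poly_function g \<and> g F0 \<noteq> 0 \<and>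
           (\<forall>F. frame d F \<and> pt d F \<in> ambient {} n \<and> g F \<noteq> 0 \<longrightarrow>
              (pt d F \<in> X \<longleftrightarrow> (\<forall>l<r. \<phi> l F = 0))) \<and>
           (\<forall>a. (\<forall>i. \<forall>j<d i. \<forall>k\<in>n i.
                   (\<Sum>l<r. a l * deriv (\<lambda>z. \<phi> l (F0(Inr (i, j, k) := z))) (F0 (Inr (i, j, k)))) = 0)
                \<longrightarrow> (\<forall>l<r. a l = 0)))))"

text \<open>The classical topology is the quotient topology of the Euclidean topology on frames.\<close>

definition classical_topology :: "('c, 'i::finite, 'b) point set \<Rightarrow> ('c, 'i, 'b) point topology" where
  "classical_topology X = topology (\<lambda>V. V \<subseteq> X \<and>
     (\<forall>d. openin (top_of_set {F. frame d F \<and> pt d F \<in> X}) {F. frame d F \<and> pt d F \<in> V}))"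

lemma openin_classical_topology:
  "openin (classical_topology X) V \<longleftrightarrow> V \<subseteq> X \<and>
     (\<forall>d. openin (top_of_set {F. frame d F \<and> pt d F \<in> X}) {F. frame d F \<and> pt d F \<in> V})"
proof -
  let ?P = "\<lambda>V. V \<subseteq> X \<and>
     (\<forall>d. openin (top_of_set {F. frame d F \<and> pt d F \<in> X}) {F. frame d F \<and> pt d F \<in> V})"
  have int: "?P (V \<inter> W)" if "?P V" "?P W" for V W
  proof -
    have eq: "{F. frame d F \<and> pt d F \<in> V \<inter> W}
        = {F. frame d F \<and> pt d F \<in> V} \<inter> {F. frame d F \<and> pt d F \<in> W}" for d by auto
    show ?thesis unfolding eq using that by auto
  qed
  have un: "?P (\<Union>\<K>)" if "\<forall>V\<in>\<K>. ?P V" for \<K>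
  proof -
    have eq: "{F. frame d F \<and> pt d F \<in> \<Union>\<K>} = (\<Union>V\<in>\<K>. {F. frame d F \<and> pt d F \<in> V})" for d by auto
    show ?thesis unfolding eq using that by (auto intro!: openin_Union)
  qed
  have "istopology ?P"
    unfolding istopology_def using int un by blast
  then show ?thesis
    unfolding classical_topology_def by (simp add: topology_inverse')
qed


section \<open>Singular cohomology with compact supports\<close>

text \<open>Complex cochains are functions on singular simplices; a cochain has compact support if it
  vanishes on all simplices avoiding some compact set.\<close>

definition cochains_c :: "'a topology \<Rightarrow> nat \<Rightarrow> (((nat \<Rightarrow> real) \<Rightarrow> 'a) \<Rightarrow> complex) set" where
  "cochains_c T p = {\<phi>. (\<forall>\<sigma>. \<not> singular_simplex p T \<sigma> \<longrightarrow> \<phi> \<sigma> = 0) \<and>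
     (\<exists>K. compactin T K \<and>
        (\<forall>\<sigma>. singular_simplex p (subtopology T (topspace T - K)) \<sigma> \<longrightarrow> \<phi> \<sigma> = 0))}"

definition coboundary ::
  "'a topology \<Rightarrow> nat \<Rightarrow> (((nat \<Rightarrow> real) \<Rightarrow> 'a) \<Rightarrow> complex) \<Rightarrow> ((nat \<Rightarrow> real) \<Rightarrow> 'a) \<Rightarrow> complex" where
  "coboundary T p \<phi> = (\<lambda>\<sigma>. if singular_simplex (Suc p) T \<sigma>
     then \<Sum>k\<le>Suc p. (- 1) ^ k * \<phi> (singular_face (Suc p) k \<sigma>) else 0)"

definition hc_dim :: "'a topology \<Rightarrow> nat \<Rightarrow> nat" where
  "hc_dim T p = quot_dim {\<phi> \<in> cochains_c T p. coboundary T p \<phi> = 0}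
     (case p of 0 \<Rightarrow> {0} | Suc q \<Rightarrow> coboundary T q ` cochains_c T q)"


section \<open>The virtual Poincare polynomial\<close>

text \<open>The characterising properties; they determine \<open>\<Upsilon>\<close> on constructible sets.  In the first
  clause the coefficients beyond twice the dimension of \<open>X\<close> vanish automatically.\<close>

definition virtual_poincare :: "(('c, 'i::finite, 'b) point set \<Rightarrow> complex poly) \<Rightarrow> bool" where
  "virtual_poincare \<Upsilon> \<longleftrightarrow>
     (\<forall>X. smooth_projective X \<longrightarrow> (\<forall>i. poly.coeff (\<Upsilon> X) i = of_nat (hc_dim (classical_topology X) i))) \<and>
     (\<forall>X Y. constructible X \<and> constructible Y \<and> X \<inter> Y = {} \<longrightarrow> \<Upsilon> (X \<union> Y) = \<Upsilon> X + \<Upsilon> Y) \<and>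
     (\<forall>(S::'c set) E B \<pi>. affine_fibration S E B \<pi> \<longrightarrow> \<Upsilon> E = \<Upsilon> B * \<Upsilon> (affine_space S))"


section \<open>The quantum torus\<close>

definition bilin :: "int^'v^'v \<Rightarrow> int^'v \<Rightarrow> int^'v \<Rightarrow> int" where
  "bilin A x y = (\<Sum>i\<in>UNIV. x $ i * (A *v y) $ i)"

type_synonym 'v torus = "(int^'v) \<Rightarrow>\<^sub>0 complex poly fract"

definition tvar :: "complex poly fract" where
  "tvar = to_fract [:0, 1:]"

definition Xmon :: "int^'v \<Rightarrow> 'v torus" where
  "Xmon \<alpha> = Poly_Mapping.single \<alpha> 1"

definition tscale :: "complex poly fract \<Rightarrow> 'v torus \<Rightarrow> 'v torus" where
  "tscale c x = Poly_Mapping.map (\<lambda>a. c * a) x"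

definition tmult :: "int^'v^'v \<Rightarrow> 'v torus \<Rightarrow> 'v torus \<Rightarrow> 'v torus" where
  "tmult \<Lambda> x y = (\<Sum>\<alpha>\<in>Poly_Mapping.keys x. \<Sum>\<beta>\<in>Poly_Mapping.keys y.
     Poly_Mapping.single (\<alpha> + \<beta>)
       (Poly_Mapping.lookup x \<alpha> * Poly_Mapping.lookup y \<beta> * tvar powi bilin \<Lambda> \<alpha> \<beta>))"

definition motivic_integral ::
  "(('c, 'i::finite, 'b) point set \<Rightarrow> complex poly) \<Rightarrow> ('c, 'i, 'b) point set
    \<Rightarrow> (('c, 'i, 'b) point \<Rightarrow> 'v torus) \<Rightarrow> 'v torus" where
  "motivic_integral \<Upsilon> Y \<phi> = (\<Sum>w\<in>\<phi> ` Y. tscale (to_fract (\<Upsilon> {y \<in> Y. \<phi> y = w})) w)"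


section \<open>Quivers and their representations\<close>

text \<open>Modules over the path algebra are taken to be representations; the space at the vertex \<open>v\<close> is
  \<open>cspace (basis M v)\<close>, and \<open>act M a\<close> is the matrix (row index first) of the arrow \<open>a\<close>.\<close>

record ('v, 'a) quiver =
  arrows :: "'a set"
  src :: "'a \<Rightarrow> 'v"
  tgt :: "'a \<Rightarrow> 'v"

definition acyclic_quiver :: "('v, 'a) quiver \<Rightarrow> bool" where
  "acyclic_quiver Q \<longleftrightarrow> finite (arrows Q) \<and> acyclic {(src Q a, tgt Q a) |a. a \<in> arrows Q}"

record ('v, 'a, 'b) rep =
  basis :: "'v \<Rightarrow> 'b set"
  act :: "'a \<Rightarrow> 'b \<Rightarrow> 'b \<Rightarrow> complex"

definition is_rep :: "('v, 'a) quiver \<Rightarrow> ('v, 'a, 'b) rep \<Rightarrow> bool" where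
  "is_rep Q M \<longleftrightarrow> (\<forall>v. finite (basis M v)) \<and>
     (\<forall>a i j. act M a i j \<noteq> 0 \<longrightarrow> a \<in> arrows Q \<and> i \<in> basis M (tgt Q a) \<and> j \<in> basis M (src Q a))"

abbreviation vspace :: "('v, 'a, 'b) rep \<Rightarrow> 'v \<Rightarrow> ('b \<Rightarrow> complex) set" where
  "vspace M v \<equiv> cspace (basis M v)"

definition dimvec :: "('v::finite \<Rightarrow> ('b \<Rightarrow> complex) set) \<Rightarrow> int^'v" where
  "dimvec N = (\<chi> v. int (cfun.dim (N v)))"

text \<open>A homomorphism \<open>f : M \<rightarrow> N\<close> is a family of matrices, \<open>f (v, i, j)\<close> being the entry in row \<open>i\<close>
  and column \<open>j\<close> at the vertex \<open>v\<close>.\<close>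

definition Hom :: "('v, 'a) quiver \<Rightarrow> ('v, 'a, 'b) rep \<Rightarrow> ('v, 'a, 'd) rep
    \<Rightarrow> (('v \<times> 'd \<times> 'b) \<Rightarrow> complex) set" where
  "Hom Q M N = {f. (\<forall>v i j. f (v, i, j) \<noteq> 0 \<longrightarrow> i \<in> basis N v \<and> j \<in> basis M v) \<and>
     (\<forall>a\<in>arrows Q. \<forall>i j. (\<Sum>k\<in>basis M (tgt Q a). f (tgt Q a, i, k) * act M a k j)
        = (\<Sum>k\<in>basis N (src Q a). act N a i k * f (src Q a, k, j)))}"

definition hom_app :: "('v, 'a, 'b) rep \<Rightarrow> (('v \<times> 'd \<times> 'b) \<Rightarrow> complex)
    \<Rightarrow> 'v \<Rightarrow> ('b \<Rightarrow> complex) \<Rightarrow> 'd \<Rightarrow> complex" where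
  "hom_app M f v = lin_app (basis M v) (\<lambda>i j. f (v, i, j))"

definition hom_comp :: "('v, 'a, 'd) rep \<Rightarrow> (('v \<times> 'e \<times> 'd) \<Rightarrow> complex)
    \<Rightarrow> (('v \<times> 'd \<times> 'b) \<Rightarrow> complex) \<Rightarrow> ('v \<times> 'e \<times> 'b) \<Rightarrow> complex" where
  "hom_comp N g f = (\<lambda>(v, i, j). \<Sum>k\<in>basis N v. g (v, i, k) * f (v, k, j))"

definition hom_ker :: "('v, 'a, 'b) rep \<Rightarrow> (('v \<times> 'd \<times> 'b) \<Rightarrow> complex)
    \<Rightarrow> 'v \<Rightarrow> ('b \<Rightarrow> complex) set" where
  "hom_ker M f v = {x \<in> vspace M v. hom_app M f v x = 0}"

definition hom_im :: "('v, 'a, 'b) rep \<Rightarrow> (('v \<times> 'd \<times> 'b) \<Rightarrow> complex)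
    \<Rightarrow> 'v \<Rightarrow> ('d \<Rightarrow> complex) set" where
  "hom_im M f v = hom_app M f v ` vspace M v"

definition submodule :: "('v, 'a) quiver \<Rightarrow> ('v, 'a, 'b) rep \<Rightarrow> ('v \<Rightarrow> ('b \<Rightarrow> complex) set) \<Rightarrow> bool" where
  "submodule Q M N \<longleftrightarrow> (\<forall>v. cfun.subspace (N v) \<and> N v \<subseteq> vspace M v) \<and>
     (\<forall>a\<in>arrows Q. \<forall>x\<in>N (src Q a). lin_app (basis M (src Q a)) (act M a) x \<in> N (tgt Q a))"

definition injective_rep :: "('v, 'a) quiver \<Rightarrow> ('v, 'a, nat) rep \<Rightarrow> bool" where
  "injective_rep Q I \<longleftrightarrow> is_rep Q I \<and>
     (\<forall>(Y :: ('v, 'a, nat) rep) (Z :: ('v, 'a, nat) rep) g f. is_rep Q Y \<and> is_rep Q Z \<and>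
        g \<in> Hom Q Y Z \<and> (\<forall>v. hom_ker Y g v = {0}) \<and> f \<in> Hom Q Y I \<longrightarrow>
        (\<exists>f'\<in>Hom Q Z I. hom_comp Z f' g = f))"

definition projective_rep :: "('v, 'a) quiver \<Rightarrow> ('v, 'a, nat) rep \<Rightarrow> bool" where
  "projective_rep Q P \<longleftrightarrow> is_rep Q P \<and>
     (\<forall>(Y :: ('v, 'a, nat) rep) (Z :: ('v, 'a, nat) rep) g f. is_rep Q Y \<and> is_rep Q Z \<and>
        g \<in> Hom Q Y Z \<and> (\<forall>v. hom_im Y g v = vspace Z v) \<and> f \<in> Hom Q P Z \<longrightarrow>
        (\<exists>f'\<in>Hom Q P Y. hom_comp Y g f' = f))"


subsection \<open>The Euler form\<close>

text \<open>Up to equivalence, an extension of \<open>M\<close> by \<open>N\<close> lives on the spaces \<open>N v \<oplus> M v\<close> and is given by the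
  upper right blocks \<open>\<xi> a : M (src a) \<rightarrow> N (tgt a)\<close> of the arrow matrices, which can be arbitrary;
  an equivalence of extensions, being of the block form \<open>1, h; 0, 1\<close>, changes \<open>\<xi>\<close> by \<open>ext_cobound h\<close>.\<close>

definition ext_cocycles :: "('v, 'a) quiver \<Rightarrow> ('v, 'a, 'b) rep \<Rightarrow> ('v, 'a, 'd) rep
    \<Rightarrow> (('a \<times> 'd \<times> 'b) \<Rightarrow> complex) set" where
  "ext_cocycles Q M N = {\<xi>. \<forall>a i j. \<xi> (a, i, j) \<noteq> 0 \<longrightarrow>
     a \<in> arrows Q \<and> i \<in> basis N (tgt Q a) \<and> j \<in> basis M (src Q a)}"

definition ext_cobound :: "('v, 'a) quiver \<Rightarrow> ('v, 'a, 'b) rep \<Rightarrow> ('v, 'a, 'd) rep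
    \<Rightarrow> (('v \<times> 'd \<times> 'b) \<Rightarrow> complex) \<Rightarrow> ('a \<times> 'd \<times> 'b) \<Rightarrow> complex" where
  "ext_cobound Q M N h = (\<lambda>(a, i, j). if a \<in> arrows Q then
     (\<Sum>k\<in>basis N (src Q a). act N a i k * h (src Q a, k, j))
     - (\<Sum>k\<in>basis M (tgt Q a). h (tgt Q a, i, k) * act M a k j) else 0)"

definition ext_dim :: "('v, 'a) quiver \<Rightarrow> ('v, 'a, 'b) rep \<Rightarrow> ('v, 'a, 'd) rep \<Rightarrow> nat" where
  "ext_dim Q M N = quot_dim (ext_cocycles Q M N)
     (ext_cobound Q M N ` {h. \<forall>v i j. h (v, i, j) \<noteq> 0 \<longrightarrow> i \<in> basis N v \<and> j \<in> basis M v})"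

definition simple_rep :: "'v \<Rightarrow> ('v, 'a, nat) rep" where
  "simple_rep v = \<lparr>basis = (\<lambda>w. if w = v then {0} else {}), act = (\<lambda>_ _ _. 0)\<rparr>"

definition euler_matrix :: "('v::finite, 'a) quiver \<Rightarrow> int^'v^'v" where
  "euler_matrix Q = (\<chi> i j. int (cfun.dim (Hom Q (simple_rep i) (simple_rep j)))
     - int (ext_dim Q (simple_rep i) (simple_rep j)))"

definition euler :: "('v::finite, 'a) quiver \<Rightarrow> int^'v \<Rightarrow> int^'v \<Rightarrow> int" where
  "euler Q = bilin (euler_matrix Q)"

definition rstar :: "('v::finite, 'a) quiver \<Rightarrow> int^'v \<Rightarrow> int^'v" where
  "rstar Q e = transpose (euler_matrix Q) *v e"

definition lstar :: "('v::finite, 'a) quiver \<Rightarrow> int^'v \<Rightarrow> int^'v" where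
  "lstar Q e = euler_matrix Q *v e"


subsection \<open>The Nakayama functor\<close>

text \<open>Paths are lists of arrows in order of traversal.  The module \<open>path_rep Q v\<close> is the direct
  summand of the regular module spanned by the paths starting at \<open>v\<close>; the regular module is the
  direct sum of these over all \<open>v\<close>.\<close>

fun is_path :: "('v, 'a) quiver \<Rightarrow> 'v \<Rightarrow> 'a list \<Rightarrow> 'v \<Rightarrow> bool" where
  "is_path Q v [] w \<longleftrightarrow> v = w"
| "is_path Q v (a # p) w \<longleftrightarrow> a \<in> arrows Q \<and> src Q a = v \<and> is_path Q (tgt Q a) p w"

definition path_rep :: "('v, 'a) quiver \<Rightarrow> 'v \<Rightarrow> ('v, 'a, 'a list) rep" where
  "path_rep Q v = \<lparr>basis = (\<lambda>w. {p. is_path Q v p w}),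
     act = (\<lambda>a p q. if a \<in> arrows Q \<and> is_path Q v q (src Q a) \<and> p = q @ [a] then 1 else 0)\<rparr>"

text \<open>The space of \<open>\<nu> P = D Hom(P, CQ)\<close> at the vertex \<open>v\<close> is the dual of \<open>Hom(P, path_rep v)\<close>.  An arrow
  \<open>a : v \<rightarrow> w\<close> acts by the transpose of \<open>Hom(P, path_rep w) \<rightarrow> Hom(P, path_rep v)\<close>, the composition
  with the right multiplication by \<open>a\<close>, which maps a path \<open>q\<close> to \<open>a # q\<close>.\<close>

definition nu_space :: "('v, 'a) quiver \<Rightarrow> ('v, 'a, 'b) rep \<Rightarrow> 'v
    \<Rightarrow> ((('v \<times> 'a list \<times> 'b) \<Rightarrow> complex) \<Rightarrow> complex) set" where
  "nu_space Q P v = dual_space (Hom Q P (path_rep Q v))"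

definition right_mult :: "'a \<Rightarrow> (('v \<times> 'a list \<times> 'b) \<Rightarrow> complex) \<Rightarrow> ('v \<times> 'a list \<times> 'b) \<Rightarrow> complex" where
  "right_mult a g = (\<lambda>(u, p, j). if p \<noteq> [] \<and> hd p = a then g (u, tl p, j) else 0)"

definition nu_act :: "('v, 'a) quiver \<Rightarrow> ('v, 'a, 'b) rep \<Rightarrow> 'a
    \<Rightarrow> ((('v \<times> 'a list \<times> 'b) \<Rightarrow> complex) \<Rightarrow> complex) \<Rightarrow> (('v \<times> 'a list \<times> 'b) \<Rightarrow> complex) \<Rightarrow> complex" where
  "nu_act Q P a l = (\<lambda>g. if g \<in> Hom Q P (path_rep Q (tgt Q a)) then l (right_mult a g) else 0)"

definition iso_nakayama :: "('v, 'a) quiver \<Rightarrow> ('v, 'a, 'b) rep \<Rightarrow> ('v, 'a, 'd) rep \<Rightarrow> bool" where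
  "iso_nakayama Q I P \<longleftrightarrow> (\<exists>\<theta>.
     (\<forall>v. bij_betw (\<theta> v) (vspace I v) (nu_space Q P v) \<and>
        (\<forall>x\<in>vspace I v. \<forall>y\<in>vspace I v. \<theta> v (x + y) = \<theta> v x + \<theta> v y) \<and>
        (\<forall>c. \<forall>x\<in>vspace I v. \<theta> v (cscale c x) = cscale c (\<theta> v x))) \<and>
     (\<forall>a\<in>arrows Q. \<forall>x\<in>vspace I (src Q a).
        \<theta> (tgt Q a) (lin_app (basis I (src Q a)) (act I a) x) = nu_act Q P a (\<theta> (src Q a) x)))"


section \<open>Characters\<close>

text \<open>The integrands of the characters of \<open>M \<oplus> I[-1]\<close> and \<open>M \<oplus> P[1]\<close> at a submodule of dimension
  vector \<open>e\<close>.\<close>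

definition inj_term :: "('v::finite, 'a) quiver \<Rightarrow> int^'v \<Rightarrow> int^'v \<Rightarrow> int^'v \<Rightarrow> 'v torus" where
  "inj_term Q m i e = tscale (tvar powi (- euler Q e (m - i - e)))
     (Xmon (- rstar Q e - lstar Q (m - i - e)))"

definition proj_term :: "('v::finite, 'a) quiver \<Rightarrow> int^'v \<Rightarrow> int^'v \<Rightarrow> int^'v \<Rightarrow> 'v torus" where
  "proj_term Q m p e = tscale (tvar powi (euler Q (p - e) (m - e)))
     (Xmon (rstar Q (p - e) - lstar Q (m - e)))"

text \<open>Submodules are the points with trivial affine component.\<close>

definition Gr :: "('v::finite, 'a) quiver \<Rightarrow> ('v, 'a, 'b) rep \<Rightarrow> int^'v \<Rightarrow> ('c, 'v, 'b) point set" where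
  "Gr Q M e = {(0, N) |N. submodule Q M N \<and> dimvec N = e}"

definition character :: "(('c, 'v::finite, 'b) point set \<Rightarrow> complex poly) \<Rightarrow> ('v, 'a) quiver
    \<Rightarrow> ('v, 'a, 'b) rep \<Rightarrow> int^'v \<Rightarrow> 'v torus" where
  "character \<Upsilon> Q M i = (\<Sum>e\<in>{e. \<forall>v. 0 \<le> e $ v \<and> e $ v \<le> dimvec (vspace M) $ v}.
     motivic_integral \<Upsilon> (Gr Q M e) (\<lambda>_. inj_term Q (dimvec (vspace M)) i e))"

text \<open>The integral over the nonzero \<open>f : M \<rightarrow> I\<close> of the character of \<open>ker f \<oplus> (coker f)[-1]\<close>, taken over
  the pairs of \<open>f\<close> and a submodule \<open>N\<close> of \<open>ker f\<close>.\<close>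

definition integral_hom_inj ::
  "((('v \<times> 'b \<times> 'b), 'v::finite, 'b) point set \<Rightarrow> complex poly) \<Rightarrow> ('v, 'a) quiver
    \<Rightarrow> ('v, 'a, 'b) rep \<Rightarrow> ('v, 'a, 'b) rep \<Rightarrow> 'v torus" where
  "integral_hom_inj \<Upsilon> Q M I = motivic_integral \<Upsilon>
     {(f, N). f \<in> Hom Q M I \<and> f \<noteq> 0 \<and> submodule Q M N \<and> (\<forall>v. N v \<subseteq> hom_ker M f v)}
     (\<lambda>(f, N). inj_term Q (dimvec (hom_ker M f)) (dimvec (vspace I) - dimvec (hom_im M f)) (dimvec N))"

text \<open>The integral over the nonzero \<open>h : P \<rightarrow> M\<close> of the character of \<open>coker h \<oplus> (ker h)[1]\<close>; a submodule
  of \<open>coker h\<close> is represented by its preimage \<open>N\<close>, a submodule of \<open>M\<close> containing the image of \<open>h\<close>.\<close>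

definition integral_hom_proj ::
  "((('v \<times> 'b \<times> 'b), 'v::finite, 'b) point set \<Rightarrow> complex poly) \<Rightarrow> ('v, 'a) quiver
    \<Rightarrow> ('v, 'a, 'b) rep \<Rightarrow> ('v, 'a, 'b) rep \<Rightarrow> 'v torus" where
  "integral_hom_proj \<Upsilon> Q P M = motivic_integral \<Upsilon>
     {(h, N). h \<in> Hom Q P M \<and> h \<noteq> 0 \<and> submodule Q M N \<and> (\<forall>v. hom_im P h v \<subseteq> N v)}
     (\<lambda>(h, N). proj_term Q (dimvec (vspace M) - dimvec (hom_im P h)) (dimvec (hom_ker P h))
        (dimvec N - dimvec (hom_im P h)))"

end

theory Submission
  imports Defs "HOL-Homology.Homology"
begin

text \<open>
  Both integrands depend only on the dimension vector \<open>e\<close> of the submodule, by rank-nullity, and they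
  are different for different \<open>e\<close> because \<open>B\<close> is invertible.  Hence the integrals are sums over \<open>e\<close>, the
  coefficients being \<open>\<Upsilon>\<close> of the bundles of nonzero vectors over \<open>Gr_e(M)\<close> with the fibres
  \<open>Hom(M/N, I)\<close> and \<open>Hom(P, N)\<close>.  By injectivity and projectivity these fibres have the constant
  dimensions \<open>\<langle>m - e, i\<rangle>\<close> and \<open>\<langle>p, e\<rangle> = \<langle>e, i\<rangle>\<close>.  They are cut out by equations that are polynomial in
  frames, so Cramer's rule trivialises the bundles locally, and a bundle of rank \<open>r\<close> contributes the factor
  \<open>t^(2r) - 1\<close>.  The contribution of \<open>e\<close> to the identity is then
  \<open>t^b (t^(2a) - 1) = (t^(2(a-b)) - 1) t^b + t^a (t^(2b) - 1) t^(a-b)\<close> with \<open>a = \<langle>m, i\<rangle>\<close>, \<open>b = \<langle>e, i\<rangle>\<close>.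

  The value \<open>t^2\<close> of the affine line is forced by the axioms: it comes from the cohomology of the
  projective line, a 2-sphere, which is computed from singular homology by extending additive maps from
  subgroups of free abelian groups to the divisible group of complex numbers.
\<close>

section \<open>Compactly supported cohomology of compact spaces\<close>

text \<open>The clauses of \<open>virtual_poincare\<close> give neither the value of an affine space
  nor invariance under isomorphism, and the fibration clause accepts only fibres with coordinates in
  the type of the affine coordinates of the points. So the projective line is built inside the given
  point type, isomorphisms are read as fibrations with a point as fibre, and a point gets the value
  1 because 1 + t^2 can be cancelled.

  Quotients such as M/N are never built as modules: Hom(M/N, I) is the kernel of the surjective
  restriction Hom(M, I) -> Hom(N, I). The Euler form enters through the two-term complex with kernel
  Hom and cokernel Ext^1, and <p, e> = <e, i> comes from E^t p = E i, a dimension count of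
  homomorphisms from P to the modules of paths.

  Charts of the bundles must be rational in frames. Hence the equations of a fibre have to be linear
  in the fibre vector with coefficients polynomial in the frame; for Hom(P, N) they come from
  polynomial left inverses of the frame of N.\<close>

lemma extend_additive_to_complex:
  fixes h :: "'a::ab_group_add \<Rightarrow> complex"
  assumes H0: "0 \<in> H" and Hd: "\<And>x y. x \<in> H \<Longrightarrow> y \<in> H \<Longrightarrow> x - y \<in> H"
    and hd: "\<And>x y. x \<in> H \<Longrightarrow> y \<in> H \<Longrightarrow> h (x - y) = h x - h y"
  obtains g where "\<And>x y. g (x - y) = g x - g y" "\<And>x. x \<in> H \<Longrightarrow> g x = h x"
proof -
  \<comment> \<open>Graphs of additive maps on subgroups, as in the proof of Baer's criterion.
    Single-valuedness of a subgroup of the product need only be tested over 0.\<close>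
  define good where "good R \<longleftrightarrow> (0, 0) \<in> R \<and>
      (\<forall>x r y s. (x, r) \<in> R \<longrightarrow> (y, s) \<in> R \<longrightarrow> (x - y, r - s) \<in> R) \<and>
      (\<forall>r. (0, r) \<in> R \<longrightarrow> r = 0)" for R :: "('a \<times> complex) set"
  define R0 where "R0 = (\<lambda>x. (x, h x)) ` H"
  have h0: "h 0 = 0" using hd[OF H0 H0] by simp
  have "good R0"
    unfolding good_def R0_def using H0 Hd hd h0 by (auto simp: image_iff)
  then have ne: "{R. good R \<and> R0 \<subseteq> R} \<noteq> {}" by blast
  have un: "\<Union>\<C> \<in> {R. good R \<and> R0 \<subseteq> R}"
    if "\<C> \<noteq> {}" "subset.chain {R. good R \<and> R0 \<subseteq> R} \<C>" for \<C>
  proof -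
    have g: "good R" "R0 \<subseteq> R" if "R \<in> \<C>" for R
      using that \<open>subset.chain _ \<C>\<close> by (auto simp: subset.chain_def)
    have tot: "R \<subseteq> R' \<or> R' \<subseteq> R" if "R \<in> \<C>" "R' \<in> \<C>" for R R'
      using that \<open>subset.chain _ \<C>\<close> unfolding subset.chain_def by blast
    obtain R where R: "R \<in> \<C>" using \<open>\<C> \<noteq> {}\<close> by blast
    have "(x - y, r - s) \<in> \<Union>\<C>" if "(x, r) \<in> \<Union>\<C>" "(y, s) \<in> \<Union>\<C>" for x y r s
    proof -
      obtain A B where AB: "A \<in> \<C>" "(x, r) \<in> A" "B \<in> \<C>" "(y, s) \<in> B" using \<open>(x, r) \<in> \<Union>\<C>\<close> \<open>(y, s) \<in> \<Union>\<C>\<close> by blast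
      then obtain C where "C \<in> \<C>" "(x, r) \<in> C" "(y, s) \<in> C" using tot[of A B] by blast
      then show ?thesis using g(1)[of C] unfolding good_def by blast
    qed
    moreover have "(0, 0) \<in> \<Union>\<C>" "R0 \<subseteq> \<Union>\<C>" using R g[OF R] by (auto simp: good_def)
    moreover have "r = 0" if "(0, r) \<in> \<Union>\<C>" for r
      using that g(1) unfolding good_def by blast
    ultimately show ?thesis unfolding good_def by blast
  qed
  obtain R where R: "good R" "R0 \<subseteq> R" and mx: "\<And>R'. good R' \<Longrightarrow> R \<subseteq> R' \<Longrightarrow> R' = R"
  proof -
    obtain R where "R \<in> {R. good R \<and> R0 \<subseteq> R}" "\<forall>X\<in>{R. good R \<and> R0 \<subseteq> R}. R \<subseteq> X \<longrightarrow> X = R"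
      using subset_Zorn_nonempty[OF ne un] by blast
    then show ?thesis using that[of R] by blast
  qed
  have R00: "(0, 0) \<in> R" and Rd: "\<And>x r y s. (x, r) \<in> R \<Longrightarrow> (y, s) \<in> R \<Longrightarrow> (x - y, r - s) \<in> R"
    and Rs: "\<And>r. (0, r) \<in> R \<Longrightarrow> r = 0"
    using R(1) unfolding good_def by blast+
  have Rm: "(- x, - r) \<in> R" if "(x, r) \<in> R" for x r using Rd[OF R00 that] by simp
  have Ra: "(x + y, r + s) \<in> R" if "(x, r) \<in> R" "(y, s) \<in> R" for x r y s
    using Rd[OF that(1) Rm[OF that(2)]] by simp
  have uniq: "r = s" if "(x, r) \<in> R" "(x, s) \<in> R" for x r s
    using Rs[of "r - s"] Rd[OF that] by simp
  \<comment> \<open>The action of the integers, needed to compare multiples of a new element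
    \<open>x\<close> with the domain already reached.\<close>
  define mul :: "int \<Rightarrow> 'a \<Rightarrow> 'a" where
    "mul n x = (if n \<ge> 0 then ((\<lambda>y. y + x) ^^ nat n) 0 else - ((\<lambda>y. y + x) ^^ nat (- n)) 0)" for n x
  have mul_nat: "mul (int n) x = ((\<lambda>y. y + x) ^^ n) 0" for n x by (simp add: mul_def)
  have mul_add1: "mul (n + 1) x = mul n x + x" for n x
  proof (cases "n \<ge> 0")
    case True then show ?thesis by (simp add: mul_def nat_add_distrib)
  next
    case False
    then obtain k where k: "n = - int (Suc k)" by (metis int_cases not_le negative_zle nat_int of_nat_0_le_iff)
    then show ?thesis by (cases k) (auto simp: mul_def nat_add_distrib)
  qed
  have mul_0: "mul 0 x = 0" for x by (simp add: mul_def)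
  have mul_add: "mul (n + k) x = mul n x + mul k x" for n k x
  proof (induction k rule: int_induct[where k=0])
    case base then show ?case by (simp add: mul_0)
  next
    case (step1 i) then show ?case using mul_add1[of i x] mul_add1[of "n + i" x] by (simp add: algebra_simps)
  next
    case (step2 i) then show ?case using mul_add1[of "i - 1" x] mul_add1[of "n + (i - 1)" x] by (simp add: algebra_simps)
  qed
  have mul_diff: "mul (n - k) x = mul n x - mul k x" for n k x
    using mul_add[of "n - k" k x] by simp
  have mul_one: "mul 1 x = x" for x using mul_add1[of 0 x] by (simp add: mul_0)
  have mul_sub1: "mul (i - 1) x = mul i x - x" for i x using mul_add1[of "i - 1" x] by simp
  have R_mul: "(mul n x, of_int n * r) \<in> R" if "(x, r) \<in> R" for n x r
  proof (induction n rule: int_induct[where k=0])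
    case base then show ?case by (simp add: mul_0 R00)
  next
    case (step1 i) then show ?case using Ra[OF step1(2) that] mul_add1[of i x] by (simp add: algebra_simps)
  next
    case (step2 i)
    then show ?case using Rd[OF step2(2) that] by (simp add: mul_sub1 left_diff_distrib)
  qed
  have mul_mul: "mul (n * k) x = mul n (mul k x)" for n k x
  proof (induction n rule: int_induct[where k=0])
    case base then show ?case by (simp add: mul_0)
  next
    case (step1 i) then show ?case by (simp only: distrib_right mul_one mult_1 mul_add)
  next
    case (step2 i)
    then show ?case by (simp only: left_diff_distrib mul_one mult_1 mul_diff)
  qed
  \<comment> \<open>If \<open>x\<close> were outside the domain of the maximal graph, adjoining it
    would contradict maximality. Its value \<open>y\<close> has to agree with the values already
    given to multiples of \<open>x\<close>; this is where division by integers is used.\<close>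
  have total: "\<exists>r. (x, r) \<in> R" for x
  proof (rule ccontr)
    assume nx: "\<nexists>r. (x, r) \<in> R"
    define J where "J = {n. n > 0 \<and> (\<exists>r. (mul (int n) x, r) \<in> R)}"
    obtain y where y: "\<And>n r. (mul n x, r) \<in> R \<Longrightarrow> r = of_int n * y"
    proof (cases "J = {}")
      case True
      have "r = of_int n * 0" if "(mul n x, r) \<in> R" for n r
      proof -
        have "n = 0"
        proof (rule ccontr)
          assume "n \<noteq> 0"
          have m: "(mul (- n) x, - r) \<in> R" using Rm[OF that] mul_diff[of 0 n x] by (simp add: mul_0)
          then have "nat \<bar>n\<bar> \<in> J" using that \<open>n \<noteq> 0\<close> unfolding J_def
            by (cases "n > 0") auto
          then show False using True by blast
        qed
        then show ?thesis using that Rs by (simp add: mul_0)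
      qed
      then show ?thesis using that by blast
    next
      case False
      \<comment> \<open>By division with remainder, every multiple of \<open>x\<close> in the domain
        is a multiple of the least positive one, so \<open>s / k\<close> is the forced
        value.\<close>
      define k where "k = (LEAST n. n \<in> J)"
      have k: "k \<in> J" using False unfolding k_def by (metis LeastI equals0I)
      then obtain s where s: "(mul (int k) x, s) \<in> R" "k > 0" unfolding J_def by blast
      have "r = of_int n * (s / of_nat k)" if "(mul n x, r) \<in> R" for n r
      proof -
        have e: "n mod int k = n - (n div int k) * int k" by (simp add: minus_div_mult_eq_mod)
        have "(mul (n mod int k) x, r - of_int (n div int k) * s) \<in> R"
          unfolding e mul_diff mul_mul using Rd[OF that R_mul[OF s(1)]] by simp
        moreover have "nat (n mod int k) < k" using s(2) by (simp add: nat_less_iff)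
        ultimately have mod0: "n mod int k = 0"
        proof -
          have "0 \<le> n mod int k" using s(2) by simp
          moreover have "nat (n mod int k) \<notin> J"
            using not_less_Least[of "nat (n mod int k)" "\<lambda>n. n \<in> J"] \<open>nat (n mod int k) < k\<close> unfolding k_def by blast
          ultimately show ?thesis using \<open>(mul (n mod int k) x, _) \<in> R\<close> unfolding J_def by (cases "n mod int k = 0") auto
        qed
        then obtain l where l: "n = l * int k" using div_mult_mod_eq[of n "int k"] by (metis add.right_neutral mod0)
        show ?thesis using uniq[OF that] R_mul[OF s(1), of l] s(2) unfolding l mul_mul by simp
      qed
      then show ?thesis using that by blast
    qed
    define R' where "R' = {(z + mul n x, r + of_int n * y) |z r n. (z, r) \<in> R}"
    have "good R'" unfolding good_def
    proof (intro conjI allI impI)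
      show "(0, 0) \<in> R'" unfolding R'_def using R00 mul_0 by force
    next
      fix a r b s assume "(a, r) \<in> R'" "(b, s) \<in> R'"
      then obtain z1 r1 n1 z2 r2 n2 where "a = z1 + mul n1 x" "r = r1 + of_int n1 * y" "(z1, r1) \<in> R"
        "b = z2 + mul n2 x" "s = r2 + of_int n2 * y" "(z2, r2) \<in> R" unfolding R'_def by blast
      then have "a - b = (z1 - z2) + mul (n1 - n2) x" "r - s = (r1 - r2) + of_int (n1 - n2) * y" "(z1 - z2, r1 - r2) \<in> R"
        using Rd by (auto simp: mul_diff algebra_simps)
      then show "(a - b, r - s) \<in> R'" unfolding R'_def by blast
    next
      fix r assume "(0, r) \<in> R'"
      then obtain z r1 n where z: "0 = z + mul n x" "r = r1 + of_int n * y" "(z, r1) \<in> R" unfolding R'_def by blast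
      then have "mul n x = - z" by (metis add.commute eq_neg_iff_add_eq_0)
      then have "(mul n x, - r1) \<in> R" using Rm z(3) by simp
      then have "- r1 = of_int n * y" by (rule y)
      then show "r = 0" unfolding z(2) by (metis add.right_inverse)
    qed
    moreover have "R \<subseteq> R'"
    proof clarify
      fix a b assume "(a, b) \<in> R"
      moreover have "(a, b) = (a + mul 0 x, b + of_int 0 * y)" by (simp add: mul_0)
      ultimately show "(a, b) \<in> R'" unfolding R'_def by blast
    qed
    ultimately have "R' = R" by (rule mx)
    moreover have "(x, y) \<in> R'"
    proof -
      have "(x, y) = (0 + mul 1 x, 0 + of_int 1 * y)" using mul_add1[of 0 x] by (simp add: mul_0)
      then show ?thesis unfolding R'_def using R00 by blast
    qed
    ultimately show False using nx by blast
  qed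
  define g where "g x = (SOME r. (x, r) \<in> R)" for x
  have g: "(x, g x) \<in> R" for x unfolding g_def using total by (rule someI_ex)
  show ?thesis
  proof (rule that[of g])
    show "g (x - y) = g x - g y" for x y using uniq[OF g Rd[OF g g]] .
    show "g x = h x" if "x \<in> H" for x
    proof -
      have "(x, h x) \<in> R" using that R(2) by (auto simp: R0_def)
      then show ?thesis using uniq[OF g] by blast
    qed
  qed
qed

section \<open>Complex cochains paired with integral singular chains\<close>

definition pairing :: "('s \<Rightarrow> complex) \<Rightarrow> ('s \<Rightarrow>\<^sub>0 int) \<Rightarrow> complex" where
  "pairing \<phi> c = (\<Sum>\<sigma>\<in>Poly_Mapping.keys c. of_int (Poly_Mapping.lookup c \<sigma>) * \<phi> \<sigma>)"

lemma pairing_superset: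
  assumes "finite S" "Poly_Mapping.keys c \<subseteq> S"
  shows "pairing \<phi> c = (\<Sum>\<sigma>\<in>S. of_int (Poly_Mapping.lookup c \<sigma>) * \<phi> \<sigma>)"
  unfolding pairing_def using assms by (intro sum.mono_neutral_left) (auto simp: in_keys_iff)

lemma pairing_diff: "pairing \<phi> (c - d) = pairing \<phi> c - pairing \<phi> d"
proof -
  let ?S = "Poly_Mapping.keys c \<union> Poly_Mapping.keys d"
  show ?thesis
    using pairing_superset[of ?S c \<phi>] pairing_superset[of ?S d \<phi>] pairing_superset[of ?S "c - d" \<phi>] keys_diff[of c d]
    by (simp add: lookup_minus algebra_simps sum_subtractf)
qed

lemma pairing_0 [simp]: "pairing \<phi> 0 = 0"
  by (simp add: pairing_def)

lemma pairing_of [simp]: "pairing \<phi> (frag_of \<sigma>) = \<phi> \<sigma>"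
  by (simp add: pairing_def)

lemma pairing_add: "pairing \<phi> (c + d) = pairing \<phi> c + pairing \<phi> d"
  using pairing_diff[of \<phi> "c + d" d] by simp

lemma pairing_sum: "pairing \<phi> (\<Sum>i\<in>A. c i) = (\<Sum>i\<in>A. pairing \<phi> (c i))"
  by (induction A rule: infinite_finite_induct) (auto simp: pairing_add)

lemma pairing_cmul: "pairing \<phi> (frag_cmul k c) = of_int k * pairing \<phi> c"
  using pairing_superset[of "Poly_Mapping.keys c" "frag_cmul k c" \<phi>] keys_cmul[of k c]
  by (simp add: pairing_def sum_distrib_left mult.assoc)

lemma pairing_lin: "pairing (\<phi> + \<psi>) c = pairing \<phi> c + pairing \<psi> c" "pairing (cscale a \<phi>) c = a * pairing \<phi> c"
  by (auto simp: pairing_def sum.distrib sum_distrib_left algebra_simps cscale_def)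

lemma pairing_coboundary:
  assumes "singular_chain (Suc p) T c"
  shows "pairing (coboundary T p \<phi>) c = pairing \<phi> (chain_boundary (Suc p) c)"
  using assms unfolding singular_chain_def
proof (induction c rule: frag_induction)
  case (one \<sigma>)
  then show ?case by (simp add: coboundary_def chain_boundary_of pairing_sum pairing_cmul del: sum.atMost_Suc)
qed (auto simp: pairing_diff chain_boundary_diff)

text \<open>The whole space may serve as the compact support, and its empty complement carries no
  simplex, so compact support is no restriction on cochains.\<close>

lemma cochains_c_compact:
  assumes "compact_space T"
  shows "cochains_c T p = {\<phi>. \<forall>\<sigma>. \<not> singular_simplex p T \<sigma> \<longrightarrow> \<phi> \<sigma> = 0}"
  using assms by (auto simp: cochains_c_def compact_space_def intro!: exI[of _ "topspace T"] simp: singular_simplex_empty)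

text \<open>Singular simplices form a basis of the chain group, so an additive map on chains is
  recovered from this cochain by \<open>pairing\<close>.\<close>

definition additive_cochain :: "'a topology \<Rightarrow> nat \<Rightarrow> ('a chain \<Rightarrow> complex) \<Rightarrow> ((nat \<Rightarrow> real) \<Rightarrow> 'a) \<Rightarrow> complex" where
  "additive_cochain T p g \<sigma> = (if singular_simplex p T \<sigma> then g (frag_of \<sigma>) else 0)"

lemma pairing_additive_cochain:
  assumes "\<And>x y. g (x - y) = g x - g y" "singular_chain p T c"
  shows "pairing (additive_cochain T p g) c = g c"
  using assms(2) unfolding singular_chain_def
proof (induction c rule: frag_induction)
  case zero then show ?case using assms(1)[of 0 0] by simp
next
  case (one \<sigma>) then show ?case by (simp add: additive_cochain_def)
qed (auto simp: assms(1) pairing_diff)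

lemma additive_cochain_in:
  "compact_space T \<Longrightarrow> additive_cochain T p g \<in> cochains_c T p"
  by (auto simp: cochains_c_compact additive_cochain_def)

lemma cochain_zero:
  assumes "\<forall>\<sigma>. \<not> singular_simplex p T \<sigma> \<longrightarrow> \<phi> \<sigma> = 0" "\<And>c. singular_chain p T c \<Longrightarrow> pairing \<phi> c = 0"
  shows "\<phi> = 0"
proof
  fix \<sigma> show "\<phi> \<sigma> = 0 \<sigma>"
    using assms(1) assms(2)[of "frag_of \<sigma>"] by (cases "singular_simplex p T \<sigma>") (auto simp: singular_chain_of)
qed

abbreviation coboundaries where
  "coboundaries T p \<equiv> (case p of 0 \<Rightarrow> {0} | Suc q \<Rightarrow> coboundary T q ` cochains_c T q)"

text \<open>The extension property makes a cochain vanishing on all cycles a coboundary.\<close>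

lemma vanishing_on_cycles_imp_coboundary:
  assumes T: "compact_space T" and \<phi>: "\<phi> \<in> cochains_c T p"
    and van: "\<And>c. singular_relcycle p T {} c \<Longrightarrow> pairing \<phi> c = 0"
  shows "\<phi> \<in> coboundaries T p"
proof (cases p)
  case 0
  have "\<phi> = 0"
    by (rule cochain_zero[of p T]) (use \<phi> van 0 in \<open>auto simp: cochains_c_compact[OF T] singular_cycle chain_boundary_def\<close>)
  then show ?thesis using 0 by simp
next
  case (Suc q)
  define H where "H = chain_boundary p ` {c. singular_chain p T c}"
  \<comment> \<open>The functional that \<open>\<phi>\<close> induces on boundaries. It does not
    depend on the chosen chain, because two choices differ by a cycle and \<open>\<phi>\<close>
    vanishes there. Extended to the whole chain group, it yields the cochain of degree
    \<open>q\<close> with coboundary \<open>\<phi>\<close>.\<close>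
  define h where "h b = pairing \<phi> (SOME c. singular_chain p T c \<and> chain_boundary p c = b)" for b
  have h: "h (chain_boundary p c) = pairing \<phi> c" if "singular_chain p T c" for c
  proof -
    define c' where "c' = (SOME c'. singular_chain p T c' \<and> chain_boundary p c' = chain_boundary p c)"
    have c': "singular_chain p T c' \<and> chain_boundary p c' = chain_boundary p c"
      unfolding c'_def by (rule someI[of _ c]) (use that in auto)
    then have "singular_relcycle p T {} (c' - c)"
      using that by (simp add: singular_cycle chain_boundary_diff singular_chain_diff)
    then have "pairing \<phi> c' = pairing \<phi> c" using van[of "c' - c"] by (simp add: pairing_diff)
    then show ?thesis unfolding h_def c'_def .
  qed
  obtain g where g: "\<And>x y. g (x - y) = g x - g y" "\<And>x. x \<in> H \<Longrightarrow> g x = h x"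
  proof (rule extend_additive_to_complex[of H h])
    show "0 \<in> H" unfolding H_def by (rule image_eqI[of _ _ 0]) auto
    fix x y assume "x \<in> H" "y \<in> H"
    then obtain a b where "singular_chain p T a" "x = chain_boundary p a" "singular_chain p T b" "y = chain_boundary p b"
      unfolding H_def by blast
    moreover then have "singular_chain p T (a - b)" "x - y = chain_boundary p (a - b)"
      by (auto simp: singular_chain_diff chain_boundary_diff)
    ultimately show "x - y \<in> H" "h (x - y) = h x - h y" unfolding H_def using h by (auto simp: pairing_diff)
  qed (use that in blast)
  let ?\<psi> = "additive_cochain T q g"
  have "\<phi> - coboundary T q ?\<psi> = 0"
  proof (rule cochain_zero[of p T])
    show "\<forall>\<sigma>. \<not> singular_simplex p T \<sigma> \<longrightarrow> (\<phi> - coboundary T q ?\<psi>) \<sigma> = 0"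
      using \<phi> Suc by (simp add: cochains_c_compact[OF T] coboundary_def)
    fix c assume c: "singular_chain p T c"
    have "pairing (coboundary T q ?\<psi>) c = g (chain_boundary p c)"
      using c Suc singular_chain_boundary_alt[of q T c]
      by (simp add: pairing_coboundary pairing_additive_cochain g(1))
    also have "\<dots> = pairing \<phi> c" using c g(2) h by (auto simp: H_def)
    finally have "pairing (coboundary T q ?\<psi>) c = pairing \<phi> c" .
    then show "pairing (\<phi> - coboundary T q ?\<psi>) c = 0"
      using pairing_lin(1)[of "\<phi> - coboundary T q ?\<psi>" "coboundary T q ?\<psi>" c] by simp
  qed
  then have "\<phi> = coboundary T q ?\<psi>" by simp
  then show ?thesis using Suc additive_cochain_in[OF T] by auto
qed

lemma pairing_cocycle_boundary:
  assumes "coboundary T p \<phi> = 0" "singular_relboundary p T {} c"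
  shows "pairing \<phi> c = 0"
proof -
  obtain d where "singular_chain (Suc p) T d" "chain_boundary (Suc p) d = c"
    using assms(2) by (auto simp: singular_boundary)
  then show ?thesis using pairing_coboundary[of p T d \<phi>] assms(1) by (simp add: pairing_def zero_fun_def)
qed

lemma pairing_coboundary_cycle:
  assumes "\<phi> \<in> coboundaries T p" "singular_relcycle p T {} c"
  shows "pairing \<phi> c = 0"
proof (cases p)
  case 0 then show ?thesis using assms by (simp add: pairing_def)
next
  case (Suc q)
  then show ?thesis using assms by (auto simp: pairing_coboundary singular_cycle)
qed

lemma hc_dim_eq_0:
  assumes T: "compact_space T"
    and triv: "\<And>c. singular_relcycle p T {} c \<Longrightarrow> singular_relboundary p T {} c"
  shows "hc_dim T p = 0"
proof -
  have "{\<phi> \<in> cochains_c T p. coboundary T p \<phi> = 0} \<subseteq> coboundaries T p"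
    using vanishing_on_cycles_imp_coboundary[OF T] pairing_cocycle_boundary triv by blast
  also have "\<dots> \<subseteq> cfun.span \<dots>" by (rule cfun.span_superset)
  finally show ?thesis unfolding hc_dim_def quot_dim_def
    by (intro Least_eq_0 exI[of _ "{}"]) simp
qed

text \<open>If homology is infinite cyclic on the class of \<open>z\<close>, reading off the
  coefficient of \<open>z\<close> is an additive map on cycles; extended to all chains, it is a
  cocycle. Any other cocycle minus its value on \<open>z\<close> times this one vanishes on cycles,
  hence is a coboundary.\<close>

lemma hc_dim_eq_1:
  assumes T: "compact_space T" and z: "singular_relcycle p T {} z"
    and gen: "\<And>c. singular_relcycle p T {} c \<Longrightarrow> \<exists>n. singular_relboundary p T {} (c - frag_cmul n z)"
    and free: "\<And>n. singular_relboundary p T {} (frag_cmul n z) \<Longrightarrow> n = 0"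
  shows "hc_dim T p = 1"
proof -
  let ?V = "{\<phi> \<in> cochains_c T p. coboundary T p \<phi> = 0}" and ?W = "coboundaries T p"
  define H where "H = {c. singular_relcycle p T {} c}"
  define h :: "'a chain \<Rightarrow> complex" where "h c = of_int (SOME n. singular_relboundary p T {} (c - frag_cmul n z))" for c
  have bd: "singular_relboundary p T {} (a - b)" if "singular_relboundary p T {} a" "singular_relboundary p T {} b" for a b
    using that by (metis singular_relboundary_diff)
  have h: "h c = of_int n" if "singular_relboundary p T {} (c - frag_cmul n z)" for c n
  proof -
    define k where "k = (SOME n. singular_relboundary p T {} (c - frag_cmul n z))"
    have "singular_relboundary p T {} (c - frag_cmul k z)" unfolding k_def by (rule someI[of _ n]) (rule that)
    from bd[OF this that] have "singular_relboundary p T {} (frag_cmul (n - k) z)" by (simp add: frag_cmul_diff_distrib algebra_simps)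
    then show ?thesis using free unfolding h_def k_def[symmetric] by fastforce
  qed
  obtain g where g: "\<And>x y. g (x - y) = g x - g y" "\<And>x. x \<in> H \<Longrightarrow> g x = h x"
  proof (rule extend_additive_to_complex[of H h])
    show "0 \<in> H" by (simp add: H_def)
    fix x y assume xy: "x \<in> H" "y \<in> H"
    then show "x - y \<in> H" by (simp add: H_def singular_relcycle_diff)
    obtain a b where ab: "singular_relboundary p T {} (x - frag_cmul a z)" "singular_relboundary p T {} (y - frag_cmul b z)"
      using gen xy unfolding H_def by blast
    have "singular_relboundary p T {} ((x - y) - frag_cmul (a - b) z)"
      using bd[OF ab] by (simp add: frag_cmul_diff_distrib algebra_simps)
    then show "h (x - y) = h x - h y" using h ab by simp
  qed (use that in blast)
  define \<phi>0 where "\<phi>0 = additive_cochain T p g"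
  have ev: "pairing \<phi>0 c = h c" if "singular_relcycle p T {} c" for c
    using that g pairing_additive_cochain[of g p T c] by (simp add: \<phi>0_def singular_cycle H_def)
  have evz: "pairing \<phi>0 z = 1" using ev[OF z] h[of z 1] by simp
  have \<phi>0: "\<phi>0 \<in> ?V"
  proof -
    have "coboundary T p \<phi>0 = 0"
    proof (rule cochain_zero[of "Suc p" T])
      fix c assume c: "singular_chain (Suc p) T c"
      have "singular_relboundary p T {} (chain_boundary (Suc p) c)" using c by (auto simp: singular_boundary)
      then have "h (chain_boundary (Suc p) c) = 0" "singular_relcycle p T {} (chain_boundary (Suc p) c)"
        using h[of "chain_boundary (Suc p) c" 0] by (auto simp: singular_relboundary_imp_relcycle)
      then show "pairing (coboundary T p \<phi>0) c = 0" using ev c by (simp add: pairing_coboundary)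
    qed (simp add: coboundary_def)
    then show ?thesis using additive_cochain_in[OF T] by (simp add: \<phi>0_def)
  qed
  have sub: "?V \<subseteq> cfun.span ({\<phi>0} \<union> ?W)"
  proof
    fix \<phi> assume \<phi>: "\<phi> \<in> ?V"
    define \<psi> where "\<psi> = \<phi> - cscale (pairing \<phi> z) \<phi>0"
    have e: "\<phi> = cscale (pairing \<phi> z) \<phi>0 + \<psi>" by (simp add: \<psi>_def)
    have "pairing \<psi> c = 0" if c: "singular_relcycle p T {} c" for c
    proof -
      obtain n where n: "singular_relboundary p T {} (c - frag_cmul n z)" using gen c by blast
      then have "pairing \<phi> c = of_int n * pairing \<phi> z" "pairing \<phi>0 c = of_int n"
        using pairing_cocycle_boundary[of T p _ "c - frag_cmul n z"] \<phi> ev[OF c] h by (auto simp: pairing_diff pairing_cmul)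
      moreover have "pairing \<phi> c = pairing (cscale (pairing \<phi> z) \<phi>0 + \<psi>) c" using e by simp
      ultimately show ?thesis by (simp add: pairing_lin)
    qed
    moreover have "\<psi> \<in> cochains_c T p" using \<phi> \<phi>0 by (auto simp: cochains_c_compact[OF T] \<psi>_def cscale_def)
    ultimately have "\<psi> \<in> ?W" using vanishing_on_cycles_imp_coboundary[OF T] by blast
    then show "\<phi> \<in> cfun.span ({\<phi>0} \<union> ?W)"
      by (subst e) (intro cfun.span_add cfun.span_scale cfun.span_base; simp)
  qed
  \<comment> \<open>The lower bound: coboundaries vanish on the cycle \<open>z\<close>, where
    \<open>\<phi>0\<close> is 1, so the empty set does not span the cocycles modulo
    coboundaries.\<close>
  have no: "\<not> ?V \<subseteq> cfun.span ?W"
  proof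
    assume "?V \<subseteq> cfun.span ?W"
    moreover have "cfun.span ?W \<subseteq> {\<phi>. pairing \<phi> z = 0}"
      by (rule cfun.span_minimal) (use pairing_coboundary_cycle z in \<open>auto simp: cfun.subspace_def pairing_lin\<close>, simp add: pairing_def)
    ultimately show False using \<phi>0 evz by auto
  qed
  show ?thesis unfolding hc_dim_def quot_dim_def
  proof (rule Least_equality)
    show "\<exists>C. finite C \<and> card C = 1 \<and> C \<subseteq> ?V \<and> ?V \<subseteq> cfun.span (C \<union> ?W)"
      using \<phi>0 sub by (intro exI[of _ "{\<phi>0}"]) auto
    fix n assume "\<exists>C. finite C \<and> card C = n \<and> C \<subseteq> ?V \<and> ?V \<subseteq> cfun.span (C \<union> ?W)"
    then show "1 \<le> n" using no by (cases n) (auto simp: card_eq_0_iff)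
  qed
qed

lemma relcycle_homology_class:
  "carrier (homology_group (int p) T) = homologous_rel_set p T {} ` {c. singular_relcycle p T {} c}"
  "\<one>\<^bsub>homology_group (int p) T\<^esub> = {c. singular_relboundary p T {} c}"
  by (simp_all add: carrier_relative_homology_group one_relative_homology_group image_def)

lemma hc_dim_trivial_homology:
  assumes T: "compact_space T" and tr: "trivial_group (homology_group (int p) T)"
  shows "hc_dim T p = 0"
proof (rule hc_dim_eq_0[OF T])
  fix c assume "singular_relcycle p T {} c"
  then have "homologous_rel_set p T {} c \<in> carrier (homology_group (int p) T)"
    by (auto simp: carrier_relative_homology_group)
  then have "homologous_rel_set p T {} c = singular_relboundary_set p T {}"
    using tr by (simp only: trivial_group_def relcycle_homology_class(2) singleton_iff)
  then show "singular_relboundary p T {} c"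
    by (simp add: homologous_rel_set_eq_relboundary)
qed

text \<open>The isomorphism becomes an integer valued function on cycles, additive and zero exactly
  on boundaries; a cycle of value 1 then meets the criterion \<open>hc_dim_eq_1\<close>.\<close>

lemma hc_dim_integer_homology:
  assumes T: "compact_space T" and iso: "homology_group (int p) T \<cong> integer_group"
  shows "hc_dim T p = 1"
proof -
  let ?H = "homology_group (int p) T" and ?cl = "homologous_rel_set p T {}"
  obtain f where f: "f \<in> iso ?H integer_group" using iso by (auto simp: is_iso_def)
  then have hom: "f \<in> hom ?H integer_group" and bij: "bij_betw f (carrier ?H) UNIV"
    by (auto simp: iso_def)
  have cl: "?cl a \<in> carrier ?H" if "singular_relcycle p T {} a" for a
    using that by (auto simp: carrier_relative_homology_group)
  have "?cl (a + b) = ?cl a \<otimes>\<^bsub>?H\<^esub> ?cl b" for a b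
  proof -
    have "\<exists>r s. x = r + s \<and> homologous_rel p T {} a r \<and> homologous_rel p T {} b s"
      if "homologous_rel p T {} (a + b) x" for x
      using that by (intro exI[of _ a] exI[of _ "x - a"]) (auto simp: homologous_rel_def algebra_simps)
    then show ?thesis
      by (fastforce simp: mult_relative_homology_group intro: homologous_rel_add)
  qed
  then have add: "f (?cl (a + b)) = f (?cl a) + f (?cl b)"
    if "singular_relcycle p T {} a" "singular_relcycle p T {} b" for a b
    using hom_mult[OF hom cl[OF that(1)] cl[OF that(2)]] by simp
  have z0: "f (?cl a) = 0 \<longleftrightarrow> singular_relboundary p T {} a" if "singular_relcycle p T {} a" for a
  proof -
    have "f \<one>\<^bsub>?H\<^esub> = 0" using hom_one[OF hom] by simp
    then have "f (?cl a) = 0 \<longleftrightarrow> ?cl a = \<one>\<^bsub>?H\<^esub>"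
      using bij cl[OF that] group.is_monoid[THEN monoid.one_closed, of ?H] unfolding bij_betw_def
      by (metis group_relative_homology_group inj_on_def)
    then show ?thesis by (simp add: homologous_rel_set_eq_relboundary)
  qed
  have neg: "f (?cl (- a)) = - f (?cl a)" if "singular_relcycle p T {} a" for a
    using add[of a "- a"] z0[of 0] that by (simp add: singular_relcycle_minus)
  have mul: "f (?cl (frag_cmul n a)) = n * f (?cl a)" if a: "singular_relcycle p T {} a" for n a
  proof (induction n rule: int_induct[where k=0])
    case base then show ?case using z0[of 0] by simp
  next
    case (step1 i)
    then show ?case using add[of "frag_cmul i a" a] a
      by (simp add: frag_cmul_distrib distrib_right singular_relcycle_cmul)
  next
    case (step2 i)
    then show ?case using add[of "frag_cmul i a" "- a"] neg[OF a] a
      by (simp add: frag_cmul_diff_distrib left_diff_distrib singular_relcycle_cmul singular_relcycle_minus)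
  qed
  obtain z where z: "singular_relcycle p T {} z" "f (?cl z) = 1"
  proof -
    have "1 \<in> f ` carrier ?H" using bij by (simp add: bij_betw_def)
    then show ?thesis using that by (auto simp: carrier_relative_homology_group)
  qed
  show ?thesis
  proof (rule hc_dim_eq_1[OF T z(1)])
    fix c assume c: "singular_relcycle p T {} c"
    define n where "n = f (?cl c)"
    have "f (?cl (c + frag_cmul (- n) z)) = 0"
      using add[OF c singular_relcycle_cmul[OF z(1)]] mul[OF z(1)] z(2) by (simp add: n_def)
    then have "singular_relboundary p T {} (c + frag_cmul (- n) z)"
      using z0 c z(1) by (simp add: singular_relcycle_add singular_relcycle_cmul del: minus_frag_cmul)
    then show "\<exists>n. singular_relboundary p T {} (c - frag_cmul n z)" by (intro exI[of _ n]) (simp add: diff_conv_add_uminus del: add_uminus_conv_diff)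
  next
    fix n assume n: "singular_relboundary p T {} (frag_cmul n z)"
    then show "n = 0" using z0[of "frag_cmul n z"] mul[OF z(1), of n] z by (simp add: singular_relcycle_cmul)
  qed
qed

section \<open>Independent families, frames and the classical topology\<close>

lemma sum_fun_apply: "(\<Sum>x\<in>S. f x) k = (\<Sum>x\<in>S. f x k)"
  by (induction S rule: infinite_finite_induct) auto

text \<open>A family independent in the sense of frames has no repetitions, since a repetition gives
  the relation with coefficients 1 and -1. This links frames to \<open>cfun.independent\<close>,
  which speaks of sets.\<close>

lemma independent_family:
  fixes g :: "'j \<Rightarrow> 'k \<Rightarrow> complex"
  assumes I: "finite I"
    and "\<And>a. (\<forall>k. (\<Sum>j\<in>I. a j * g j k) = 0) \<Longrightarrow> \<forall>j\<in>I. a j = 0"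
  shows "inj_on g I" "cfun.independent (g ` I)"
proof -
  show inj: "inj_on g I"
  proof (rule inj_onI, rule ccontr)
    fix x y assume xy: "x \<in> I" "y \<in> I" "g x = g y" "x \<noteq> y"
    have "(\<Sum>j\<in>I. (if j = x then 1 else if j = y then -1 else 0) * g j k) = 0" for k
    proof -
      have "(\<Sum>j\<in>I. (if j = x then 1 else if j = y then -1 else 0) * g j k)
          = (\<Sum>j\<in>I. (if j = x then g j k else 0) - (if j = y then g j k else 0))"
        using xy(4) by (intro sum.cong) auto
      also have "\<dots> = g x k - g y k" using xy I by (simp add: sum_subtractf)
      finally show ?thesis using xy(3) by simp
    qed
    then show False using assms(2)[of "\<lambda>j. if j = x then 1 else if j = y then -1 else 0"] xy by auto
  qed
  show "cfun.independent (g ` I)"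
    unfolding cfun.independent_explicit_finite_subsets
  proof (intro allI impI ballI)
    fix S u x assume S: "S \<subseteq> g ` I" "finite S" "(\<Sum>x\<in>S. cscale (u x) x) = 0" "x \<in> S"
    define a where "a j = (if g j \<in> S then u (g j) else 0)" for j
    have "(\<Sum>j\<in>I. a j * g j k) = 0" for k
    proof -
      have "(\<Sum>j\<in>I. a j * g j k) = (\<Sum>j\<in>{j \<in> I. g j \<in> S}. a j * g j k)"
        using I by (intro sum.mono_neutral_right) (auto simp: a_def)
      also have "\<dots> = (\<Sum>x\<in>S. u x * x k)"
        by (rule sum.reindex_cong[symmetric, of g]) (use S inj in \<open>auto simp: inj_on_def a_def\<close>)
      also have "\<dots> = (\<Sum>x\<in>S. cscale (u x) x) k" by (simp add: cscale_def sum_fun_apply)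
      finally show ?thesis using S(3) by simp
    qed
    then have "\<forall>j\<in>I. a j = 0" by (intro assms(2)) auto
    then show "u x = 0" using S(1,4) by (fastforce simp: a_def)
  qed
qed

lemma frame_independent:
  assumes "frame d F"
  shows "inj_on (\<lambda>j k. F (Inr (i, j, k))) {..<d i}" "cfun.independent ((\<lambda>j k. F (Inr (i, j, k))) ` {..<d i})"
proof -
  have a: "\<forall>j<d i. a j = 0" if "\<forall>k. (\<Sum>j<d i. a j * F (Inr (i, j, k))) = 0" for a
    using assms that by (simp add: frame_def)
  show "inj_on (\<lambda>j k. F (Inr (i, j, k))) {..<d i}" "cfun.independent ((\<lambda>j k. F (Inr (i, j, k))) ` {..<d i})"
    using independent_family[of "{..<d i}" "\<lambda>j k. F (Inr (i, j, k))"] a by auto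
qed

text \<open>A point thus determines the degree of every frame representing it, and a condition on
  the dimension vector becomes a condition on \<open>d\<close> alone, constant in the frame.\<close>

lemma dim_pt:
  assumes "frame d F"
  shows "cfun.dim (snd (pt d F) i) = d i"
  using cfun.dim_eq_card_independent[OF frame_independent(2)[OF assms, of i]] card_image[OF frame_independent(1)[OF assms, of i]]
  by (simp add: pt_def)

lemma topspace_classical_topology [simp]: "topspace (classical_topology X) = X"
proof -
  have "openin (classical_topology X) X" by (simp add: openin_classical_topology)
  then show ?thesis
    unfolding topspace_def using openin_classical_topology by blast
qed

lemma continuous_map_pt:
  "continuous_map (top_of_set {F. frame d F \<and> pt d F \<in> X}) (classical_topology X) (pt d)"
  unfolding continuous_map_def
proof (intro conjI allI impI)
  fix U assume "openin (classical_topology X) U"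
  then have U: "U \<subseteq> X" "openin (top_of_set {F. frame d F \<and> pt d F \<in> X}) {F. frame d F \<and> pt d F \<in> U}"
    by (auto simp: openin_classical_topology)
  have "{F \<in> topspace (top_of_set {F. frame d F \<and> pt d F \<in> X}). pt d F \<in> U} = {F. frame d F \<and> pt d F \<in> U}"
    using U(1) by auto
  then show "openin (top_of_set {F. frame d F \<and> pt d F \<in> X})
      {F \<in> topspace (top_of_set {F. frame d F \<and> pt d F \<in> X}). pt d F \<in> U}" using U(2) by simp
qed auto

section \<open>The projective line\<close>

definition vec2 :: "complex \<times> complex \<Rightarrow> nat \<Rightarrow> complex" where
  "vec2 z k = (if k = 0 then fst z else if k = 1 then snd z else 0)"

text \<open>A line in the plane is placed in the component \<open>v\<close>, with zero subspaces
  elsewhere: \<open>\<Upsilon>\<close> is defined on one type of points, and the projective line has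
  to be realised in that type.\<close>

definition line_pt :: "'i \<Rightarrow> complex \<times> complex \<Rightarrow> ('c, 'i::finite, nat) point" where
  "line_pt v z = ((\<lambda>_. 0), (\<lambda>_. {0})(v := cfun.span {vec2 z}))"

definition proj_line :: "'i \<Rightarrow> ('c, 'i::finite, nat) point set" where
  "proj_line v = line_pt v ` (- {0})"

definition frame_deg :: "'i \<Rightarrow> 'i \<Rightarrow> nat" where
  "frame_deg v i = (if i = v then 1 else 0)"

definition line_frame :: "'i \<Rightarrow> complex \<times> complex \<Rightarrow> ('c, 'i, nat) coords" where
  "line_frame v z = (\<lambda>k. case k of Inl _ \<Rightarrow> 0 | Inr (i, j, l) \<Rightarrow> if i = v \<and> j = 0 then vec2 z l else 0)"

definition frame_vec :: "'i \<Rightarrow> ('c, 'i, nat) coords \<Rightarrow> complex \<times> complex" where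
  "frame_vec v F = (F (Inr (v, 0, 0)), F (Inr (v, 0, 1)))"

lemma vec2_eq_0_iff: "(\<forall>k. vec2 z k = 0) \<longleftrightarrow> z = 0"
  by (cases z) (auto simp: vec2_def zero_prod_def dest: spec[of _ 0] spec[of _ 1])

lemma vec2_in: "vec2 z \<in> cspace {0, 1}"
  by (auto simp: vec2_def cspace_def)

lemma subspace_cspace: "cfun.subspace (cspace S)"
  by (auto simp: cfun.subspace_def cspace_def cscale_def)

lemma vec2_eqI: "w \<in> cspace {0, 1} \<Longrightarrow> w = vec2 (w 0, w 1)"
  by (auto simp: vec2_def cspace_def fun_eq_iff)

lemma frame_frame_deg:
  "frame (frame_deg v) F \<longleftrightarrow> (\<forall>i j k. frame_deg v i \<le> j \<longrightarrow> F (Inr (i, j, k)) = 0) \<and> (\<exists>k. F (Inr (v, 0, k)) \<noteq> 0)"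
proof -
  have "(\<forall>i a. (\<forall>k. (\<Sum>j<frame_deg v i. a j * F (Inr (i, j, k))) = 0) \<longrightarrow> (\<forall>j<frame_deg v i. a j = 0))
      \<longleftrightarrow> (\<forall>a. (\<forall>k. (\<Sum>j<1. a j * F (Inr (v, j, k))) = 0) \<longrightarrow> (\<forall>j<1. (a j :: complex) = 0))"
    by (auto simp: frame_deg_def)
  also have "\<dots> \<longleftrightarrow> (\<exists>k. F (Inr (v, 0, k)) \<noteq> 0)"
    by (auto dest: spec[of _ "\<lambda>_. 1"])
  finally show ?thesis unfolding frame_def by simp
qed

lemma pt_frame_deg:
  "pt (frame_deg v) F = (\<lambda>c. F (Inl c), (\<lambda>_. {0})(v := cfun.span {\<lambda>k. F (Inr (v, 0, k))}))"
proof -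
  have "{..<1::nat} = {0}" by auto
  then show ?thesis by (auto simp: pt_def frame_deg_def fun_eq_iff)
qed

lemma frame_line_frame: "z \<noteq> 0 \<Longrightarrow> frame (frame_deg v) (line_frame v z)"
  unfolding frame_frame_deg using vec2_eq_0_iff[of z] by (auto simp: line_frame_def frame_deg_def)

lemma pt_line_frame: "pt (frame_deg v) (line_frame v z) = line_pt v z"
  by (simp add: pt_frame_deg line_frame_def line_pt_def)

lemma proportional_pairs:
  fixes w z :: "complex \<times> complex"
  assumes "w \<noteq> 0" "z \<noteq> 0" "fst w * snd z = snd w * fst z"
  obtains c where "c \<noteq> 0" "fst w = c * fst z" "snd w = c * snd z"
proof (cases "fst z = 0")
  case True
  then have "snd z \<noteq> 0" using assms(2) by (cases z) (auto simp: zero_prod_def)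
  then show ?thesis using that[of "snd w / snd z"] assms True by (cases w) (auto simp: zero_prod_def)
next
  case False
  then show ?thesis using that[of "fst w / fst z"] assms
    by (cases w; cases "fst w = 0") (auto simp: zero_prod_def field_simps)
qed

lemma span_vec2_eq_iff:
  assumes "w \<noteq> 0" "z \<noteq> 0"
  shows "cfun.span {vec2 w} = cfun.span {vec2 z} \<longleftrightarrow> fst w * snd z = snd w * fst z"
proof
  assume "cfun.span {vec2 w} = cfun.span {vec2 z}"
  then have "vec2 w \<in> cfun.span {vec2 z}" using cfun.span_base[of "vec2 w" "{vec2 w}"] by simp
  then obtain c where "vec2 w = cscale c (vec2 z)" by (auto simp: cfun.span_singleton)
  from fun_cong[OF this, of 0] fun_cong[OF this, of 1]
  show "fst w * snd z = snd w * fst z" by (simp add: vec2_def cscale_def)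
next
  assume e: "fst w * snd z = snd w * fst z"
  obtain c where c: "c \<noteq> 0" "fst w = c * fst z" "snd w = c * snd z"
    using proportional_pairs[OF assms e] by blast
  then have v: "vec2 w = cscale c (vec2 z)" by (auto simp: vec2_def cscale_def)
  show "cfun.span {vec2 w} = cfun.span {vec2 z}"
    unfolding v using cfun.span_image_scale[of "{vec2 z}" "\<lambda>_. c"] c(1) by simp
qed

lemma inner_vec:
  assumes "frame (frame_deg v) F" "(\<lambda>k. F (Inr (v, 0, k))) \<in> cspace {0, 1}"
  shows "frame_vec v F \<noteq> 0 \<and> (\<lambda>k. F (Inr (v, 0, k))) = vec2 (frame_vec v F)"
proof
  show e: "(\<lambda>k. F (Inr (v, 0, k))) = vec2 (frame_vec v F)"
    unfolding frame_vec_def by (rule vec2_eqI[OF assms(2)])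
  obtain k where "F (Inr (v, 0, k)) \<noteq> 0" using assms(1) by (auto simp: frame_frame_deg)
  then show "frame_vec v F \<noteq> 0" using fun_cong[OF e, of k] vec2_eq_0_iff[of "frame_vec v F"] by metis
qed

lemma frame_proj_line:
  fixes F :: "('c, 'i::finite, nat) coords"
  assumes F: "frame d F" "pt d F \<in> proj_line v"
  shows "d = frame_deg v" "frame_vec v F \<noteq> 0" "pt d F = line_pt v (frame_vec v F)"
proof -
  obtain z where z: "z \<noteq> 0" "pt d F = line_pt v z" using F(2) by (auto simp: proj_line_def)
  have "d i = frame_deg v i" for i
    using dim_pt[OF F(1), of i] dim_pt[OF frame_line_frame[OF z(1)], of v i] z(2)
    unfolding pt_line_frame by metis
  then show d: "d = frame_deg v" by auto
  have "snd (pt (frame_deg v) F) v = cfun.span {vec2 z}" using z(2) unfolding d by (simp add: line_pt_def)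
  then have "cfun.span {\<lambda>k. F (Inr (v, 0, k))} = cfun.span {vec2 z}"
    by (simp add: pt_frame_deg line_pt_def)
  then have "(\<lambda>k. F (Inr (v, 0, k))) \<in> cfun.span {vec2 z}"
    using cfun.span_base[of "\<lambda>k. F (Inr (v, 0, k))" "{\<lambda>k. F (Inr (v, 0, k))}"] by simp
  then have "(\<lambda>k. F (Inr (v, 0, k))) \<in> cspace {0, 1}"
    using cfun.span_minimal[of "{vec2 z}" "cspace {0, 1}"] vec2_in[of z] subspace_cspace by blast
  then have w: "frame_vec v F \<noteq> 0" "(\<lambda>k. F (Inr (v, 0, k))) = vec2 (frame_vec v F)"
    using inner_vec[OF F(1)[unfolded d]] by blast+
  show "frame_vec v F \<noteq> 0" by (rule w(1))
  have "fst (pt (frame_deg v) F) = (\<lambda>_. 0)" using z(2) unfolding d by (simp add: line_pt_def)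
  then show "pt d F = line_pt v (frame_vec v F)" unfolding d pt_frame_deg line_pt_def w(2)[symmetric] by simp
qed

lemma ambientD:
  assumes "p \<in> ambient S n"
  shows "fst p \<in> cspace S" "cfun.subspace (snd p i)" "snd p i \<subseteq> cspace (n i)"
  using assms unfolding ambient_def by auto blast+

lemma ambient_frame_deg:
  fixes F :: "('c, 'i::finite, nat) coords"
  assumes "frame (frame_deg v) F" "pt (frame_deg v) F \<in> ambient {} ((\<lambda>_. {})(v := {0, 1}))"
  shows "pt (frame_deg v) F \<in> proj_line v"
proof -
  have "cfun.span {\<lambda>k. F (Inr (v, 0, k))} \<subseteq> cspace {0, 1}" "(\<lambda>c. F (Inl c)) = (\<lambda>_. 0)"
    using ambientD(1)[OF assms(2)] ambientD(3)[OF assms(2), of v] by (simp_all add: pt_frame_deg cspace_def fun_eq_iff)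
  then have "(\<lambda>k. F (Inr (v, 0, k))) \<in> cspace {0, 1}" "(\<lambda>c. F (Inl c)) = (\<lambda>_. 0)"
    using cfun.span_base[of "\<lambda>k. F (Inr (v, 0, k))" "{\<lambda>k. F (Inr (v, 0, k))}"] by auto
  then show ?thesis using inner_vec[OF assms(1)]
    by (auto simp: proj_line_def pt_frame_deg line_pt_def)
qed

lemma proj_line_ambient: "proj_line v \<subseteq> ambient {} ((\<lambda>_. {})(v := {0, 1}))"
proof -
  have "cfun.span {vec2 z} \<subseteq> cspace {0, 1}" for z
    by (rule cfun.span_minimal) (use subspace_cspace vec2_in in blast)+
  moreover have "cfun.subspace {0::nat \<Rightarrow> complex}" "{0::nat \<Rightarrow> complex} \<subseteq> cspace {}" "(\<lambda>_. 0) \<in> cspace {}"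
    by (auto simp: cspace_def cfun.subspace_single_0)
  ultimately have "line_pt v z \<in> ambient {} ((\<lambda>_. {})(v := {0, 1}))" for z
    unfolding line_pt_def ambient_def using cfun.subspace_span by auto
  then show ?thesis unfolding proj_line_def by blast
qed

lemma zclosed_proj_line: "zclosed_in {} ((\<lambda>_. {})(v := {0, 1})) (proj_line v :: ('c, 'i::finite, nat) point set)"
  unfolding zclosed_in_def
proof (intro conjI allI)
  fix d
  show "\<exists>\<Phi>. (\<forall>\<phi>\<in>\<Phi>. poly_function \<phi>) \<and> (\<forall>F :: ('c, 'i, nat) coords. frame d F \<and> pt d F \<in> ambient {} ((\<lambda>_. {})(v := {0, 1})) \<longrightarrow>
      (pt d F \<in> proj_line v) = (\<forall>\<phi>\<in>\<Phi>. \<phi> F = 0))"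
  proof (cases "d = frame_deg v")
    case True
    then show ?thesis using ambient_frame_deg by (intro exI[of _ "{}"]) auto
  next
    case False
    then have "pt d F \<notin> proj_line v" if "frame d F" for F :: "('c, 'i, nat) coords" using frame_proj_line(1)[OF that] by blast
    then show ?thesis by (intro exI[of _ "{\<lambda>_. 1}"]) (simp add: pf_const)
  qed
qed (rule proj_line_ambient)

lemma smooth_projective_proj_line: "smooth_projective (proj_line v :: ('c, 'i::finite, nat) point set)"
  unfolding smooth_projective_def
proof (intro exI[of _ "(\<lambda>_. {})(v := {0, 1})"] conjI allI impI)
  show "zclosed_in {} ((\<lambda>_. {})(v := {0, 1})) (proj_line v)" by (rule zclosed_proj_line)
  fix d and F0 :: "('c, 'i, nat) coords" assume "frame d F0 \<and> pt d F0 \<in> proj_line v"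
  then have d: "d = frame_deg v" using frame_proj_line(1) by blast
  show "\<exists>(r::nat) \<phi> g. (\<forall>l<r. poly_function (\<phi> l)) \<and> poly_function g \<and> g F0 \<noteq> 0 \<and>
           (\<forall>F :: ('c, 'i, nat) coords. frame d F \<and> pt d F \<in> ambient {} ((\<lambda>_. {})(v := {0, 1})) \<and> g F \<noteq> 0 \<longrightarrow>
              (pt d F \<in> proj_line v \<longleftrightarrow> (\<forall>l<r. \<phi> l F = 0))) \<and>
           (\<forall>a. (\<forall>i. \<forall>j<d i. \<forall>k\<in>((\<lambda>_. {})(v := {0, 1})) i.
                   (\<Sum>l<r. a l * deriv (\<lambda>z. \<phi> l (F0(Inr (i, j, k) := z))) (F0 (Inr (i, j, k)))) = 0)
                \<longrightarrow> (\<forall>l<r. a l = 0))"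
  \<comment> \<open>Every frame of this degree in the ambient variety represents a point of the
    line, so no equation is imposed and the Jacobian condition is empty.\<close>
  proof (rule exI[of _ "0::nat"], rule exI[of _ "\<lambda>_ _. 0"], rule exI[of _ "\<lambda>_. 1"], intro conjI allI impI)
    fix F :: "('c, 'i, nat) coords" assume "frame d F \<and> pt d F \<in> ambient {} ((\<lambda>_. {})(v := {0, 1})) \<and> (1::complex) \<noteq> 0"
    then have "pt d F \<in> proj_line v" unfolding d using ambient_frame_deg by blast
    then show "pt d F \<in> proj_line v \<longleftrightarrow> (\<forall>l<0::nat. (0::complex) = 0)" by simp
  qed (simp_all add: pf_const)
qed auto

section \<open>The Hopf map and the homeomorphism with the 2-sphere\<close>

definition hopf_c :: "complex \<times> complex \<Rightarrow> complex" where "hopf_c z = fst z * cnj (snd z)"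

definition hopf_a :: "complex \<times> complex \<Rightarrow> real" where "hopf_a z = (cmod (fst z))\<^sup>2"

definition hopf_b :: "complex \<times> complex \<Rightarrow> real" where "hopf_b z = (cmod (snd z))\<^sup>2"

text \<open>The Hopf map S^3 -> S^2, made homogeneous of degree 0 so that it factors over lines. It
  takes values in sequences because \<open>nsphere\<close> consists of sequences.\<close>

definition hopf :: "complex \<times> complex \<Rightarrow> nat \<Rightarrow> real" where
  "hopf z k = (if k = 0 then 2 * Re (hopf_c z) / (hopf_a z + hopf_b z)
     else if k = 1 then 2 * Im (hopf_c z) / (hopf_a z + hopf_b z)
     else if k = 2 then (hopf_a z - hopf_b z) / (hopf_a z + hopf_b z) else 0)"

lemma hopf_norm_pos: "z \<noteq> 0 \<Longrightarrow> hopf_a z + hopf_b z > 0"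
  by (cases z) (auto simp: zero_prod_def sum_power2_gt_zero_iff hopf_a_def hopf_b_def)

lemma hopf_c_norm: "(Re (hopf_c z))\<^sup>2 + (Im (hopf_c z))\<^sup>2 = hopf_a z * hopf_b z"
  unfolding hopf_a_def hopf_b_def hopf_c_def by (metis cmod_power2 norm_mult complex_mod_cnj power_mult_distrib)

lemma hopf_in: assumes "z \<noteq> 0" shows "hopf z \<in> topspace (nsphere 2)"
proof -
  have s: "(\<Sum>i\<le>2. (hopf z i)\<^sup>2) = (hopf z 0)\<^sup>2 + (hopf z 1)\<^sup>2 + (hopf z 2)\<^sup>2"
    by (simp add: numeral_2_eq_2)
  have eq: "(2 * R / N)\<^sup>2 + (2 * J / N)\<^sup>2 + (D / N)\<^sup>2 = (4 * (R\<^sup>2 + J\<^sup>2) + D\<^sup>2) / N\<^sup>2" for R J D N :: real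
    by (simp add: power_divide add_divide_distrib power_mult_distrib)
  have "(hopf z 0)\<^sup>2 + (hopf z 1)\<^sup>2 + (hopf z 2)\<^sup>2
      = (4 * (hopf_a z * hopf_b z) + (hopf_a z - hopf_b z)\<^sup>2) / (hopf_a z + hopf_b z)\<^sup>2"
    unfolding hopf_c_norm[symmetric] eq[symmetric] by (simp add: hopf_def)
  also have "4 * (hopf_a z * hopf_b z) + (hopf_a z - hopf_b z)\<^sup>2 = (hopf_a z + hopf_b z)\<^sup>2"
    by (simp add: power2_eq_square algebra_simps)
  also have "(hopf_a z + hopf_b z)\<^sup>2 / (hopf_a z + hopf_b z)\<^sup>2 = 1"
    using hopf_norm_pos[OF assms] by (intro divide_self) auto
  finally show ?thesis unfolding nsphere using s by (auto simp: hopf_def)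
qed

text \<open>The squared modulus of the determinant of \<open>z\<close> and \<open>w\<close> expands
  to a_w b_z + b_w a_z - 2 Re(c_z cnj(c_w)), with a, b, c the values of \<open>hopf_a\<close>,
  \<open>hopf_b\<close>, \<open>hopf_c\<close>. Equal Hopf images make the two products and the real
  part all equal, so the determinant vanishes.\<close>

lemma hopf_eq_imp:
  assumes "z \<noteq> 0" "w \<noteq> 0" "hopf z = hopf w"
  shows "fst w * snd z = snd w * fst z"
proof -
  note pos = hopf_norm_pos[OF assms(1)] hopf_norm_pos[OF assms(2)]
  have r: "2 * Re (hopf_c z) / (hopf_a z + hopf_b z) = 2 * Re (hopf_c w) / (hopf_a w + hopf_b w)"
    "2 * Im (hopf_c z) / (hopf_a z + hopf_b z) = 2 * Im (hopf_c w) / (hopf_a w + hopf_b w)"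
    "(hopf_a z - hopf_b z) / (hopf_a z + hopf_b z) = (hopf_a w - hopf_b w) / (hopf_a w + hopf_b w)"
    using fun_cong[OF assms(3), of 0] fun_cong[OF assms(3), of 1] fun_cong[OF assms(3), of 2]
    by (simp_all add: hopf_def)
  have e1: "Re (hopf_c z) * (hopf_a w + hopf_b w) = Re (hopf_c w) * (hopf_a z + hopf_b z)"
    "Im (hopf_c z) * (hopf_a w + hopf_b w) = Im (hopf_c w) * (hopf_a z + hopf_b z)"
    using r pos frac_eq_eq[of "hopf_a z + hopf_b z" "hopf_a w + hopf_b w"] by simp_all
  have "(hopf_a z - hopf_b z) * (hopf_a w + hopf_b w) = (hopf_a w - hopf_b w) * (hopf_a z + hopf_b z)"
    using r(3) pos frac_eq_eq[of "hopf_a z + hopf_b z" "hopf_a w + hopf_b w"] by simp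
  then have AB: "hopf_a z * hopf_b w = hopf_a w * hopf_b z" by (simp add: algebra_simps)
  have "(Re (hopf_c z) * Re (hopf_c w) + Im (hopf_c z) * Im (hopf_c w)) * (hopf_a w + hopf_b w)
      = Re (hopf_c w) * (Re (hopf_c z) * (hopf_a w + hopf_b w)) + Im (hopf_c w) * (Im (hopf_c z) * (hopf_a w + hopf_b w))"
    by (simp add: algebra_simps)
  also have "\<dots> = ((Re (hopf_c w))\<^sup>2 + (Im (hopf_c w))\<^sup>2) * (hopf_a z + hopf_b z)"
    unfolding e1 by (simp add: power2_eq_square algebra_simps)
  also have "\<dots> = hopf_a w * (hopf_a z * hopf_b w) + hopf_b w * (hopf_a w * hopf_b z)"
    unfolding hopf_c_norm by (simp add: algebra_simps)
  also have "\<dots> = hopf_a w * hopf_b z * (hopf_a w + hopf_b w)" unfolding AB by (simp add: algebra_simps)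
  finally have m: "Re (hopf_c z) * Re (hopf_c w) + Im (hopf_c z) * Im (hopf_c w) = hopf_a w * hopf_b z"
    using pos by simp
  have "(cmod (fst w * snd z - snd w * fst z))\<^sup>2
     = hopf_a w * hopf_b z + hopf_b w * hopf_a z - 2 * (Re (hopf_c z) * Re (hopf_c w) + Im (hopf_c z) * Im (hopf_c w))"
    unfolding hopf_a_def hopf_b_def hopf_c_def cmod_power2 by (simp add: power2_eq_square algebra_simps)
  then have "(cmod (fst w * snd z - snd w * fst z))\<^sup>2 = 0" using m AB by (simp add: mult.commute)
  then show ?thesis by simp
qed

lemma hopf_scale:
  assumes "z \<noteq> 0" "w \<noteq> 0" "fst w * snd z = snd w * fst z"
  shows "hopf w = hopf z"
proof -
  obtain c where c: "c \<noteq> 0" "fst w = c * fst z" "snd w = c * snd z"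
    using proportional_pairs[OF assms(2,1,3)] by blast
  define k where "k = (cmod c)\<^sup>2"
  have k: "k \<noteq> 0" using c(1) by (simp add: k_def)
  have "hopf_a w = k * hopf_a z" "hopf_b w = k * hopf_b z"
    unfolding hopf_a_def hopf_b_def k_def c by (simp_all add: norm_mult power_mult_distrib)
  then have ab: "hopf_a w + hopf_b w = k * (hopf_a z + hopf_b z)" "hopf_a w - hopf_b w = k * (hopf_a z - hopf_b z)"
    by (simp_all add: distrib_left right_diff_distrib)
  have "hopf_c w = of_real k * hopf_c z"
    unfolding hopf_c_def k_def c by (simp only: complex_norm_square complex_cnj_mult ac_simps)
  then have "2 * Re (hopf_c w) = k * (2 * Re (hopf_c z))" "2 * Im (hopf_c w) = k * (2 * Im (hopf_c z))" by simp_all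
  then have "hopf w n = hopf z n" for n
    unfolding hopf_def ab by (simp only: mult_divide_mult_cancel_left[OF k])
  then show ?thesis by blast
qed

lemma hopf_surj:
  assumes "x \<in> topspace (nsphere 2)"
  obtains z where "z \<noteq> 0" "hopf z = x"
proof -
  have x: "(x 0)\<^sup>2 + (x 1)\<^sup>2 + (x 2)\<^sup>2 = 1" "\<And>i. i > 2 \<Longrightarrow> x i = 0"
    using assms by (auto simp: nsphere numeral_2_eq_2)
  have eqI: "hopf z = x" if "hopf z 0 = x 0" "hopf z 1 = x 1" "hopf z 2 = x 2" for z
  proof
    fix k :: nat
    consider "k = 0" | "k = 1" | "k = 2" | "k > 2" by linarith
    then show "hopf z k = x k" using that x(2) by cases (auto simp: hopf_def)
  qed
  show ?thesis
  proof (cases "x 2 = -1")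
    case True
    then have "x 0 = 0" "x 1 = 0" using x(1) by (auto simp: sum_power2_eq_zero_iff)
    then have "hopf (0, 1) = x" using True by (intro eqI) (auto simp: hopf_def hopf_a_def hopf_b_def hopf_c_def)
    then show ?thesis using that[of "(0, 1)"] by (auto simp: zero_prod_def)
  next
    case False
    \<comment> \<open>Stereographic projection in homogeneous form: the preimage is (1 + x2, x0 - i
      x1), of squared norm 2 (1 + x2). At the pole x2 = -1 this vector is zero, whence the separate
      case.\<close>
    define a where "a = 1 + x 2"
    have a: "a \<noteq> 0" using False by (simp add: a_def)
    define z where "z = (complex_of_real a, Complex (x 0) (- x 1))"
    have "hopf_a z + hopf_b z = 2 * a" "hopf_a z - hopf_b z = 2 * a * x 2" "hopf_c z = of_real a * Complex (x 0) (x 1)"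
      using x(1) unfolding hopf_a_def hopf_b_def hopf_c_def z_def a_def cmod_power2
      by (simp_all add: power2_eq_square algebra_simps complex_eq_iff)
    then have "hopf z = x" using a by (intro eqI) (auto simp: hopf_def)
    moreover have "z \<noteq> 0" using a by (simp add: z_def zero_prod_def)
    ultimately show ?thesis using that by blast
  qed
qed

definition hopf_pt :: "'i \<Rightarrow> ('c, 'i::finite, nat) point \<Rightarrow> nat \<Rightarrow> real" where
  "hopf_pt v q = hopf (SOME z. z \<noteq> 0 \<and> cfun.span {vec2 z} = snd q v)"

lemma hopf_line_pt: "z \<noteq> 0 \<Longrightarrow> hopf_pt v (line_pt v z) = hopf z"
proof -
  assume z: "z \<noteq> 0"
  define w where "w = (SOME w. w \<noteq> 0 \<and> cfun.span {vec2 w} = cfun.span {vec2 z})"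
  have "w \<noteq> 0 \<and> cfun.span {vec2 w} = cfun.span {vec2 z}"
    unfolding w_def by (rule someI[of _ z]) (use z in auto)
  then have "hopf w = hopf z" using hopf_scale[OF z, of w] span_vec2_eq_iff[of w z] z by blast
  then show "hopf_pt v (line_pt v z) = hopf z" by (simp add: hopf_pt_def line_pt_def w_def)
qed

lemma line_pt_eq_iff:
  assumes "w \<noteq> 0" "z \<noteq> 0"
  shows "line_pt v w = line_pt v z \<longleftrightarrow> fst w * snd z = snd w * fst z"
  unfolding span_vec2_eq_iff[OF assms, symmetric] line_pt_def
  by (auto dest: fun_cong[of _ _ v])

text \<open>The unit sphere of the plane maps onto the projective line, which inherits compactness
  and path connectedness through this map.\<close>

lemma continuous_line_pt:
  "continuous_map (top_of_set (sphere 0 1)) (classical_topology (proj_line v :: ('c, 'i::finite, nat) point set)) (line_pt v)"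
proof -
  let ?Y = "top_of_set {F :: ('c, 'i, nat) coords. frame (frame_deg v) F \<and> pt (frame_deg v) F \<in> proj_line v}"
  have "continuous_on (sphere 0 1) (line_frame v :: _ \<Rightarrow> ('c, 'i, nat) coords)"
  proof (rule continuous_on_coordinatewise_then_product)
    fix k :: "'c + 'i \<times> nat \<times> nat"
    show "continuous_on (sphere 0 1) (\<lambda>z. line_frame v z k)"
    proof (cases k)
      case (Inr q)
      obtain i j l where "q = (i, j, l)" by (cases q)
      then show ?thesis using Inr by (cases "i = v \<and> j = 0"; cases "l = 0"; cases "l = 1") (auto simp: line_frame_def vec2_def intro!: continuous_intros)
    qed (simp add: line_frame_def)
  qed
  moreover have "line_frame v \<in> sphere 0 1 \<rightarrow> {F :: ('c, 'i, nat) coords. frame (frame_deg v) F \<and> pt (frame_deg v) F \<in> proj_line v}"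
  proof
    fix z :: "complex \<times> complex" assume "z \<in> sphere 0 1"
    then have "z \<noteq> 0" by auto
    then show "line_frame v z \<in> {F :: ('c, 'i, nat) coords. frame (frame_deg v) F \<and> pt (frame_deg v) F \<in> proj_line v}"
      by (simp add: pt_line_frame proj_line_def frame_line_frame)
  qed
  ultimately have "continuous_map (top_of_set (sphere 0 1)) ?Y (line_frame v)"
    by (simp add: continuous_map_in_subtopology image_subset_iff_funcset)
  from continuous_map_compose[OF this continuous_map_pt]
  show ?thesis by (simp add: o_def pt_line_frame)
qed

lemma line_pt_sphere: "line_pt v ` sphere 0 1 = proj_line v"
proof (rule antisym)
  show "line_pt v ` sphere 0 1 \<subseteq> proj_line v" by (auto simp: proj_line_def)
  show "proj_line v \<subseteq> line_pt v ` sphere 0 1"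
  proof
    fix x assume "x \<in> proj_line v"
    then obtain z where z: "z \<noteq> 0" "x = line_pt v z" by (auto simp: proj_line_def)
    then have "line_pt v (z /\<^sub>R norm z) = x" unfolding z(2)
      by (subst line_pt_eq_iff) auto
    moreover have "z /\<^sub>R norm z \<in> sphere 0 1" using z(1) by simp
    ultimately show "x \<in> line_pt v ` sphere 0 1" by blast
  qed
qed

lemma compact_path_connected_proj_line:
  "compact_space (classical_topology (proj_line v))" "path_connected_space (classical_topology (proj_line v))"
proof -
  have "compactin (classical_topology (proj_line v)) (line_pt v ` sphere 0 1)"
    by (rule image_compactin[OF _ continuous_line_pt]) (simp add: compactin_subtopology compact_sphere)
  then show "compact_space (classical_topology (proj_line v))"
    unfolding line_pt_sphere by (simp add: compact_space_def)
  have "path_connected (sphere (0 :: complex \<times> complex) 1)"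
    by (rule path_connected_sphere) simp
  then have "path_connectedin (top_of_set (sphere (0 :: complex \<times> complex) 1)) (sphere 0 1)"
    by (simp add: path_connectedin_subtopology)
  from path_connectedin_continuous_map_image[OF continuous_line_pt this]
  show "path_connected_space (classical_topology (proj_line v))"
    unfolding line_pt_sphere by (metis path_connectedin_topspace topspace_classical_topology)
qed

text \<open>The classical topology is a quotient topology, so openness is tested on frames; there
  the map is an explicit quotient with nonvanishing denominator.\<close>

lemma continuous_hopf_pt:
  "continuous_map (classical_topology (proj_line v :: ('c, 'i::finite, nat) point set)) (nsphere 2) (hopf_pt v)"
proof -
  let ?X = "proj_line v :: ('c, 'i, nat) point set"
  have im: "hopf_pt v \<in> ?X \<rightarrow> topspace (nsphere 2)"
  proof
    fix x assume "x \<in> ?X"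
    then obtain z where z: "z \<noteq> 0" "x = line_pt v z" unfolding proj_line_def by blast
    show "hopf_pt v x \<in> topspace (nsphere 2)" unfolding z(2) hopf_line_pt[OF z(1)] by (rule hopf_in[OF z(1)])
  qed
  have "continuous_map (classical_topology ?X) euclideanreal (\<lambda>x. hopf_pt v x k)" for k
    unfolding continuous_map_def
  proof (intro conjI allI impI)
    fix U assume "openin euclideanreal U"
    then have U: "open U" by simp
    show "openin (classical_topology ?X) {x \<in> topspace (classical_topology ?X). hopf_pt v x k \<in> U}"
      unfolding openin_classical_topology
    proof (intro conjI allI)
      fix d
      let ?D = "{F :: ('c, 'i, nat) coords. frame d F \<and> pt d F \<in> ?X}"
      have eq: "{F. frame d F \<and> pt d F \<in> {x \<in> topspace (classical_topology ?X). hopf_pt v x k \<in> U}}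
          = ?D \<inter> (\<lambda>F. hopf (frame_vec v F) k) -` U"
      proof -
        have "hopf_pt v (pt d F) k = hopf (frame_vec v F) k" if "frame d F" "pt d F \<in> ?X" for F :: "('c, 'i, nat) coords"
          using frame_proj_line(3)[OF that] hopf_line_pt[OF frame_proj_line(2)[OF that]] by metis
        then show ?thesis by auto
      qed
      have ne: "(cmod (F (Inr (v, 0, 0))))\<^sup>2 + (cmod (F (Inr (v, 0, Suc 0))))\<^sup>2 \<noteq> 0" if "F \<in> ?D" for F
      proof -
        have "frame_vec v F \<noteq> 0" using frame_proj_line(2) that by blast
        from hopf_norm_pos[OF this] show ?thesis unfolding hopf_a_def hopf_b_def frame_vec_def fst_conv snd_conv One_nat_def by linarith
      qed
      have c: "continuous_on ?D (\<lambda>F. F k)" for k by (intro continuous_on_product_coordinates continuous_on_subset[OF _ subset_UNIV])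
      have "continuous_on ?D (\<lambda>F. hopf (frame_vec v F) k)"
        unfolding hopf_def hopf_a_def hopf_b_def hopf_c_def frame_vec_def
        using ne by (cases "k = 0"; cases "k = 1"; cases "k = 2") (auto intro!: continuous_intros c)
      then show "openin (top_of_set ?D) {F. frame d F \<and> pt d F \<in> {x \<in> topspace (classical_topology ?X). hopf_pt v x k \<in> U}}"
        unfolding eq using U by (rule continuous_openin_preimage_gen)
    qed auto
  qed auto
  then have "continuous_map (classical_topology ?X) (powertop_real UNIV) (hopf_pt v)"
    by (simp add: continuous_map_componentwise_UNIV)
  then show ?thesis using im unfolding nsphere
    by (simp add: continuous_map_in_subtopology topspace_subtopology)
qed

text \<open>A continuous bijection from a compact space to a Hausdorff space is a
  homeomorphism.\<close>

lemma homeomorphic_proj_line: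
  "classical_topology (proj_line v :: ('c, 'i::finite, nat) point set) homeomorphic_space nsphere 2"
proof -
  let ?X = "proj_line v :: ('c, 'i, nat) point set"
  have "homeomorphic_map (classical_topology ?X) (nsphere 2) (hopf_pt v)"
  proof (rule continuous_imp_homeomorphic_map)
    show "Hausdorff_space (nsphere 2)"
      unfolding nsphere by (intro Hausdorff_space_subtopology) (simp add: Hausdorff_space_product_topology)
    have "topspace (nsphere 2) \<subseteq> hopf_pt v ` ?X"
    proof
      fix x assume "x \<in> topspace (nsphere 2)"
      then obtain z where "z \<noteq> 0" "hopf z = x" by (rule hopf_surj)
      then have "x = hopf_pt v (line_pt v z :: ('c, 'i, nat) point)" "(line_pt v z :: ('c, 'i, nat) point) \<in> ?X"
        by (simp_all add: hopf_line_pt proj_line_def)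
      then show "x \<in> hopf_pt v ` ?X" by blast
    qed
    moreover have "hopf_pt v ` ?X \<subseteq> topspace (nsphere 2)"
      using continuous_map_image_subset_topspace[OF continuous_hopf_pt[of v]] by simp
    ultimately show "hopf_pt v ` topspace (classical_topology ?X) = topspace (nsphere 2)" by simp
    show "inj_on (hopf_pt v) (topspace (classical_topology ?X))"
    proof (rule inj_onI)
      fix x y assume "x \<in> topspace (classical_topology ?X)" "y \<in> topspace (classical_topology ?X)" "hopf_pt v x = hopf_pt v y"
      then obtain z w where zw: "z \<noteq> 0" "x = line_pt v z" "w \<noteq> 0" "y = line_pt v w" "hopf_pt v x = hopf_pt v y"
        unfolding topspace_classical_topology proj_line_def by blast
      then have "hopf w = hopf z" unfolding zw(2,4) hopf_line_pt[OF zw(1)] hopf_line_pt[OF zw(3)] by simp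
      then show "x = y" unfolding zw(2,4) line_pt_eq_iff[OF zw(1,3)] by (rule hopf_eq_imp[OF zw(3,1)])
    qed
  qed (auto intro: compact_path_connected_proj_line continuous_hopf_pt)
  then show ?thesis by (rule homeomorphic_map_imp_homeomorphic_space)
qed

text \<open>Reduced homology is transported from the 2-sphere and agrees with homology in positive
  degrees; degree 0 rests on path connectedness.\<close>

lemma hc_dim_proj_line:
  "hc_dim (classical_topology (proj_line v :: ('c, 'i::finite, nat) point set)) p = (if p = 0 \<or> p = 2 then 1 else 0)"
proof -
  let ?T = "classical_topology (proj_line v :: ('c, 'i, nat) point set)"
  note C = compact_path_connected_proj_line[of v]
  have red: "reduced_homology_group (int p) ?T \<cong> reduced_homology_group (int p) (nsphere 2)"
    by (rule homeomorphic_space_imp_isomorphic_reduced_homology_groups[OF homeomorphic_proj_line])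
  consider "p = 0" | "p = 2" | "p \<noteq> 0" "p \<noteq> 2" by blast
  then show ?thesis
  proof cases
    case 1
    have "line_pt v (1, 1) \<in> (proj_line v :: ('c, 'i, nat) point set)" by (auto simp: proj_line_def zero_prod_def)
    then have "homology_group 0 ?T \<cong> integer_group"
      using C(2) by (intro isomorphic_integer_zeroth_homology_group) auto
    then show ?thesis using hc_dim_integer_homology[OF C(1), of 0] 1 by simp
  next
    case 2
    have "homology_group (int p) ?T \<cong> integer_group"
      using iso_trans[OF red, of integer_group] reduced_homology_group_nsphere(1)[of 2] 2
      by (simp add: un_reduced_homology_group)
    then show ?thesis using hc_dim_integer_homology[OF C(1), of p] 2 by simp
  next
    case 3
    have "trivial_group (reduced_homology_group (int p) (nsphere 2))"
      using 3 by (intro reduced_homology_group_nsphere(2)) auto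
    then have "trivial_group (reduced_homology_group (int p) ?T)"
      using isomorphic_group_triviality[OF red] by simp
    then show ?thesis using hc_dim_trivial_homology[OF C(1), of p] 3 by (simp add: un_reduced_homology_group)
  qed
qed

section \<open>Polynomial functions\<close>

lemma poly_function_sum:
  "(\<And>i. i \<in> A \<Longrightarrow> poly_function (f i)) \<Longrightarrow> poly_function (\<lambda>F. \<Sum>i\<in>A. f i F)"
  by (induction A rule: infinite_finite_induct) (auto intro: poly_function.intros)

lemma poly_function_uminus: "poly_function f \<Longrightarrow> poly_function (\<lambda>F. - f F)"
  using pf_mult[OF pf_const[of "-1"], of f] by simp

lemma poly_function_diff: "poly_function f \<Longrightarrow> poly_function g \<Longrightarrow> poly_function (\<lambda>F. f F - g F)"
  using pf_add[of f "\<lambda>F. - g F"] by (simp add: poly_function_uminus)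

lemma poly_function_if: "(c \<Longrightarrow> poly_function f) \<Longrightarrow> (\<not> c \<Longrightarrow> poly_function g) \<Longrightarrow> poly_function (\<lambda>F. if c then f F else g F)"
  by (cases c) auto

lemma poly_function_subst:
  assumes "poly_function \<phi>" "\<And>k. poly_function (q k)"
  shows "poly_function (\<lambda>F. \<phi> (\<lambda>k. q k F))"
  using assms(1) by induction (auto intro: poly_function.intros assms(2))

lemmas poly_function_intros = pf_const pf_coord pf_add pf_mult poly_function_sum poly_function_uminus
  poly_function_diff poly_function_if

lemma poly_function_Inr:
  assumes "poly_function \<phi>"
  shows "poly_function (\<lambda>F. \<phi> (F \<circ> Inr))"
  using poly_function_subst[OF assms, of "\<lambda>k F. F (Inr k)"] by (simp add: pf_coord o_def)

text \<open>Fraction-free Gaussian elimination: \<open>L\<close> is a left inverse, up to the factor \<open>b\<close>, of the matrix with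
  the columns \<open>A j\<close>.\<close>

lemma poly_left_inverse:
  assumes "finite J" "\<And>j r. j \<in> J \<Longrightarrow> r \<in> R \<Longrightarrow> poly_function (A j r)"
    and "\<And>a. (\<forall>r\<in>R. (\<Sum>j\<in>J. a j * A j r F0) = 0) \<Longrightarrow> \<forall>j\<in>J. a j = 0"
  shows "\<exists>K L b. finite K \<and> K \<subseteq> R \<and> poly_function b \<and> b F0 \<noteq> 0 \<and> (\<forall>j\<in>J. \<forall>r\<in>K. poly_function (L j r)) \<and>
    (\<forall>F. \<forall>j\<in>J. \<forall>j'\<in>J. (\<Sum>r\<in>K. L j r F * A j' r F) = (if j = j' then b F else 0))"
  using assms
proof (induction J rule: finite_induct)
  case empty
  show ?case by (rule exI[of _ "{}"], rule exI, rule exI[of _ "\<lambda>_. 1"]) (auto intro: pf_const)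
next
  case (insert x J)
  have ind: "\<forall>j\<in>J. a j = 0" if a: "\<forall>r\<in>R. (\<Sum>j\<in>J. a j * A j r F0) = 0" for a
  proof -
    have "\<forall>r\<in>R. (\<Sum>j\<in>insert x J. (a(x := 0)) j * A j r F0) = 0"
    proof
      fix r assume "r \<in> R"
      have "(\<Sum>j\<in>J. (a(x := 0)) j * A j r F0) = (\<Sum>j\<in>J. a j * A j r F0)"
        using insert.hyps(2) by (intro sum.cong) auto
      then show "(\<Sum>j\<in>insert x J. (a(x := 0)) j * A j r F0) = 0"
        using insert.hyps a \<open>r \<in> R\<close> by simp
    qed
    from insert.prems(2)[OF this] show ?thesis using insert.hyps(2) by (metis fun_upd_other insertCI)
  qed
  have "\<exists>K L b. finite K \<and> K \<subseteq> R \<and> poly_function b \<and> b F0 \<noteq> 0 \<and> (\<forall>j\<in>J. \<forall>r\<in>K. poly_function (L j r)) \<and>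
    (\<forall>F. \<forall>j\<in>J. \<forall>j'\<in>J. (\<Sum>r\<in>K. L j r F * A j' r F) = (if j = j' then b F else 0))"
    by (rule insert.IH) (use insert.prems(1) ind in blast)+
  then obtain K L b where K: "finite K" "K \<subseteq> R" and b: "poly_function b" "b F0 \<noteq> 0"
    and L0: "\<forall>j\<in>J. \<forall>r\<in>K. poly_function (L j r)"
    and LA0: "\<forall>F. \<forall>j\<in>J. \<forall>j'\<in>J. (\<Sum>r\<in>K. L j r F * A j' r F) = (if j = j' then b F else 0)"
    by (elim exE conjE)
  have L: "poly_function (L j r)" if "j \<in> J" "r \<in> K" for j r using L0 that by blast
  have LA: "(\<Sum>r\<in>K. L j r F * A j' r F) = (if j = j' then b F else 0)" if "j \<in> J" "j' \<in> J" for F j j'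
    using LA0 that by blast
  \<comment> \<open>\<open>lam j\<close> is \<open>b\<close> times the coefficient of the new column
    along column \<open>j\<close> as seen by the old left inverse, and \<open>res\<close> is
    \<open>b\<close> times what then remains of the new column. If \<open>res\<close> vanished in
    all rows at \<open>F0\<close>, the columns would be dependent there; a row \<open>r0\<close>
    with nonzero residue is the new pivot.\<close>
  define lam where "lam j F = (\<Sum>s\<in>K. L j s F * A x s F)" for j F
  define res where "res r F = b F * A x r F - (\<Sum>j\<in>J. lam j F * A j r F)" for r F
  have "\<exists>r\<in>R. res r F0 \<noteq> 0"
  proof (rule ccontr)
    assume "\<not> (\<exists>r\<in>R. res r F0 \<noteq> 0)"
    then have z: "res r F0 = 0" if "r \<in> R" for r using that by blast
    have "\<forall>r\<in>R. (\<Sum>j\<in>insert x J. (if j = x then b F0 else - lam j F0) * A j r F0) = 0"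
    proof
      fix r assume "r \<in> R"
      have "(\<Sum>j\<in>J. (if j = x then b F0 else - lam j F0) * A j r F0) = - (\<Sum>j\<in>J. lam j F0 * A j r F0)"
        unfolding sum_negf[symmetric] using insert.hyps(2) by (intro sum.cong) auto
      then show "(\<Sum>j\<in>insert x J. (if j = x then b F0 else - lam j F0) * A j r F0) = 0"
        using insert.hyps z[OF \<open>r \<in> R\<close>] by (simp add: res_def)
    qed
    from insert.prems(2)[OF this] show False using b(2) by auto
  qed
  then obtain r0 where r0: "r0 \<in> R" "res r0 F0 \<noteq> 0" by blast
  \<comment> \<open>The row vector \<open>M\<close> annihilates the old columns and sends the new
    one to \<open>res r0\<close>. Subtracting \<open>lam j\<close> times \<open>M\<close> from
    \<open>res r0\<close> times row \<open>j\<close> of \<open>L\<close> clears the new column, at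
    the price of the denominator \<open>res r0 * b\<close>.\<close>
  define M where "M r F = (if r = r0 then b F else 0) - (if r \<in> K then \<Sum>j\<in>J. L j r F * A j r0 F else 0)" for r F
  define L' where "L' j r F = (if j = x then b F * M r F
      else (if r \<in> K then res r0 F * L j r F else 0) - lam j F * M r F)" for j r F
  let ?K = "insert r0 K"
  have K': "finite ?K" "?K \<subseteq> R" using K r0 by auto
  have plam: "poly_function (lam j)" if "j \<in> J" for j
    unfolding lam_def using L[OF that] insert.prems(1) K(2) by (auto intro!: poly_function_intros)
  have pres: "poly_function (res r)" if "r \<in> R" for r
    unfolding res_def using that insert.prems(1) plam b(1) by (auto intro!: poly_function_intros)
  have pM: "poly_function (M r)" if "r \<in> ?K" for r
    unfolding M_def using that insert.prems(1) L b(1) r0(1) by (auto intro!: poly_function_intros)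
  have pL': "poly_function (L' j r)" if "j \<in> insert x J" "r \<in> ?K" for j r
    unfolding L'_def using that pM plam pres[OF r0(1)] L b(1) by (auto intro!: poly_function_intros)
  have restr: "(\<Sum>r\<in>?K. (if r \<in> K then f r else 0) * g r) = (\<Sum>r\<in>K. f r * g r)" for f g :: "_ \<Rightarrow> complex"
    using K'(1) by (intro sum.mono_neutral_cong_right) auto
  have sM: "(\<Sum>r\<in>?K. M r F * A j r F) = b F * A j r0 F - (\<Sum>i\<in>J. (\<Sum>r\<in>K. L i r F * A j r F) * A i r0 F)" for j F
  proof -
    have "(\<Sum>r\<in>?K. M r F * A j r F) = (\<Sum>r\<in>?K. (if r = r0 then b F * A j r F else 0))
        - (\<Sum>r\<in>?K. (if r \<in> K then \<Sum>i\<in>J. L i r F * A i r0 F else 0) * A j r F)"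
      unfolding sum_subtractf[symmetric] by (intro sum.cong) (auto simp: M_def left_diff_distrib)
    also have "(\<Sum>r\<in>?K. (if r = r0 then b F * A j r F else 0)) = b F * A j r0 F"
      using K'(1) by simp
    also have "(\<Sum>r\<in>?K. (if r \<in> K then \<Sum>i\<in>J. L i r F * A i r0 F else 0) * A j r F)
        = (\<Sum>i\<in>J. (\<Sum>r\<in>K. L i r F * A j r F) * A i r0 F)"
      unfolding restr sum_distrib_right by (subst sum.swap) (simp add: ac_simps)
    finally show ?thesis .
  qed
  have sMx: "(\<Sum>r\<in>?K. M r F * A x r F) = res r0 F" for F
    unfolding sM by (simp add: res_def lam_def)
  have sMj: "(\<Sum>r\<in>?K. M r F * A j r F) = 0" if "j \<in> J" for j F
  proof -
    have "(\<Sum>i\<in>J. (\<Sum>r\<in>K. L i r F * A j r F) * A i r0 F) = (\<Sum>i\<in>J. if i = j then b F * A i r0 F else 0)"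
      using LA that by (intro sum.cong) auto
    also have "\<dots> = b F * A j r0 F" using insert.hyps(1) that by simp
    finally show ?thesis unfolding sM by simp
  qed
  have sLx: "(\<Sum>r\<in>?K. L' x r F * A j r F) = b F * (\<Sum>r\<in>?K. M r F * A j r F)" for j F
    unfolding L'_def sum_distrib_left by (simp add: mult.assoc)
  have sLj: "(\<Sum>r\<in>?K. L' i r F * A j r F)
      = res r0 F * (\<Sum>r\<in>K. L i r F * A j r F) - lam i F * (\<Sum>r\<in>?K. M r F * A j r F)" if "i \<in> J" for i j F
  proof -
    have ix: "i \<noteq> x" using that insert.hyps(2) by blast
    have "(\<Sum>r\<in>?K. L' i r F * A j r F) = (\<Sum>r\<in>?K. (if r \<in> K then res r0 F * L i r F else 0) * A j r F)
        - (\<Sum>r\<in>?K. lam i F * (M r F * A j r F))"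
      unfolding sum_subtractf[symmetric] using ix by (intro sum.cong) (auto simp: L'_def left_diff_distrib mult.assoc)
    then show ?thesis unfolding restr sum_distrib_left by (simp add: mult.assoc)
  qed
  have "(\<Sum>r\<in>?K. L' i r F * A j r F) = (if i = j then res r0 F * b F else 0)"
    if ij: "i \<in> insert x J" "j \<in> insert x J" for i j F
  proof -
    consider "i = x" "j = x" | "i = x" "j \<in> J" | "i \<in> J" "j = x" | "i \<in> J" "j \<in> J" using ij by blast
    then show ?thesis
    proof cases
      case 1 then show ?thesis unfolding 1 sLx sMx by simp
    next
      case 2 then show ?thesis unfolding 2(1) sLx sMj[OF 2(2)] using insert.hyps(2) by auto
    next
      case 3 then show ?thesis unfolding 3(2) sLj[OF 3(1)] sMx using insert.hyps(2) by (auto simp: lam_def)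
    next
      case 4 then show ?thesis unfolding sLj[OF 4(1)] sMj[OF 4(2)] LA[OF 4] by simp
    qed
  qed
  moreover have "poly_function (\<lambda>F. res r0 F * b F)" "res r0 F0 * b F0 \<noteq> 0"
    using pf_mult[OF pres[OF r0(1)] b(1)] b(2) r0(2) by auto
  ultimately show ?case using K' pL'
    by (intro exI[of _ ?K] exI[of _ L'] exI[of _ "\<lambda>F. res r0 F * b F"]) blast
qed

section \<open>Closed conditions, morphisms and isomorphisms in frame coordinates\<close>

definition dependent_at :: "'j set \<Rightarrow> 'r set \<Rightarrow> ('j \<Rightarrow> 'r \<Rightarrow> 'f \<Rightarrow> complex) \<Rightarrow> 'f \<Rightarrow> bool" where
  "dependent_at J R A F \<longleftrightarrow> (\<exists>a. (\<forall>r\<in>R. (\<Sum>j\<in>J. a j * A j r F) = 0) \<and> (\<exists>j\<in>J. a j \<noteq> 0))"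

definition polynomial_condition :: "((('k \<Rightarrow> complex)) \<Rightarrow> bool) \<Rightarrow> bool" where
  "polynomial_condition P \<longleftrightarrow> (\<exists>\<Phi>. (\<forall>\<phi>\<in>\<Phi>. poly_function \<phi>) \<and> (\<forall>F. P F \<longleftrightarrow> (\<forall>\<phi>\<in>\<Phi>. \<phi> F = 0)))"

lemma polynomial_condition_eq_0: "poly_function \<phi> \<Longrightarrow> polynomial_condition (\<lambda>F. \<phi> F = 0)"
  unfolding polynomial_condition_def by (rule exI[of _ "{\<phi>}"]) auto

lemma polynomial_condition_Ball:
  assumes "\<And>x. x \<in> A \<Longrightarrow> polynomial_condition (P x)"
  shows "polynomial_condition (\<lambda>F. \<forall>x\<in>A. P x F)"
proof -
  have "\<forall>x\<in>A. \<exists>\<Phi>. (\<forall>\<phi>\<in>\<Phi>. poly_function \<phi>) \<and> (\<forall>F. P x F \<longleftrightarrow> (\<forall>\<phi>\<in>\<Phi>. \<phi> F = 0))"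
    using assms unfolding polynomial_condition_def by blast
  then obtain \<Phi> where "\<forall>x\<in>A. (\<forall>\<phi>\<in>\<Phi> x. poly_function \<phi>) \<and> (\<forall>F. P x F \<longleftrightarrow> (\<forall>\<phi>\<in>\<Phi> x. \<phi> F = 0))"
    by (rule bchoice[THEN exE])
  then show ?thesis unfolding polynomial_condition_def by (intro exI[of _ "\<Union>x\<in>A. \<Phi> x"]) auto
qed

lemma polynomial_condition_conj:
  assumes "polynomial_condition P" "polynomial_condition Q"
  shows "polynomial_condition (\<lambda>F. P F \<and> Q F)"
proof -
  have "polynomial_condition (if b then P else Q)" for b using assms by simp
  then have "polynomial_condition (\<lambda>F. \<forall>b\<in>UNIV. (if b then P else Q) F)" by (rule polynomial_condition_Ball)
  then show ?thesis by (simp add: all_bool_eq conj_commute)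
qed

lemma polynomial_condition_const: "polynomial_condition (\<lambda>_. c)"
  using polynomial_condition_eq_0[OF pf_const[of "if c then 0 else 1"]] by (cases c) auto

lemma polynomial_condition_Inr: "polynomial_condition P \<Longrightarrow> polynomial_condition (\<lambda>F. P (F \<circ> Inr))"
  unfolding polynomial_condition_def
proof (elim exE conjE)
  fix \<Phi> assume "\<forall>\<phi>\<in>\<Phi>. poly_function \<phi>" "\<forall>F. P F = (\<forall>\<phi>\<in>\<Phi>. \<phi> F = 0)"
  then show "\<exists>\<Phi>. (\<forall>\<phi>\<in>\<Phi>. poly_function \<phi>) \<and> (\<forall>F. P (F \<circ> Inr) = (\<forall>\<phi>\<in>\<Phi>. \<phi> F = 0))"
    by (intro exI[of _ "(\<lambda>\<phi> F. \<phi> (F \<circ> Inr)) ` \<Phi>"]) (auto intro: poly_function_Inr)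
qed

text \<open>In place of minors, the equations are all polynomials vanishing on the dependence locus.
  They suffice: at an independent \<open>F0\<close> the denominator \<open>b\<close> of a polynomial
  left inverse is nonzero, while the same \<open>b\<close> vanishes wherever the columns are
  dependent.\<close>

lemma polynomial_condition_dependent:
  assumes J: "finite J" "\<And>j r. j \<in> J \<Longrightarrow> r \<in> R \<Longrightarrow> poly_function (A j r)"
  shows "polynomial_condition (dependent_at J R A)"
  unfolding polynomial_condition_def
proof (intro exI[of _ "{\<phi>. poly_function \<phi> \<and> (\<forall>F. dependent_at J R A F \<longrightarrow> \<phi> F = 0)}"] conjI allI)
  fix F0
  show "dependent_at J R A F0 \<longleftrightarrow> (\<forall>\<phi>\<in>{\<phi>. poly_function \<phi> \<and> (\<forall>F. dependent_at J R A F \<longrightarrow> \<phi> F = 0)}. \<phi> F0 = 0)"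
  proof (rule iffI)
    assume v: "\<forall>\<phi>\<in>{\<phi>. poly_function \<phi> \<and> (\<forall>F. dependent_at J R A F \<longrightarrow> \<phi> F = 0)}. \<phi> F0 = 0"
    show "dependent_at J R A F0"
    proof (rule ccontr)
      assume "\<not> dependent_at J R A F0"
      then have ind: "\<forall>j\<in>J. a j = 0" if "\<forall>r\<in>R. (\<Sum>j\<in>J. a j * A j r F0) = 0" for a
        using that by (auto simp: dependent_at_def)
      have "\<exists>K L b. finite K \<and> K \<subseteq> R \<and> poly_function b \<and> b F0 \<noteq> 0 \<and> (\<forall>j\<in>J. \<forall>r\<in>K. poly_function (L j r)) \<and>
          (\<forall>F. \<forall>j\<in>J. \<forall>j'\<in>J. (\<Sum>r\<in>K. L j r F * A j' r F) = (if j = j' then b F else 0))"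
        by (rule poly_left_inverse) (use J ind in auto)
      then obtain K L b where K: "finite K" "K \<subseteq> R" and b: "poly_function b" "b F0 \<noteq> 0"
        and LA: "\<forall>F. \<forall>j\<in>J. \<forall>j'\<in>J. (\<Sum>r\<in>K. L j r F * A j' r F) = (if j = j' then b F else 0)" by blast
      have "b F = 0" if "dependent_at J R A F" for F
      proof -
        obtain a i where a: "\<And>r. r \<in> R \<Longrightarrow> (\<Sum>j\<in>J. a j * A j r F) = 0" "i \<in> J" "a i \<noteq> 0"
          using \<open>dependent_at J R A F\<close> unfolding dependent_at_def by blast
        have "0 = (\<Sum>r\<in>K. L i r F * (\<Sum>j\<in>J. a j * A j r F))" using a(1) K(2) by (simp add: subset_iff)
        also have "\<dots> = (\<Sum>j\<in>J. a j * (\<Sum>r\<in>K. L i r F * A j r F))"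
          unfolding sum_distrib_left by (subst sum.swap) (simp add: ac_simps)
        also have "\<dots> = (\<Sum>j\<in>J. if j = i then a i * b F else 0)"
          using LA a(2) by (intro sum.cong) auto
        also have "\<dots> = a i * b F" using J(1) a(2) by simp
        finally show ?thesis using a(3) by simp
      qed
      then show False using v b by blast
    qed
  qed blast
qed blast

lemma zclosed_inI:
  assumes "X \<subseteq> ambient S n"
    and "\<And>d. \<exists>P. polynomial_condition P \<and> (\<forall>F. frame d F \<and> pt d F \<in> ambient S n \<longrightarrow> (pt d F \<in> X \<longleftrightarrow> P F))"
  shows "zclosed_in S n X"
  unfolding zclosed_in_def
proof (intro conjI allI)
  fix d
  obtain P where P: "polynomial_condition P" "\<forall>F. frame d F \<and> pt d F \<in> ambient S n \<longrightarrow> (pt d F \<in> X \<longleftrightarrow> P F)"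
    using assms(2) by blast
  then obtain \<Phi> where "\<forall>\<phi>\<in>\<Phi>. poly_function \<phi>" "\<forall>F. P F \<longleftrightarrow> (\<forall>\<phi>\<in>\<Phi>. \<phi> F = 0)"
    unfolding polynomial_condition_def by blast
  then show "\<exists>\<Phi>. (\<forall>\<phi>\<in>\<Phi>. poly_function \<phi>) \<and>
      (\<forall>F. frame d F \<and> pt d F \<in> ambient S n \<longrightarrow> (pt d F \<in> X) = (\<forall>\<phi>\<in>\<Phi>. \<phi> F = 0))"
    using P(2) by (intro exI[of _ \<Phi>]) simp
qed (rule assms(1))

lemma zclosed_inE:
  assumes "zclosed_in S n X"
  obtains P where "polynomial_condition P" "\<And>F. frame d F \<Longrightarrow> pt d F \<in> ambient S n \<Longrightarrow> (pt d F \<in> X \<longleftrightarrow> P F)"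
proof -
  obtain \<Phi> where \<Phi>: "\<forall>\<phi>\<in>\<Phi>. poly_function \<phi>"
     "\<forall>F. frame d F \<and> pt d F \<in> ambient S n \<longrightarrow> (pt d F \<in> X \<longleftrightarrow> (\<forall>\<phi>\<in>\<Phi>. \<phi> F = 0))"
    using assms unfolding zclosed_in_def by blast
  have "polynomial_condition (\<lambda>F. \<forall>\<phi>\<in>\<Phi>. \<phi> F = 0)"
    using \<Phi>(1) by (intro polynomial_condition_Ball polynomial_condition_eq_0) blast
  then show ?thesis by (rule that) (use \<Phi>(2) in simp)
qed

lemma zclosedI: "zclosed_in S n X \<Longrightarrow> finite S \<Longrightarrow> (\<And>i. finite (n i)) \<Longrightarrow> zclosed X"
  unfolding zclosed_def by (rule exI[of _ S], rule exI[of _ n]) simp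

lemma zclosed_empty: "zclosed {}"
proof (rule zclosedI)
  show "zclosed_in {} (\<lambda>_. {}) {}"
    by (rule zclosed_inI) (simp, rule exI[of _ "\<lambda>_. False"], simp add: polynomial_condition_const)
qed auto

lemma zclosed_imp_locally_closed: "zclosed X \<Longrightarrow> locally_closed X"
  unfolding locally_closed_def using zclosed_empty by (intro exI[of _ X] exI[of _ "{}"]) simp

lemma locally_closed_imp_constructible: "locally_closed X \<Longrightarrow> constructible X"
  unfolding constructible_def by (intro exI[of _ "{X}"]) auto

lemma zclosed_diff_constructible: "zclosed A \<Longrightarrow> zclosed B \<Longrightarrow> constructible (A - B)"
  by (intro locally_closed_imp_constructible) (auto simp: locally_closed_def)

lemma frame_cong: "(\<And>z. F (Inr z) = F' (Inr z)) \<Longrightarrow> frame d F \<longleftrightarrow> frame d F'"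
  unfolding frame_def by simp

lemma snd_pt_cong: "(\<And>z. F (Inr z) = F' (Inr z)) \<Longrightarrow> snd (pt d F) = snd (pt d F')"
  unfolding pt_def by simp

lemma fst_pt: "fst (pt d F) = (\<lambda>c. F (Inl c))"
  by (simp add: pt_def)

lemma pt_eqI: "(\<And>c. F (Inl c) = x c) \<Longrightarrow> snd (pt d F) = p \<Longrightarrow> pt d F = (x, p)"
  by (auto simp: pt_def)

text \<open>Maps that leave the subspaces alone need no denominator: the frame entries are
  copied.\<close>

lemma morphism_coord:
  fixes X :: "('c, 'i::finite, 'b) point set" and Y :: "('c2, 'i, 'b) point set"
  assumes im: "(\<lambda>(x, p). (\<lambda>k. q k x, p)) ` X \<subseteq> Y" and q: "\<And>k. poly_function (q k)"
  shows "morphism X Y (\<lambda>(x, p). (\<lambda>k. q k x, p))"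
  unfolding morphism_def
proof (intro conjI allI impI)
  fix d and F0 :: "('c, 'i, 'b) coords" assume "frame d F0 \<and> pt d F0 \<in> X"
  define g :: "'c2 + 'i \<times> nat \<times> 'b \<Rightarrow> ('c, 'i, 'b) coords \<Rightarrow> complex"
    where "g k = (case k of Inl c \<Rightarrow> \<lambda>F. q c (\<lambda>k. F (Inl k)) | Inr z \<Rightarrow> \<lambda>F. F (Inr z))" for k
  have "poly_function (g k)" for k
    by (cases k) (auto simp: g_def intro: poly_function_intros poly_function_subst[OF q])
  moreover have "frame d (\<lambda>k. g k F / 1) \<and> pt d (\<lambda>k. g k F / 1) = (case pt d F of (x, p) \<Rightarrow> (\<lambda>k. q k x, p))"
    if "frame d F" for F
    using that frame_cong[of F "\<lambda>k. g k F / 1" d] by (simp add: g_def pt_def)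
  ultimately show "\<exists>d' g b. (\<forall>k. poly_function (g k)) \<and> poly_function b \<and> b F0 \<noteq> 0 \<and>
      (\<forall>F. frame d F \<and> pt d F \<in> X \<and> b F \<noteq> 0 \<longrightarrow> frame d' (\<lambda>k. g k F / b F) \<and>
        pt d' (\<lambda>k. g k F / b F) = (case pt d F of (x, p) \<Rightarrow> (\<lambda>k. q k x, p)))"
    by - (rule exI[of _ d], rule exI[of _ g], rule exI[of _ "\<lambda>_. 1"], simp add: pf_const)
qed (rule im)

lemma morphism_cong:
  assumes f: "morphism X Y f" and eq: "\<And>x. x \<in> X \<Longrightarrow> f x = h x"
  shows "morphism X Y h"
  unfolding morphism_def
proof (intro conjI allI impI)
  show "h ` X \<subseteq> Y" using f eq image_cong[of X X f h] by (simp add: morphism_def)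
  fix d F0 assume "frame d F0 \<and> pt d F0 \<in> X"
  then obtain d' g b where g: "\<forall>k. poly_function (g k)" "poly_function b" "b F0 \<noteq> 0"
    "\<forall>F. frame d F \<and> pt d F \<in> X \<and> b F \<noteq> 0 \<longrightarrow> frame d' (\<lambda>k. g k F / b F) \<and> pt d' (\<lambda>k. g k F / b F) = f (pt d F)"
    using f unfolding morphism_def by blast
  show "\<exists>d' g b. (\<forall>k. poly_function (g k)) \<and> poly_function b \<and> b F0 \<noteq> 0 \<and>
      (\<forall>F. frame d F \<and> pt d F \<in> X \<and> b F \<noteq> 0 \<longrightarrow> frame d' (\<lambda>k. g k F / b F) \<and> pt d' (\<lambda>k. g k F / b F) = h (pt d F))"
    by (rule exI[of _ d'], rule exI[of _ g], rule exI[of _ b]) (simp add: g eq[symmetric])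
qed

lemma variety_isoI:
  assumes "morphism X Y \<psi>" "morphism Y X \<phi>" "\<And>x. x \<in> X \<Longrightarrow> \<phi> (\<psi> x) = x" "\<And>y. y \<in> Y \<Longrightarrow> \<psi> (\<phi> y) = y"
  shows "variety_iso X Y \<psi>"
proof -
  have X: "\<psi> ` X \<subseteq> Y" "\<phi> ` Y \<subseteq> X" using assms(1,2) by (auto simp: morphism_def)
  have bij: "bij_betw \<psi> X Y" by (rule bij_betw_byWitness[of X \<phi>]) (use assms(3,4) X in auto)
  have "inv_into X \<psi> y = \<phi> y" if "y \<in> Y" for y
    using bij_betw_inv_into_left[OF bij, of "\<phi> y"] assms(4)[OF that] X(2) that by auto
  then have "morphism Y X (inv_into X \<psi>)" using morphism_cong[OF assms(2), of "inv_into X \<psi>"] by simp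
  then show ?thesis using bij assms(1) by (simp add: variety_iso_def)
qed

lemma affine_fibration_trivial:
  assumes "finite S" "locally_closed E" "locally_closed B" "morphism E B \<pi>"
    and "variety_iso (times_affine B S) E \<psi>"
    and "\<And>x y p. (x, p) \<in> B \<Longrightarrow> y \<in> cspace S \<Longrightarrow> \<pi> (\<psi> (case_sum x y, p)) = (x, p)"
  shows "affine_fibration S E B \<pi>"
  unfolding affine_fibration_def
proof (intro conjI ballI)
  fix b assume "b \<in> B"
  show "\<exists>C \<psi>. zclosed C \<and> b \<notin> C \<and> variety_iso (times_affine (B - C) S) {e \<in> E. \<pi> e \<notin> C} \<psi> \<and>
      (\<forall>x y p. (x, p) \<in> B - C \<and> y \<in> cspace S \<longrightarrow> \<pi> (\<psi> (case_sum x y, p)) = (x, p))"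
    using assms(5,6) zclosed_empty by (intro exI[of _ "{}"] exI[of _ \<psi>]) auto
qed (use assms in auto)

section \<open>Dimensions of coordinate subspaces\<close>

abbreviation clinear :: "(('k \<Rightarrow> complex) \<Rightarrow> 'l \<Rightarrow> complex) \<Rightarrow> bool" where
  "clinear \<equiv> module_hom cscale cscale"

lemma clinearI:
  assumes "\<And>x y. f (x + y) = f x + f y" "\<And>c x. f (cscale c x) = cscale c (f x)"
  shows "clinear f"
  by unfold_locales (simp_all add: assms)

lemma clinear_add: "clinear f \<Longrightarrow> f (x + y) = f x + f y"
  and clinear_scale: "clinear f \<Longrightarrow> f (cscale c x) = cscale c (f x)"
  and clinear_diff: "clinear f \<Longrightarrow> f (x - y) = f x - f y"
  and clinear_0: "clinear f \<Longrightarrow> f 0 = 0"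
  by (simp_all add: module_hom.add module_hom.scale module_hom.diff module_hom.zero)

definition unit_vec :: "'k \<Rightarrow> 'k \<Rightarrow> complex" where
  "unit_vec j k = (if k = j then 1 else 0)"

lemma cspace_expand:
  assumes "finite S" "x \<in> cspace S"
  shows "x = (\<Sum>j\<in>S. cscale (x j) (unit_vec j))"
proof
  fix k
  have "(\<Sum>j\<in>S. cscale (x j) (unit_vec j)) k = (\<Sum>j\<in>S. if j = k then x j else 0)"
    by (auto simp: sum_fun_apply cscale_def unit_vec_def intro!: sum.cong)
  also have "\<dots> = x k" using assms by (auto simp: cspace_def)
  finally show "x k = (\<Sum>j\<in>S. cscale (x j) (unit_vec j)) k" by simp
qed

lemma cspace_subset_span: "finite S \<Longrightarrow> cspace S \<subseteq> cfun.span (unit_vec ` S)"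
proof
  fix x assume "finite S" "x \<in> cspace S"
  then have "x = (\<Sum>j\<in>S. cscale (x j) (unit_vec j))" by (rule cspace_expand)
  also have "\<dots> \<in> cfun.span (unit_vec ` S)"
    by (intro cfun.span_sum cfun.span_scale cfun.span_base) auto
  finally show "x \<in> cfun.span (unit_vec ` S)" .
qed

lemma finite_independent_cspace:
  assumes "finite S" "B \<subseteq> cspace S" "cfun.independent B"
  shows "finite B"
  using cfun.independent_span_bound[of "unit_vec ` S" B] cspace_subset_span[OF assms(1)] assms by auto

text \<open>Functions on an arbitrary index type need not form a finite-dimensional space;
  finiteness enters through \<open>W \<subseteq> cspace S\<close>. A basis of the kernel is extended
  to one of \<open>W\<close>, and the added vectors map to a basis of the image.\<close>

lemma dim_image_kernel:
  assumes S: "finite S" and W: "cfun.subspace W" "W \<subseteq> cspace S" and f: "clinear f"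
  shows "cfun.dim W = cfun.dim (f ` W) + cfun.dim {x \<in> W. f x = 0}"
proof -
  let ?K = "{x \<in> W. f x = 0}"
  have K: "cfun.subspace ?K"
    using W(1) clinear_add[OF f] clinear_scale[OF f] clinear_0[OF f]
    by (auto simp: cfun.subspace_def cscale_def fun_eq_iff)
  obtain BK where BK: "BK \<subseteq> ?K" "cfun.independent BK" "?K \<subseteq> cfun.span BK" "card BK = cfun.dim ?K"
    by (rule cfun.basis_exists)
  obtain B where B: "BK \<subseteq> B" "B \<subseteq> W" "cfun.independent B" "W \<subseteq> cfun.span B"
    using cfun.maximal_independent_subset_extend[of BK W] BK by auto
  have finB: "finite B" using finite_independent_cspace[OF S _ B(3)] B(2) W(2) by auto
  have dimW: "cfun.dim W = card B" using B by (intro cfun.dim_unique) auto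
  let ?D = "B - BK"
  have indD: "cfun.independent ?D" using B(3) cfun.independent_mono by blast
  \<comment> \<open>A vector of this span that lies in the kernel has a representation in
    \<open>B\<close> supported both on \<open>BK\<close> and on its complement, so it is 0.\<close>
  have inj: "inj_on f (cfun.span ?D)"
    unfolding module_hom.inj_on_iff_eq_0[OF f cfun.subspace_span]
  proof (intro ballI impI)
    fix x assume x: "x \<in> cfun.span ?D" "f x = 0"
    have "x \<in> W" using x(1) cfun.span_minimal[of ?D W] B(2) W(1) by blast
    then have xK: "x \<in> cfun.span BK" using x(2) BK(3) by blast
    have xB: "x \<in> cfun.span B" using x(1) cfun.span_mono[of ?D B] by blast
    have "cfun.representation B x b = 0" for b
    proof -
      have "cfun.representation B x = cfun.representation ?D x"
        by (rule cfun.representation_extend) (use B(3) x(1) in auto)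
      moreover have "cfun.representation B x = cfun.representation BK x"
        by (rule cfun.representation_extend) (use B xK in auto)
      ultimately show ?thesis using cfun.representation_ne_zero[of ?D x b] cfun.representation_ne_zero[of BK x b] by auto
    qed
    then show "x = 0" using cfun.sum_nonzero_representation_eq[OF B(3) xB] by simp
  qed
  have "cfun.dim (f ` W) = card (f ` ?D)"
  proof (rule cfun.dim_unique)
    show "f ` ?D \<subseteq> f ` W" using B(2) by blast
    show "cfun.independent (f ` ?D)" by (rule module_hom.independent_injective_image[OF f indD inj])
    have "f ` B \<subseteq> cfun.span (f ` ?D)"
    proof
      fix y assume "y \<in> f ` B"
      then obtain b where "b \<in> B" "y = f b" by blast
      then show "y \<in> cfun.span (f ` ?D)"
        using BK(1) cfun.span_zero[of "f ` ?D"] cfun.span_base[of y "f ` ?D"] by (cases "b \<in> BK") auto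
    qed
    then have "cfun.span (f ` B) \<subseteq> cfun.span (f ` ?D)" by (rule cfun.span_minimal) (rule cfun.subspace_span)
    then show "f ` W \<subseteq> cfun.span (f ` ?D)" using module_hom.span_image[OF f, of B] B(4) by blast
  qed simp
  also have "\<dots> = card ?D"
    by (rule card_image) (use inj cfun.span_superset[of ?D] in \<open>auto intro: inj_on_subset\<close>)
  finally have "cfun.dim (f ` W) = card B - card BK"
    using card_Diff_subset[of BK B] finB B(1) finite_subset by auto
  moreover have "card BK \<le> card B" using card_mono[OF finB B(1)] .
  ultimately show ?thesis using dimW BK(4) by simp
qed

lemma dim_cspace: "finite S \<Longrightarrow> cfun.dim (cspace S) = card S"
proof -
  assume S: "finite S"
  have "(\<forall>k. (\<Sum>j\<in>S. a j * unit_vec j k) = 0) \<Longrightarrow> \<forall>j\<in>S. a j = 0" for a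
  proof (intro ballI)
    fix k assume z: "\<forall>k. (\<Sum>j\<in>S. a j * unit_vec j k) = 0" and k: "k \<in> S"
    have "(\<Sum>j\<in>S. a j * unit_vec j k) = (\<Sum>j\<in>S. if j = k then a j else 0)"
      by (intro sum.cong) (auto simp: unit_vec_def)
    then show "a k = 0" using z k S by simp
  qed
  note ind = independent_family[OF S this]
  show ?thesis
  proof (rule cfun.dim_unique[OF _ _ ind(2)])
    show "unit_vec ` S \<subseteq> cspace S" by (auto simp: unit_vec_def cspace_def)
  qed (use cspace_subset_span[OF S] card_image[OF ind(1)] in auto)
qed

text \<open>\<open>S - J\<close> is a set of coordinates on \<open>W\<close>.\<close>

lemma exists_coordinates:
  assumes S: "finite S" and W: "cfun.subspace W" "W \<subseteq> cspace S"
  obtains J where "J \<subseteq> S" "\<And>f. f \<in> W \<Longrightarrow> f \<in> cspace J \<Longrightarrow> f = 0" "cfun.dim W = card (S - J)"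
    "\<And>y. \<exists>f\<in>W. \<forall>t\<in>S - J. f t = y t"
proof -
  \<comment> \<open>\<open>J\<close> will be maximal with \<open>W \<inter> cspace J = {0}\<close>.
    Maximality gives for each \<open>t\<close> in \<open>S - J\<close> a vector of \<open>W\<close>
    that is nonzero at \<open>t\<close> and zero at the other coordinates outside \<open>J\<close>;
    rescaled, these vectors are the basis \<open>h\<close> dual to the coordinates.\<close>
  define \<J> where "\<J> = {J. J \<subseteq> S \<and> (\<forall>f\<in>W. f \<in> cspace J \<longrightarrow> f = 0)}"
  have "finite \<J>" using S unfolding \<J>_def by (intro finite_subset[OF _ finite_Pow_iff[THEN iffD2, OF S]]) auto
  moreover have "{} \<in> \<J>" by (auto simp: \<J>_def cspace_def fun_eq_iff)
  ultimately obtain J where J: "J \<in> \<J>" and mx: "\<And>J'. J' \<in> \<J> \<Longrightarrow> J \<subseteq> J' \<Longrightarrow> J = J'"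
    using finite_has_maximal[of \<J>] by blast
  have JS: "J \<subseteq> S" and Jz: "\<And>f. f \<in> W \<Longrightarrow> f \<in> cspace J \<Longrightarrow> f = 0" using J by (auto simp: \<J>_def)
  have "\<exists>h\<in>W. \<forall>s\<in>S - J. h s = (if s = t then 1 else 0)" if t: "t \<in> S - J" for t
  proof -
    have "insert t J \<notin> \<J>" using mx[of "insert t J"] t by blast
    then obtain f where f: "f \<in> W" "f \<in> cspace (insert t J)" "f \<noteq> 0" using t JS by (auto simp: \<J>_def)
    have ft: "f t \<noteq> 0"
    proof
      assume "f t = 0"
      then have "f \<in> cspace J" using f(2) by (auto simp: cspace_def)
      then show False using Jz f by blast
    qed
    have "cscale (1 / f t) f \<in> W" using f(1) W(1) by (simp add: cfun.subspace_scale)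
    moreover have "\<forall>s\<in>S - J. cscale (1 / f t) f s = (if s = t then 1 else 0)"
      using f(2) ft by (auto simp: cscale_def cspace_def)
    ultimately show ?thesis by blast
  qed
  then obtain h where h: "\<And>t. t \<in> S - J \<Longrightarrow> h t \<in> W" "\<And>t s. t \<in> S - J \<Longrightarrow> s \<in> S - J \<Longrightarrow> h t s = (if s = t then 1 else 0)"
    by metis
  define comb where "comb y = (\<Sum>t\<in>S - J. cscale (y t) (h t))" for y :: "'a \<Rightarrow> complex"
  have comb: "comb y s = y s" if "s \<in> S - J" for y s
  proof -
    have "comb y s = (\<Sum>t\<in>S - J. if t = s then y t else 0)"
      unfolding comb_def sum_fun_apply cscale_def using h(2) that by (intro sum.cong) auto
    then show ?thesis using S that by simp
  qed
  have combW: "comb y \<in> W" for y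
    unfolding comb_def using W(1) h(1) by (intro cfun.subspace_sum cfun.subspace_scale) auto
  have fin: "finite (S - J)" using S by simp
  have "(\<forall>k. (\<Sum>j\<in>S - J. a j * h j k) = 0) \<Longrightarrow> \<forall>j\<in>S - J. a j = 0" for a
    using comb[of _ a] by (simp add: comb_def sum_fun_apply cscale_def)
  note ind = independent_family[OF fin this]
  have "cfun.dim W = card (S - J)"
  proof (rule cfun.dim_unique[OF _ _ ind(2)])
    show "h ` (S - J) \<subseteq> W" using h(1) by blast
    show "card (h ` (S - J)) = card (S - J)" by (rule card_image[OF ind(1)])
    show "W \<subseteq> cfun.span (h ` (S - J))"
    proof
      fix f assume f: "f \<in> W"
      have "f - comb f \<in> W" using W(1) f combW by (simp add: cfun.subspace_diff)
      moreover have "f - comb f \<in> cspace J"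
      proof -
        have "f k - comb f k = 0" if "k \<notin> J" for k
        proof (cases "k \<in> S")
          case False
          have "f \<in> cspace S" "comb f \<in> cspace S" using f combW[of f] W(2) by blast+
          then show ?thesis using False by (simp add: cspace_def)
        qed (use comb that in simp)
        then show ?thesis by (simp add: cspace_def)
      qed
      ultimately have "f = comb f" using Jz[of "f - comb f"] by simp
      also have "comb f \<in> cfun.span (h ` (S - J))"
        unfolding comb_def by (intro cfun.span_sum cfun.span_scale cfun.span_base) auto
      finally show "f \<in> cfun.span (h ` (S - J))" .
    qed
  qed
  then show ?thesis using that[OF JS Jz] combW comb by blast
qed

lemma dim_le_card_cspace:
  assumes "finite S" "W \<subseteq> cspace S" shows "cfun.dim W \<le> card S"
proof -
  have "W \<subseteq> cfun.span (unit_vec ` S)" using assms cspace_subset_span by blast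
  from cfun.dim_le_card[OF this] show ?thesis using card_image_le[of S unit_vec] assms(1) by simp
qed

text \<open>This transports \<open>J\<close>, found for the fibre at one point, to nearby fibres:
  there the projection to \<open>S - J\<close> is known to be injective, and the dimensions agree.
  The image is everything because a set of coordinates on it, chosen inside \<open>S - J\<close>,
  has the full size.\<close>

lemma coordinates_surj:
  assumes S: "finite S" and W: "cfun.subspace W" "W \<subseteq> cspace S"
    and J: "\<And>f. f \<in> W \<Longrightarrow> f \<in> cspace J \<Longrightarrow> f = 0" "cfun.dim W = card (S - J)"
  shows "\<exists>f\<in>W. \<forall>t\<in>S - J. f t = y t"
proof -
  define \<rho> where "\<rho> f = (\<lambda>k. if k \<in> S - J then f k else 0)" for f :: "'a \<Rightarrow> complex"
  have \<rho>: "clinear \<rho>" by (rule clinearI) (auto simp: \<rho>_def cscale_def fun_eq_iff)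
  have ker: "{x \<in> W. \<rho> x = 0} = {0}"
  proof (intro equalityI subsetI)
    fix x assume x: "x \<in> {x \<in> W. \<rho> x = 0}"
    have "x k = 0" if "k \<notin> J" for k
    proof (cases "k \<in> S")
      case True
      have "\<rho> x k = 0" using x by simp
      then show ?thesis using True that by (simp add: \<rho>_def)
    next
      case False
      then show ?thesis using x W(2) by (auto simp: cspace_def)
    qed
    then show "x \<in> {0}" using x J(1)[of x] by (auto simp: cspace_def)
  next
    fix x :: "'a \<Rightarrow> complex" assume "x \<in> {0}"
    then show "x \<in> {x \<in> W. \<rho> x = 0}" using cfun.subspace_0[OF W(1)] clinear_0[OF \<rho>] by simp
  qed
  have "cfun.dim {0 :: 'a \<Rightarrow> complex} = 0"
    by (rule cfun.dim_unique[of "{}"]) (auto simp: cfun.dependent_explicit)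
  then have d: "cfun.dim (\<rho> ` W) = card (S - J)"
    using dim_image_kernel[OF S W \<rho>] J(2) unfolding ker by simp
  have sub: "cfun.subspace (\<rho> ` W)" "\<rho> ` W \<subseteq> cspace (S - J)"
    using module_hom.subspace_image[OF \<rho> W(1)] by (auto simp: \<rho>_def cspace_def)
  have fin: "finite (S - J)" using S by simp
  obtain J' where J': "J' \<subseteq> S - J" "cfun.dim (\<rho> ` W) = card ((S - J) - J')" "\<And>y. \<exists>f\<in>\<rho> ` W. \<forall>t\<in>(S - J) - J'. f t = y t"
    using exists_coordinates[OF fin sub] by metis
  have "J' = {}"
  proof -
    have "(S - J) - J' = S - J" using J'(1,2) d fin by (metis Diff_subset card_subset_eq)
    then show ?thesis using J'(1) by blast
  qed
  then obtain f where "f \<in> \<rho> ` W" "\<forall>t\<in>S - J. f t = y t" using J'(3)[of y] by auto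
  then obtain g where g: "g \<in> W" "f = \<rho> g" by blast
  then have "\<forall>t\<in>S - J. g t = y t" using \<open>\<forall>t\<in>S - J. f t = y t\<close> by (simp add: \<rho>_def)
  then show ?thesis using g(1) by blast
qed

text \<open>Makes statements about frames applicable at every point, and later supplies bases of
  submodules.\<close>

lemma exists_frame:
  fixes q :: "('c, 'i::finite, 'b) point"
  assumes q: "q \<in> ambient S n" and n: "\<And>i. finite (n i)"
  obtains d F where "frame d F" "pt d F = q"
proof -
  have "\<exists>B. finite B \<and> cfun.independent B \<and> cfun.span B = snd q i" for i
  proof -
    obtain B where B: "B \<subseteq> snd q i" "cfun.independent B" "snd q i \<subseteq> cfun.span B"
      by (rule cfun.basis_exists)
    note a = ambientD(2)[OF q, of i] ambientD(3)[OF q, of i]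
    have "cfun.span B \<subseteq> snd q i" using B(1) a(1) by (rule cfun.span_minimal)
    moreover have "finite B" using finite_independent_cspace[OF n, of B i] B a(2) by auto
    ultimately show ?thesis using B by (intro exI[of _ B]) auto
  qed
  then obtain B where B: "\<And>i. finite (B i)" "\<And>i. cfun.independent (B i)" "\<And>i. cfun.span (B i) = snd q i" by metis
  have "\<exists>e. bij_betw e {..<card (B i)} (B i)" for i
    using ex_bij_betw_nat_finite[OF B(1), of i] by (simp add: atLeast0LessThan)
  then obtain e where e: "\<And>i. bij_betw (e i) {..<card (B i)} (B i)" by metis
  define d where "d i = card (B i)" for i
  define F :: "('c, 'i, 'b) coords" where
    "F k = (case k of Inl c \<Rightarrow> fst q c | Inr (i, j, l) \<Rightarrow> if j < d i then e i j l else 0)" for k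
  have im: "(\<lambda>j k. F (Inr (i, j, k))) ` {..<d i} = B i" for i
    using e[of i] by (auto simp: F_def d_def bij_betw_def image_def)
  have "\<forall>j<d i. a j = 0" if z: "\<forall>k. (\<Sum>j<d i. a j * F (Inr (i, j, k))) = 0" for i a
  proof (intro allI impI)
    fix j assume j: "j < d i"
    define u where "u b = a (inv_into {..<d i} (e i) b)" for b
    have ev: "u (e i j) = a j" if "j < d i" for j
      using e[of i] that by (simp add: u_def d_def bij_betw_def)
    have "(\<Sum>b\<in>B i. cscale (u b) b) = 0"
    proof
      fix k
      have "(\<Sum>b\<in>B i. cscale (u b) b) k = (\<Sum>b\<in>B i. u b * b k)" by (simp add: sum_fun_apply cscale_def)
      also have "\<dots> = (\<Sum>j<d i. u (e i j) * e i j k)"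
        by (rule sum.reindex_bij_betw[symmetric]) (use e[of i] in \<open>simp add: d_def\<close>)
      also have "\<dots> = (\<Sum>j<d i. a j * F (Inr (i, j, k)))" by (intro sum.cong) (auto simp: ev F_def)
      finally show "(\<Sum>b\<in>B i. cscale (u b) b) k = 0 k" using z by simp
    qed
    moreover have "e i j \<in> B i" using e[of i] j by (auto simp: d_def bij_betw_def)
    ultimately have "u (e i j) = 0"
      using B(2)[of i] B(1)[of i] unfolding cfun.independent_explicit_finite_subsets by blast
    then show "a j = 0" using ev j by simp
  qed
  then have "frame d F" unfolding frame_def by (auto simp: F_def)
  moreover have "pt d F = q" unfolding pt_def im B(3) by (simp add: F_def)
  ultimately show ?thesis by (rule that)
qed

section \<open>Families of subspaces given by linear equations\<close>

lemma cspace_empty: "cspace {} = {\<lambda>_. 0}"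
  by (auto simp: cspace_def)

definition total_space ::
  "('c, 'i::finite, 'b) point set \<Rightarrow> (('i \<Rightarrow> ('b \<Rightarrow> complex) set) \<Rightarrow> ('c \<Rightarrow> complex) set) \<Rightarrow> ('c, 'i, 'b) point set" where
  "total_space B V = {(f, p). (0, p) \<in> B \<and> f \<in> V p}"

text \<open>A vector bundle of rank \<open>r\<close> over the closed set \<open>B\<close>, inside
  the trivial bundle with fibre \<open>cspace S0\<close>. Its equations are linear in the fibre
  vector, with coefficients polynomial in the frame entries of the base point, and may depend on the
  frame degree \<open>d\<close>.\<close>

locale linear_family =
  fixes B :: "('c, 'i::finite, 'b) point set" and n :: "'i \<Rightarrow> 'b set" and S0 :: "'c set"
    and V :: "('i \<Rightarrow> ('b \<Rightarrow> complex) set) \<Rightarrow> ('c \<Rightarrow> complex) set"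
    and Eq :: "('i \<Rightarrow> nat) \<Rightarrow> ('c \<Rightarrow> ('i \<times> nat \<times> 'b \<Rightarrow> complex) \<Rightarrow> complex) set"
    and r :: nat
  assumes S0: "finite S0" and n: "\<And>i. finite (n i)" and B: "zclosed_in {} n B"
    and Eq: "\<And>d c j. c \<in> Eq d \<Longrightarrow> j \<in> S0 \<Longrightarrow> poly_function (c j)"
    and V: "\<And>d (F :: ('c, 'i, 'b) coords) f. frame d F \<Longrightarrow> (0, snd (pt d F)) \<in> B \<Longrightarrow>
      f \<in> V (snd (pt d F)) \<longleftrightarrow> f \<in> cspace S0 \<and> (\<forall>c\<in>Eq d. (\<Sum>j\<in>S0. f j * c j (F \<circ> Inr)) = 0)"
    and dimV: "\<And>p. (0, p) \<in> B \<Longrightarrow> cfun.dim (V p) = r"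
begin

lemma base_ambient: "B \<subseteq> ambient {} n"
  using B unfolding zclosed_in_def by (rule conjunct1)

lemma base_zero:
  assumes "(x, p) \<in> B" shows "x = 0"
proof -
  have "(x, p) \<in> ambient {} n" using assms base_ambient by (rule rev_subsetD)
  then have "x \<in> cspace {}" by (simp add: ambient_def)
  then show ?thesis by (simp add: cspace_empty zero_fun_def)
qed

lemma base_frame:
  assumes "(0, p) \<in> B"
  obtains d and F :: "('c, 'i, 'b) coords" where "frame d F" "pt d F = (0, p)"
proof -
  have "(0 :: 'c \<Rightarrow> complex, p) \<in> ambient {} n" using assms base_ambient by (rule rev_subsetD)
  then obtain d and F :: "('c, 'i, 'b) coords" where "frame d F" "pt d F = (0, p)" by (rule exists_frame[OF _ n])
  then show ?thesis by (rule that)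
qed

lemma fibre: "(0, p) \<in> B \<Longrightarrow> V p \<subseteq> cspace S0" "(0, p) \<in> B \<Longrightarrow> cfun.subspace (V p)"
proof -
  assume p: "(0, p) \<in> B"
  obtain d and F :: "('c, 'i, 'b) coords" where F: "frame d F" "pt d F = (0, p)" using base_frame[OF p] .
  have e: "f \<in> V p \<longleftrightarrow> f \<in> cspace S0 \<and> (\<forall>c\<in>Eq d. (\<Sum>j\<in>S0. f j * c j (F \<circ> Inr)) = 0)" for f
    using V[OF F(1), of f] F(2) p by simp
  show "V p \<subseteq> cspace S0" using e by blast
  show "cfun.subspace (V p)"
  proof (rule cfun.subspaceI)
    show "0 \<in> V p" unfolding e by (simp add: cspace_def)
    show "x + y \<in> V p" if "x \<in> V p" "y \<in> V p" for x y
      using that unfolding e by (simp add: distrib_right sum.distrib cfun.subspace_add[OF subspace_cspace])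
    show "cscale c x \<in> V p" if "x \<in> V p" for c x
    proof -
      have "(\<Sum>j\<in>S0. cscale c x j * q j (F \<circ> Inr)) = c * (\<Sum>j\<in>S0. x j * q j (F \<circ> Inr))" for q
        by (simp add: cscale_def sum_distrib_left mult.assoc)
      then show ?thesis using that unfolding e by (simp add: cfun.subspace_scale[OF subspace_cspace])
    qed
  qed
qed

lemma zclosed_total_space: "zclosed (total_space B V)"
proof (rule zclosedI)
  show "zclosed_in S0 n (total_space B V)"
  proof (rule zclosed_inI)
    show "total_space B V \<subseteq> ambient S0 n"
    proof (clarsimp simp: total_space_def)
      fix f p assume a: "(0, p) \<in> B" "f \<in> V p"
      then have "(0 :: 'c \<Rightarrow> complex, p) \<in> ambient {} n" "f \<in> cspace S0" using base_ambient fibre(1) by blast+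
      then show "(f, p) \<in> ambient S0 n" by (simp only: ambient_def mem_Collect_eq case_prod_conv) blast
    qed
    fix d
    obtain P where P: "polynomial_condition P" "\<And>F. frame d F \<Longrightarrow> pt d F \<in> ambient {} n \<Longrightarrow> (pt d F \<in> B \<longleftrightarrow> P F)"
      using zclosed_inE[OF B] by blast
    \<comment> \<open>The condition \<open>P\<close> for the base concerns points with zero vector
      part, whereas here the vector part is a fibre vector; \<open>F0\<close> erases it before
      \<open>P\<close> is evaluated.\<close>
    define F0 :: "('c, 'i, 'b) coords \<Rightarrow> ('c, 'i, 'b) coords" where
      "F0 F = (\<lambda>k. case k of Inl _ \<Rightarrow> 0 | Inr z \<Rightarrow> F (Inr z))" for F
    have P0: "polynomial_condition (\<lambda>F. P (F0 F))"
    proof -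
      obtain \<Phi> where \<Phi>: "\<forall>\<phi>\<in>\<Phi>. poly_function \<phi>" "\<forall>F. P F = (\<forall>\<phi>\<in>\<Phi>. \<phi> F = 0)"
        using P(1) unfolding polynomial_condition_def by blast
      have "poly_function (\<lambda>F. \<phi> (F0 F))" if "\<phi> \<in> \<Phi>" for \<phi>
        unfolding F0_def
      proof (rule poly_function_subst[where q = "\<lambda>k F. case k of Inl _ \<Rightarrow> 0 | Inr z \<Rightarrow> F (Inr z)"])
        show "poly_function (\<lambda>F :: ('c, 'i, 'b) coords. case k of Inl _ \<Rightarrow> 0 | Inr z \<Rightarrow> F (Inr z))" for k :: "'c + 'i \<times> nat \<times> 'b"
          by (cases k) (auto intro: poly_function_intros)
      qed (use \<Phi>(1) that in blast)
      then have "polynomial_condition (\<lambda>F. \<forall>\<phi>\<in>\<Phi>. \<phi> (F0 F) = 0)"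
        by (intro polynomial_condition_Ball polynomial_condition_eq_0)
      then show ?thesis using \<Phi>(2) by simp
    qed
    have Q: "polynomial_condition (\<lambda>F. \<forall>c\<in>Eq d. (\<Sum>j\<in>S0. F (Inl j) * c j (F \<circ> Inr)) = 0)"
      by (intro polynomial_condition_Ball polynomial_condition_eq_0 poly_function_sum pf_mult pf_coord poly_function_Inr Eq)
    show "\<exists>P. polynomial_condition P \<and> (\<forall>F :: ('c, 'i, 'b) coords. frame d F \<and> pt d F \<in> ambient S0 n \<longrightarrow> (pt d F \<in> total_space B V \<longleftrightarrow> P F))"
    proof (intro exI conjI allI impI)
      show "polynomial_condition (\<lambda>F :: ('c, 'i, 'b) coords. P (F0 F) \<and> (\<forall>c\<in>Eq d. (\<Sum>j\<in>S0. F (Inl j) * c j (F \<circ> Inr)) = 0))"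
        by (rule polynomial_condition_conj[OF P0 Q])
      fix F :: "('c, 'i, 'b) coords" assume F: "frame d F \<and> pt d F \<in> ambient S0 n"
      have f0: "frame d (F0 F)" using F frame_cong[of F "F0 F" d] by (simp add: F0_def)
      have p0: "pt d (F0 F) = (0, snd (pt d F))"
        by (rule pt_eqI) (auto simp: F0_def intro: snd_pt_cong)
      have "pt d (F0 F) \<in> ambient {} n" using F unfolding p0 by (cases "pt d F") (simp add: ambient_def cspace_def)
      then have "(0, snd (pt d F)) \<in> B \<longleftrightarrow> P (F0 F)" using P(2)[OF f0] p0 by simp
      moreover have "pt d F \<in> total_space B V \<longleftrightarrow> (0, snd (pt d F)) \<in> B \<and> fst (pt d F) \<in> V (snd (pt d F))"
        by (cases "pt d F") (simp add: total_space_def)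
      moreover have "fst (pt d F) \<in> cspace S0" using F ambientD(1) by blast
      ultimately show "pt d F \<in> total_space B V \<longleftrightarrow> P (F0 F) \<and> (\<forall>c\<in>Eq d. (\<Sum>j\<in>S0. F (Inl j) * c j (F \<circ> Inr)) = 0)"
        using V[of d F "fst (pt d F)"] F unfolding fst_pt by blast
    qed
  qed
qed (use S0 n in auto)

lemma zclosed_base: "zclosed B"
  using zclosedI[OF B] n by simp

text \<open>Choose \<open>J\<close> so that the remaining coordinates \<open>T\<close> of
  \<open>S0\<close> are coordinates on the fibre at \<open>b\<close>. They are so on every fibre
  meeting \<open>cspace J\<close> only in 0, an open condition on the base, and over that open set
  the \<open>J\<close>-coordinates are rational functions of the frame and the
  \<open>T\<close>-coordinates.\<close>

lemma affine_fibration_total_space: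
  fixes S :: "'s set"
  assumes S: "finite S" "card S = r"
  shows "affine_fibration S (total_space B V) B (\<lambda>(x, p). (\<lambda>_. 0, p))"
  unfolding affine_fibration_def
proof (intro conjI ballI)
  let ?E = "total_space B V" and ?\<pi> = "\<lambda>(x :: 'c \<Rightarrow> complex, p :: 'i \<Rightarrow> ('b \<Rightarrow> complex) set). (\<lambda>_ :: 'c. 0 :: complex, p)"
  show "finite S" by (rule S(1))
  show "locally_closed ?E" "locally_closed B"
    by (rule zclosed_imp_locally_closed[OF zclosed_total_space], rule zclosed_imp_locally_closed[OF zclosed_base])
  have z: "(\<lambda>_. 0) = (0 :: 'c \<Rightarrow> complex)" by (simp add: zero_fun_def)
  show "morphism ?E B ?\<pi>"
    by (rule morphism_coord) (auto simp: total_space_def z intro: poly_function_intros)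
  fix b assume b: "b \<in> B"
  define p0 where "p0 = snd b"
  have p0: "b = (0, p0)" "(0, p0) \<in> B"
    using b base_zero[of "fst b" p0] by (simp_all add: p0_def prod_eq_iff) (metis prod.collapse)
  obtain J where J: "J \<subseteq> S0" "\<And>f. f \<in> V p0 \<Longrightarrow> f \<in> cspace J \<Longrightarrow> f = 0" "cfun.dim (V p0) = card (S0 - J)"
    using exists_coordinates[OF S0 fibre(2)[OF p0(2)] fibre(1)[OF p0(2)]] by metis
  define T where "T = S0 - J"
  have T: "finite T" "card T = r" "S0 = J \<union> T" "J \<inter> T = {}" "finite J"
    using S0 J(1,3) dimV[OF p0(2)] finite_subset by (auto simp: T_def)
  \<comment> \<open>The fibre of the fibration is prescribed as \<open>cspace S\<close>, so the
    coordinates in \<open>T\<close> are renamed.\<close>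
  obtain \<sigma> where \<sigma>: "bij_betw \<sigma> S T" using S T(1,2) by (metis finite_same_card_bij)
  define \<tau> where "\<tau> = inv_into S \<sigma>"
  have \<sigma>\<tau>: "\<tau> t \<in> S" "\<sigma> (\<tau> t) = t" if "t \<in> T" for t
    using \<sigma> that by (auto simp: \<tau>_def bij_betw_def f_inv_into_f inv_into_into)
  have \<tau>\<sigma>: "\<sigma> s \<in> T" "\<tau> (\<sigma> s) = s" if "s \<in> S" for s
    using \<sigma> that by (auto simp: \<tau>_def bij_betw_def)
  \<comment> \<open>The locus where \<open>T\<close> fails to be a set of coordinates; in frames it
    says that the columns \<open>J\<close> of the system of equations are dependent.\<close>
  define C where "C = {(x, p). (x, p) \<in> B \<and> (\<exists>f\<in>V p. f \<in> cspace J \<and> f \<noteq> 0)}"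
  have dep: "(\<exists>f\<in>V (snd (pt d F)). f \<in> cspace J \<and> f \<noteq> 0) \<longleftrightarrow> dependent_at J (Eq d) (\<lambda>j c. c j) (F \<circ> Inr)"
    if F: "frame d F" "(0, snd (pt d F)) \<in> B" for d and F :: "('x, 'i, 'b) coords"
  proof -
    have V': "f \<in> V (snd (pt d F)) \<longleftrightarrow> f \<in> cspace S0 \<and> (\<forall>c\<in>Eq d. (\<Sum>j\<in>S0. f j * c j (F \<circ> Inr)) = 0)" for f
    proof -
      \<comment> \<open>The assumption on \<open>V\<close> concerns frames with affine coordinates
        of type \<open>'c\<close>. Moving the frame entries into such a frame makes the equivalence
        available also for the trivialised bundle, which has additional affine coordinates.\<close>
      define F' :: "('c, 'i, 'b) coords" where "F' k = (case k of Inl _ \<Rightarrow> 0 | Inr z \<Rightarrow> F (Inr z))" for k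
      have "F' \<circ> Inr = F \<circ> Inr" by (auto simp: F'_def)
      moreover have "frame d F'" using F(1) unfolding frame_def by (simp add: F'_def)
      moreover have "snd (pt d F') = snd (pt d F)" by (simp add: pt_def F'_def)
      ultimately show ?thesis using V[of d F' f] F(2) by simp
    qed
    have sumJ: "(\<Sum>j\<in>S0. f j * c j (F \<circ> Inr)) = (\<Sum>j\<in>J. f j * c j (F \<circ> Inr))" if "f \<in> cspace J" for f c
      using that J(1) S0 by (intro sum.mono_neutral_right) (auto simp: cspace_def)
    show ?thesis
    proof
      assume "\<exists>f\<in>V (snd (pt d F)). f \<in> cspace J \<and> f \<noteq> 0"
      then obtain f where f: "f \<in> V (snd (pt d F))" "f \<in> cspace J" "f \<noteq> 0" by blast
      then have "\<forall>c\<in>Eq d. (\<Sum>j\<in>J. f j * c j (F \<circ> Inr)) = 0" using V' sumJ by simp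
      moreover have "\<exists>j\<in>J. f j \<noteq> 0" using f(2,3) by (auto simp: cspace_def fun_eq_iff)
      ultimately show "dependent_at J (Eq d) (\<lambda>j c. c j) (F \<circ> Inr)" unfolding dependent_at_def by (intro exI[of _ f] conjI)
    next
      assume "dependent_at J (Eq d) (\<lambda>j c. c j) (F \<circ> Inr)"
      then obtain a where a: "\<forall>c\<in>Eq d. (\<Sum>j\<in>J. a j * c j (F \<circ> Inr)) = 0" "\<exists>j\<in>J. a j \<noteq> 0"
        unfolding dependent_at_def by blast
      define f where "f j = (if j \<in> J then a j else 0)" for j
      have fJ: "f \<in> cspace J" by (simp add: f_def cspace_def)
      moreover have "f \<in> cspace S0" using J(1) by (auto simp: f_def cspace_def)
      moreover have "(\<Sum>j\<in>S0. f j * c j (F \<circ> Inr)) = (\<Sum>j\<in>J. a j * c j (F \<circ> Inr))" for c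
        unfolding sumJ[OF fJ] by (rule sum.cong) (auto simp: f_def)
      moreover have "f \<noteq> 0" using a(2) by (auto simp: f_def fun_eq_iff)
      ultimately show "\<exists>f\<in>V (snd (pt d F)). f \<in> cspace J \<and> f \<noteq> 0" using V' a(1) by auto
    qed
  qed
  have "zclosed_in {} n C"
  proof (rule zclosed_inI)
    show "C \<subseteq> ambient {} n" using base_ambient unfolding C_def by blast
    fix d
    obtain P where P: "polynomial_condition P" "\<And>F. frame d F \<Longrightarrow> pt d F \<in> ambient {} n \<Longrightarrow> (pt d F \<in> B \<longleftrightarrow> P F)"
      using zclosed_inE[OF B] by blast
    show "\<exists>P. polynomial_condition P \<and> (\<forall>F :: ('c, 'i, 'b) coords. frame d F \<and> pt d F \<in> ambient {} n \<longrightarrow> (pt d F \<in> C \<longleftrightarrow> P F))"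
    proof (intro exI conjI allI impI)
      have "polynomial_condition (dependent_at J (Eq d) (\<lambda>j c. c j))"
        by (rule polynomial_condition_dependent) (use T Eq in auto)
      then show "polynomial_condition (\<lambda>F. P F \<and> dependent_at J (Eq d) (\<lambda>j c. c j) (F \<circ> Inr))"
        by (intro polynomial_condition_conj P(1) polynomial_condition_Inr)
      fix F :: "('c, 'i, 'b) coords" assume F: "frame d F \<and> pt d F \<in> ambient {} n"
      then have "fst (pt d F) = 0" using ambientD(1)[of "pt d F" "{}" n] by (simp add: cspace_empty zero_fun_def)
      then have pe: "pt d F = (0, snd (pt d F))" by (cases "pt d F") simp
      have "pt d F \<in> C \<longleftrightarrow> (0, snd (pt d F)) \<in> B \<and> (\<exists>f\<in>V (snd (pt d F)). f \<in> cspace J \<and> f \<noteq> 0)"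
        by (subst pe) (simp add: C_def)
      also have "\<dots> \<longleftrightarrow> (0, snd (pt d F)) \<in> B \<and> dependent_at J (Eq d) (\<lambda>j c. c j) (F \<circ> Inr)"
        using dep F by blast
      finally show "pt d F \<in> C \<longleftrightarrow> P F \<and> dependent_at J (Eq d) (\<lambda>j c. c j) (F \<circ> Inr)"
        using P(2)[of F] F pe by simp
    qed
  qed
  then have zC: "zclosed C" by (rule zclosedI) (use n in auto)
  have bC: "b \<notin> C" using J(2) p0(1) by (auto simp: C_def)
  have solve: "\<exists>!f. f \<in> V p \<and> (\<forall>t\<in>T. f t = y t)" if p: "(0, p) \<in> B" "(0, p) \<notin> C" for p and y :: "'c \<Rightarrow> complex"
  proof -
    have Jp: "f = 0" if f: "f \<in> V p" "f \<in> cspace J" for f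
    proof (rule ccontr)
      assume "f \<noteq> 0"
      then have "(0, p) \<in> C" unfolding C_def using p(1) f by blast
      then show False using p(2) by blast
    qed
    have "cfun.dim (V p) = card (S0 - J)" using dimV[OF p(1)] T(2) by (simp add: T_def)
    from coordinates_surj[OF S0 fibre(2)[OF p(1)] fibre(1)[OF p(1)] Jp this]
    have "\<exists>f\<in>V p. \<forall>t\<in>S0 - J. f t = y t" by blast
    then obtain f where f: "f \<in> V p" "\<forall>t\<in>T. f t = y t" by (auto simp: T_def)
    show ?thesis
    proof (rule ex1I[of _ f])
      show "f \<in> V p \<and> (\<forall>t\<in>T. f t = y t)" using f by simp
      fix g assume g: "g \<in> V p \<and> (\<forall>t\<in>T. g t = y t)"
      have "g - f \<in> V p" using fibre(2)[OF p(1)] f(1) g by (simp add: cfun.subspace_diff)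
      moreover have "g - f \<in> cspace J"
      proof -
        have "g k - f k = 0" if "k \<notin> J" for k
        proof (cases "k \<in> T")
          case False
          then have "k \<notin> S0" using that T(3) by blast
          moreover have "f \<in> cspace S0" "g \<in> cspace S0" using f(1) g fibre(1)[OF p(1)] by blast+
          ultimately show ?thesis by (simp add: cspace_def)
        qed (use f(2) g in simp)
        then show ?thesis by (simp add: cspace_def)
      qed
      ultimately show "g = f" using Jp[of "g - f"] by simp
    qed
  qed
  define sec where "sec p y = (THE f. f \<in> V p \<and> (\<forall>t\<in>T. f t = y t))" for p and y :: "'c \<Rightarrow> complex"
  have sec: "sec p y \<in> V p" "\<And>t. t \<in> T \<Longrightarrow> sec p y t = y t" if "(0, p) \<in> B" "(0, p) \<notin> C" for p y
    using theI'[OF solve[OF that, of y]] by (auto simp: sec_def)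
  have sec_eq: "sec p y = f" if "(0, p) \<in> B" "(0, p) \<notin> C" "f \<in> V p" "\<forall>t\<in>T. f t = y t" for p y f
    unfolding sec_def by (rule the1_equality[OF solve[OF that(1,2)]]) (use that(3,4) in simp)
  let ?X = "times_affine (B - C) S" and ?Y = "{e \<in> ?E. ?\<pi> e \<notin> C}"
  define \<psi> :: "('c + 's, 'i, 'b) point \<Rightarrow> ('c, 'i, 'b) point" where
    "\<psi> = (\<lambda>(z, p). (sec p (\<lambda>t. z (Inr (\<tau> t))), p))"
  define \<phi> :: "('c, 'i, 'b) point \<Rightarrow> ('c + 's, 'i, 'b) point" where
    "\<phi> = (\<lambda>(f, p). (\<lambda>k. (case k of Inl _ \<Rightarrow> (\<lambda>_. 0) | Inr s \<Rightarrow> (\<lambda>f. if s \<in> S then f (\<sigma> s) else 0)) f, p))"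
  have X: "\<exists>y. z = case_sum 0 y \<and> y \<in> cspace S \<and> (0, p) \<in> B \<and> (0, p) \<notin> C" if zp: "(z, p) \<in> ?X" for z p
  proof -
    obtain x y where xy: "z = case_sum x y" "(x, p) \<in> B - C" "y \<in> cspace S"
      using zp unfolding times_affine_def by blast
    then have "x = 0" using base_zero[of x p] by simp
    then show ?thesis using xy by (intro exI[of _ y]) simp
  qed
  have Y: "f \<in> V p \<and> (0, p) \<in> B \<and> (0, p) \<notin> C" if "(f, p) \<in> ?Y" for f p
    using that by (simp add: total_space_def z)
  have \<psi>Y: "\<psi> q \<in> ?Y" if "q \<in> ?X" for q
  proof -
    obtain z p where "q = (z, p)" by (cases q)
    then show ?thesis using X[of z p] that sec(1) by (auto simp: \<psi>_def total_space_def z)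
  qed
  have \<phi>X: "\<phi> q \<in> ?X" if "q \<in> ?Y" for q
  proof -
    obtain f p where q: "q = (f, p)" by (cases q)
    then have a: "(0, p) \<in> B - C" using Y[of f p] that by blast
    have e: "fst (\<phi> q) = case_sum 0 (\<lambda>s. if s \<in> S then f (\<sigma> s) else 0)"
      unfolding q \<phi>_def by (auto split: sum.split)
    have "(\<lambda>s. if s \<in> S then f (\<sigma> s) else 0) \<in> cspace S" by (simp add: cspace_def)
    then have "(fst (\<phi> q), p) \<in> ?X" unfolding e times_affine_def using a by blast
    then show ?thesis by (simp add: q \<phi>_def)
  qed
  have "variety_iso ?X ?Y \<psi>"
  proof (rule variety_isoI)
    show "morphism ?Y ?X \<phi>" unfolding \<phi>_def
    proof (rule morphism_coord)
      show "(\<lambda>(f, p). (\<lambda>k. (case k of Inl _ \<Rightarrow> (\<lambda>_. 0) | Inr s \<Rightarrow> (\<lambda>f. if s \<in> S then f (\<sigma> s) else 0)) f, p)) ` ?Y \<subseteq> ?X"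
        using \<phi>X unfolding \<phi>_def by blast
    qed (auto split: sum.split intro: poly_function_intros)
    show "\<phi> (\<psi> q) = q" if "q \<in> ?X" for q
    proof -
      obtain z p where q: "q = (z, p)" by (cases q)
      have "(z, p) \<in> ?X" using that q by simp
      from X[OF this] obtain y where y: "z = case_sum 0 y" "y \<in> cspace S" "(0, p) \<in> B" "(0, p) \<notin> C" by blast
      have "(case k of Inl _ \<Rightarrow> (\<lambda>_. 0) | Inr s \<Rightarrow> (\<lambda>f. if s \<in> S then f (\<sigma> s) else 0)) (sec p (\<lambda>t. z (Inr (\<tau> t)))) = z k" for k
        using y(1,2) \<tau>\<sigma> sec(2)[OF y(3,4)] by (cases k) (auto simp: cspace_def)
      then show ?thesis by (simp add: q \<phi>_def \<psi>_def)
    qed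
    show "\<psi> (\<phi> q) = q" if "q \<in> ?Y" for q
    proof -
      obtain f p where q: "q = (f, p)" by (cases q)
      have a: "f \<in> V p" "(0, p) \<in> B" "(0, p) \<notin> C" using Y[of f p] that q by auto
      have "sec p (\<lambda>t. if \<tau> t \<in> S then f (\<sigma> (\<tau> t)) else 0) = f"
        by (rule sec_eq[OF a(2,3,1)]) (simp add: \<sigma>\<tau>)
      then show ?thesis by (simp add: q \<phi>_def \<psi>_def)
    qed
    show "morphism ?X ?Y \<psi>" unfolding morphism_def
    proof (intro conjI allI impI)
      show "\<psi> ` ?X \<subseteq> ?Y" using \<psi>Y by blast
      fix d and F0 :: "('c + 's, 'i, 'b) coords" assume F0: "frame d F0 \<and> pt d F0 \<in> ?X"
      have XB: "(0, snd (pt d F)) \<in> B" "(0, snd (pt d F)) \<notin> C" if "pt d F \<in> ?X" for F :: "('c + 's, 'i, 'b) coords"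
        using X[of "fst (pt d F)" "snd (pt d F)"] that by auto
      have "\<not> dependent_at J (Eq d) (\<lambda>j c. c j) (F0 \<circ> Inr)"
        using dep[of d F0] F0 XB[of F0] by (simp add: C_def)
      then have ind: "\<forall>j\<in>J. a j = 0" if "\<forall>c\<in>Eq d. (\<Sum>j\<in>J. a j * c j (F0 \<circ> Inr)) = 0" for a
        using that by (auto simp: dependent_at_def)
      have "\<exists>K L b. finite K \<and> K \<subseteq> Eq d \<and> poly_function b \<and> b (F0 \<circ> Inr) \<noteq> 0 \<and> (\<forall>j\<in>J. \<forall>r\<in>K. poly_function (L j r)) \<and>
          (\<forall>G. \<forall>j\<in>J. \<forall>j'\<in>J. (\<Sum>r\<in>K. L j r G * r j' G) = (if j = j' then b G else 0))"
        by (rule poly_left_inverse[where A = "\<lambda>j c. c j"]) (use T Eq ind in auto)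
      then obtain K L b where K: "finite K" "K \<subseteq> Eq d" and b: "poly_function b" "b (F0 \<circ> Inr) \<noteq> 0"
        and L: "\<forall>j\<in>J. \<forall>r\<in>K. poly_function (L j r)"
        and LA: "\<forall>G. \<forall>j\<in>J. \<forall>j'\<in>J. (\<Sum>r\<in>K. L j r G * r j' G) = (if j = j' then b G else 0)" by (elim exE conjE)
      \<comment> \<open>Numerators over the common denominator \<open>b\<close>. The
        \<open>T\<close>-coordinates are copied, the \<open>J\<close>-coordinates arise by applying
        the left inverse \<open>L\<close> to the negated \<open>T\<close>-part of the equations, and
        every copied entry carries a factor \<open>b\<close> to cancel the division.\<close>
      define g :: "('c + 'i \<times> nat \<times> 'b) \<Rightarrow> ('c + 's, 'i, 'b) coords \<Rightarrow> complex" where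
        "g k = (case k of Inl c \<Rightarrow> (if c \<in> T then (\<lambda>F. b (F \<circ> Inr) * F (Inl (Inr (\<tau> c))))
            else if c \<in> J then (\<lambda>F. - (\<Sum>r\<in>K. L c r (F \<circ> Inr) * (\<Sum>t\<in>T. F (Inl (Inr (\<tau> t))) * r t (F \<circ> Inr))))
            else (\<lambda>_. 0))
          | Inr z \<Rightarrow> (\<lambda>F. b (F \<circ> Inr) * F (Inr z)))" for k
      have "poly_function (g k)" for k
      proof (cases k)
        case (Inl c)
        have "poly_function (r t)" if "r \<in> K" "t \<in> T" for r t using Eq[of r d t] that K(2) T(3) by blast
        then show ?thesis using Inl L b(1) unfolding g_def
          by (auto intro!: poly_function_intros poly_function_Inr)
      next
        case (Inr z)
        then show ?thesis using b(1) by (auto simp: g_def intro!: pf_mult pf_coord poly_function_Inr)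
      qed
      moreover have "poly_function (\<lambda>F :: ('c + 's, 'i, 'b) coords. b (F \<circ> Inr))" by (rule poly_function_Inr[OF b(1)])
      moreover have "frame d (\<lambda>k. g k F / b (F \<circ> Inr)) \<and> pt d (\<lambda>k. g k F / b (F \<circ> Inr)) = \<psi> (pt d F)"
        if F: "frame d F" "pt d F \<in> ?X" "b (F \<circ> Inr) \<noteq> 0" for F :: "('c + 's, 'i, 'b) coords"
      proof
        let ?F = "\<lambda>k. g k F / b (F \<circ> Inr)" and ?p = "snd (pt d F)"
        have Fi: "?F (Inr z) = F (Inr z)" for z using F(3) by (simp add: g_def)
        show "frame d ?F" using F(1) unfolding frame_def Fi .
        have p: "snd (pt d ?F) = ?p" unfolding pt_def Fi by simp
        define f where "f = sec ?p (\<lambda>t. F (Inl (Inr (\<tau> t))))"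
        note pB = XB[OF F(2)]
        have f: "f \<in> V ?p" "\<And>t. t \<in> T \<Longrightarrow> f t = F (Inl (Inr (\<tau> t)))" unfolding f_def using sec[OF pB] by auto
        have V': "f \<in> cspace S0 \<and> (\<forall>c\<in>Eq d. (\<Sum>j\<in>S0. f j * c j (F \<circ> Inr)) = 0)"
        proof -
          define F' :: "('c, 'i, 'b) coords" where "F' k = (case k of Inl _ \<Rightarrow> 0 | Inr z \<Rightarrow> F (Inr z))" for k
          have "F' \<circ> Inr = F \<circ> Inr" by (auto simp: F'_def)
          moreover have "frame d F'" using F(1) unfolding frame_def by (simp add: F'_def)
          moreover have "snd (pt d F') = ?p" by (simp add: pt_def F'_def)
          ultimately show ?thesis using V[of d F' f] pB(1) f(1) by simp
        qed
        have "?F (Inl c) = f c" for c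
        proof -
          consider "c \<in> T" | "c \<in> J" "c \<notin> T" | "c \<notin> S0" using T(3) by blast
          then show ?thesis
          proof cases
            case 1 then show ?thesis using F(3) f(2) by (simp add: g_def)
          next
            case 2
            have eq: "(\<Sum>j\<in>J. f j * r j (F \<circ> Inr)) = - (\<Sum>t\<in>T. F (Inl (Inr (\<tau> t))) * r t (F \<circ> Inr))" if "r \<in> K" for r
            proof -
              have "0 = (\<Sum>j\<in>S0. f j * r j (F \<circ> Inr))" using V' that K(2) by auto
              also have "\<dots> = (\<Sum>j\<in>J. f j * r j (F \<circ> Inr)) + (\<Sum>t\<in>T. f t * r t (F \<circ> Inr))"
                unfolding T(3) by (rule sum.union_disjoint) (use T in auto)
              also have "(\<Sum>t\<in>T. f t * r t (F \<circ> Inr)) = (\<Sum>t\<in>T. F (Inl (Inr (\<tau> t))) * r t (F \<circ> Inr))"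
                by (rule sum.cong) (use f(2) in auto)
              finally show ?thesis unfolding eq_neg_iff_add_eq_0 by (rule sym)
            qed
            have "g (Inl c) F = (\<Sum>r\<in>K. L c r (F \<circ> Inr) * (\<Sum>j\<in>J. f j * r j (F \<circ> Inr)))"
            proof -
              have "(\<Sum>r\<in>K. L c r (F \<circ> Inr) * (\<Sum>j\<in>J. f j * r j (F \<circ> Inr)))
                  = (\<Sum>r\<in>K. L c r (F \<circ> Inr) * - (\<Sum>t\<in>T. F (Inl (Inr (\<tau> t))) * r t (F \<circ> Inr)))"
                by (rule sum.cong[OF refl]) (simp only: eq)
              then show ?thesis using 2 by (simp add: g_def sum_negf)
            qed
            also have "\<dots> = (\<Sum>j\<in>J. f j * (\<Sum>r\<in>K. L c r (F \<circ> Inr) * r j (F \<circ> Inr)))"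
              unfolding sum_distrib_left by (subst sum.swap) (simp add: ac_simps)
            also have "\<dots> = (\<Sum>j\<in>J. if j = c then f c * b (F \<circ> Inr) else 0)"
              using LA 2(1) by (intro sum.cong) auto
            also have "\<dots> = f c * b (F \<circ> Inr)" using T(5) 2(1) by simp
            finally show ?thesis using F(3) by simp
          next
            case 3 then show ?thesis using V' T(3) by (auto simp: g_def cspace_def)
          qed
        qed
        then have "pt d ?F = (f, ?p)" using p by (rule pt_eqI)
        also have "\<dots> = \<psi> (pt d F)" by (simp add: \<psi>_def f_def pt_def)
        finally show "pt d ?F = \<psi> (pt d F)" .
      qed
      ultimately show "\<exists>d' g b. (\<forall>k. poly_function (g k)) \<and> poly_function b \<and> b F0 \<noteq> 0 \<and>
          (\<forall>F :: ('c + 's, 'i, 'b) coords. frame d F \<and> pt d F \<in> ?X \<and> b F \<noteq> 0 \<longrightarrow> frame d' (\<lambda>k. g k F / b F) \<and> pt d' (\<lambda>k. g k F / b F) = \<psi> (pt d F))"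
        using b(2) by - (rule exI[of _ d], rule exI[of _ g], rule exI[of _ "\<lambda>F. b (F \<circ> Inr)"], simp)
    qed
  qed
  moreover have "?\<pi> (\<psi> (case_sum x y, p)) = (x, p)" if "(x, p) \<in> B - C \<and> y \<in> cspace S" for x p and y :: "'s \<Rightarrow> complex"
    using that base_zero[of x p] by (simp add: \<psi>_def z)
  ultimately show "\<exists>C \<psi>. zclosed C \<and> b \<notin> C \<and> variety_iso (times_affine (B - C) S) {e \<in> ?E. ?\<pi> e \<notin> C} \<psi> \<and>
      (\<forall>x y p. (x, p) \<in> B - C \<and> y \<in> cspace S \<longrightarrow> ?\<pi> (\<psi> (case_sum x y, p)) = (x, p))"
    using zC bC by - (rule exI[of _ C], rule exI[of _ \<psi>], simp)
qed

end

section \<open>The virtual Poincare polynomial of affine spaces and of linear families\<close>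

lemma poly_function_case_sum:
  "(\<And>c. poly_function (f c)) \<Longrightarrow> (\<And>s. poly_function (g s)) \<Longrightarrow>
    poly_function (\<lambda>x. case k of Inl c \<Rightarrow> f c x | Inr s \<Rightarrow> g s x)"
  by (cases k) auto

lemma affine_space_ambient: "affine_space S = ambient S (\<lambda>_. {})"
proof -
  have eq: "(\<forall>i. cfun.subspace (p i) \<and> p i \<subseteq> cspace {}) \<longleftrightarrow> p = (\<lambda>_. {0})" for p :: "'b \<Rightarrow> ('c \<Rightarrow> complex) set"
  proof
    assume a: "\<forall>i. cfun.subspace (p i) \<and> p i \<subseteq> cspace {}"
    have "p i = {0}" for i
      using a cfun.subspace_0[of "p i"] by (auto simp: cspace_empty zero_fun_def)
    then show "p = (\<lambda>_. {0})" by blast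
  next
    assume "p = (\<lambda>_. {0})"
    then show "\<forall>i. cfun.subspace (p i) \<and> p i \<subseteq> cspace {}" by (simp add: cfun.subspace_single_0 cspace_def)
  qed
  show ?thesis unfolding affine_space_def ambient_def eq by auto
qed

lemma zclosed_affine_space:
  assumes "finite S" shows "zclosed (affine_space S)"
proof (rule zclosedI)
  show "zclosed_in S (\<lambda>_. {}) (affine_space S)"
    by (rule zclosed_inI) (simp add: affine_space_ambient, rule exI[of _ "\<lambda>_. True"], simp add: affine_space_ambient polynomial_condition_const)
qed (use assms in auto)

lemma mem_times_affine:
  "(z, p) \<in> times_affine U S \<longleftrightarrow> ((\<lambda>c. z (Inl c)), p) \<in> U \<and> (\<lambda>s. z (Inr s)) \<in> cspace S"
proof
  assume "((\<lambda>c. z (Inl c)), p) \<in> U \<and> (\<lambda>s. z (Inr s)) \<in> cspace S"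
  moreover have "z = case_sum (\<lambda>c. z (Inl c)) (\<lambda>s. z (Inr s))" by (auto split: sum.split)
  ultimately show "(z, p) \<in> times_affine U S" unfolding times_affine_def by blast
qed (auto simp: times_affine_def)

lemma mem_affine_space: "(x, p) \<in> affine_space S \<longleftrightarrow> x \<in> cspace S \<and> p = (\<lambda>_. {0})"
  by (auto simp: affine_space_def)

lemma morphism_id: "X \<subseteq> Y \<Longrightarrow> morphism X Y (\<lambda>x. x)"
  using morphism_coord[of "\<lambda>k x. x k" X Y] by (auto simp: id_def intro: poly_function_intros)

text \<open>A space is a fibration over itself with a point as fibre; this gives the relation that
  determines the value of a point.\<close>

lemma affine_fibration_identity:
  assumes "locally_closed X"
  shows "affine_fibration ({} :: 's set) X X (\<lambda>x. x)"
proof (rule affine_fibration_trivial)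
  let ?q = "\<lambda>(k :: 'a + 's) x. (case k of Inl c \<Rightarrow> x c | Inr s \<Rightarrow> (0 :: complex))"
  show "variety_iso (times_affine X ({} :: 's set)) X (\<lambda>(z, p). (\<lambda>k. z (Inl k), p))"
  proof (rule variety_isoI[where \<phi> = "\<lambda>(x, p). (\<lambda>k. ?q k x, p)"])
    show "morphism (times_affine X ({} :: 's set)) X (\<lambda>(z, p). (\<lambda>k. z (Inl k), p))"
      by (rule morphism_coord) (auto simp: mem_times_affine intro: poly_function_intros)
    show "morphism X (times_affine X ({} :: 's set)) (\<lambda>(x, p). (\<lambda>k. ?q k x, p))"
      by (rule morphism_coord) (auto simp: mem_times_affine cspace_def intro: poly_function_case_sum poly_function_intros)
  qed (auto simp: mem_times_affine cspace_empty fun_eq_iff split: sum.split)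
qed (auto simp: assms morphism_id)

text \<open>Splits off one coordinate, for the induction on the dimension of an affine
  space.\<close>

lemma affine_fibration_insert:
  assumes S: "finite S" "s \<notin> S"
  shows "affine_fibration {s} (affine_space (insert s S)) (affine_space S) (\<lambda>(x, p). (\<lambda>k. if k = s then 0 else x k, p))"
proof (rule affine_fibration_trivial)
  let ?q = "\<lambda>(k :: 'a + 'a) x. (case k of Inl c \<Rightarrow> if c = s then 0 else x c | Inr c \<Rightarrow> if c = s then x s else (0 :: complex))"
  show "locally_closed (affine_space (insert s S))" "locally_closed (affine_space S)"
    using S by (intro zclosed_imp_locally_closed zclosed_affine_space; simp)+
  show "morphism (affine_space (insert s S)) (affine_space S) (\<lambda>(x, p). (\<lambda>k. if k = s then 0 else x k, p))"
    by (rule morphism_coord) (auto simp: mem_affine_space cspace_def intro: poly_function_intros)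
  show "variety_iso (times_affine (affine_space S) {s}) (affine_space (insert s S))
      (\<lambda>(z, p). (\<lambda>k. if k = s then z (Inr s) else z (Inl k), p))"
  proof (rule variety_isoI[where \<phi> = "\<lambda>(x, p). (\<lambda>k. ?q k x, p)"])
    show "morphism (times_affine (affine_space S) {s}) (affine_space (insert s S)) (\<lambda>(z, p). (\<lambda>k. if k = s then z (Inr s) else z (Inl k), p))"
      by (rule morphism_coord) (auto simp: mem_times_affine mem_affine_space cspace_def intro: poly_function_intros)
    show "morphism (affine_space (insert s S)) (times_affine (affine_space S) {s}) (\<lambda>(x, p). (\<lambda>k. ?q k x, p))"
    proof (rule morphism_coord)
      show "poly_function (?q k)" for k :: "'a + 'a" by (cases k) (auto intro: poly_function_intros)
    qed (auto simp: mem_times_affine mem_affine_space cspace_def)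
  qed (use S(2) in \<open>auto simp: mem_times_affine mem_affine_space cspace_def fun_eq_iff split: sum.split\<close>)
qed (use S in \<open>auto simp: mem_affine_space cspace_def fun_eq_iff\<close>)

section \<open>The affine line and the point at infinity in the projective line\<close>

lemma morphism_line_pt:
  fixes X :: "('c, 'i::finite, 'b) point set" and Y :: "('c2, 'i, nat) point set"
  assumes q: "poly_function q0" "poly_function q1" "\<And>x p. (x, p) \<in> X \<Longrightarrow> (q0 x, q1 x) \<noteq> (0, 0)"
    and im: "(\<lambda>(x, p). line_pt v (q0 x, q1 x)) ` X \<subseteq> Y"
  shows "morphism X Y (\<lambda>(x, p). line_pt v (q0 x, q1 x))"
  unfolding morphism_def
proof (intro conjI allI impI)
  fix d and F0 :: "('c, 'i, 'b) coords" assume "frame d F0 \<and> pt d F0 \<in> X"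
  define g where "g k F = line_frame v (q0 (\<lambda>c. F (Inl c)), q1 (\<lambda>c. F (Inl c))) k"
    for k :: "'c2 + 'i \<times> nat \<times> nat" and F :: "('c, 'i, 'b) coords"
  have "poly_function (g k)" for k
  proof -
    have "poly_function (\<lambda>F :: ('c, 'i, 'b) coords. q0 (\<lambda>c. F (Inl c)))" "poly_function (\<lambda>F :: ('c, 'i, 'b) coords. q1 (\<lambda>c. F (Inl c)))"
      using q(1,2) by (auto intro: poly_function_subst pf_coord)
    then show ?thesis unfolding g_def line_frame_def vec2_def
      by (cases k) (auto split: prod.split intro!: poly_function_intros)
  qed
  moreover have "frame (frame_deg v) (\<lambda>k. g k F / 1) \<and> pt (frame_deg v) (\<lambda>k. g k F / 1) = (case pt d F of (x, p) \<Rightarrow> (line_pt v (q0 x, q1 x) :: ('c2, 'i, nat) point))"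
    if "pt d F \<in> X" for F :: "('c, 'i, 'b) coords"
  proof -
    have "(q0 (\<lambda>c. F (Inl c)), q1 (\<lambda>c. F (Inl c))) \<noteq> 0"
      using q(3)[of "\<lambda>c. F (Inl c)" "snd (pt d F)"] that by (simp add: pt_def zero_prod_def)
    from frame_line_frame[OF this, of v] show ?thesis
      by (simp add: g_def pt_line_frame) (simp add: pt_def)
  qed
  ultimately show "\<exists>d' g b. (\<forall>k. poly_function (g k)) \<and> poly_function b \<and> b F0 \<noteq> 0 \<and>
      (\<forall>F. frame d F \<and> pt d F \<in> X \<and> b F \<noteq> 0 \<longrightarrow> frame d' (\<lambda>k. g k F / b F) \<and>
        pt d' (\<lambda>k. g k F / b F) = (case pt d F of (x, p) \<Rightarrow> (line_pt v (q0 x, q1 x) :: ('c2, 'i, nat) point)))"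
    by - (rule exI[of _ "frame_deg v"], rule exI[of _ g], rule exI[of _ "\<lambda>_. 1"], simp add: pf_const)
qed (rule im)

definition affine_line :: "'i \<Rightarrow> ('c, 'i::finite, nat) point set" where
  "affine_line v = range (\<lambda>a. line_pt v (1, a))"

definition infinity_pt :: "'i \<Rightarrow> ('c, 'i::finite, nat) point" where
  "infinity_pt v = line_pt v (0, 1)"

lemma proj_line_split:
  "proj_line v = (affine_line v \<union> {infinity_pt v} :: ('c, 'i::finite, nat) point set)"
  "infinity_pt v \<notin> (affine_line v :: ('c, 'i, nat) point set)"
proof -
  have "line_pt v z \<in> (affine_line v \<union> {infinity_pt v} :: ('c, 'i, nat) point set)" if "z \<noteq> 0" for z
  proof (cases "fst z = 0")
    case True
    then have "line_pt v z = (infinity_pt v :: ('c, 'i, nat) point)"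
      unfolding infinity_pt_def by (subst line_pt_eq_iff) (use that in \<open>auto simp: zero_prod_def\<close>)
    then show ?thesis by simp
  next
    case False
    then have "line_pt v z = (line_pt v (1, snd z / fst z) :: ('c, 'i, nat) point)"
      by (subst line_pt_eq_iff) (use that in \<open>auto simp: zero_prod_def\<close>)
    then show ?thesis unfolding affine_line_def by blast
  qed
  moreover have "infinity_pt v \<in> (proj_line v :: ('c, 'i, nat) point set)" "affine_line v \<subseteq> (proj_line v :: ('c, 'i, nat) point set)"
    by (auto simp: proj_line_def infinity_pt_def affine_line_def zero_prod_def)
  ultimately show "proj_line v = (affine_line v \<union> {infinity_pt v} :: ('c, 'i, nat) point set)" unfolding proj_line_def by blast
  have "line_pt v (0, 1) \<noteq> (line_pt v (1, a) :: ('c, 'i, nat) point)" for a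
    by (subst line_pt_eq_iff) (auto simp: zero_prod_def)
  then show "infinity_pt v \<notin> (affine_line v :: ('c, 'i, nat) point set)" unfolding affine_line_def infinity_pt_def by blast
qed

lemma zclosed_infinity: "zclosed {infinity_pt v :: ('c, 'i::finite, nat) point}"
proof (rule zclosedI)
  let ?n = "(\<lambda>_. {})(v := {0, 1 :: nat})"
  show "zclosed_in {} ?n {infinity_pt v :: ('c, 'i, nat) point}"
  proof (rule zclosed_inI)
    show "{infinity_pt v :: ('c, 'i, nat) point} \<subseteq> ambient {} ?n"
      using proj_line_ambient[of v] proj_line_split(1)[of v] by blast
    fix d
    show "\<exists>P. polynomial_condition P \<and> (\<forall>F :: ('c, 'i, nat) coords. frame d F \<and> pt d F \<in> ambient {} ?n \<longrightarrow>
        (pt d F \<in> {infinity_pt v} \<longleftrightarrow> P F))"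
    proof (intro exI conjI allI impI)
      show "polynomial_condition (\<lambda>F :: ('c, 'i, nat) coords. d = frame_deg v \<and> F (Inr (v, 0, 0)) = 0)"
        by (intro polynomial_condition_conj polynomial_condition_const polynomial_condition_eq_0 pf_coord)
      fix F :: "('c, 'i, nat) coords" assume F: "frame d F \<and> pt d F \<in> ambient {} ?n"
      show "pt d F \<in> {infinity_pt v} \<longleftrightarrow> d = frame_deg v \<and> F (Inr (v, 0, 0)) = 0"
      proof (cases "d = frame_deg v")
        case True
        then have "pt d F \<in> proj_line v" using F ambient_frame_deg by blast
        note * = frame_proj_line(2,3)[OF _ this]
        have "pt d F = infinity_pt v \<longleftrightarrow> fst (frame_vec v F) = 0"
          unfolding infinity_pt_def *(2)[OF conjunct1[OF F]]
          by (subst line_pt_eq_iff) (use * F in \<open>auto simp: zero_prod_def\<close>)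
        then show ?thesis using True by (simp add: frame_vec_def)
      next
        case False
        then have "pt d F \<notin> proj_line v" using F frame_proj_line(1) by blast
        then show ?thesis using False proj_line_split(1)[of v] by auto
      qed
    qed
  qed
qed auto

lemma zclosed_proj_line': "zclosed (proj_line v)"
  by (rule zclosedI[OF zclosed_proj_line]) auto

lemma locally_closed_affine_line: "locally_closed (affine_line v)"
  unfolding locally_closed_def
  using zclosed_proj_line'[of v] zclosed_infinity[of v] proj_line_split[of v]
  by - (rule exI[of _ "proj_line v"], rule exI[of _ "{infinity_pt v}"], auto)

text \<open>Inverse of the chart a -> [1 : a]; on \<open>affine_line\<close> the choice is
  unique.\<close>

definition slope :: "'i \<Rightarrow> ('i \<Rightarrow> (nat \<Rightarrow> complex) set) \<Rightarrow> complex" where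
  "slope v p = (SOME a. p v = cfun.span {vec2 (1, a)})"

lemma slope_line_pt: "slope v (snd (line_pt v (1, a))) = a"
proof -
  have "(cfun.span {vec2 (1, a)} = cfun.span {vec2 (1, b)}) = (b = a)" for b
    by (subst span_vec2_eq_iff) (auto simp: zero_prod_def)
  then show ?thesis unfolding slope_def line_pt_def by simp
qed

lemma mem_times_affine_empty:
  assumes "\<And>x p. (x, p) \<in> U \<Longrightarrow> x = (\<lambda>_. 0)"
  shows "(z, p) \<in> times_affine U {} \<longleftrightarrow> z = (\<lambda>_. 0) \<and> ((\<lambda>_. 0), p) \<in> U"
proof -
  have "z = (\<lambda>_. 0) \<longleftrightarrow> (\<lambda>c. z (Inl c)) = (\<lambda>_. 0) \<and> (\<lambda>s. z (Inr s)) = (\<lambda>_. 0)"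
    by (auto simp: fun_eq_iff) (metis old.sum.exhaust)
  then show ?thesis unfolding mem_times_affine cspace_empty using assms by auto
qed

lemma times_affine_affine_line:
  "times_affine (affine_line v :: ('c, 'i::finite, nat) point set) ({} :: 's set) = affine_line v"
proof -
  have "(z, p) \<in> times_affine (affine_line v :: ('c, 'i, nat) point set) ({} :: 's set) \<longleftrightarrow> (z, p) \<in> affine_line v" for z p
    by (subst mem_times_affine_empty) (auto simp: affine_line_def line_pt_def)
  then show ?thesis by auto
qed

lemma times_affine_infinity:
  "times_affine {infinity_pt v :: ('c, 'i::finite, nat) point} ({} :: 's set) = {infinity_pt v}"
proof -
  have "(z, p) \<in> times_affine {infinity_pt v :: ('c, 'i, nat) point} ({} :: 's set) \<longleftrightarrow> (z, p) \<in> {infinity_pt v}" for z p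
    by (subst mem_times_affine_empty) (auto simp: infinity_pt_def line_pt_def)
  then show ?thesis by auto
qed

lemma frame_0: "(\<And>z. F (Inr z) = 0) \<Longrightarrow> frame (\<lambda>_. 0) F"
  by (simp add: frame_def)

lemma pt_0: "pt (\<lambda>_. 0) F = (\<lambda>c. F (Inl c), \<lambda>_. {0})"
  by (simp add: pt_def)

definition slope_pt :: "'i \<Rightarrow> 'c2 \<Rightarrow> ('c, 'i::finite, nat) point \<Rightarrow> ('c2, 'i, nat) point" where
  "slope_pt v s q = (\<lambda>k. if k = s then slope v (snd q) else 0, \<lambda>_. {0})"

text \<open>On \<open>affine_line\<close> the spanning vector is a nonzero multiple of (1, a), so
  its first entry does not vanish and the slope is a quotient of two frame entries.\<close>

lemma morphism_slope_pt:
  "morphism (affine_line v :: ('c, 'i::finite, nat) point set) (affine_space {s} :: ('c2, 'i, nat) point set) (slope_pt v s)"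
  unfolding morphism_def
proof (intro conjI allI impI)
  show "slope_pt v s ` (affine_line v :: ('c, 'i, nat) point set) \<subseteq> (affine_space {s} :: ('c2, 'i, nat) point set)"
    by (auto simp: mem_affine_space cspace_def slope_pt_def)
  fix d and F0 :: "('c, 'i, nat) coords" assume F0: "frame d F0 \<and> pt d F0 \<in> affine_line v"
  have key: "F (Inr (v, 0, 0)) \<noteq> 0 \<and> slope v (snd (pt d F)) = F (Inr (v, 0, 1)) / F (Inr (v, 0, 0))"
    if F: "frame d F" "pt d F \<in> affine_line v" for F :: "('c, 'i, nat) coords"
  proof -
    have P: "pt d F \<in> proj_line v" using F(2) proj_line_split(1)[of v] by blast
    note w = frame_proj_line(2,3)[OF F(1) P]
    obtain a where a: "pt d F = line_pt v (1, a)" using F(2) unfolding affine_line_def by blast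
    have eq: "line_pt v (frame_vec v F) = (line_pt v (1, a) :: ('c, 'i, nat) point)"
      using a unfolding w(2) .
    have nz: "(1, a) \<noteq> (0 :: complex \<times> complex)" by (simp add: zero_prod_def)
    have e: "fst (frame_vec v F) * a = snd (frame_vec v F)"
      using iffD1[OF line_pt_eq_iff[OF w(1) nz] eq] by simp
    have "fst (frame_vec v F) \<noteq> 0"
    proof
      assume z: "fst (frame_vec v F) = 0"
      then have "snd (frame_vec v F) = 0" using e by simp
      with z have "frame_vec v F = 0" by (simp add: prod_eq_iff)
      then show False using w(1) by simp
    qed
    moreover have "slope v (snd (pt d F)) = a" unfolding a by (rule slope_line_pt)
    ultimately show ?thesis using e by (simp add: frame_vec_def field_simps)
  qed
  define g :: "'c2 + 'i \<times> nat \<times> nat \<Rightarrow> ('c, 'i, nat) coords \<Rightarrow> complex" where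
    "g k = (if k = Inl s then (\<lambda>F. F (Inr (v, 0, 1))) else (\<lambda>_. 0))" for k
  have "\<forall>k. poly_function (g k)" by (auto simp: g_def intro: poly_function_intros)
  moreover have "poly_function (\<lambda>F :: ('c, 'i, nat) coords. F (Inr (v, 0, 0)))" by (rule pf_coord)
  moreover have "frame (\<lambda>_. 0) (\<lambda>k. g k F / F (Inr (v, 0, 0))) \<and> pt (\<lambda>_. 0) (\<lambda>k. g k F / F (Inr (v, 0, 0))) = slope_pt v s (pt d F)"
    if "frame d F" "pt d F \<in> affine_line v" for F :: "('c, 'i, nat) coords"
  proof
    show "frame (\<lambda>_. 0) (\<lambda>k. g k F / F (Inr (v, 0, 0)))" by (rule frame_0) (simp add: g_def)
    show "pt (\<lambda>_. 0) (\<lambda>k. g k F / F (Inr (v, 0, 0))) = slope_pt v s (pt d F)"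
      unfolding pt_0 slope_pt_def conjunct2[OF key[OF that]] by (auto simp: g_def)
  qed
  moreover have "F0 (Inr (v, 0, 0)) \<noteq> 0" using key[of F0] F0 by blast
  ultimately show "\<exists>d' g b. (\<forall>k. poly_function (g k)) \<and> poly_function b \<and> b F0 \<noteq> 0 \<and>
      (\<forall>F. frame d F \<and> pt d F \<in> affine_line v \<and> b F \<noteq> 0 \<longrightarrow> frame d' (\<lambda>k. g k F / b F) \<and>
        pt d' (\<lambda>k. g k F / b F) = (slope_pt v s (pt d F) :: ('c2, 'i, nat) point))"
    by - (rule exI[of _ "\<lambda>_. 0"], rule exI[of _ g], rule exI[of _ "\<lambda>F. F (Inr (v, 0, 0))"], simp)
qed

definition line_chart :: "'i \<Rightarrow> 'c2 \<Rightarrow> ('c2, 'i::finite, nat) point \<Rightarrow> ('c, 'i, nat) point" where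
  "line_chart v s = (\<lambda>(x, p). line_pt v (1, x s))"

lemma morphism_line_chart:
  "morphism (affine_space {s} :: ('c2, 'i::finite, nat) point set) (affine_line v :: ('c, 'i, nat) point set) (line_chart v s)"
  unfolding line_chart_def
  by (rule morphism_line_pt) (auto simp: affine_line_def intro: poly_function_intros)

lemma line_chart_slope_pt: "slope v (snd q) = a \<Longrightarrow> line_chart v s (slope_pt v s q) = line_pt v (1, a)"
  by (simp add: line_chart_def slope_pt_def)

text \<open>Isomorphism invariance in the form in which the fibration clause supplies it: the
  coordinate line is a fibration with one-point fibres over the affine chart of the projective
  line.\<close>

lemma affine_fibration_affine_line:
  "affine_fibration ({} :: 's set) (affine_space {s} :: ('c2, 'i::finite, nat) point set)
    (affine_line v :: ('c, 'i, nat) point set) (line_chart v s)"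
proof (rule affine_fibration_trivial)
  show "locally_closed (affine_space {s} :: ('c2, 'i, nat) point set)"
    by (intro zclosed_imp_locally_closed zclosed_affine_space) simp
  show "locally_closed (affine_line v :: ('c, 'i, nat) point set)" by (rule locally_closed_affine_line)
  show "morphism (affine_space {s} :: ('c2, 'i, nat) point set) (affine_line v :: ('c, 'i, nat) point set) (line_chart v s)"
    by (rule morphism_line_chart)
  show "variety_iso (times_affine (affine_line v :: ('c, 'i, nat) point set) ({} :: 's set))
      (affine_space {s} :: ('c2, 'i, nat) point set) (slope_pt v s)"
    unfolding times_affine_affine_line
  proof (rule variety_isoI)
    show "morphism (affine_line v :: ('c + 's, 'i, nat) point set) (affine_space {s} :: ('c2, 'i, nat) point set) (slope_pt v s)"
      by (rule morphism_slope_pt)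
    show "morphism (affine_space {s} :: ('c2, 'i, nat) point set) (affine_line v :: ('c + 's, 'i, nat) point set) (line_chart v s)"
      by (rule morphism_line_chart)
    show "line_chart v s (slope_pt v s x :: ('c2, 'i, nat) point) = x" if "x \<in> affine_line v" for x :: "('c + 's, 'i, nat) point"
    proof -
      obtain a where a: "x = line_pt v (1, a)" using \<open>x \<in> affine_line v\<close> unfolding affine_line_def by blast
      show ?thesis unfolding a by (rule line_chart_slope_pt[OF slope_line_pt])
    qed
    show "slope_pt v s (line_chart v s y :: ('c + 's, 'i, nat) point) = y" if "y \<in> affine_space {s}" for y :: "('c2, 'i, nat) point"
    proof -
      obtain x where x: "y = (x, \<lambda>_. {0})" "x \<in> cspace {s}" using \<open>y \<in> affine_space {s}\<close> unfolding affine_space_def by blast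
      have "slope v (snd (line_chart v s y :: ('c + 's, 'i, nat) point)) = x s"
        unfolding line_chart_def x(1) prod.case by (rule slope_line_pt)
      then show ?thesis using x by (simp add: slope_pt_def fun_eq_iff cspace_def)
    qed
  qed
  fix x and y :: "'s \<Rightarrow> complex" and p assume xp: "(x, p) \<in> (affine_line v :: ('c, 'i, nat) point set)"
  then obtain a where a: "(x, p) = line_pt v (1, a)" unfolding affine_line_def by blast
  have "slope v (snd (x, p)) = a" unfolding a by (rule slope_line_pt)
  then have "slope v p = a" by (simp only: snd_conv)
  then show "line_chart v s (slope_pt v s (case_sum x y, p) :: ('c2, 'i, nat) point) = (x, p)"
    unfolding a by (intro line_chart_slope_pt) simp
qed simp

lemma morphism_to_origin: "morphism X (affine_space {} :: ('c2, 'i::finite, nat) point set) (\<lambda>_. (\<lambda>_. 0, \<lambda>_. {0}))"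
  unfolding morphism_def
proof (intro conjI allI impI)
  show "(\<lambda>_. (\<lambda>_. 0, \<lambda>_. {0})) ` X \<subseteq> (affine_space {} :: ('c2, 'i, nat) point set)"
    by (auto simp: mem_affine_space cspace_empty)
  fix d F0
  have fr: "frame (\<lambda>_. 0) ((\<lambda>_. 0) :: ('c2, 'i, nat) coords)" by (rule frame_0) simp
  show "\<exists>d' g b. (\<forall>k. poly_function (g k)) \<and> poly_function b \<and> b F0 \<noteq> 0 \<and>
      (\<forall>F. frame d F \<and> pt d F \<in> X \<and> b F \<noteq> 0 \<longrightarrow> frame d' (\<lambda>k. g k F / b F) \<and>
        pt d' (\<lambda>k. g k F / b F) = ((\<lambda>_. 0, \<lambda>_. {0}) :: ('c2, 'i, nat) point))"
    by (rule exI[of _ "\<lambda>_. 0"], rule exI[of _ "\<lambda>_ _. 0"], rule exI[of _ "\<lambda>_. 1"])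
      (use fr in \<open>simp add: pf_const pt_0\<close>)
qed

lemma morphism_to_infinity:
  "morphism (affine_space {} :: ('c2, 'i::finite, nat) point set) {infinity_pt v :: ('c, 'i, nat) point} (\<lambda>_. infinity_pt v)"
  using morphism_line_pt[of "\<lambda>_. 0" "\<lambda>_. 1" "affine_space {} :: ('c2, 'i, nat) point set" v "{infinity_pt v :: ('c, 'i, nat) point}"]
  by (simp add: infinity_pt_def pf_const case_prod_unfold image_subset_iff)

text \<open>Compares the point at infinity with the origin, again through one-point fibres.\<close>

lemma affine_fibration_infinity:
  "affine_fibration ({} :: 's set) (affine_space {} :: ('c2, 'i::finite, nat) point set)
    {infinity_pt v :: ('c, 'i, nat) point} (\<lambda>_. infinity_pt v)"
proof (rule affine_fibration_trivial)
  show "locally_closed (affine_space {} :: ('c2, 'i, nat) point set)"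
    by (intro zclosed_imp_locally_closed zclosed_affine_space) simp
  show "locally_closed {infinity_pt v :: ('c, 'i, nat) point}" by (intro zclosed_imp_locally_closed zclosed_infinity)
  show "variety_iso (times_affine {infinity_pt v :: ('c, 'i, nat) point} ({} :: 's set))
      (affine_space {} :: ('c2, 'i, nat) point set) (\<lambda>_. (\<lambda>_. 0, \<lambda>_. {0}))"
    unfolding times_affine_infinity
    by (rule variety_isoI[OF morphism_to_origin morphism_to_infinity]) (auto simp: affine_space_def cspace_empty)
qed (auto simp: morphism_to_infinity)

section \<open>Values of \<Upsilon> forced by its characterising properties\<close>

locale poincare =
  fixes \<Upsilon> :: "('c, 'i::finite, nat) point set \<Rightarrow> complex poly"
  assumes vp: "virtual_poincare \<Upsilon>"
begin

lemma Upsilon_Un: "constructible X \<Longrightarrow> constructible Y \<Longrightarrow> X \<inter> Y = {} \<Longrightarrow> \<Upsilon> (X \<union> Y) = \<Upsilon> X + \<Upsilon> Y"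
  using vp[unfolded virtual_poincare_def, THEN conjunct2, THEN conjunct1, rule_format, of X Y] by simp

lemma Upsilon_smooth_projective:
  "smooth_projective X \<Longrightarrow> poly.coeff (\<Upsilon> X) k = of_nat (hc_dim (classical_topology X) k)"
  using vp[unfolded virtual_poincare_def, THEN conjunct1, rule_format, of X k] by simp

lemma Upsilon_fibration: "affine_fibration (S :: 'c set) E B \<pi> \<Longrightarrow> \<Upsilon> E = \<Upsilon> B * \<Upsilon> (affine_space S)"
  using vp[unfolded virtual_poincare_def, THEN conjunct2, THEN conjunct2, rule_format, of S E B \<pi>] by simp

lemma Upsilon_empty: "\<Upsilon> {} = 0"
proof -
  have "constructible ({} :: ('c, 'i, nat) point set)"
    by (intro locally_closed_imp_constructible zclosed_imp_locally_closed zclosed_empty)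
  then show ?thesis using Upsilon_Un[of "{}" "{}"] by simp
qed

lemma Upsilon_proj_line: "\<Upsilon> (proj_line v) = [:1, 0, 1:]"
proof (rule poly_eqI)
  fix p
  have "poly.coeff (\<Upsilon> (proj_line v)) p = of_nat (hc_dim (classical_topology (proj_line v :: ('c, 'i, nat) point set)) p)"
    by (rule Upsilon_smooth_projective[OF smooth_projective_proj_line])
  then show "poly.coeff (\<Upsilon> (proj_line v)) p = poly.coeff [:1, 0, 1:] p"
    unfolding hc_dim_proj_line by (auto simp: coeff_pCons split: nat.split)
qed

lemma Upsilon_line_sum: "\<Upsilon> (affine_line v) + \<Upsilon> {infinity_pt v} = [:1, 0, 1:]"
proof -
  have "affine_line v \<inter> {infinity_pt v} = ({} :: ('c, 'i, nat) point set)"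
    using proj_line_split(2)[where 'c = 'c, of v] by simp
  from Upsilon_Un[OF locally_closed_imp_constructible[OF locally_closed_affine_line]
      locally_closed_imp_constructible[OF zclosed_imp_locally_closed[OF zclosed_infinity]] this]
  show ?thesis unfolding proj_line_split(1)[symmetric] Upsilon_proj_line by (rule sym)
qed

lemma Upsilon_point_unit: "locally_closed X \<Longrightarrow> \<Upsilon> X = \<Upsilon> X * \<Upsilon> (affine_space {})"
  by (rule Upsilon_fibration[OF affine_fibration_identity])

text \<open>With u for this value, both pieces of the projective line are unchanged under
  multiplication by u, so 1 + t^2 = (1 + t^2) u; the nonzero factor is cancelled.\<close>

lemma Upsilon_point: "\<Upsilon> (affine_space {}) = 1"
proof -
  let ?u = "\<Upsilon> (affine_space {})" and ?v = "undefined :: 'i"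
  have "[:1, 0, 1:] = [:1, 0, 1:] * ?u"
    using Upsilon_point_unit[OF locally_closed_affine_line[of ?v]]
      Upsilon_point_unit[OF zclosed_imp_locally_closed[OF zclosed_infinity[of ?v]]] Upsilon_line_sum[of ?v]
    by (metis distrib_right)
  then have "[:1, 0, 1:] * ?u = [:1, 0, 1:] * 1" by (simp only: mult_1_right)
  then show ?thesis by (subst (asm) mult_left_cancel) simp_all
qed

lemma Upsilon_affine_line: "\<Upsilon> (affine_space {s}) = [:0, 1:] ^ 2"
proof -
  let ?v = "undefined :: 'i"
  have "\<Upsilon> {infinity_pt ?v} = 1"
    using Upsilon_fibration[OF affine_fibration_infinity[of ?v]] Upsilon_point by simp
  then have "\<Upsilon> (affine_line ?v) = [:1, 0, 1:] - 1" using Upsilon_line_sum[of ?v] by (metis add_diff_cancel_right')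
  also have "\<dots> = [:0, 1:] ^ 2" by (simp add: one_pCons power2_eq_square)
  finally have "\<Upsilon> (affine_line ?v) = [:0, 1:] ^ 2" .
  then show ?thesis
    using Upsilon_fibration[OF affine_fibration_affine_line[of s ?v]] Upsilon_point by simp
qed

lemma Upsilon_affine_space: "finite S \<Longrightarrow> \<Upsilon> (affine_space S) = [:0, 1:] ^ (2 * card S)"
proof (induction S rule: finite_induct)
  case empty then show ?case by (simp add: Upsilon_point)
next
  case (insert s S)
  then show ?case
    using Upsilon_fibration[OF affine_fibration_insert[OF insert.hyps]] by (simp add: Upsilon_affine_line power_add[symmetric] del: mult_pCons_left mult_pCons_right)
qed

text \<open>\<open>B\<close> itself is the zero section of the bundle, so additivity subtracts its
  value from t^(2r) times the same value.\<close>

lemma Upsilon_nonzero_vectors: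
  assumes "linear_family B n S0 V Eq r"
  shows "\<Upsilon> (total_space B V - B) = \<Upsilon> B * ([:0, 1:] ^ (2 * r) - 1)"
proof (cases "B = {}")
  case True
  then show ?thesis by (simp add: total_space_def Upsilon_empty)
next
  case False
  interpret linear_family B n S0 V Eq r by (rule assms)
  obtain q where q: "q \<in> B" using False by blast
  then have "fst q = 0" using base_zero[of "fst q" "snd q"] by simp
  then have p: "(0, snd q) \<in> B" using q by (cases q) simp
  have "r \<le> card S0" using dim_le_card_cspace[OF S0 fibre(1)[OF p]] dimV[OF p] by simp
  \<comment> \<open>The fibration clause wants fibre coordinates of type \<open>'c\<close>;
    \<open>S0\<close> contains enough of them because the fibres lie in
    \<open>cspace S0\<close>.\<close>
  then obtain S where S': "S \<subseteq> S0" "card S = r" by (rule obtain_subset_with_card_n)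
  then have S: "finite S" "card S = r" using S0 finite_subset by auto
  have "B \<subseteq> total_space B V"
  proof
    fix q assume q: "q \<in> B"
    then have "q = (0, snd q)" using base_zero[of "fst q" "snd q"] by (simp add: prod_eq_iff)
    then show "q \<in> total_space B V" using q cfun.subspace_0[OF fibre(2)[of "snd q"]]
      by (cases q) (simp add: total_space_def)
  qed
  then have "\<Upsilon> (total_space B V) = \<Upsilon> (total_space B V - B) + \<Upsilon> B"
    using Upsilon_Un[of "total_space B V - B" B] zclosed_diff_constructible[OF zclosed_total_space zclosed_base]
      locally_closed_imp_constructible[OF zclosed_imp_locally_closed[OF zclosed_base]]
    by (simp add: Un_absorb2 Int_commute)
  moreover have "\<Upsilon> (total_space B V) = \<Upsilon> B * [:0, 1:] ^ (2 * r)"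
    using Upsilon_fibration[OF affine_fibration_total_space[OF S]] Upsilon_affine_space[OF S(1)] S(2) by simp
  ultimately show ?thesis by (simp add: algebra_simps)
qed

end

section \<open>The Euler form\<close>

text \<open>Coordinates for the first term of the standard complex, the sum over the vertices v of
  Hom(M_v, N_v); \<open>ext_index\<close> serves the second term, a sum over arrows. The map
  \<open>ext_cobound\<close> between the two has kernel Hom and, for modules, cokernel
  Ext^1.\<close>

definition hom_index :: "('v, 'a, 'b) rep \<Rightarrow> ('v, 'a, 'd) rep \<Rightarrow> ('v \<times> 'd \<times> 'b) set" where
  "hom_index M N = (SIGMA v:UNIV. basis N v \<times> basis M v)"

definition ext_index :: "('v, 'a) quiver \<Rightarrow> ('v, 'a, 'b) rep \<Rightarrow> ('v, 'a, 'd) rep \<Rightarrow> ('a \<times> 'd \<times> 'b) set" where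
  "ext_index Q M N = (SIGMA a:arrows Q. basis N (tgt Q a) \<times> basis M (src Q a))"

lemma cspace_hom_index: "cspace (hom_index M N) = {h. \<forall>v i j. h (v, i, j) \<noteq> 0 \<longrightarrow> i \<in> basis N v \<and> j \<in> basis M v}"
  by (auto simp: cspace_def hom_index_def)

lemma ext_cocycles_eq: "ext_cocycles Q M N = cspace (ext_index Q M N)"
  by (auto simp: ext_cocycles_def cspace_def ext_index_def)

lemma Hom_eq_kernel: "Hom Q M N = {h \<in> cspace (hom_index M N). ext_cobound Q M N h = 0}"
  unfolding Hom_def cspace_hom_index ext_cobound_def by (auto simp: fun_eq_iff)

lemma clinear_ext_cobound: "clinear (ext_cobound Q M N)"
  by (rule clinearI) (auto simp: ext_cobound_def cscale_def fun_eq_iff algebra_simps sum.distrib sum_distrib_left)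

lemma finite_hom_index:
  fixes M :: "('v::finite, 'a, 'b) rep"
  assumes "\<And>v. finite (basis M v)" "\<And>v. finite (basis N v)"
  shows "finite (hom_index M N)"
  unfolding hom_index_def using assms by (intro finite_SigmaI finite_cartesian_product) auto

lemma subspace_Hom: "cfun.subspace (Hom Q M N)"
  unfolding Hom_eq_kernel
  by (rule cfun.subspaceI)
    (simp_all add: clinear_add[OF clinear_ext_cobound] clinear_scale[OF clinear_ext_cobound] clinear_0[OF clinear_ext_cobound]
      cfun.subspace_0[OF subspace_cspace] cfun.subspace_add[OF subspace_cspace] cfun.subspace_scale[OF subspace_cspace])

lemma Hom_subset: "Hom Q M N \<subseteq> cspace (hom_index M N)"
  unfolding Hom_eq_kernel by blast

lemma dimvec_vspace: "finite (basis M v) \<Longrightarrow> dimvec (vspace M) $ v = int (card (basis M v))"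
  by (simp add: dimvec_def dim_cspace)

lemma quot_dim_zero:
  assumes "finite S" shows "quot_dim (cspace S) {0} = card S"
proof -
  have sp: "cfun.span (C \<union> {0}) = cfun.span C" for C :: "('a \<Rightarrow> complex) set"
    by (metis Un_empty_right Un_insert_right cfun.span_insert_0)
  show ?thesis unfolding quot_dim_def sp
  proof (rule Least_equality)
    obtain B where B: "B \<subseteq> cspace S" "cfun.independent B" "cspace S \<subseteq> cfun.span B" "card B = cfun.dim (cspace S)"
      by (rule cfun.basis_exists)
    then show "\<exists>C. finite C \<and> card C = card S \<and> C \<subseteq> cspace S \<and> cspace S \<subseteq> cfun.span C"
      using finite_independent_cspace[OF assms B(1,2)] dim_cspace[OF assms] by (intro exI[of _ B]) simp
    fix n assume "\<exists>C. finite C \<and> card C = n \<and> C \<subseteq> cspace S \<and> cspace S \<subseteq> cfun.span C"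
    then show "card S \<le> n" using cfun.dim_le_card[of "cspace S"] dim_cspace[OF assms] by metis
  qed
qed

lemma Hom_simple: "Hom Q (simple_rep i) (simple_rep j) = cspace (if i = j then {(i, 0, 0)} else {})"
  unfolding Hom_def cspace_def simple_rep_def by (auto split: if_splits) (metis neq0_conv)+

text \<open>Arrows act by zero on simple modules, so \<open>ext_cobound\<close> vanishes and all
  cocycles count, one dimension for each arrow from \<open>i\<close> to \<open>j\<close>.\<close>

lemma ext_dim_simple:
  fixes Q :: "('v, 'a) quiver"
  assumes "finite (arrows Q)"
  shows "ext_dim Q (simple_rep i) (simple_rep j) = card {a \<in> arrows Q. src Q a = i \<and> tgt Q a = j}"
proof -
  let ?S = "simple_rep :: 'v \<Rightarrow> ('v, 'a, nat) rep"
  let ?A = "{a \<in> arrows Q. src Q a = i \<and> tgt Q a = j}"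
  have "ext_index Q (?S i) (?S j) = (\<lambda>a. (a, 0, 0)) ` ?A"
    by (auto simp: ext_index_def simple_rep_def split: if_splits)
  moreover have "card ((\<lambda>a. (a, 0 :: nat, 0 :: nat)) ` ?A) = card ?A" by (rule card_image) (auto simp: inj_on_def)
  moreover have "ext_cobound Q (?S i) (?S j) h = 0" for h
    by (auto simp: ext_cobound_def simple_rep_def fun_eq_iff)
  then have "ext_cobound Q (?S i) (?S j) ` {h. \<forall>v k l. h (v, k, l) \<noteq> 0 \<longrightarrow>
      k \<in> basis (?S j) v \<and> l \<in> basis (?S i) v} = {0}"
    by (auto simp: image_constant_conv intro!: exI[of _ "\<lambda>_. 0"])
  ultimately show ?thesis
    unfolding ext_dim_def ext_cocycles_eq by (simp only:) (use quot_dim_zero[of "(\<lambda>a. (a, 0 :: nat, 0 :: nat)) ` ?A"] assms in simp)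
qed

lemma euler_matrix_entry:
  assumes "finite (arrows Q)"
  shows "euler_matrix Q $ i $ j = (if i = j then 1 else 0) - (\<Sum>a\<in>arrows Q. if src Q a = i \<and> tgt Q a = j then 1 else 0)"
proof -
  have "card {a \<in> arrows Q. src Q a = i \<and> tgt Q a = j} = (\<Sum>a\<in>arrows Q. if src Q a = i \<and> tgt Q a = j then 1 else 0)"
    using assms by (simp add: sum.If_cases Int_def)
  moreover have "cfun.dim (cspace (if i = j then {(i, 0 :: nat, 0 :: nat)} else {})) = (if i = j then 1 else 0)"
    by (subst dim_cspace) auto
  ultimately show ?thesis
    unfolding euler_matrix_def by (simp add: Hom_simple ext_dim_simple[OF assms] of_nat_sum if_distrib cong: if_cong)
qed

lemma lstar_entry:
  assumes "finite (arrows Q)"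
  shows "lstar Q y $ i = y $ i - (\<Sum>a | a \<in> arrows Q \<and> src Q a = i. y $ tgt Q a)"
proof -
  have "lstar Q y $ i = (\<Sum>j\<in>UNIV. (if i = j then y $ j else 0)) - (\<Sum>j\<in>UNIV. \<Sum>a\<in>arrows Q. if src Q a = i \<and> tgt Q a = j then y $ j else 0)"
    unfolding lstar_def matrix_vector_mult_def
    by (simp add: euler_matrix_entry[OF assms] left_diff_distrib sum_subtractf sum_distrib_right if_distrib[where f = "\<lambda>x. x * _"] cong: if_cong)
  also have "(\<Sum>j\<in>UNIV. \<Sum>a\<in>arrows Q. if src Q a = i \<and> tgt Q a = j then y $ j else 0)
      = (\<Sum>a\<in>arrows Q. \<Sum>j\<in>UNIV. if src Q a = i \<and> tgt Q a = j then y $ j else 0)" by (rule sum.swap)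
  also have "\<dots> = (\<Sum>a\<in>arrows Q. if src Q a = i then y $ tgt Q a else 0)"
    by (intro sum.cong refl) auto
  also have "\<dots> = (\<Sum>a | a \<in> arrows Q \<and> src Q a = i. y $ tgt Q a)"
    using assms by (simp add: sum.If_cases Int_def)
  finally show ?thesis by simp
qed

lemma euler_eq_sum:
  fixes x y :: "int^'v::finite"
  assumes "finite (arrows Q)"
  shows "euler Q x y = (\<Sum>v\<in>UNIV. x $ v * y $ v) - (\<Sum>a\<in>arrows Q. x $ src Q a * y $ tgt Q a)"
proof -
  have "euler Q x y = (\<Sum>i\<in>UNIV. x $ i * lstar Q y $ i)" by (simp add: euler_def bilin_def lstar_def)
  also have "\<dots> = (\<Sum>i\<in>UNIV. x $ i * y $ i) - (\<Sum>i\<in>UNIV. \<Sum>a\<in>arrows Q. if src Q a = i then x $ i * y $ tgt Q a else 0)"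
    unfolding lstar_entry[OF assms] using assms
    by (simp add: right_diff_distrib sum_subtractf sum_distrib_left sum.If_cases Int_def)
  also have "(\<Sum>i\<in>UNIV. \<Sum>a\<in>arrows Q. if src Q a = i then x $ i * y $ tgt Q a else 0)
      = (\<Sum>a\<in>arrows Q. \<Sum>i\<in>UNIV. if src Q a = i then x $ i * y $ tgt Q a else 0)" by (rule sum.swap)
  finally show ?thesis by simp
qed

text \<open>The Euler characteristic of the standard complex is the Euler form. Surjectivity of
  \<open>ext_cobound\<close>, that is Ext^1 = 0, leaves the dimension of Hom.\<close>

lemma dim_Hom_eq_euler:
  fixes M :: "('v::finite, 'a, 'b) rep" and N :: "('v, 'a, 'd) rep"
  assumes Q: "finite (arrows Q)" and M: "is_rep Q M" and N: "is_rep Q N"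
    and surj: "\<And>\<xi>. \<xi> \<in> ext_cocycles Q M N \<Longrightarrow> \<exists>h\<in>cspace (hom_index M N). ext_cobound Q M N h = \<xi>"
  shows "int (cfun.dim (Hom Q M N)) = euler Q (dimvec (vspace M)) (dimvec (vspace N))"
proof -
  have fM: "finite (basis M v)" and fN: "finite (basis N v)" for v using M N by (auto simp: is_rep_def)
  note fin = finite_hom_index[OF fM fN]
  have actM: "act M a k j = 0" if "k \<notin> basis M (tgt Q a) \<or> j \<notin> basis M (src Q a)" for a k j
    using M that unfolding is_rep_def by blast
  have actN: "act N a k j = 0" if "k \<notin> basis N (tgt Q a) \<or> j \<notin> basis N (src Q a)" for a k j
    using N that unfolding is_rep_def by blast
  have im: "ext_cobound Q M N ` cspace (hom_index M N) = ext_cocycles Q M N"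
  proof (intro equalityI subsetI)
    fix \<xi> assume "\<xi> \<in> ext_cobound Q M N ` cspace (hom_index M N)"
    then obtain h where h: "h \<in> cspace (hom_index M N)" "\<xi> = ext_cobound Q M N h" by blast
    have hz: "h (v, i, j) = 0" if "i \<notin> basis N v \<or> j \<notin> basis M v" for v i j
      using h(1) that by (auto simp: cspace_hom_index)
    have "\<xi> (a, i, j) = 0" if "\<not> (a \<in> arrows Q \<and> i \<in> basis N (tgt Q a) \<and> j \<in> basis M (src Q a))" for a i j
      using that unfolding h(2) ext_cobound_def by (auto simp: hz actM actN)
    then show "\<xi> \<in> ext_cocycles Q M N" unfolding ext_cocycles_def by blast
  qed (use surj in blast)
  have finE: "finite (ext_index Q M N)"
    unfolding ext_index_def using Q fM fN by (intro finite_SigmaI finite_cartesian_product) auto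
  have "card (hom_index M N) = card (ext_index Q M N) + cfun.dim (Hom Q M N)"
    using dim_image_kernel[OF fin subspace_cspace subset_refl clinear_ext_cobound[of Q M N]]
    unfolding im ext_cocycles_eq dim_cspace[OF fin] dim_cspace[OF finE] Hom_eq_kernel .
  moreover have "card (hom_index M N) = (\<Sum>v\<in>UNIV. card (basis N v) * card (basis M v))"
    unfolding hom_index_def by (subst card_SigmaI) (auto simp: fM fN card_cartesian_product)
  moreover have "card (ext_index Q M N) = (\<Sum>a\<in>arrows Q. card (basis N (tgt Q a)) * card (basis M (src Q a)))"
    unfolding ext_index_def by (subst card_SigmaI) (auto simp: fM fN Q card_cartesian_product)
  ultimately have "int (cfun.dim (Hom Q M N)) = int (\<Sum>v\<in>UNIV. card (basis N v) * card (basis M v))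
      - int (\<Sum>a\<in>arrows Q. card (basis N (tgt Q a)) * card (basis M (src Q a)))" by linarith
  then show ?thesis unfolding euler_eq_sum[OF Q] by (simp add: dimvec_vspace fM fN mult.commute)
qed

section \<open>Extensions by injective and projective modules\<close>

definition id_hom :: "('v, 'a, 'b) rep \<Rightarrow> ('v \<times> 'b \<times> 'b) \<Rightarrow> complex" where
  "id_hom M = (\<lambda>(v, i, j). if i = j \<and> j \<in> basis M v then 1 else 0)"

lemma id_hom_Hom:
  assumes "is_rep Q M" shows "id_hom M \<in> Hom Q M M"
proof -
  have fM: "finite (basis M v)" for v using assms by (auto simp: is_rep_def)
  have act: "act M a k j = 0" if "k \<notin> basis M (tgt Q a) \<or> j \<notin> basis M (src Q a)" for a k j
    using assms that unfolding is_rep_def by blast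
  have 1: "(\<Sum>k\<in>basis M v. (if i = k \<and> k \<in> basis M v then 1 else 0) * f k) = (if i \<in> basis M v then f i else (0::complex))" for v i f
  proof -
    have "(\<Sum>k\<in>basis M v. (if i = k \<and> k \<in> basis M v then 1 else 0) * f k) = (\<Sum>k\<in>basis M v. if i = k then f k else 0)"
      by (intro sum.cong) auto
    then show ?thesis using fM by simp
  qed
  have 2: "(\<Sum>k\<in>basis M v. f k * (if k = j \<and> j \<in> basis M v then 1 else 0)) = (if j \<in> basis M v then f j else (0::complex))" for v j f
  proof -
    have "(\<Sum>k\<in>basis M v. f k * (if k = j \<and> j \<in> basis M v then 1 else 0)) = (\<Sum>k\<in>basis M v. if k = j then f k else 0)"
      by (intro sum.cong) auto
    then show ?thesis using fM by simp
  qed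
  show ?thesis unfolding Hom_def id_hom_def mem_Collect_eq prod.case 1 2 using act by (auto split: if_splits)
qed

text \<open>Even numbers encode the basis of the submodule \<open>N\<close> (through \<open>e\<close>, with inverse \<open>D\<close>), odd ones the
  basis of the quotient \<open>M\<close>.\<close>

definition ext_rep :: "('v, 'a) quiver \<Rightarrow> ('d \<Rightarrow> nat) \<Rightarrow> (nat \<Rightarrow> 'd) \<Rightarrow> ('v, 'a, nat) rep \<Rightarrow> ('v, 'a, 'd) rep
    \<Rightarrow> (('a \<times> 'd \<times> nat) \<Rightarrow> complex) \<Rightarrow> ('v, 'a, nat) rep" where
  "ext_rep Q e D M N \<xi> = (let Z = \<lambda>v. (\<lambda>i. 2 * e i) ` basis N v \<union> (\<lambda>j. 2 * j + 1) ` basis M v in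
    \<lparr>basis = Z, act = (\<lambda>a p q. if a \<in> arrows Q \<and> p \<in> Z (tgt Q a) \<and> q \<in> Z (src Q a) then
       (if even p then (if even q then act N a (D (p div 2)) (D (q div 2)) else \<xi> (a, D (p div 2), q div 2))
        else (if even q then 0 else act M a (p div 2) (q div 2))) else 0)\<rparr>)"

text \<open>The middle term needs a basis of natural numbers, because injectivity and projectivity
  are tested on such modules, whereas \<open>N\<close> may have another kind of basis, such as the
  paths of \<open>path_rep\<close>.\<close>

locale extension =
  fixes Q :: "('v::finite, 'a) quiver" and e :: "'d \<Rightarrow> nat" and D :: "nat \<Rightarrow> 'd"
    and M :: "('v, 'a, nat) rep" and N :: "('v, 'a, 'd) rep" and \<xi> :: "('a \<times> 'd \<times> nat) \<Rightarrow> complex"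
  assumes M: "is_rep Q M" and N: "is_rep Q N" and D: "\<And>v i. i \<in> basis N v \<Longrightarrow> D (e i) = i"
    and \<xi>: "\<xi> \<in> ext_cocycles Q M N"
begin

abbreviation "Z \<equiv> ext_rep Q e D M N \<xi>"

lemma fM: "finite (basis M v)" and fN: "finite (basis N v)"
  using M N by (auto simp: is_rep_def)

lemma actM: "a \<notin> arrows Q \<or> k \<notin> basis M (tgt Q a) \<or> j \<notin> basis M (src Q a) \<Longrightarrow> act M a k j = 0"
  using M unfolding is_rep_def by blast

lemma actN: "a \<notin> arrows Q \<or> k \<notin> basis N (tgt Q a) \<or> j \<notin> basis N (src Q a) \<Longrightarrow> act N a k j = 0"
  using N unfolding is_rep_def by blast

lemma xi_0: "a \<notin> arrows Q \<or> k \<notin> basis N (tgt Q a) \<or> j \<notin> basis M (src Q a) \<Longrightarrow> \<xi> (a, k, j) = 0"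
  using \<xi> unfolding ext_cocycles_def by blast

lemma basis_Z: "basis Z v = (\<lambda>i. 2 * e i) ` basis N v \<union> (\<lambda>j. 2 * j + 1) ` basis M v"
  by (simp add: ext_rep_def Let_def)

lemma inj_e: "inj_on (\<lambda>i. 2 * e i) (basis N v)"
  using D by (auto simp: inj_on_def) (metis D)

lemma even_odd: "2 * (m :: nat) \<noteq> 2 * k + 1" "2 * k + 1 \<noteq> 2 * (m :: nat)" "Suc (2 * k) \<noteq> 2 * (m :: nat)" "2 * (m :: nat) \<noteq> Suc (2 * k)"
  by presburger+

lemma sum_Z: "(\<Sum>k\<in>basis Z v. f k) = (\<Sum>i\<in>basis N v. f (2 * e i)) + (\<Sum>j\<in>basis M v. f (2 * j + 1))"
proof -
  have "(\<Sum>k\<in>basis Z v. f k) = (\<Sum>k\<in>(\<lambda>i. 2 * e i) ` basis N v. f k) + (\<Sum>k\<in>(\<lambda>j. 2 * j + 1) ` basis M v. f k)"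
    unfolding basis_Z using fM fN by (intro sum.union_disjoint) (auto simp: even_odd)
  moreover have "inj_on (\<lambda>j :: nat. 2 * j + 1) (basis M v)" by (auto simp: inj_on_def)
  ultimately show ?thesis by (simp only: sum.reindex[OF inj_e] sum.reindex o_def)
qed

lemma act_Z:
  assumes "a \<in> arrows Q"
  shows "i \<in> basis N (tgt Q a) \<Longrightarrow> k \<in> basis N (src Q a) \<Longrightarrow> act Z a (2 * e i) (2 * e k) = act N a i k"
    "i \<in> basis N (tgt Q a) \<Longrightarrow> j \<in> basis M (src Q a) \<Longrightarrow> act Z a (2 * e i) (2 * j + 1) = \<xi> (a, i, j)"
    "l \<in> basis M (tgt Q a) \<Longrightarrow> j \<in> basis M (src Q a) \<Longrightarrow> act Z a (2 * l + 1) (2 * j + 1) = act M a l j"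
    "act Z a (2 * l + 1) (2 * e k) = 0"
  using assms D by (auto simp: ext_rep_def Let_def)

lemma act_Z_0:
  assumes "\<not> (a \<in> arrows Q \<and> p \<in> basis Z (tgt Q a) \<and> q \<in> basis Z (src Q a))"
  shows "act Z a p q = 0"
  using assms unfolding ext_rep_def Let_def rep.simps by (rule if_not_P)

lemma is_rep_Z: "is_rep Q Z"
  unfolding is_rep_def
proof (intro conjI allI impI)
  show "finite (basis Z v)" for v unfolding basis_Z using fM fN by simp
qed (metis act_Z_0)+

lemma proj_Hom: "(\<lambda>(v, l, q). if q = 2 * l + 1 \<and> l \<in> basis M v then 1 else 0) \<in> Hom Q Z M" (is "?g \<in> _")
  unfolding Hom_def mem_Collect_eq
proof (intro conjI allI impI ballI)
  fix v i j assume "?g (v, i, j) \<noteq> 0"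
  then show "i \<in> basis M v" "j \<in> basis Z v" by (auto simp: basis_Z split: if_splits)
next
  fix a i q assume a: "a \<in> arrows Q"
  have "(\<Sum>k\<in>basis Z (tgt Q a). ?g (tgt Q a, i, k) * act Z a k q)
      = (\<Sum>j\<in>basis M (tgt Q a). if i = j then act Z a (2 * i + 1) q else 0)"
    unfolding sum_Z by (auto simp: even_odd intro!: sum.cong sum.neutral)
  also have "\<dots> = (if i \<in> basis M (tgt Q a) then act Z a (2 * i + 1) q else 0)" using fM by simp
  also have "\<dots> = (\<Sum>k\<in>basis M (src Q a). act M a i k * ?g (src Q a, k, q))"
  proof (cases "\<exists>k\<in>basis M (src Q a). q = 2 * k + 1")
    case True
    then obtain k where k: "k \<in> basis M (src Q a)" "q = 2 * k + 1" by blast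
    have "(\<Sum>k\<in>basis M (src Q a). act M a i k * ?g (src Q a, k, q)) = (\<Sum>l\<in>basis M (src Q a). if k = l then act M a i k else 0)"
      using k by (intro sum.cong) auto
    also have "\<dots> = act M a i k" using fM k by simp
    finally show ?thesis using act_Z(3)[OF a _ k(1), of i] k(2) actM[of a i k] by auto
  next
    case False
    then have "act Z a (2 * i + 1) q = 0" by (auto simp: ext_rep_def Let_def even_odd elim!: oddE)
    moreover have "(\<Sum>k\<in>basis M (src Q a). act M a i k * ?g (src Q a, k, q)) = 0"
      using False by (intro sum.neutral) auto
    ultimately show ?thesis by simp
  qed
  finally show "(\<Sum>k\<in>basis Z (tgt Q a). ?g (tgt Q a, i, k) * act Z a k q) = (\<Sum>k\<in>basis M (src Q a). act M a i k * ?g (src Q a, k, q))" .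
qed

lemma incl_Hom: "(\<lambda>(v, p, i). if p = 2 * e i \<and> i \<in> basis N v then 1 else 0) \<in> Hom Q N Z" (is "?g \<in> _")
  unfolding Hom_def mem_Collect_eq
proof (intro conjI allI impI ballI)
  fix v i j assume "?g (v, i, j) \<noteq> 0"
  then show "i \<in> basis Z v" "j \<in> basis N v" by (auto simp: basis_Z split: if_splits)
next
  fix a p j assume a: "a \<in> arrows Q"
  have "(\<Sum>k\<in>basis Z (src Q a). act Z a p k * ?g (src Q a, k, j))
      = (\<Sum>i\<in>basis N (src Q a). if i = j then act Z a p (2 * e j) else 0)"
    unfolding sum_Z using D by (auto simp: even_odd intro!: sum.cong sum.neutral) (metis D)+
  also have "\<dots> = (if j \<in> basis N (src Q a) then act Z a p (2 * e j) else 0)" using fN by simp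
  also have "\<dots> = (\<Sum>k\<in>basis N (tgt Q a). ?g (tgt Q a, p, k) * act N a k j)"
  proof (cases "\<exists>k\<in>basis N (tgt Q a). p = 2 * e k")
    case True
    then obtain k where k: "k \<in> basis N (tgt Q a)" "p = 2 * e k" by blast
    have "(\<Sum>l\<in>basis N (tgt Q a). ?g (tgt Q a, p, l) * act N a l j) = (\<Sum>l\<in>basis N (tgt Q a). if k = l then act N a k j else 0)"
      using k D by (intro sum.cong) (auto, metis D)
    also have "\<dots> = act N a k j" using fN k by simp
    finally show ?thesis using act_Z(1)[OF a k(1), of j] k(2) actN[of a k j] by auto
  next
    case False
    then have "j \<in> basis N (src Q a) \<Longrightarrow> act Z a p (2 * e j) = 0" by (auto simp: ext_rep_def Let_def even_odd elim!: evenE)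
    moreover have "(\<Sum>k\<in>basis N (tgt Q a). ?g (tgt Q a, p, k) * act N a k j) = 0"
      using False by (intro sum.neutral) auto
    ultimately show ?thesis by simp
  qed
  finally show "(\<Sum>k\<in>basis N (tgt Q a). ?g (tgt Q a, p, k) * act N a k j) = (\<Sum>k\<in>basis Z (src Q a). act Z a p k * ?g (src Q a, k, j))" by simp
qed

text \<open>Lifting the identity gives a section of the projection of the middle term onto
  \<open>M\<close>, and \<open>h\<close> is its component in \<open>N\<close>. Compatibility with an
  arrow a reads h M_a = N_a h + \<xi>_a, whence the sign.\<close>

lemma projective_splits:
  assumes P: "projective_rep Q M"
  shows "\<exists>h\<in>cspace (hom_index M N). ext_cobound Q M N h = - \<xi>"
proof -
  let ?g = "\<lambda>(v :: 'v, l, q). if q = 2 * l + 1 \<and> l \<in> basis M v then 1 else (0 :: complex)"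
  have surj: "hom_im Z ?g v = vspace M v" for v
  proof (intro equalityI subsetI)
    fix y assume "y \<in> hom_im Z ?g v"
    then show "y \<in> vspace M v" by (auto simp: hom_im_def hom_app_def lin_app_def cspace_def intro!: sum.neutral)
  next
    fix y assume y: "y \<in> vspace M v"
    define x where "x q = (if odd q then y (q div 2) else 0)" for q
    have "x \<in> vspace Z v" using y by (auto simp: x_def cspace_def basis_Z image_iff elim!: oddE)
    moreover have "hom_app Z ?g v x = y"
    proof
      fix l
      have "hom_app Z ?g v x l = (\<Sum>j\<in>basis M v. if l = j then y l else 0)"
        unfolding hom_app_def lin_app_def sum_Z by (auto simp: even_odd x_def intro!: sum.cong sum.neutral)
      also have "\<dots> = y l" using fM y by (auto simp: cspace_def)
      finally show "hom_app Z ?g v x l = y l" .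
    qed
    ultimately show "y \<in> hom_im Z ?g v" unfolding hom_im_def by blast
  qed
  have "\<exists>f'\<in>Hom Q M Z. hom_comp Z ?g f' = id_hom M"
    using P is_rep_Z M proj_Hom surj id_hom_Hom[OF M] unfolding projective_rep_def by blast
  then obtain f where f: "f \<in> Hom Q M Z" "hom_comp Z ?g f = id_hom M" by blast
  define h where "h = (\<lambda>(v, i, j). if i \<in> basis N v then f (v, 2 * e i, j) else 0)"
  have fz: "f (v, p, j) = 0" if "j \<notin> basis M v" for v p j using f(1) that unfolding Hom_def by blast
  have odd: "f (v, 2 * l + 1, j) = (if l = j then 1 else 0)" if "l \<in> basis M v" "j \<in> basis M v" for v l j
  proof -
    have "hom_comp Z ?g f (v, l, j) = (\<Sum>k\<in>basis M v. if l = k then f (v, 2 * l + 1, j) else 0)"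
      unfolding hom_comp_def prod.case sum_Z by (auto simp: even_odd intro!: sum.cong sum.neutral)
    also have "\<dots> = f (v, 2 * l + 1, j)" using fM that by simp
    finally show ?thesis using f(2) that by (simp add: id_hom_def)
  qed
  have "ext_cobound Q M N h = - \<xi>"
  proof
    fix x :: "'a \<times> 'd \<times> nat"
    obtain a i j where x: "x = (a, i, j)" by (cases x)
    show "ext_cobound Q M N h x = (- \<xi>) x"
    proof (cases "a \<in> arrows Q \<and> i \<in> basis N (tgt Q a) \<and> j \<in> basis M (src Q a)")
      case True
      then have a: "a \<in> arrows Q" and i: "i \<in> basis N (tgt Q a)" and j: "j \<in> basis M (src Q a)" by auto
      have "(\<Sum>k\<in>basis M (tgt Q a). h (tgt Q a, i, k) * act M a k j)
          = (\<Sum>k\<in>basis M (tgt Q a). f (tgt Q a, 2 * e i, k) * act M a k j)" using i by (simp add: h_def)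
      also have "\<dots> = (\<Sum>k\<in>basis Z (src Q a). act Z a (2 * e i) k * f (src Q a, k, j))"
        using f(1) a unfolding Hom_def by blast
      also have "\<dots> = (\<Sum>k\<in>basis N (src Q a). act N a i k * h (src Q a, k, j)) + (\<Sum>k\<in>basis M (src Q a). if k = j then \<xi> (a, i, j) else 0)"
        unfolding sum_Z using act_Z(1)[OF a i] act_Z(2)[OF a i] j odd
        by (intro arg_cong2[where f = "(+)"] sum.cong refl) (auto simp: h_def)
      also have "(\<Sum>k\<in>basis M (src Q a). if k = j then \<xi> (a, i, j) else 0) = \<xi> (a, i, j)" using fM j by simp
      finally show ?thesis using a by (simp add: x ext_cobound_def)
    next
      case False
      then show ?thesis unfolding x ext_cobound_def using xi_0[of a i j] actM actN fz by (auto simp: h_def)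
    qed
  qed
  moreover have "h \<in> cspace (hom_index M N)" using fz unfolding cspace_hom_index by (auto simp: h_def split: if_splits)
  ultimately show ?thesis by blast
qed

end

text \<open>Dually, extending the identity of \<open>N\<close> gives a retraction of the middle term
  onto \<open>N\<close>, and \<open>h\<close> is its component on \<open>M\<close>. Now an arrow a
  gives N_a h = \<xi>_a + h M_a, without a change of sign.\<close>

lemma injective_splits:
  fixes M N :: "('v::finite, 'a, nat) rep"
  assumes I: "injective_rep Q N" and M: "is_rep Q M" and \<xi>: "\<xi> \<in> ext_cocycles Q M N"
  shows "\<exists>h\<in>cspace (hom_index M N). ext_cobound Q M N h = \<xi>"
proof -
  interpret extension Q id id M N \<xi> by unfold_locales (use assms in \<open>auto simp: injective_rep_def\<close>)
  let ?g = "\<lambda>(v :: 'v, p, i). if p = 2 * id i \<and> i \<in> basis N v then 1 else (0 :: complex)"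
  have inj: "hom_ker N ?g v = {0}" for v
  proof (intro equalityI subsetI)
    fix x assume x: "x \<in> hom_ker N ?g v"
    have "x i = 0" for i
    proof (cases "i \<in> basis N v")
      case True
      have "0 = hom_app N ?g v x (2 * i)" using x by (simp add: hom_ker_def)
      also have "\<dots> = (\<Sum>j\<in>basis N v. if i = j then x i else 0)"
        unfolding hom_app_def lin_app_def by (auto intro!: sum.cong)
      also have "\<dots> = x i" using fN True by simp
      finally show ?thesis by simp
    qed (use x in \<open>auto simp: hom_ker_def cspace_def\<close>)
    then show "x \<in> {0}" by auto
  qed (auto simp: hom_ker_def cspace_def hom_app_def lin_app_def fun_eq_iff)
  have "\<exists>f'\<in>Hom Q Z N. hom_comp Z f' ?g = id_hom N"
    using I is_rep_Z N incl_Hom inj id_hom_Hom[OF N] unfolding injective_rep_def by blast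
  then obtain f where f: "f \<in> Hom Q Z N" "hom_comp Z f ?g = id_hom N" by blast
  define h where "h = (\<lambda>(v, i, j). if j \<in> basis M v then f (v, i, 2 * j + 1) else 0)"
  have fz: "f (v, i, p) = 0" if "i \<notin> basis N v" for v p i using f(1) that unfolding Hom_def by blast
  have ev: "f (v, i, 2 * k) = (if i = k then 1 else 0)" if "i \<in> basis N v" "k \<in> basis N v" for v i k
  proof -
    have "hom_comp Z f ?g (v, i, k) = (\<Sum>l\<in>basis N v. if l = k then f (v, i, 2 * k) else 0)"
      unfolding hom_comp_def prod.case sum_Z using that by (auto simp: even_odd intro!: sum.cong sum.neutral)
    also have "\<dots> = f (v, i, 2 * k)" using fN that by simp
    finally show ?thesis using f(2) that by (simp add: id_hom_def)
  qed
  have "ext_cobound Q M N h = \<xi>"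
  proof
    fix x :: "'a \<times> nat \<times> nat"
    obtain a i j where x: "x = (a, i, j)" by (cases x)
    show "ext_cobound Q M N h x = \<xi> x"
    proof (cases "a \<in> arrows Q \<and> i \<in> basis N (tgt Q a) \<and> j \<in> basis M (src Q a)")
      case True
      then have a: "a \<in> arrows Q" and i: "i \<in> basis N (tgt Q a)" and j: "j \<in> basis M (src Q a)" by auto
      have "(\<Sum>k\<in>basis N (src Q a). act N a i k * h (src Q a, k, j))
          = (\<Sum>k\<in>basis N (src Q a). act N a i k * f (src Q a, k, 2 * j + 1))" using j by (simp add: h_def)
      also have "\<dots> = (\<Sum>k\<in>basis Z (tgt Q a). f (tgt Q a, i, k) * act Z a k (2 * j + 1))"
        using f(1) a unfolding Hom_def by auto
      also have "\<dots> = (\<Sum>k\<in>basis N (tgt Q a). if i = k then \<xi> (a, i, j) else 0) + (\<Sum>k\<in>basis M (tgt Q a). h (tgt Q a, i, k) * act M a k j)"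
        unfolding sum_Z using act_Z(2)[OF a _ j] act_Z(3)[OF a _ j] i ev
        by (intro arg_cong2[where f = "(+)"] sum.cong refl) (auto simp: h_def)
      also have "(\<Sum>k\<in>basis N (tgt Q a). if i = k then \<xi> (a, i, j) else 0) = \<xi> (a, i, j)" using fN i by simp
      finally show ?thesis using a by (simp add: x ext_cobound_def)
    next
      case False
      then show ?thesis unfolding x ext_cobound_def using xi_0[of a i j] actM actN fz by (auto simp: h_def)
    qed
  qed
  moreover have "h \<in> cspace (hom_index M N)" using fz unfolding cspace_hom_index by (auto simp: h_def split: if_splits)
  ultimately show ?thesis by blast
qed

lemma dim_Hom_injective:
  fixes M N :: "('v::finite, 'a, nat) rep"
  assumes "finite (arrows Q)" "is_rep Q M" "injective_rep Q N"
  shows "int (cfun.dim (Hom Q M N)) = euler Q (dimvec (vspace M)) (dimvec (vspace N))"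
proof (rule dim_Hom_eq_euler[OF assms(1,2)])
  show "is_rep Q N" using assms(3) by (simp add: injective_rep_def)
qed (rule injective_splits[OF assms(3,2)])

lemma dim_Hom_projective:
  fixes M :: "('v::finite, 'a, nat) rep" and N :: "('v, 'a, 'd) rep"
  assumes Q: "finite (arrows Q)" and PM: "projective_rep Q M" and N: "is_rep Q N"
  shows "int (cfun.dim (Hom Q M N)) = euler Q (dimvec (vspace M)) (dimvec (vspace N))"
proof (rule dim_Hom_eq_euler[OF Q _ N])
  show M': "is_rep Q M" using PM by (simp add: projective_rep_def)
  fix \<xi> assume \<xi>: "\<xi> \<in> ext_cocycles Q M N"
  have "finite (\<Union>v. basis N v)" using N by (auto simp: is_rep_def)
  from finite_imp_inj_to_nat_seg[OF this] obtain e :: "'d \<Rightarrow> nat" where e: "inj_on e (\<Union>v. basis N v)" by metis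
  \<comment> \<open>The cocycle is negated to offset the sign in \<open>projective_splits\<close>;
    \<open>e\<close> numbers the finitely many basis elements of \<open>N\<close>.\<close>
  interpret extension Q e "inv_into (\<Union>v. basis N v) e" M N "- \<xi>"
  proof
    show "inv_into (\<Union>v. basis N v) e (e i) = i" if "i \<in> basis N v" for v i
      using that by (intro inv_into_f_f[OF e]) blast
    show "- \<xi> \<in> ext_cocycles Q M N" using \<xi> unfolding ext_cocycles_def by simp
  qed (rule M' N)+
  show "\<exists>h\<in>cspace (hom_index M N). ext_cobound Q M N h = \<xi>"
    using projective_splits[OF PM] unfolding minus_minus .
qed

section \<open>The Nakayama functor on dimension vectors\<close>

text \<open>Evaluation at a basis \<open>B\<close> of \<open>U\<close> identifies the dual space
  with \<open>cspace B\<close>. Composed with \<open>\<theta>\<close> it is a linear bijection from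
  \<open>cspace T\<close>, and rank-nullity compares the dimensions.\<close>

lemma dual_dim:
  fixes U :: "('k \<Rightarrow> complex) set" and \<theta> :: "('b \<Rightarrow> complex) \<Rightarrow> ('k \<Rightarrow> complex) \<Rightarrow> complex"
  assumes S: "finite S" and U: "cfun.subspace U" "U \<subseteq> cspace S" and T: "finite T"
    and bij: "bij_betw \<theta> (cspace T) (dual_space U)"
    and add: "\<And>x y. x \<in> cspace T \<Longrightarrow> y \<in> cspace T \<Longrightarrow> \<theta> (x + y) = \<theta> x + \<theta> y"
    and scale: "\<And>c x. x \<in> cspace T \<Longrightarrow> \<theta> (cscale c x) = cscale c (\<theta> x)"
  shows "card T = cfun.dim U"
proof -
  obtain B where B: "B \<subseteq> U" "cfun.independent B" "U \<subseteq> cfun.span B" "card B = cfun.dim U"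
    by (rule cfun.basis_exists)
  have finB: "finite B" using finite_independent_cspace[OF S _ B(2)] B(1) U(2) by blast
  have UB: "U = cfun.span B" using B(3) cfun.span_minimal[OF B(1) U(1)] by blast
  \<comment> \<open>\<open>\<theta>\<close> is known to be linear on \<open>cspace T\<close> only;
    cutting off outside \<open>T\<close> first makes the composite linear on all functions, as
    \<open>dim_image_kernel\<close> requires.\<close>
  define \<rho> where "\<rho> x = (\<lambda>k. if k \<in> T then x k else 0)" for x :: "'b \<Rightarrow> complex"
  have \<rho>T: "\<rho> x \<in> cspace T" for x by (simp add: \<rho>_def cspace_def)
  have \<rho>id: "\<rho> x = x" if "x \<in> cspace T" for x using that by (auto simp: \<rho>_def cspace_def)
  have \<rho>add: "\<rho> (x + y) = \<rho> x + \<rho> y" and \<rho>scale: "\<rho> (cscale c x) = cscale c (\<rho> x)" for x y c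
    by (auto simp: \<rho>_def cscale_def fun_eq_iff)
  define \<Phi> where "\<Phi> x = (\<lambda>b. if b \<in> B then \<theta> (\<rho> x) b else 0)" for x
  have lin: "clinear \<Phi>"
  proof (rule clinearI)
    show "\<Phi> (x + y) = \<Phi> x + \<Phi> y" for x y by (auto simp: \<Phi>_def \<rho>add add[OF \<rho>T \<rho>T] fun_eq_iff)
    show "\<Phi> (cscale c x) = cscale c (\<Phi> x)" for c x
      unfolding \<Phi>_def \<rho>scale scale[OF \<rho>T] by (auto simp: cscale_def fun_eq_iff)
  qed
  have dual: "\<theta> x \<in> dual_space U" if "x \<in> cspace T" for x using bij that by (auto simp: bij_betw_def)
  have \<theta>0: "\<theta> 0 = 0" using add[of 0 0] cfun.subspace_0[OF subspace_cspace[of T]] by simp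
  have ker: "{x \<in> cspace T. \<Phi> x = 0} = {0}"
  proof (intro equalityI subsetI)
    fix x assume x: "x \<in> {x \<in> cspace T. \<Phi> x = 0}"
    then have xT: "x \<in> cspace T" by blast
    note l = dual[OF xT]
    have lB: "\<theta> x b = 0" if "b \<in> B" for b
    proof -
      have "\<Phi> x b = 0" using x by simp
      then show ?thesis using that \<rho>id[OF xT] by (simp add: \<Phi>_def)
    qed
    have sub: "cfun.subspace {u \<in> U. \<theta> x u = 0}"
    proof (rule cfun.subspaceI)
      have "\<theta> x (cscale 0 0) = 0 * \<theta> x 0" using l cfun.subspace_0[OF U(1)] unfolding dual_space_def by blast
      then show "0 \<in> {u \<in> U. \<theta> x u = 0}" using cfun.subspace_0[OF U(1)] by simp
      fix u w assume uw: "u \<in> {u \<in> U. \<theta> x u = 0}" "w \<in> {u \<in> U. \<theta> x u = 0}"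
      have "\<theta> x (u + w) = \<theta> x u + \<theta> x w" using l uw unfolding dual_space_def by blast
      then show "u + w \<in> {u \<in> U. \<theta> x u = 0}" using uw cfun.subspace_add[OF U(1)] by simp
    next
      fix c u assume u: "u \<in> {u \<in> U. \<theta> x u = 0}"
      have "\<theta> x (cscale c u) = c * \<theta> x u" using l u unfolding dual_space_def by blast
      then show "cscale c u \<in> {u \<in> U. \<theta> x u = 0}" using u cfun.subspace_scale[OF U(1)] by simp
    qed
    have "U \<subseteq> {u \<in> U. \<theta> x u = 0}"
      using cfun.span_minimal[OF _ sub, of B] B(1) lB unfolding UB by blast
    then have "\<theta> x u = 0" for u using l unfolding dual_space_def by blast
    then have "\<theta> x = \<theta> 0" unfolding \<theta>0 by (simp add: fun_eq_iff)
    then show "x \<in> {0}"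
      using bij xT cfun.subspace_0[OF subspace_cspace[of T]] by (auto simp: bij_betw_def inj_on_def)
  next
    fix x :: "'b \<Rightarrow> complex" assume "x \<in> {0}"
    then show "x \<in> {x \<in> cspace T. \<Phi> x = 0}" using cfun.subspace_0[OF subspace_cspace] clinear_0[OF lin] by simp
  qed
  have im: "\<Phi> ` cspace T = cspace B"
  proof (intro equalityI subsetI)
    fix y assume "y \<in> \<Phi> ` cspace T"
    then show "y \<in> cspace B" by (auto simp: \<Phi>_def cspace_def)
  next
    fix y assume y: "y \<in> cspace B"
    define l where "l u = (if u \<in> U then \<Sum>b\<in>B. cfun.representation B u b * y b else 0)" for u
    have "l \<in> dual_space U" unfolding dual_space_def
    proof (intro CollectI conjI ballI allI impI)
      fix u w assume uw: "u \<in> U" "w \<in> U"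
      then have "cfun.representation B (u + w) = (\<lambda>b. cfun.representation B u b + cfun.representation B w b)"
        unfolding UB by (intro cfun.representation_add[OF B(2)])
      then show "l (u + w) = l u + l w"
        using uw cfun.subspace_add[OF U(1) uw] by (simp add: l_def distrib_right sum.distrib)
    next
      fix c u assume u: "u \<in> U"
      then have "cfun.representation B (cscale c u) = (\<lambda>b. c * cfun.representation B u b)"
        unfolding UB by (intro cfun.representation_scale[OF B(2)])
      then show "l (cscale c u) = c * l u"
        using u cfun.subspace_scale[OF U(1) u] by (simp add: l_def sum_distrib_left mult.assoc)
    qed (simp add: l_def)
    then have "l \<in> \<theta> ` cspace T" using bij by (simp add: bij_betw_def)
    then obtain x where x: "x \<in> cspace T" "\<theta> x = l" by blast
    have "l b = y b" if b: "b \<in> B" for b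
    proof -
      have "cfun.representation B b = (\<lambda>w. if w = b then 1 else 0)" by (rule cfun.representation_basis[OF B(2) b])
      then show ?thesis using b B(1) finB by (simp add: l_def subset_iff if_distrib[where f = "\<lambda>x. x * _"] cong: if_cong)
    qed
    then have "\<Phi> x = y" using y x \<rho>id[OF x(1)] by (auto simp: \<Phi>_def cspace_def)
    then show "y \<in> \<Phi> ` cspace T" using x(1) by blast
  qed
  have "cfun.dim {0 :: 'b \<Rightarrow> complex} = 0"
    by (rule cfun.dim_unique[of "{}"]) (auto simp: cfun.dependent_explicit)
  then show ?thesis
    using dim_image_kernel[OF T subspace_cspace subset_refl lin] dim_cspace[OF T] dim_cspace[OF finB] B(4)
    unfolding ker im by simp
qed

lemma is_path_first:
  "{p. is_path Q v p w} = (if v = w then {[]} else {}) \<union> (\<Union>a\<in>{a \<in> arrows Q. src Q a = v}. (#) a ` {p. is_path Q (tgt Q a) p w})"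
proof -
  have "is_path Q v p w \<longleftrightarrow> p \<in> (if v = w then {[]} else {}) \<union> (\<Union>a\<in>{a \<in> arrows Q. src Q a = v}. (#) a ` {p. is_path Q (tgt Q a) p w})" for p
    by (cases p) auto
  then show ?thesis by blast
qed

text \<open>Well-founded induction along the arrows, splitting off the first one.\<close>

lemma finite_paths:
  assumes Q: "acyclic_quiver Q"
  shows "finite {p. is_path Q v p w}"
proof -
  let ?R = "{(src Q a, tgt Q a) |a. a \<in> arrows Q}"
  have "?R = (\<lambda>a. (src Q a, tgt Q a)) ` arrows Q" by blast
  then have "finite ?R" using Q by (simp add: acyclic_quiver_def)
  then have "wf (?R\<inverse>)" using Q by (intro finite_acyclic_wf_converse) (auto simp: acyclic_quiver_def)
  then show ?thesis
  proof (induction v rule: wf_induct_rule)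
    case (less v)
    have "finite {a \<in> arrows Q. src Q a = v}" using Q by (simp add: acyclic_quiver_def)
    moreover have "finite {p. is_path Q (tgt Q a) p w}" if "a \<in> {a \<in> arrows Q. src Q a = v}" for a
      using that by (intro less) blast
    ultimately show ?case by (subst is_path_first) auto
  qed
qed

lemma card_paths:
  assumes Q: "acyclic_quiver Q"
  shows "card {p. is_path Q v p w} = (if v = w then 1 else 0) + (\<Sum>a | a \<in> arrows Q \<and> src Q a = v. card {p. is_path Q (tgt Q a) p w})"
proof -
  let ?A = "{a \<in> arrows Q. src Q a = v}" and ?P = "\<lambda>a. (#) a ` {p. is_path Q (tgt Q a) p w}"
  have fA: "finite ?A" using Q by (simp add: acyclic_quiver_def)
  have fP: "finite (?P a)" for a using finite_paths[OF Q] by simp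
  have "card {p. is_path Q v p w} = card (if v = w then {[] :: 'b list} else {}) + card (\<Union>a\<in>?A. ?P a)"
    unfolding is_path_first[of Q v w] using fA fP by (intro card_Un_disjoint) auto
  also have "card (\<Union>a\<in>?A. ?P a) = (\<Sum>a\<in>?A. card (?P a))"
    using fA fP by (intro card_UN_disjoint) auto
  also have "\<dots> = (\<Sum>a\<in>?A. card {p. is_path Q (tgt Q a) p w})"
    by (intro sum.cong refl card_image) (auto simp: inj_on_def)
  finally show ?thesis by simp
qed

lemma is_path_snoc: "is_path Q v (p @ [a]) w \<longleftrightarrow> is_path Q v p (src Q a) \<and> a \<in> arrows Q \<and> tgt Q a = w"
  by (induction p arbitrary: v) auto

lemma is_rep_path_rep:
  assumes "acyclic_quiver Q" shows "is_rep Q (path_rep Q v)"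
  unfolding is_rep_def path_rep_def using finite_paths[OF assms] by (auto simp: is_path_snoc split: if_splits)

text \<open>Taking dimensions in D Hom(P, CQ) gives i_v = <p, \<pi>_v>, where \<pi>_v counts the
  paths starting at v. Splitting off the first arrow, \<pi>_w minus the sum of the \<pi>_(tgt a)
  over the arrows a from w is the unit vector at w. Hence (E i)_w is the value of <p, -> on that
  unit vector, which is (E^t p)_w.\<close>

lemma rstar_eq_lstar_nakayama:
  fixes Q :: "('v::finite, 'a) quiver" and I P :: "('v, 'a, nat) rep"
  assumes Q: "acyclic_quiver Q" and P: "projective_rep Q P" and I: "is_rep Q I" and nu: "iso_nakayama Q I P"
  shows "rstar Q (dimvec (vspace P)) = lstar Q (dimvec (vspace I))"
proof -
  have fQ: "finite (arrows Q)" using Q by (simp add: acyclic_quiver_def)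
  have fI: "finite (basis I v)" and fP: "finite (basis P v)" for v
    using I P by (auto simp: is_rep_def projective_rep_def)
  define \<pi> :: "'v \<Rightarrow> int^'v" where "\<pi> v = dimvec (vspace (path_rep Q v))" for v
  have \<pi>: "\<pi> v $ w = int (card {p. is_path Q v p w})" for v w
    unfolding \<pi>_def using is_rep_path_rep[OF Q, of v] by (subst dimvec_vspace) (simp_all add: is_rep_def path_rep_def)
  let ?p = "dimvec (vspace P)" and ?i = "dimvec (vspace I)"
  obtain \<theta> where \<theta>: "\<And>v. bij_betw (\<theta> v) (vspace I v) (nu_space Q P v)"
      "\<And>v x y. x \<in> vspace I v \<Longrightarrow> y \<in> vspace I v \<Longrightarrow> \<theta> v (x + y) = \<theta> v x + \<theta> v y"
      "\<And>v c x. x \<in> vspace I v \<Longrightarrow> \<theta> v (cscale c x) = cscale c (\<theta> v x)"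
    using nu unfolding iso_nakayama_def by blast
  have i: "?i $ v = euler Q ?p (\<pi> v)" for v
  proof -
    have "finite (hom_index P (path_rep Q v))"
      using fP is_rep_path_rep[OF Q, of v] by (intro finite_hom_index) (auto simp: is_rep_def)
    then have "card (basis I v) = cfun.dim (Hom Q P (path_rep Q v))"
      by (rule dual_dim[OF _ subspace_Hom Hom_subset fI \<theta>(1)[unfolded nu_space_def] \<theta>(2,3)])
    then show ?thesis
      using dim_Hom_projective[OF fQ P is_rep_path_rep[OF Q, of v]] by (simp add: dimvec_vspace fI \<pi>_def)
  qed
  have eu: "euler Q ?p y = (\<Sum>u\<in>UNIV. rstar Q ?p $ u * y $ u)" for y
  proof -
    have "euler Q ?p y = (\<Sum>u\<in>UNIV. \<Sum>w\<in>UNIV. ?p $ u * euler_matrix Q $ u $ w * y $ w)"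
      by (simp add: euler_def bilin_def matrix_vector_mult_def sum_distrib_left mult.assoc)
    also have "\<dots> = (\<Sum>w\<in>UNIV. \<Sum>u\<in>UNIV. ?p $ u * euler_matrix Q $ u $ w * y $ w)" by (rule sum.swap)
    also have "\<dots> = (\<Sum>w\<in>UNIV. rstar Q ?p $ w * y $ w)"
      by (simp add: rstar_def matrix_vector_mult_def transpose_def sum_distrib_right mult.commute mult.left_commute) (simp add: sum_distrib_left)
    finally show ?thesis .
  qed
  have "lstar Q ?i $ w = rstar Q ?p $ w" for w
  proof -
    have "lstar Q ?i $ w = euler Q ?p (\<pi> w) - (\<Sum>a | a \<in> arrows Q \<and> src Q a = w. euler Q ?p (\<pi> (tgt Q a)))"
      unfolding lstar_entry[OF fQ] i ..
    also have "(\<Sum>a | a \<in> arrows Q \<and> src Q a = w. euler Q ?p (\<pi> (tgt Q a)))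
        = (\<Sum>u\<in>UNIV. rstar Q ?p $ u * (\<Sum>a | a \<in> arrows Q \<and> src Q a = w. \<pi> (tgt Q a) $ u))"
      unfolding eu by (subst sum.swap) (simp add: sum_distrib_left)
    also have "euler Q ?p (\<pi> w) - \<dots> = (\<Sum>u\<in>UNIV. if u = w then rstar Q ?p $ u else 0)"
      unfolding eu sum_subtractf[symmetric] right_diff_distrib[symmetric] \<pi> card_paths[OF Q, of w]
      by (intro sum.cong refl) auto
    finally show ?thesis by simp
  qed
  then show ?thesis by (simp add: vec_eq_iff)
qed

section \<open>Homomorphisms vanishing on, or with image in, a submodule\<close>

lemma hom_comp_Hom:
  assumes g: "g \<in> Hom Q N L" and f: "f \<in> Hom Q M N"
  shows "hom_comp N g f \<in> Hom Q M L"
  unfolding Hom_def mem_Collect_eq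
proof (intro conjI allI impI ballI)
  fix v i j assume "hom_comp N g f (v, i, j) \<noteq> 0"
  then obtain k where "g (v, i, k) \<noteq> 0" "f (v, k, j) \<noteq> 0"
    unfolding hom_comp_def prod.case by (metis (no_types, lifting) mult_eq_0_iff sum.neutral)
  then show "i \<in> basis L v" "j \<in> basis M v" using assms unfolding Hom_def by blast+
next
  fix a i j assume a: "a \<in> arrows Q"
  have f': "(\<Sum>k\<in>basis M (tgt Q a). f (tgt Q a, i, k) * act M a k j) = (\<Sum>k\<in>basis N (src Q a). act N a i k * f (src Q a, k, j))" for i j
    using f a unfolding Hom_def by blast
  have g': "(\<Sum>k\<in>basis N (tgt Q a). g (tgt Q a, i, k) * act N a k j) = (\<Sum>k\<in>basis L (src Q a). act L a i k * g (src Q a, k, j))" for i j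
    using g a unfolding Hom_def by blast
  have "(\<Sum>k\<in>basis M (tgt Q a). hom_comp N g f (tgt Q a, i, k) * act M a k j)
      = (\<Sum>l\<in>basis N (tgt Q a). g (tgt Q a, i, l) * (\<Sum>k\<in>basis M (tgt Q a). f (tgt Q a, l, k) * act M a k j))"
    unfolding hom_comp_def prod.case sum_distrib_left sum_distrib_right by (subst sum.swap) (simp add: mult.assoc)
  also have "\<dots> = (\<Sum>k\<in>basis N (src Q a). (\<Sum>l\<in>basis N (tgt Q a). g (tgt Q a, i, l) * act N a l k) * f (src Q a, k, j))"
    unfolding f' sum_distrib_left sum_distrib_right by (subst sum.swap) (simp add: mult.assoc)
  also have "\<dots> = (\<Sum>k\<in>basis L (src Q a). act L a i k * hom_comp N g f (src Q a, k, j))"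
    unfolding g' hom_comp_def prod.case sum_distrib_left sum_distrib_right by (subst sum.swap) (simp add: mult.assoc)
  finally show "(\<Sum>k\<in>basis M (tgt Q a). hom_comp N g f (tgt Q a, i, k) * act M a k j)
      = (\<Sum>k\<in>basis L (src Q a). act L a i k * hom_comp N g f (src Q a, k, j))" .
qed

lemma clinear_hom_app: "clinear (hom_app M f v)"
  by (rule clinearI) (auto simp: hom_app_def lin_app_def cscale_def fun_eq_iff distrib_left sum.distrib sum_distrib_left mult.left_commute)

lemma span_family:
  fixes g :: "nat \<Rightarrow> 'k \<Rightarrow> complex"
  shows "x \<in> cfun.span (g ` {..<n}) \<longleftrightarrow> (\<exists>c. \<forall>k. x k = (\<Sum>j<n. c j * g j k))"
proof
  assume "x \<in> cfun.span (g ` {..<n})"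
  then show "\<exists>c. \<forall>k. x k = (\<Sum>j<n. c j * g j k)"
  proof (induction rule: cfun.span_induct_alt)
    case base
    then show ?case by (intro exI[of _ "\<lambda>_. 0"]) simp
  next
    case (step c y z)
    then obtain i d where i: "i < n" "y = g i" and d: "\<forall>k. z k = (\<Sum>j<n. d j * g j k)" by blast
    have "(\<Sum>j<n. (d j + (if j = i then c else 0)) * g j k) = z k + c * g i k" for k
    proof -
      have "(\<Sum>j<n. (d j + (if j = i then c else 0)) * g j k) = (\<Sum>j<n. d j * g j k) + (\<Sum>j<n. if j = i then c * g j k else 0)"
        unfolding sum.distrib[symmetric] by (intro sum.cong) (auto simp: distrib_right)
      then show ?thesis using i(1) d by simp
    qed
    then show ?case using i(2) by (intro exI[of _ "\<lambda>j. d j + (if j = i then c else 0)"]) (simp add: cscale_def)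
  qed
next
  assume "\<exists>c. \<forall>k. x k = (\<Sum>j<n. c j * g j k)"
  then obtain c where "\<forall>k. x k = (\<Sum>j<n. c j * g j k)" by blast
  then have "x = (\<Sum>j<n. cscale (c j) (g j))" by (simp add: fun_eq_iff sum_fun_apply cscale_def)
  moreover have "(\<Sum>j<n. cscale (c j) (g j)) \<in> cfun.span (g ` {..<n})"
    by (rule cfun.span_sum, rule cfun.span_scale, rule cfun.span_base, rule imageI)
  ultimately show "x \<in> cfun.span (g ` {..<n})" by (simp only:)
qed

text \<open>Turns a family of subspaces into a module with a chosen basis, so that injectivity and
  the dimension formulas apply to it. The basis at each vertex comes from a frame, and
  \<open>g\<close> is the inclusion.\<close>

lemma submodule_rep:
  fixes M :: "('v::finite, 'a, nat) rep"
  assumes M: "is_rep Q M" and N: "Defs.submodule Q M N"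
  shows "\<exists>(N' :: ('v, 'a, nat) rep) g. is_rep Q N' \<and> g \<in> Hom Q N' M \<and> (\<forall>v. hom_ker N' g v = {0}) \<and>
    (\<forall>v. hom_im N' g v = N v) \<and> dimvec (vspace N') = dimvec N"
proof -
  have fM: "finite (basis M v)" for v using M by (simp add: is_rep_def)
  have "(0 :: unit \<Rightarrow> complex, N) \<in> ambient {} (basis M)"
    using N by (simp add: ambient_def Defs.submodule_def cspace_def)
  then obtain d and F :: "(unit, 'v, nat) coords" where F: "frame d F" "pt d F = (0, N)" by (rule exists_frame[OF _ fM])
  define b where "b v j k = F (Inr (v, j, k))" for v j k
  have Nspan: "N v = cfun.span (b v ` {..<d v})" for v
  proof -
    have "b v = (\<lambda>j k. F (Inr (v, j, k)))" by (intro ext) (simp add: b_def)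
    then show ?thesis using fun_cong[OF arg_cong[OF F(2), of snd], of v] by (simp add: pt_def)
  qed
  have ind: "\<forall>j<d v. c j = 0" if "\<forall>k. (\<Sum>j<d v. c j * b v j k) = 0" for v c
    using F(1) that unfolding frame_def b_def by blast
  have bN: "b v j \<in> N v" if "j < d v" for v j unfolding Nspan using that by (intro cfun.span_base) blast
  have bM: "b v j k = 0" if "j < d v" "k \<notin> basis M v" for v j k
    using bN[OF that(1)] N that(2) unfolding Defs.submodule_def cspace_def by blast
  \<comment> \<open>The matrix of the arrow \<open>a\<close> in the frames: \<open>c a j i\<close>
    is the coefficient of basis vector \<open>i\<close> in the image of basis vector
    \<open>j\<close>.\<close>
  define c where "c a j = (SOME c. \<forall>k. (\<Sum>l\<in>basis M (src Q a). act M a k l * b (src Q a) j l) = (\<Sum>i<d (tgt Q a). c i * b (tgt Q a) i k))" for a j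
  have c: "(\<Sum>l\<in>basis M (src Q a). act M a k l * b (src Q a) j l) = (\<Sum>i<d (tgt Q a). c a j i * b (tgt Q a) i k)"
    if "a \<in> arrows Q" "j < d (src Q a)" for a j k
  proof -
    have "lin_app (basis M (src Q a)) (act M a) (b (src Q a) j) \<in> N (tgt Q a)"
      using N bN[OF that(2)] that(1) unfolding Defs.submodule_def by blast
    then show ?thesis unfolding Nspan span_family lin_app_def c_def by (rule someI2_ex) (rule spec)
  qed
  define N' :: "('v, 'a, nat) rep" where
    "N' = \<lparr>basis = (\<lambda>v. {..<d v}), act = (\<lambda>a i j. if a \<in> arrows Q \<and> i < d (tgt Q a) \<and> j < d (src Q a) then c a j i else 0)\<rparr>"
  define g where "g = (\<lambda>(v, k, j). if j < d v then b v j k else 0)"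
  have app: "hom_app N' g v x k = (\<Sum>j<d v. x j * b v j k)" for v x k
    by (simp add: hom_app_def lin_app_def N'_def g_def mult.commute)
  show ?thesis
  proof (rule exI[of _ N'], rule exI[of _ g], intro conjI allI)
    show "is_rep Q N'" by (auto simp: is_rep_def N'_def split: if_splits)
    show "g \<in> Hom Q N' M" unfolding Hom_def mem_Collect_eq
    proof (intro conjI allI impI ballI)
      fix v i j assume "g (v, i, j) \<noteq> 0"
      then show "i \<in> basis M v" "j \<in> basis N' v" using bM by (auto simp: g_def N'_def split: if_splits)
    next
      fix a i j assume a: "a \<in> arrows Q"
      show "(\<Sum>k\<in>basis N' (tgt Q a). g (tgt Q a, i, k) * act N' a k j) = (\<Sum>k\<in>basis M (src Q a). act M a i k * g (src Q a, k, j))"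
      proof (cases "j < d (src Q a)")
        case True
        then show ?thesis using c[OF a True, of i] a by (simp add: g_def N'_def mult.commute)
      qed (simp add: g_def N'_def)
    qed
    show "hom_ker N' g v = {0}" for v
    proof (intro equalityI subsetI)
      fix x assume x: "x \<in> hom_ker N' g v"
      then have "\<forall>k. (\<Sum>j<d v. x j * b v j k) = 0" unfolding app[symmetric] by (simp add: hom_ker_def)
      from ind[OF this] have "x j = 0" for j
        using x by (cases "j < d v") (simp_all add: hom_ker_def cspace_def N'_def)
      then show "x \<in> {0}" by (simp add: fun_eq_iff)
    next
      fix x :: "nat \<Rightarrow> complex" assume "x \<in> {0}"
      then show "x \<in> hom_ker N' g v" using clinear_0[OF clinear_hom_app] by (simp add: hom_ker_def cspace_def)
    qed
    show "hom_im N' g v = N v" for v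
    proof (intro equalityI subsetI)
      fix y assume "y \<in> hom_im N' g v"
      then obtain x where "y = hom_app N' g v x" by (auto simp: hom_im_def)
      then show "y \<in> N v" unfolding Nspan span_family using app by auto
    next
      fix y assume "y \<in> N v"
      then obtain x where x: "\<forall>k. y k = (\<Sum>j<d v. x j * b v j k)" unfolding Nspan span_family by blast
      define x' where "x' j = (if j < d v then x j else 0)" for j
      have "x' \<in> vspace N' v" by (simp add: x'_def cspace_def N'_def)
      moreover have "hom_app N' g v x' = y" unfolding fun_eq_iff app using x by (simp add: x'_def)
      ultimately show "y \<in> hom_im N' g v" unfolding hom_im_def by blast
    qed
    show "dimvec (vspace N') = dimvec N"
      using dim_pt[OF F(1)] F(2) by (simp add: vec_eq_iff dimvec_def N'_def dim_cspace)
  qed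
qed

text \<open>For a submodule \<open>N\<close>, a model of Hom(M/N, I) inside Hom(M, I), which spares
  the quotient module.\<close>

definition Hom_vanishing where
  "Hom_vanishing Q M I N = {f \<in> Hom Q M I. \<forall>v. N v \<subseteq> hom_ker M f v}"

text \<open>For a submodule \<open>N\<close>, a model of Hom(P, N) inside Hom(P, M).\<close>

definition Hom_into where
  "Hom_into Q P M N = {h \<in> Hom Q P M. \<forall>v. hom_im P h v \<subseteq> N v}"

lemma hom_app_comp:
  assumes "x \<in> vspace M v"
  shows "hom_app M (hom_comp N g f) v x = hom_app N g v (hom_app M f v x)"
  unfolding hom_app_def lin_app_def hom_comp_def fun_eq_iff prod.case sum_distrib_left sum_distrib_right
  by (subst sum.swap) (simp add: mult.assoc)

lemma hom_app_unit_vec: "finite (basis M v) \<Longrightarrow> j \<in> basis M v \<Longrightarrow> hom_app M f v (unit_vec j) = (\<lambda>i. f (v, i, j))"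
  by (auto simp: hom_app_def lin_app_def unit_vec_def if_distrib[where f = "\<lambda>x. _ * x"] cong: if_cong)

lemma unit_vec_cspace: "j \<in> S \<Longrightarrow> unit_vec j \<in> cspace S"
  by (auto simp: unit_vec_def cspace_def)

lemma hom_app_in: "f \<in> Hom Q M N \<Longrightarrow> hom_app M f v x \<in> vspace N v"
  unfolding hom_app_def lin_app_def cspace_def Hom_def mem_Collect_eq by (intro allI impI sum.neutral ballI) (metis mult_eq_0_iff)

lemma hom_eq_0I:
  fixes f :: "'v \<times> 'd \<times> 'b \<Rightarrow> complex"
  assumes "f \<in> Hom Q M N" "\<And>v. finite (basis M v)" "\<And>v x. x \<in> vspace M v \<Longrightarrow> hom_app M f v x = 0"
  shows "f = 0"
proof
  fix t :: "'v \<times> 'd \<times> 'b"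
  obtain v i j where t: "t = (v, i, j)" by (cases t)
  show "f t = 0 t"
  proof (cases "j \<in> basis M v")
    case True
    from hom_app_unit_vec[OF assms(2) True, of f] assms(3)[OF unit_vec_cspace[OF True]]
    show ?thesis unfolding t by (metis zero_fun_def)
  next
    case False
    then have "f (v, i, j) = 0" using assms(1) unfolding Hom_def by blast
    then show ?thesis by (simp add: t)
  qed
qed

text \<open>Restriction maps Hom(M, I) onto Hom(N, I) because I is injective, and its kernel is the
  space in question. Both Hom dimensions are values of the Euler form.\<close>

lemma dim_Hom_vanishing:
  fixes M I :: "('v::finite, 'a, nat) rep"
  assumes Q: "finite (arrows Q)" and M: "is_rep Q M" and I: "injective_rep Q I" and N: "Defs.submodule Q M N"
  shows "int (cfun.dim (Hom_vanishing Q M I N)) = euler Q (dimvec (vspace M)) (dimvec (vspace I)) - euler Q (dimvec N) (dimvec (vspace I))"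
proof -
  from submodule_rep[OF M N] obtain N' :: "('v, 'a, nat) rep" and g where N'g: "is_rep Q N' \<and> g \<in> Hom Q N' M \<and>
    (\<forall>v. hom_ker N' g v = {0}) \<and> (\<forall>v. hom_im N' g v = N v) \<and> dimvec (vspace N') = dimvec N" by (elim exE)
  have N': "is_rep Q N'" and g: "g \<in> Hom Q N' M" and ker: "\<And>v. hom_ker N' g v = {0}"
    and im: "\<And>v. hom_im N' g v = N v" and dim: "dimvec (vspace N') = dimvec N" using N'g by simp_all
  have fM: "finite (basis M v)" and fI: "finite (basis I v)" and fN: "finite (basis N' v)" for v
    using M I N' by (auto simp: is_rep_def injective_rep_def)
  let ?\<rho> = "\<lambda>f. hom_comp M f g"
  have lin: "clinear ?\<rho>"
    by (rule clinearI) (auto simp: hom_comp_def cscale_def fun_eq_iff distrib_right sum.distrib sum_distrib_left mult.assoc)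
  have "?\<rho> ` Hom Q M I = Hom Q N' I"
  proof (intro equalityI subsetI)
    fix f assume "f \<in> Hom Q N' I"
    then have "\<exists>f'\<in>Hom Q M I. hom_comp M f' g = f"
      using I[unfolded injective_rep_def, THEN conjunct2, rule_format, of N' M g f] N' M g ker by simp
    then show "f \<in> ?\<rho> ` Hom Q M I" by blast
  qed (use hom_comp_Hom g in blast)
  moreover have "{f \<in> Hom Q M I. ?\<rho> f = 0} = Hom_vanishing Q M I N"
  proof -
    have "?\<rho> f = 0 \<longleftrightarrow> (\<forall>v. N v \<subseteq> hom_ker M f v)" if f: "f \<in> Hom Q M I" for f
    proof
      assume z: "?\<rho> f = 0"
      show "\<forall>v. N v \<subseteq> hom_ker M f v"
      proof (intro allI subsetI)
        fix v y assume y: "y \<in> N v"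
        then obtain x where x: "x \<in> vspace N' v" "y = hom_app N' g v x" unfolding im[symmetric] hom_im_def by blast
        have "hom_app M f v y = hom_app N' (?\<rho> f) v x" unfolding x(2) hom_app_comp[OF x(1)] ..
        also have "\<dots> = 0" unfolding z by (simp add: hom_app_def lin_app_def fun_eq_iff)
        finally show "y \<in> hom_ker M f v" using x(2) hom_app_in[OF g] by (simp add: hom_ker_def)
      qed
    next
      assume v: "\<forall>v. N v \<subseteq> hom_ker M f v"
      show "?\<rho> f = 0"
      proof (rule hom_eq_0I[OF hom_comp_Hom[OF f g] fN])
        fix v x assume x: "x \<in> vspace N' v"
        then have "hom_app N' g v x \<in> N v" unfolding im[symmetric] hom_im_def by blast
        then show "hom_app N' (?\<rho> f) v x = 0" unfolding hom_app_comp[OF x] using v by (auto simp: hom_ker_def)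
      qed
    qed
    then show ?thesis unfolding Hom_vanishing_def by blast
  qed
  ultimately have "cfun.dim (Hom Q M I) = cfun.dim (Hom Q N' I) + cfun.dim (Hom_vanishing Q M I N)"
    using dim_image_kernel[OF finite_hom_index[OF fM fI] subspace_Hom Hom_subset lin, of Q] by simp
  then show ?thesis using dim_Hom_injective[OF Q M I] dim_Hom_injective[OF Q N' I] dim by simp
qed

text \<open>Composition with the inclusion \<open>g\<close> identifies Hom(P, N') with the
  homomorphisms into \<open>N\<close>, and projectivity gives the dimension of Hom(P, N').\<close>

lemma dim_Hom_into:
  fixes M P :: "('v::finite, 'a, nat) rep"
  assumes Q: "finite (arrows Q)" and M: "is_rep Q M" and P: "projective_rep Q P" and N: "Defs.submodule Q M N"
  shows "int (cfun.dim (Hom_into Q P M N)) = euler Q (dimvec (vspace P)) (dimvec N)"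
proof -
  from submodule_rep[OF M N] obtain N' :: "('v, 'a, nat) rep" and g where N'g: "is_rep Q N' \<and> g \<in> Hom Q N' M \<and>
    (\<forall>v. hom_ker N' g v = {0}) \<and> (\<forall>v. hom_im N' g v = N v) \<and> dimvec (vspace N') = dimvec N" by (elim exE)
  have N': "is_rep Q N'" and g: "g \<in> Hom Q N' M" and ker: "\<And>v. hom_ker N' g v = {0}"
    and im: "\<And>v. hom_im N' g v = N v" and dim: "dimvec (vspace N') = dimvec N" using N'g by simp_all
  have fM: "finite (basis M v)" and fP: "finite (basis P v)" and fN: "finite (basis N' v)" for v
    using M P N' by (auto simp: is_rep_def projective_rep_def)
  have P': "is_rep Q P" using P by (simp add: projective_rep_def)
  let ?\<rho> = "\<lambda>h. hom_comp N' g h"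
  have lin: "clinear ?\<rho>"
    by (rule clinearI) (auto simp: hom_comp_def cscale_def fun_eq_iff distrib_left sum.distrib sum_distrib_left mult.left_commute)
  have inj: "x = y" if "x \<in> vspace N' v" "y \<in> vspace N' v" "hom_app N' g v x = hom_app N' g v y" for v x y
  proof -
    have "x - y \<in> hom_ker N' g v"
      using that cfun.subspace_diff[OF subspace_cspace that(1,2)] by (simp add: hom_ker_def clinear_diff[OF clinear_hom_app])
    then show ?thesis unfolding ker by simp
  qed
  have "?\<rho> ` Hom Q P N' = Hom_into Q P M N"
  proof (intro equalityI subsetI)
    fix h assume "h \<in> ?\<rho> ` Hom Q P N'"
    then obtain h' where h': "h' \<in> Hom Q P N'" "h = ?\<rho> h'" by blast
    have "hom_im P h v \<subseteq> N v" for v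
    proof
      fix y assume "y \<in> hom_im P h v"
      then obtain x where x: "x \<in> vspace P v" "y = hom_app P h v x" by (auto simp: hom_im_def)
      then have "y = hom_app N' g v (hom_app P h' v x)" by (simp add: h'(2) hom_app_comp)
      then show "y \<in> N v" unfolding im[symmetric] hom_im_def using hom_app_in[OF h'(1)] by blast
    qed
    then show "h \<in> Hom_into Q P M N" using hom_comp_Hom[OF g h'(1)] h'(2) by (simp add: Hom_into_def)
  next
    fix h assume h: "h \<in> Hom_into Q P M N"
    then have hH: "h \<in> Hom Q P M" and hN: "\<And>v. hom_im P h v \<subseteq> N v" by (auto simp: Hom_into_def)
    have col: "\<exists>x\<in>vspace N' v. hom_app N' g v x = (\<lambda>i. h (v, i, j))" if j: "j \<in> basis P v" for v j
    proof -
      have "(\<lambda>i. h (v, i, j)) \<in> hom_im P h v"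
        unfolding hom_im_def hom_app_unit_vec[OF fP j, of h, symmetric] using unit_vec_cspace[OF j] by blast
      then have "(\<lambda>i. h (v, i, j)) \<in> hom_im N' g v" using hN[of v] im[of v] by blast
      then obtain x where x: "(\<lambda>i. h (v, i, j)) = hom_app N' g v x" "x \<in> vspace N' v" unfolding hom_im_def by (rule imageE)
      show ?thesis by (rule bexI[of _ x], rule x(1)[symmetric], rule x(2))
    qed
    \<comment> \<open>The columns of \<open>h\<close>, pulled back along the injective
      \<open>g\<close>; they will be the columns of the factorisation \<open>h'\<close>.\<close>
    define X where "X v j = (SOME x. x \<in> vspace N' v \<and> hom_app N' g v x = (\<lambda>i. h (v, i, j)))" for v j
    have X: "X v j \<in> vspace N' v" "hom_app N' g v (X v j) = (\<lambda>i. h (v, i, j))" if "j \<in> basis P v" for v j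
      using someI_ex[of "\<lambda>x. x \<in> vspace N' v \<and> hom_app N' g v x = (\<lambda>i. h (v, i, j))"] col[OF that] unfolding X_def by blast+
    define h' where "h' = (\<lambda>(v, i, j). if j \<in> basis P v then X v j i else 0)"
    have comp: "?\<rho> h' = h"
    proof
      fix t :: "'v \<times> nat \<times> nat"
      obtain v i j where t: "t = (v, i, j)" by (cases t)
      show "?\<rho> h' t = h t"
      proof (cases "j \<in> basis P v")
        case True
        then show ?thesis using fun_cong[OF X(2)[OF True], of i] by (simp add: t hom_comp_def h'_def hom_app_def lin_app_def)
      next
        case False
        then have "h (v, i, j) = 0" using hH unfolding Hom_def by blast
        then show ?thesis using False by (simp add: t hom_comp_def h'_def)
      qed
    qed
    have "h' \<in> Hom Q P N'" unfolding Hom_def mem_Collect_eq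
    proof (intro conjI allI impI ballI)
      fix v i j assume "h' (v, i, j) \<noteq> 0"
      then show "i \<in> basis N' v" "j \<in> basis P v" using X(1) by (auto simp: h'_def cspace_def split: if_splits)
    next
      fix a i j assume a: "a \<in> arrows Q"
      have actP: "act P a k j = 0" if "k \<notin> basis P (tgt Q a) \<or> j \<notin> basis P (src Q a)" for k j
        using P' that unfolding is_rep_def by blast
      have actN: "act N' a k j = 0" if "k \<notin> basis N' (tgt Q a) \<or> j \<notin> basis N' (src Q a)" for k j
        using N' that unfolding is_rep_def by blast
      \<comment> \<open>Compatibility of \<open>h'\<close> with the arrow \<open>a\<close> is
        checked after applying \<open>g\<close>, where it turns into the compatibility of
        \<open>h\<close>.\<close>
      define y1 where "y1 i = (\<Sum>k\<in>basis P (tgt Q a). h' (tgt Q a, i, k) * act P a k j)" for i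
      define y2 where "y2 i = (\<Sum>k\<in>basis N' (src Q a). act N' a i k * h' (src Q a, k, j))" for i
      have "y1 \<in> vspace N' (tgt Q a)" using X(1)[of _ "tgt Q a"] by (auto simp: y1_def cspace_def h'_def intro!: sum.neutral)
      moreover have "y2 \<in> vspace N' (tgt Q a)" using actN by (auto simp: y2_def cspace_def intro!: sum.neutral)
      moreover have "hom_app N' g (tgt Q a) y1 = hom_app N' g (tgt Q a) y2"
      proof
        fix m
        have gH: "(\<Sum>k\<in>basis M (src Q a). act M a m k * g (src Q a, k, l)) = (\<Sum>k\<in>basis N' (tgt Q a). g (tgt Q a, m, k) * act N' a k l)" for l
          by (rule sym) (use g a in \<open>unfold Hom_def, blast\<close>)
        have "hom_app N' g (tgt Q a) y1 m = (\<Sum>k\<in>basis P (tgt Q a). ?\<rho> h' (tgt Q a, m, k) * act P a k j)"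
          unfolding hom_app_def lin_app_def y1_def hom_comp_def prod.case sum_distrib_left sum_distrib_right
          by (subst sum.swap) (simp add: mult.assoc)
        also have "\<dots> = (\<Sum>k\<in>basis M (src Q a). act M a m k * ?\<rho> h' (src Q a, k, j))"
          unfolding comp using hH a unfolding Hom_def by blast
        also have "\<dots> = (\<Sum>l\<in>basis N' (src Q a). (\<Sum>k\<in>basis M (src Q a). act M a m k * g (src Q a, k, l)) * h' (src Q a, l, j))"
          unfolding hom_comp_def prod.case sum_distrib_left sum_distrib_right by (subst sum.swap) (simp add: mult.assoc)
        also have "\<dots> = (\<Sum>l\<in>basis N' (src Q a). (\<Sum>k\<in>basis N' (tgt Q a). g (tgt Q a, m, k) * act N' a k l) * h' (src Q a, l, j))"
          by (simp only: gH)
        also have "\<dots> = (\<Sum>k\<in>basis N' (tgt Q a). \<Sum>l\<in>basis N' (src Q a). g (tgt Q a, m, k) * act N' a k l * h' (src Q a, l, j))"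
          unfolding sum_distrib_right by (rule sum.swap)
        also have "\<dots> = hom_app N' g (tgt Q a) y2 m"
          by (simp add: hom_app_def lin_app_def y2_def sum_distrib_left mult.assoc)
        finally show "hom_app N' g (tgt Q a) y1 m = hom_app N' g (tgt Q a) y2 m" .
      qed
      ultimately have "y1 = y2" by - (rule inj[of _ "tgt Q a"])
      then show "(\<Sum>k\<in>basis P (tgt Q a). h' (tgt Q a, i, k) * act P a k j) = (\<Sum>k\<in>basis N' (src Q a). act N' a i k * h' (src Q a, k, j))"
        unfolding y1_def y2_def by (rule fun_cong)
    qed
    then show "h \<in> ?\<rho> ` Hom Q P N'" using comp by blast
  qed
  moreover have "{h \<in> Hom Q P N'. ?\<rho> h = 0} = {0}"
  proof (intro equalityI subsetI)
    fix h assume h: "h \<in> {h \<in> Hom Q P N'. ?\<rho> h = 0}"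
    then have hH: "h \<in> Hom Q P N'" by blast
    have "h = 0"
    proof (rule hom_eq_0I[OF hH fP])
      fix v x assume x: "x \<in> vspace P v"
      have z: "hom_comp N' g h = 0" using h by blast
      have 1: "hom_app N' g v (hom_app P h v x) = hom_app P (hom_comp N' g h) v x" by (rule hom_app_comp[OF x, symmetric])
      have 2: "hom_app P (hom_comp N' g h) v x = 0" unfolding z by (simp add: hom_app_def lin_app_def fun_eq_iff)
      have 3: "hom_app N' g v 0 = 0" by (rule clinear_0[OF clinear_hom_app])
      show "hom_app P h v x = 0"
        by (rule inj[OF hom_app_in[OF hH, of v x] cfun.subspace_0[OF subspace_cspace, of "basis N' v"]]) (simp only: 1 2 3)
    qed
    then show "h \<in> {0}" by simp
  next
    fix h :: "'v \<times> nat \<times> nat \<Rightarrow> complex" assume "h \<in> {0}"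
    then show "h \<in> {h \<in> Hom Q P N'. ?\<rho> h = 0}" using cfun.subspace_0[OF subspace_Hom[of Q P N']] clinear_0[OF lin] by simp
  qed
  moreover have "cfun.dim {0 :: 'v \<times> nat \<times> nat \<Rightarrow> complex} = 0"
    by (rule cfun.dim_unique[of "{}"]) (auto simp: cfun.dependent_explicit)
  ultimately have "cfun.dim (Hom Q P N') = cfun.dim (Hom_into Q P M N)"
    using dim_image_kernel[OF finite_hom_index[OF fP fN] subspace_Hom Hom_subset lin, of Q] by simp
  then show ?thesis using dim_Hom_projective[OF Q P N'] dim by simp
qed

lemma dimvec_ker_im:
  fixes M :: "('v::finite, 'a, 'b) rep"
  assumes "\<And>v. finite (basis M v)"
  shows "dimvec (hom_ker M f) + dimvec (hom_im M f) = dimvec (vspace M)"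
proof -
  have "cfun.dim (vspace M v) = cfun.dim (hom_im M f v) + cfun.dim (hom_ker M f v)" for v
    using dim_image_kernel[OF assms subspace_cspace subset_refl clinear_hom_app[of M f v], of v] by (simp add: hom_ker_def hom_im_def)
  then show ?thesis by (simp add: vec_eq_iff dimvec_def)
qed

section \<open>Equations of quiver Grassmannians and of the Hom-bundles over them\<close>

lemma frame_mem_iff:
  assumes "frame d F"
  shows "y \<in> snd (pt d F) v \<longleftrightarrow> (\<exists>c. \<forall>k. y k = (\<Sum>j<d v. c j * F (Inr (v, j, k))))"
  unfolding pt_def snd_conv span_family ..

lemma frame_independent_coeffs:
  assumes "frame d F" "\<And>k. (\<Sum>j<d v. a j * F (Inr (v, j, k))) = 0"
  shows "\<forall>j<d v. a j = 0"
  using assms unfolding frame_def by blast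

text \<open>The vector is appended to the frame as the column with index \<open>d v\<close>. A
  dependence must involve it, as the frame vectors are independent, and can then be solved for
  it.\<close>

lemma frame_mem_iff_dependent:
  assumes F: "frame d F" and y: "\<And>s. Y s (F \<circ> Inr) = y s"
  shows "y \<in> snd (pt d F) v \<longleftrightarrow>
    dependent_at {..d v} UNIV (\<lambda>l s G. if l < d v then G (v, l, s) else Y s G) (F \<circ> Inr)"
proof -
  have sum: "(\<Sum>l\<in>{..d v}. a l * (if l < d v then (F \<circ> Inr) (v, l, s) else Y s (F \<circ> Inr)))
      = (\<Sum>l<d v. a l * F (Inr (v, l, s))) + a (d v) * y s" for a s
  proof -
    have "{..d v} = insert (d v) {..<d v}" by auto
    then show ?thesis by (simp add: y add.commute)
  qed
  show ?thesis unfolding dependent_at_def sum frame_mem_iff[OF F]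
  proof
    assume "\<exists>c. \<forall>k. y k = (\<Sum>j<d v. c j * F (Inr (v, j, k)))"
    then obtain c where c: "\<forall>k. y k = (\<Sum>j<d v. c j * F (Inr (v, j, k)))" by (rule exE)
    show "\<exists>a. (\<forall>s\<in>UNIV. (\<Sum>l<d v. a l * F (Inr (v, l, s))) + a (d v) * y s = 0) \<and> (\<exists>l\<in>{..d v}. a l \<noteq> 0)"
      by (rule exI[of _ "\<lambda>l. if l < d v then c l else - 1"]) (use c in \<open>auto intro: bexI[of _ "d v"]\<close>)
  next
    assume "\<exists>a. (\<forall>s\<in>UNIV. (\<Sum>l<d v. a l * F (Inr (v, l, s))) + a (d v) * y s = 0) \<and> (\<exists>l\<in>{..d v}. a l \<noteq> 0)"
    then obtain a where a: "\<And>s. (\<Sum>l<d v. a l * F (Inr (v, l, s))) + a (d v) * y s = 0" "\<exists>l\<in>{..d v}. a l \<noteq> 0" by auto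
    have nz: "a (d v) \<noteq> 0"
    proof
      assume z: "a (d v) = 0"
      have "(\<Sum>l<d v. a l * F (Inr (v, l, s))) = 0" for s using a(1)[of s] z by simp
      from frame_independent_coeffs[OF F this] have "\<forall>l<d v. a l = 0" .
      then show False using a(2) z by (metis atMost_iff le_neq_implies_less)
    qed
    have "y s = (\<Sum>l<d v. - a l / a (d v) * F (Inr (v, l, s)))" for s
    proof -
      have "a (d v) * y s = - (\<Sum>l<d v. a l * F (Inr (v, l, s)))" using a(1)[of s] by (simp add: eq_neg_iff_add_eq_0 add.commute)
      then have "y s = - (\<Sum>l<d v. a l * F (Inr (v, l, s))) / a (d v)" using nz by (simp add: field_simps)
      then show ?thesis by (simp add: sum_negf sum_divide_distrib)
    qed
    then show "\<exists>c. \<forall>k. y k = (\<Sum>j<d v. c j * F (Inr (v, j, k)))" by (intro exI allI)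
  qed
qed

lemma frame_vector_mem: "j < d v \<Longrightarrow> (\<lambda>k. F (Inr (v, j, k))) \<in> snd (pt d F) v"
  unfolding pt_def by (simp add: cfun.span_base)

lemma frame_span_subset:
  assumes "cfun.subspace W" "\<And>j. j < d v \<Longrightarrow> (\<lambda>k. F (Inr (v, j, k))) \<in> W"
  shows "snd (pt d F) v \<subseteq> W"
proof -
  have "(\<lambda>j k. F (Inr (v, j, k))) ` {..<d v} \<subseteq> W" using assms(2) by (simp add: image_subset_iff)
  then show ?thesis unfolding pt_def snd_conv by (rule cfun.span_minimal[OF _ assms(1)])
qed

lemma clinear_lin_app: "clinear (lin_app S A)"
  by (rule clinearI) (auto simp: lin_app_def cscale_def fun_eq_iff distrib_left sum.distrib sum_distrib_left mult.left_commute)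

lemma subspace_preimage:
  assumes "clinear f" "cfun.subspace W" shows "cfun.subspace {x. f x \<in> W}"
  by (rule cfun.subspaceI)
    (simp_all add: clinear_0[OF assms(1)] clinear_add[OF assms(1)] clinear_scale[OF assms(1)]
      cfun.subspace_0[OF assms(2)] cfun.subspace_add[OF assms(2)] cfun.subspace_scale[OF assms(2)])

lemma Gr_mem:
  "(x, N) \<in> Gr Q M e \<longleftrightarrow> x = 0 \<and> Defs.submodule Q M N \<and> dimvec N = e"
  by (auto simp: Gr_def)

text \<open>Stability under an arrow need only be tested on frame vectors, where it is a dependence
  condition; the dimension vector is constant for fixed \<open>d\<close>.\<close>

lemma zclosed_in_Gr:
  fixes M :: "('v::finite, 'a, 'b) rep"
  shows "zclosed_in {} (basis M) (Gr Q M e :: ('c, 'v, 'b) point set)"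
proof (rule zclosed_inI)
  show "Gr Q M e \<subseteq> ambient {} (basis M)"
    by (auto simp: Gr_def ambient_def Defs.submodule_def cspace_def)
  fix d :: "'v \<Rightarrow> nat"
  define A where "A a j l s G = (if l < d (tgt Q a) then G (tgt Q a, l, s)
      else \<Sum>k\<in>basis M (src Q a). act M a s k * G (src Q a, j, k))" for a j l s and G :: "'v \<times> nat \<times> 'b \<Rightarrow> complex"
  have A: "poly_function (A a j l s)" for a j l s
    unfolding A_def by (intro poly_function_intros)
  have "polynomial_condition (dependent_at {..d (tgt Q a)} UNIV (A a j))" for a j
    by (intro polynomial_condition_dependent A finite_atMost)
  then have dep: "polynomial_condition (\<lambda>F :: ('c, 'v, 'b) coords. dependent_at {..d (tgt Q a)} UNIV (A a j) (F \<circ> Inr))" for a j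
    by (rule polynomial_condition_Inr)
  let ?P = "\<lambda>F :: ('c, 'v, 'b) coords. (\<forall>v. int (d v) = e $ v) \<and>
    (\<forall>a\<in>arrows Q. \<forall>j\<in>{..<d (src Q a)}. dependent_at {..d (tgt Q a)} UNIV (A a j) (F \<circ> Inr))"
  have "polynomial_condition ?P"
    by (intro polynomial_condition_conj polynomial_condition_const polynomial_condition_Ball dep)
  moreover have "pt d F \<in> Gr Q M e \<longleftrightarrow> ?P F" if F: "frame d F" "pt d F \<in> ambient {} (basis M)" for F :: "('c, 'v, 'b) coords"
  proof -
    let ?N = "snd (pt d F)"
    have 0: "pt d F = (0, ?N)" using F(2) by (cases "pt d F") (auto simp: ambient_def cspace_empty zero_fun_def)
    have sub: "cfun.subspace (?N v)" "?N v \<subseteq> vspace M v" for v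
      using F(2) by (cases "pt d F"; simp add: ambient_def)+
    have arrow: "(\<forall>x\<in>?N (src Q a). lin_app (basis M (src Q a)) (act M a) x \<in> ?N (tgt Q a)) \<longleftrightarrow>
        (\<forall>j\<in>{..<d (src Q a)}. dependent_at {..d (tgt Q a)} UNIV (A a j) (F \<circ> Inr))" for a
    proof -
      have "lin_app (basis M (src Q a)) (act M a) (\<lambda>k. F (Inr (src Q a, j, k))) \<in> ?N (tgt Q a)
          \<longleftrightarrow> dependent_at {..d (tgt Q a)} UNIV (A a j) (F \<circ> Inr)" for j
        unfolding A_def by (rule frame_mem_iff_dependent[OF F(1)]) (simp add: lin_app_def)
      moreover have "(\<forall>x\<in>?N (src Q a). lin_app (basis M (src Q a)) (act M a) x \<in> ?N (tgt Q a)) \<longleftrightarrow>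
          (\<forall>j\<in>{..<d (src Q a)}. lin_app (basis M (src Q a)) (act M a) (\<lambda>k. F (Inr (src Q a, j, k))) \<in> ?N (tgt Q a))"
      proof
        assume "\<forall>j\<in>{..<d (src Q a)}. lin_app (basis M (src Q a)) (act M a) (\<lambda>k. F (Inr (src Q a, j, k))) \<in> ?N (tgt Q a)"
        then have "?N (src Q a) \<subseteq> {x. lin_app (basis M (src Q a)) (act M a) x \<in> ?N (tgt Q a)}"
          by (intro frame_span_subset subspace_preimage clinear_lin_app sub(1)) simp
        then show "\<forall>x\<in>?N (src Q a). lin_app (basis M (src Q a)) (act M a) x \<in> ?N (tgt Q a)" by blast
      qed (auto intro: frame_vector_mem)
      ultimately show ?thesis by simp
    qed
    have "dimvec ?N = e \<longleftrightarrow> (\<forall>v. int (d v) = e $ v)" by (simp add: dimvec_def vec_eq_iff dim_pt[OF F(1)])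
    moreover have "pt d F \<in> Gr Q M e \<longleftrightarrow> Defs.submodule Q M ?N \<and> dimvec ?N = e"
      by (subst 0) (simp add: Gr_mem)
    ultimately show ?thesis using sub arrow unfolding Defs.submodule_def by blast
  qed
  ultimately show "\<exists>P. polynomial_condition P \<and> (\<forall>F :: ('c, 'v, 'b) coords. frame d F \<and> pt d F \<in> ambient {} (basis M) \<longrightarrow> (pt d F \<in> Gr Q M e \<longleftrightarrow> P F))"
    by (intro exI[of _ ?P]) blast
qed

text \<open>The rows of the matrix of \<open>ext_cobound\<close>. The last argument, on which they
  are constant, fits them to the format of a linear family.\<close>

definition Hom_equations :: "('v, 'a) quiver \<Rightarrow> ('v, 'a, 'b) rep \<Rightarrow> ('v, 'a, 'd) rep
    \<Rightarrow> (('v \<times> 'd \<times> 'b) \<Rightarrow> 'g \<Rightarrow> complex) set" where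
  "Hom_equations Q M N = range (\<lambda>x t _. ext_cobound Q M N (unit_vec t) x)"

lemma clinear_expand:
  assumes f: "clinear f" and S: "finite S" "x \<in> cspace S"
  shows "f x k = (\<Sum>j\<in>S. x j * f (unit_vec j) k)"
proof -
  have "f (\<Sum>j\<in>S. cscale (x j) (unit_vec j)) = (\<Sum>j\<in>S. cscale (x j) (f (unit_vec j)))"
    by (simp only: module_hom.sum[OF f] clinear_scale[OF f])
  then have "f x = (\<Sum>j\<in>S. cscale (x j) (f (unit_vec j)))" unfolding cspace_expand[OF S, symmetric] .
  then show ?thesis by (simp add: sum_fun_apply cscale_def)
qed

lemma Hom_iff_equations:
  assumes fin: "finite (hom_index M N)"
  shows "f \<in> Hom Q M N \<longleftrightarrow>
    f \<in> cspace (hom_index M N) \<and> (\<forall>c\<in>Hom_equations Q M N. (\<Sum>t\<in>hom_index M N. f t * c t G) = 0)"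
proof (cases "f \<in> cspace (hom_index M N)")
  case True
  have "ext_cobound Q M N f = 0 \<longleftrightarrow> (\<forall>x. (\<Sum>t\<in>hom_index M N. f t * ext_cobound Q M N (unit_vec t) x) = 0)"
    unfolding fun_eq_iff clinear_expand[OF clinear_ext_cobound fin True] by simp
  then show ?thesis using True by (simp add: Hom_eq_kernel Hom_equations_def)
qed (simp add: Hom_eq_kernel)

text \<open>Writes one row of a matrix-vector product as a sum over all entries of \<open>f\<close>,
  the shape that the equations of a linear family must have.\<close>

lemma hom_index_sum_row:
  assumes f: "f \<in> cspace (hom_index M N)" and fin: "finite (hom_index M N)" "finite (basis M v)"
  shows "(\<Sum>t\<in>hom_index M N. f t * (if fst t = v \<and> fst (snd t) = i then g (snd (snd t)) else 0))
    = (\<Sum>k\<in>basis M v. f (v, i, k) * g k)"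
proof -
  have "(\<Sum>t\<in>hom_index M N. f t * (if fst t = v \<and> fst (snd t) = i then g (snd (snd t)) else 0))
      = (\<Sum>t\<in>(\<lambda>k. (v, i, k)) ` basis M v. f t * g (snd (snd t)))"
    using f fin by (intro sum.mono_neutral_cong) (auto simp: hom_index_def cspace_def)
  also have "\<dots> = (\<Sum>k\<in>basis M v. f (v, i, k) * g k)"
    by (subst sum.reindex) (auto simp: inj_on_def)
  finally show ?thesis .
qed

lemma hom_index_sum_column:
  assumes f: "f \<in> cspace (hom_index M N)" and fin: "finite (hom_index M N)" "finite (basis N v)"
  shows "(\<Sum>t\<in>hom_index M N. f t * (if fst t = v \<and> snd (snd t) = j then g (fst (snd t)) else 0))
    = (\<Sum>i\<in>basis N v. f (v, i, j) * g i)"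
proof -
  have "(\<Sum>t\<in>hom_index M N. f t * (if fst t = v \<and> snd (snd t) = j then g (fst (snd t)) else 0))
      = (\<Sum>t\<in>(\<lambda>i. (v, i, j)) ` basis N v. f t * g (fst (snd t)))"
    using f fin by (intro sum.mono_neutral_cong) (auto simp: hom_index_def cspace_def)
  also have "\<dots> = (\<Sum>i\<in>basis N v. f (v, i, j) * g i)"
    by (subst sum.reindex) (auto simp: inj_on_def)
  finally show ?thesis .
qed

text \<open>Each equation is coordinate \<open>i\<close> of the image of the frame vector
  \<open>j\<close> at \<open>v\<close>, as a linear form in the homomorphism.\<close>

definition vanishing_equations :: "('v \<Rightarrow> nat) \<Rightarrow> (('v \<times> 'd \<times> 'b) \<Rightarrow> ('v \<times> nat \<times> 'b \<Rightarrow> complex) \<Rightarrow> complex) set" where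
  "vanishing_equations d =
    {\<lambda>t G. if fst t = v \<and> fst (snd t) = i then G (v, j, snd (snd t)) else 0 |v i j. j < d v}"

lemma ball_setcompr3: "(\<forall>c\<in>{f u v w |u v w. R u v w}. S c) \<longleftrightarrow> (\<forall>u v w. R u v w \<longrightarrow> S (f u v w))"
  by blast

lemma ball_setcompr5: "(\<forall>c\<in>{f u v w x y |u v w x y. R u v w x y}. S c) \<longleftrightarrow> (\<forall>u v w x y. R u v w x y \<longrightarrow> S (f u v w x y))"
  by blast

lemma vanishing_iff_equations:
  fixes f :: "'v::finite \<times> 'd \<times> 'b \<Rightarrow> complex" and F :: "('c, 'v, 'b) coords"
  assumes f: "f \<in> cspace (hom_index M I)" and fin: "finite (hom_index M I)" "\<And>v. finite (basis M v)"
    and sub: "\<And>v. snd (pt d F) v \<subseteq> vspace M v"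
  shows "(\<forall>v. snd (pt d F) v \<subseteq> hom_ker M f v) \<longleftrightarrow>
    (\<forall>c\<in>vanishing_equations d. (\<Sum>t\<in>hom_index M I. f t * c t (F \<circ> Inr)) = 0)"
proof -
  have app: "hom_app M f v (\<lambda>k. F (Inr (v, j, k))) i =
      (\<Sum>t\<in>hom_index M I. f t * (if fst t = v \<and> fst (snd t) = i then (F \<circ> Inr) (v, j, snd (snd t)) else 0))" for v j i
    by (subst hom_index_sum_row[OF f fin(1) fin(2)[of v], where g = "\<lambda>k. (F \<circ> Inr) (v, j, k)"])
      (simp add: hom_app_def lin_app_def)
  have ker: "cfun.subspace (hom_ker M f v)" for v
    unfolding hom_ker_def by (rule cfun.subspaceI)
      (simp_all add: clinear_0[OF clinear_hom_app] clinear_add[OF clinear_hom_app] clinear_scale[OF clinear_hom_app]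
        cfun.subspace_0[OF subspace_cspace] cfun.subspace_add[OF subspace_cspace] cfun.subspace_scale[OF subspace_cspace])
  have "snd (pt d F) v \<subseteq> hom_ker M f v \<longleftrightarrow> (\<forall>j<d v. hom_app M f v (\<lambda>k. F (Inr (v, j, k))) = 0)" for v
  proof
    assume "snd (pt d F) v \<subseteq> hom_ker M f v"
    then show "\<forall>j<d v. hom_app M f v (\<lambda>k. F (Inr (v, j, k))) = 0"
      using frame_vector_mem[of _ d v F] unfolding hom_ker_def by blast
  next
    assume "\<forall>j<d v. hom_app M f v (\<lambda>k. F (Inr (v, j, k))) = 0"
    then show "snd (pt d F) v \<subseteq> hom_ker M f v"
      using frame_vector_mem[of _ d v F] sub[of v] by (intro frame_span_subset ker) (auto simp: hom_ker_def)
  qed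
  then have "(\<forall>v. snd (pt d F) v \<subseteq> hom_ker M f v) \<longleftrightarrow> (\<forall>v i j. j < d v \<longrightarrow> hom_app M f v (\<lambda>k. F (Inr (v, j, k))) i = 0)"
    by (auto simp: fun_eq_iff)
  also have "\<dots> \<longleftrightarrow> (\<forall>c\<in>vanishing_equations d. (\<Sum>t\<in>hom_index M I. f t * c t (F \<circ> Inr)) = 0)"
    unfolding app vanishing_equations_def ball_setcompr3 ..
  finally show ?thesis .
qed

text \<open>A pair \<open>(L, b)\<close> stands for the rational left inverse \<open>L / b\<close> of the matrix with the columns \<open>G (v, l, _)\<close>;
  it makes membership in the column space a polynomial condition.\<close>

definition left_inverses :: "'b set \<Rightarrow> nat \<Rightarrow> 'v
    \<Rightarrow> ((nat \<Rightarrow> 'b \<Rightarrow> ('v \<times> nat \<times> 'b \<Rightarrow> complex) \<Rightarrow> complex) \<times> (('v \<times> nat \<times> 'b \<Rightarrow> complex) \<Rightarrow> complex)) set" where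
  "left_inverses S n v = {(L, b). poly_function b \<and> (\<forall>l s. poly_function (L l s)) \<and>
     (\<forall>G. \<forall>l<n. \<forall>l'<n. (\<Sum>s\<in>S. L l s G * G (v, l', s)) = (if l = l' then b G else 0))}"

text \<open>The dependence criterion does not exhibit its equations as linear in \<open>y\<close>,
  which a linear family demands; comparing \<open>y\<close> with its projection through a left
  inverse does. All pairs are imposed at once, since one denominator may vanish at some frames: on
  the span every pair gives a true equation, and a pair with \<open>b\<close> nonzero at the frame
  forces membership.\<close>

lemma mem_iff_left_inverses:
  fixes F :: "('c, 'v::finite, 'b) coords"
  assumes F: "frame d F" and S: "finite S" and sub: "snd (pt d F) v \<subseteq> cspace S" and y: "y \<in> cspace S"
  shows "y \<in> snd (pt d F) v \<longleftrightarrow> (\<forall>(L, b)\<in>left_inverses S (d v) v. \<forall>k.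
    b (F \<circ> Inr) * y k - (\<Sum>l<d v. (\<Sum>s\<in>S. L l s (F \<circ> Inr) * y s) * F (Inr (v, l, k))) = 0)"
proof
  assume "y \<in> snd (pt d F) v"
  then obtain c where "\<forall>k. y k = (\<Sum>j<d v. c j * F (Inr (v, j, k)))" unfolding frame_mem_iff[OF F] by (rule exE)
  then have c: "y k = (\<Sum>j<d v. c j * F (Inr (v, j, k)))" for k by (rule spec)
  show "\<forall>(L, b)\<in>left_inverses S (d v) v. \<forall>k.
    b (F \<circ> Inr) * y k - (\<Sum>l<d v. (\<Sum>s\<in>S. L l s (F \<circ> Inr) * y s) * F (Inr (v, l, k))) = 0"
  proof (intro ballI, clarify)
    fix L b k assume "(L, b) \<in> left_inverses S (d v) v"
    then have all: "\<forall>G. \<forall>l<d v. \<forall>l'<d v. (\<Sum>s\<in>S. L l s G * G (v, l', s)) = (if l = l' then b G else 0)"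
      by (simp add: left_inverses_def)
    have LI: "(\<Sum>s\<in>S. L l s (F \<circ> Inr) * F (Inr (v, l', s))) = (if l = l' then b (F \<circ> Inr) else 0)"
      if "l < d v" "l' < d v" for l l'
      using spec[OF all, of "F \<circ> Inr"] that by simp
    have "(\<Sum>s\<in>S. L l s (F \<circ> Inr) * y s) = c l * b (F \<circ> Inr)" if l: "l < d v" for l
    proof -
      have "(\<Sum>s\<in>S. L l s (F \<circ> Inr) * y s) = (\<Sum>s\<in>S. \<Sum>j<d v. c j * (L l s (F \<circ> Inr) * F (Inr (v, j, s))))"
        unfolding c by (simp add: sum_distrib_left mult.left_commute)
      also have "\<dots> = (\<Sum>j<d v. c j * (\<Sum>s\<in>S. L l s (F \<circ> Inr) * F (Inr (v, j, s))))"
        unfolding sum_distrib_left by (rule sum.swap)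
      also have "\<dots> = (\<Sum>j<d v. if j = l then c l * b (F \<circ> Inr) else 0)"
        using LI[OF l] by (intro sum.cong) auto
      finally show ?thesis using l by simp
    qed
    then have "(\<Sum>l<d v. (\<Sum>s\<in>S. L l s (F \<circ> Inr) * y s) * F (Inr (v, l, k))) = (\<Sum>l<d v. b (F \<circ> Inr) * (c l * F (Inr (v, l, k))))"
      by (intro sum.cong) (auto simp: mult_ac)
    also have "\<dots> = b (F \<circ> Inr) * y k" unfolding c sum_distrib_left ..
    finally show "b (F \<circ> Inr) * y k - (\<Sum>l<d v. (\<Sum>s\<in>S. L l s (F \<circ> Inr) * y s) * F (Inr (v, l, k))) = 0" by simp
  qed
next
  assume eq: "\<forall>(L, b)\<in>left_inverses S (d v) v. \<forall>k.
    b (F \<circ> Inr) * y k - (\<Sum>l<d v. (\<Sum>s\<in>S. L l s (F \<circ> Inr) * y s) * F (Inr (v, l, k))) = 0"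
  have "\<forall>j\<in>{..<d v}. a j = 0" if a: "\<forall>r\<in>S. (\<Sum>j\<in>{..<d v}. a j * (F \<circ> Inr) (v, j, r)) = 0" for a
  proof -
    have out: "F (Inr (v, j, k)) = 0" if "j < d v" "k \<notin> S" for j k
    proof -
      have "(\<lambda>k. F (Inr (v, j, k))) \<in> cspace S"
        using frame_vector_mem[where d = d and v = v and F = F and j = j, OF that(1)] sub by blast
      then show ?thesis using that(2) by (simp add: cspace_def)
    qed
    have "(\<Sum>j<d v. a j * F (Inr (v, j, k))) = 0" for k
      by (cases "k \<in> S") (use a out in auto)
    from frame_independent_coeffs[OF F this] show ?thesis by simp
  qed
  then have "\<exists>K L b. finite K \<and> K \<subseteq> S \<and> poly_function b \<and> b (F \<circ> Inr) \<noteq> 0 \<and> (\<forall>j\<in>{..<d v}. \<forall>r\<in>K. poly_function (L j r)) \<and>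
    (\<forall>G. \<forall>j\<in>{..<d v}. \<forall>j'\<in>{..<d v}. (\<Sum>r\<in>K. L j r G * G (v, j', r)) = (if j = j' then b G else 0))"
    by (intro poly_left_inverse[where A = "\<lambda>j r G. G (v, j, r)" and ?F0.0 = "F \<circ> Inr"] finite_lessThan pf_coord)
  then obtain K L b where K: "finite K" "K \<subseteq> S" "poly_function b" "b (F \<circ> Inr) \<noteq> 0" "\<forall>j\<in>{..<d v}. \<forall>r\<in>K. poly_function (L j r)"
    "\<forall>G. \<forall>j\<in>{..<d v}. \<forall>j'\<in>{..<d v}. (\<Sum>r\<in>K. L j r G * G (v, j', r)) = (if j = j' then b G else 0)" by (elim exE conjE)
  \<comment> \<open>Entries outside \<open>K\<close> or beyond the frame are filled with 0, since
    \<open>left_inverses\<close> sums over all of \<open>S\<close> and asks every entry to be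
    polynomial.\<close>
  define L' where "L' l s = (if l < d v \<and> s \<in> K then L l s else (\<lambda>_. 0))" for l s
  have "(\<Sum>s\<in>S. L' l s G * G (v, l', s)) = (if l = l' then b G else 0)" if "l < d v" "l' < d v" for G l l'
  proof -
    have "(\<Sum>s\<in>S. L' l s G * G (v, l', s)) = (\<Sum>s\<in>K. L l s G * G (v, l', s))"
      using S K(2) that by (intro sum.mono_neutral_cong_right) (auto simp: L'_def)
    then show ?thesis using K(6) that by simp
  qed
  moreover have "poly_function (L' l s)" for l s using K(5) by (simp add: L'_def pf_const)
  ultimately have "(L', b) \<in> left_inverses S (d v) v" using K(3) unfolding left_inverses_def by simp
  with eq have eq': "b (F \<circ> Inr) * y k - (\<Sum>l<d v. (\<Sum>s\<in>S. L' l s (F \<circ> Inr) * y s) * F (Inr (v, l, k))) = 0" for k by (fastforce simp only: prod.case)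
  have "y k = (\<Sum>l<d v. ((\<Sum>s\<in>S. L' l s (F \<circ> Inr) * y s) / b (F \<circ> Inr)) * F (Inr (v, l, k)))" for k
  proof -
    have "y k = (\<Sum>l<d v. (\<Sum>s\<in>S. L' l s (F \<circ> Inr) * y s) * F (Inr (v, l, k))) / b (F \<circ> Inr)"
      using eq'[of k] K(4) by (simp add: field_simps)
    then show ?thesis by (subst (asm) sum_divide_distrib) simp
  qed
  then show "y \<in> snd (pt d F) v" unfolding frame_mem_iff[OF F] by (intro exI allI)
qed

text \<open>Coordinate \<open>k\<close> of the membership equation for column \<open>j\<close> of
  the homomorphism at \<open>v\<close>, one for each left inverse.\<close>

definition into_equations :: "('v, 'a, 'b) rep \<Rightarrow> ('v, 'a, 'd) rep \<Rightarrow> ('v \<Rightarrow> nat)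
    \<Rightarrow> (('v \<times> 'd \<times> 'b) \<Rightarrow> ('v \<times> nat \<times> 'd \<Rightarrow> complex) \<Rightarrow> complex) set" where
  "into_equations P M d = {\<lambda>t G. if fst t = v \<and> snd (snd t) = j
      then b G * (if fst (snd t) = k then 1 else 0) - (\<Sum>l<d v. L l (fst (snd t)) G * G (v, l, k)) else 0
    |v j k L b. j \<in> basis P v \<and> (L, b) \<in> left_inverses (basis M v) (d v) v}"

lemma into_iff_equations:
  fixes h :: "'v::finite \<times> 'd \<times> 'b \<Rightarrow> complex" and F :: "('c, 'v, 'd) coords"
  assumes h: "h \<in> cspace (hom_index P M)"
    and fin: "finite (hom_index P M)" "\<And>v. finite (basis P v)" "\<And>v. finite (basis M v)"
    and F: "frame d F" and sub: "\<And>v. snd (pt d F) v \<subseteq> vspace M v"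
  shows "(\<forall>v. hom_im P h v \<subseteq> snd (pt d F) v) \<longleftrightarrow>
    (\<forall>c\<in>into_equations P M d. (\<Sum>t\<in>hom_index P M. h t * c t (F \<circ> Inr)) = 0)"
proof -
  have column: "(\<lambda>i. h (v, i, j)) \<in> vspace M v" for v j
    using h unfolding cspace_hom_index by (auto simp: cspace_def)
  have "hom_im P h v \<subseteq> snd (pt d F) v \<longleftrightarrow> (\<forall>j\<in>basis P v. (\<lambda>i. h (v, i, j)) \<in> snd (pt d F) v)" for v
  proof
    assume im: "hom_im P h v \<subseteq> snd (pt d F) v"
    show "\<forall>j\<in>basis P v. (\<lambda>i. h (v, i, j)) \<in> snd (pt d F) v"
    proof
      fix j assume j: "j \<in> basis P v"
      have "hom_app P h v (unit_vec j) \<in> hom_im P h v"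
        unfolding hom_im_def using unit_vec_cspace[OF j] by (rule imageI)
      then show "(\<lambda>i. h (v, i, j)) \<in> snd (pt d F) v" using im unfolding hom_app_unit_vec[OF fin(2) j] by blast
    qed
  next
    assume col: "\<forall>j\<in>basis P v. (\<lambda>i. h (v, i, j)) \<in> snd (pt d F) v"
    show "hom_im P h v \<subseteq> snd (pt d F) v"
    proof
      fix y assume "y \<in> hom_im P h v"
      then obtain x where "y = hom_app P h v x" by (auto simp: hom_im_def)
      then have "y = (\<Sum>j\<in>basis P v. cscale (x j) (\<lambda>i. h (v, i, j)))"
        by (simp add: hom_app_def lin_app_def fun_eq_iff sum_fun_apply cscale_def mult.commute)
      moreover have "(\<Sum>j\<in>basis P v. cscale (x j) (\<lambda>i. h (v, i, j))) \<in> snd (pt d F) v"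
        using col unfolding pt_def snd_conv by (intro cfun.span_sum cfun.span_scale) blast
      ultimately show "y \<in> snd (pt d F) v" by (simp only:)
    qed
  qed
  then have "(\<forall>v. hom_im P h v \<subseteq> snd (pt d F) v) \<longleftrightarrow> (\<forall>v. \<forall>j\<in>basis P v. \<forall>(L, b)\<in>left_inverses (basis M v) (d v) v. \<forall>k.
      b (F \<circ> Inr) * h (v, k, j) - (\<Sum>l<d v. (\<Sum>s\<in>basis M v. L l s (F \<circ> Inr) * h (v, s, j)) * F (Inr (v, l, k))) = 0)"
    by (simp only: mem_iff_left_inverses[OF F fin(3) sub column])
  also have "\<dots> \<longleftrightarrow> (\<forall>v. \<forall>j\<in>basis P v. \<forall>(L, b)\<in>left_inverses (basis M v) (d v) v. \<forall>k.
      (\<Sum>t\<in>hom_index P M. h t * (if fst t = v \<and> snd (snd t) = j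
        then b (F \<circ> Inr) * (if fst (snd t) = k then 1 else 0) - (\<Sum>l<d v. L l (fst (snd t)) (F \<circ> Inr) * (F \<circ> Inr) (v, l, k)) else 0)) = 0)"
  proof -
    have "b (F \<circ> Inr) * h (v, k, j) - (\<Sum>l<d v. (\<Sum>s\<in>basis M v. L l s (F \<circ> Inr) * h (v, s, j)) * F (Inr (v, l, k)))
      = (\<Sum>t\<in>hom_index P M. h t * (if fst t = v \<and> snd (snd t) = j
        then b (F \<circ> Inr) * (if fst (snd t) = k then 1 else 0) - (\<Sum>l<d v. L l (fst (snd t)) (F \<circ> Inr) * (F \<circ> Inr) (v, l, k)) else 0))"
      for v j k b and L :: "nat \<Rightarrow> 'd \<Rightarrow> ('v \<times> nat \<times> 'd \<Rightarrow> complex) \<Rightarrow> complex"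
    proof -
      let ?G = "F \<circ> Inr"
      have "(\<Sum>t\<in>hom_index P M. h t * (if fst t = v \<and> snd (snd t) = j
          then b ?G * (if fst (snd t) = k then 1 else 0) - (\<Sum>l<d v. L l (fst (snd t)) ?G * ?G (v, l, k)) else 0))
        = (\<Sum>s\<in>basis M v. h (v, s, j) * (b ?G * (if s = k then 1 else 0) - (\<Sum>l<d v. L l s ?G * ?G (v, l, k))))"
        by (rule hom_index_sum_column[OF h fin(1) fin(3),
              where g = "\<lambda>s. b ?G * (if s = k then 1 else 0) - (\<Sum>l<d v. L l s ?G * ?G (v, l, k))"])
      also have "\<dots> = (\<Sum>s\<in>basis M v. if s = k then b ?G * h (v, k, j) else 0)
          - (\<Sum>s\<in>basis M v. \<Sum>l<d v. L l s ?G * h (v, s, j) * F (Inr (v, l, k)))"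
        unfolding sum_subtractf[symmetric] by (intro sum.cong refl) (simp add: right_diff_distrib sum_distrib_left mult_ac)
      also have "(\<Sum>s\<in>basis M v. if s = k then b ?G * h (v, k, j) else 0) = b ?G * h (v, k, j)"
        using fin(3)[of v] column[of v j] by (auto simp: cspace_def)
      also have "(\<Sum>s\<in>basis M v. \<Sum>l<d v. L l s ?G * h (v, s, j) * F (Inr (v, l, k)))
          = (\<Sum>l<d v. (\<Sum>s\<in>basis M v. L l s ?G * h (v, s, j)) * F (Inr (v, l, k)))"
        unfolding sum_distrib_right by (rule sum.swap)
      finally show ?thesis by (rule sym)
    qed
    then show ?thesis by (simp only:)
  qed
  also have "\<dots> \<longleftrightarrow> (\<forall>c\<in>into_equations P M d. (\<Sum>t\<in>hom_index P M. h t * c t (F \<circ> Inr)) = 0)"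
    unfolding into_equations_def ball_setcompr5 by fast
  finally show ?thesis .
qed

lemma poly_function_Hom_equations: "c \<in> Hom_equations Q M N \<Longrightarrow> poly_function (c t)"
  unfolding Hom_equations_def by (auto intro: pf_const)

lemma poly_function_vanishing_equations: "c \<in> vanishing_equations d \<Longrightarrow> poly_function (c t)"
  unfolding vanishing_equations_def by (auto intro: poly_function_intros)

lemma poly_function_into_equations: "c \<in> into_equations P M d \<Longrightarrow> poly_function (c t)"
proof -
  assume "c \<in> into_equations P M d"
  then obtain v j k L b where c: "c = (\<lambda>t G. if fst t = v \<and> snd (snd t) = j
      then b G * (if fst (snd t) = k then 1 else 0) - (\<Sum>l<d v. L l (fst (snd t)) G * G (v, l, k)) else 0)"
    and LI: "(L, b) \<in> left_inverses (basis M v) (d v) v" unfolding into_equations_def by blast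
  have "poly_function b" "\<And>l s. poly_function (L l s)" using LI by (simp_all add: left_inverses_def)
  then show "poly_function (c t)" unfolding c by (intro poly_function_intros)
qed

text \<open>Where the Grassmannian is nonempty the rank is a dimension, so \<open>nat\<close> loses
  nothing; over an empty base there are no fibres to measure.\<close>

lemma linear_family_vanishing:
  fixes M I :: "('v::finite, 'a, nat) rep"
  assumes Q: "finite (arrows Q)" and M: "is_rep Q M" and I: "injective_rep Q I"
  shows "linear_family (Gr Q M e) (basis M) (hom_index M I) (Hom_vanishing Q M I)
    (\<lambda>d. Hom_equations Q M I \<union> vanishing_equations d)
    (nat (euler Q (dimvec (vspace M)) (dimvec (vspace I)) - euler Q e (dimvec (vspace I))))"
proof
  show fM: "finite (basis M v)" for v using M by (simp add: is_rep_def)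
  have fI: "finite (basis I v)" for v using I by (simp add: injective_rep_def is_rep_def)
  show fin: "finite (hom_index M I)" by (rule finite_hom_index[OF fM fI])
  show "zclosed_in {} (basis M) (Gr Q M e)" by (rule zclosed_in_Gr)
  show "poly_function (c j)" if "c \<in> Hom_equations Q M I \<union> vanishing_equations d" for d c j
    using that poly_function_Hom_equations poly_function_vanishing_equations by blast
  show "cfun.dim (Hom_vanishing Q M I p) = nat (euler Q (dimvec (vspace M)) (dimvec (vspace I)) - euler Q e (dimvec (vspace I)))"
    if "(0, p) \<in> Gr Q M e" for p
  proof -
    have "Defs.submodule Q M p" "dimvec p = e" using that by (simp_all add: Gr_mem)
    then show ?thesis using dim_Hom_vanishing[OF Q M I, of p] by simp
  qed
  fix d and F :: "('v \<times> nat \<times> nat, 'v, nat) coords" and f :: "'v \<times> nat \<times> nat \<Rightarrow> complex"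
  assume F: "frame d F" "(0, snd (pt d F)) \<in> Gr Q M e"
  have sub: "snd (pt d F) v \<subseteq> vspace M v" for v using F(2) by (simp add: Gr_mem Defs.submodule_def)
  show "f \<in> Hom_vanishing Q M I (snd (pt d F)) \<longleftrightarrow> f \<in> cspace (hom_index M I) \<and>
      (\<forall>c\<in>Hom_equations Q M I \<union> vanishing_equations d. (\<Sum>j\<in>hom_index M I. f j * c j (F \<circ> Inr)) = 0)"
    using Hom_iff_equations[OF fin, of f Q "F \<circ> Inr"] vanishing_iff_equations[OF _ fin fM sub, of f]
    unfolding Hom_vanishing_def by blast
qed

lemma linear_family_into:
  fixes M P :: "('v::finite, 'a, nat) rep"
  assumes Q: "finite (arrows Q)" and M: "is_rep Q M" and P: "projective_rep Q P"
  shows "linear_family (Gr Q M e) (basis M) (hom_index P M) (Hom_into Q P M)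
    (\<lambda>d. Hom_equations Q P M \<union> into_equations P M d) (nat (euler Q (dimvec (vspace P)) e))"
proof
  show fM: "finite (basis M v)" for v using M by (simp add: is_rep_def)
  have fP: "finite (basis P v)" for v using P by (simp add: projective_rep_def is_rep_def)
  show fin: "finite (hom_index P M)" by (rule finite_hom_index[OF fP fM])
  show "zclosed_in {} (basis M) (Gr Q M e)" by (rule zclosed_in_Gr)
  show "poly_function (c j)" if "c \<in> Hom_equations Q P M \<union> into_equations P M d" for d c j
    using that poly_function_Hom_equations poly_function_into_equations by blast
  show "cfun.dim (Hom_into Q P M p) = nat (euler Q (dimvec (vspace P)) e)" if "(0, p) \<in> Gr Q M e" for p
  proof -
    have "Defs.submodule Q M p" "dimvec p = e" using that by (simp_all add: Gr_mem)
    then show ?thesis using dim_Hom_into[OF Q M P, of p] by simp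
  qed
  fix d and F :: "('v \<times> nat \<times> nat, 'v, nat) coords" and f :: "'v \<times> nat \<times> nat \<Rightarrow> complex"
  assume F: "frame d F" "(0, snd (pt d F)) \<in> Gr Q M e"
  have sub: "snd (pt d F) v \<subseteq> vspace M v" for v using F(2) by (simp add: Gr_mem Defs.submodule_def)
  show "f \<in> Hom_into Q P M (snd (pt d F)) \<longleftrightarrow> f \<in> cspace (hom_index P M) \<and>
      (\<forall>c\<in>Hom_equations Q P M \<union> into_equations P M d. (\<Sum>j\<in>hom_index P M. f j * c j (F \<circ> Inr)) = 0)"
    using Hom_iff_equations[OF fin, of f Q "F \<circ> Inr"] into_iff_equations[OF _ fin fP fM F(1) sub, of f]
    unfolding Hom_into_def by blast
qed

section \<open>Computations in the quantum torus\<close>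

lemma lookup_tscale: "Poly_Mapping.lookup (tscale c x) \<alpha> = c * Poly_Mapping.lookup x \<alpha>"
  unfolding tscale_def by (simp add: Poly_Mapping.map.rep_eq when_def)

lemma tscale_single: "tscale c (Poly_Mapping.single \<alpha> x) = Poly_Mapping.single \<alpha> (c * x)"
  by (rule poly_mapping_eqI) (simp add: lookup_tscale lookup_single when_def)

lemma tscale_add: "tscale c (x + y) = tscale c x + tscale c y"
  by (rule poly_mapping_eqI) (simp add: lookup_tscale lookup_add distrib_left)

lemma tscale_0_left: "tscale 0 x = 0"
  by (rule poly_mapping_eqI) (simp add: lookup_tscale)

lemma tscale_0_right: "tscale c 0 = 0"
  by (rule poly_mapping_eqI) (simp add: lookup_tscale)

lemma tscale_sum: "tscale c (\<Sum>e\<in>A. f e) = (\<Sum>e\<in>A. tscale c (f e))"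
  by (induction A rule: infinite_finite_induct) (simp_all add: tscale_add tscale_0_right)

lemma lookup_tmult_Xmon_right:
  "Poly_Mapping.lookup (tmult \<Lambda> x (Xmon \<beta>)) \<gamma> = Poly_Mapping.lookup x (\<gamma> - \<beta>) * tvar powi bilin \<Lambda> (\<gamma> - \<beta>) \<beta>"
proof -
  have "tmult \<Lambda> x (Xmon \<beta>) = (\<Sum>\<alpha>\<in>Poly_Mapping.keys x.
      Poly_Mapping.single (\<alpha> + \<beta>) (Poly_Mapping.lookup x \<alpha> * tvar powi bilin \<Lambda> \<alpha> \<beta>))"
    by (simp add: tmult_def Xmon_def)
  then have "Poly_Mapping.lookup (tmult \<Lambda> x (Xmon \<beta>)) \<gamma> =
      (\<Sum>\<alpha>\<in>Poly_Mapping.keys x. if \<alpha> = \<gamma> - \<beta> then Poly_Mapping.lookup x \<alpha> * tvar powi bilin \<Lambda> \<alpha> \<beta> else 0)"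
    by (simp add: lookup_sum lookup_single when_def algebra_simps)
  also have "\<dots> = Poly_Mapping.lookup x (\<gamma> - \<beta>) * tvar powi bilin \<Lambda> (\<gamma> - \<beta>) \<beta>"
    by (simp add: in_keys_iff)
  finally show ?thesis .
qed

lemma lookup_tmult_Xmon_left:
  "Poly_Mapping.lookup (tmult \<Lambda> (Xmon \<beta>) x) \<gamma> = Poly_Mapping.lookup x (\<gamma> - \<beta>) * tvar powi bilin \<Lambda> \<beta> (\<gamma> - \<beta>)"
proof -
  have "tmult \<Lambda> (Xmon \<beta>) x = (\<Sum>\<alpha>\<in>Poly_Mapping.keys x.
      Poly_Mapping.single (\<beta> + \<alpha>) (Poly_Mapping.lookup x \<alpha> * tvar powi bilin \<Lambda> \<beta> \<alpha>))"
    by (simp add: tmult_def Xmon_def)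
  then have "Poly_Mapping.lookup (tmult \<Lambda> (Xmon \<beta>) x) \<gamma> =
      (\<Sum>\<alpha>\<in>Poly_Mapping.keys x. if \<alpha> = \<gamma> - \<beta> then Poly_Mapping.lookup x \<alpha> * tvar powi bilin \<Lambda> \<beta> \<alpha> else 0)"
    by (simp add: lookup_sum lookup_single when_def algebra_simps)
  also have "\<dots> = Poly_Mapping.lookup x (\<gamma> - \<beta>) * tvar powi bilin \<Lambda> \<beta> (\<gamma> - \<beta>)"
    by (simp add: in_keys_iff)
  finally show ?thesis .
qed

text \<open>Compared coefficientwise, so that coinciding exponents and vanishing coefficients, which
  affect \<open>keys\<close>, need no separate treatment.\<close>

lemma tmult_sum_Xmon_right:
  "tmult \<Lambda> (\<Sum>e\<in>A. Poly_Mapping.single (\<alpha> e) (c e)) (Xmon \<beta>)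
    = (\<Sum>e\<in>A. Poly_Mapping.single (\<alpha> e + \<beta>) (c e * tvar powi bilin \<Lambda> (\<alpha> e) \<beta>))"
  unfolding poly_mapping_eq_iff fun_eq_iff lookup_tmult_Xmon_right lookup_sum lookup_single sum_distrib_right
  by (intro allI sum.cong refl) (auto simp: when_def algebra_simps)

lemma tmult_Xmon_left_sum:
  "tmult \<Lambda> (Xmon \<beta>) (\<Sum>e\<in>A. Poly_Mapping.single (\<alpha> e) (c e))
    = (\<Sum>e\<in>A. Poly_Mapping.single (\<alpha> e + \<beta>) (c e * tvar powi bilin \<Lambda> \<beta> (\<alpha> e)))"
  unfolding poly_mapping_eq_iff fun_eq_iff lookup_tmult_Xmon_left lookup_sum lookup_single sum_distrib_right
  by (intro allI sum.cong refl) (auto simp: when_def algebra_simps)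

lemma single_eqD: "Poly_Mapping.single \<alpha> c = Poly_Mapping.single \<beta> c' \<Longrightarrow> c \<noteq> 0 \<Longrightarrow> \<alpha> = \<beta>"
  by (metis lookup_single_eq lookup_single_not_eq)

lemma tvar_nonzero: "tvar \<noteq> 0"
  by (simp add: tvar_def to_fract_eq_0_iff)

lemma to_fract_power: "to_fract (p ^ n) = to_fract p ^ n"
  by (induction n) simp_all

text \<open>The integral runs over the values of \<open>\<phi>\<close>. Injectivity of
  \<open>\<tau>\<close> makes its level sets those of \<open>\<epsilon>\<close>, and indices not
  attained contribute \<open>\<Upsilon> {} = 0\<close>.\<close>

lemma motivic_integral_graded:
  assumes \<Upsilon>: "\<Upsilon> {} = 0" and A: "finite A" "\<And>y. y \<in> Y \<Longrightarrow> \<epsilon> y \<in> A" and inj: "inj_on \<tau> A"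
    and \<phi>: "\<And>y. y \<in> Y \<Longrightarrow> \<phi> y = \<tau> (\<epsilon> y)"
  shows "motivic_integral \<Upsilon> Y \<phi> = (\<Sum>e\<in>A. tscale (to_fract (\<Upsilon> {y \<in> Y. \<epsilon> y = e})) (\<tau> e))"
proof -
  have \<epsilon>A: "\<epsilon> ` Y \<subseteq> A" using A(2) by blast
  have im: "\<phi> ` Y = \<tau> ` \<epsilon> ` Y" unfolding image_image using \<phi> by (rule image_cong[OF refl])
  have level: "{y \<in> Y. \<phi> y = \<tau> e} = {y \<in> Y. \<epsilon> y = e}" if "e \<in> \<epsilon> ` Y" for e
    using that A(2) \<phi> inj by (auto simp: inj_on_def)
  have "motivic_integral \<Upsilon> Y \<phi> = (\<Sum>e\<in>\<epsilon> ` Y. tscale (to_fract (\<Upsilon> {y \<in> Y. \<phi> y = \<tau> e})) (\<tau> e))"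
    unfolding motivic_integral_def im by (subst sum.reindex[OF inj_on_subset[OF inj \<epsilon>A]]) simp
  also have "\<dots> = (\<Sum>e\<in>\<epsilon> ` Y. tscale (to_fract (\<Upsilon> {y \<in> Y. \<epsilon> y = e})) (\<tau> e))"
    by (rule sum.cong[OF refl]) (simp only: level)
  also have "\<dots> = (\<Sum>e\<in>A. tscale (to_fract (\<Upsilon> {y \<in> Y. \<epsilon> y = e})) (\<tau> e))"
  proof (rule sum.mono_neutral_left[OF A(1) \<epsilon>A], rule ballI)
    fix e assume "e \<in> A - \<epsilon> ` Y"
    then have "{y \<in> Y. \<epsilon> y = e} = {}" by blast
    then show "tscale (to_fract (\<Upsilon> {y \<in> Y. \<epsilon> y = e})) (\<tau> e) = 0" by (simp only: \<Upsilon> to_fract_0 tscale_0_left)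
  qed
  finally show ?thesis .
qed

section \<open>Bilinear forms\<close>

lemma bilin_diff_left: "bilin A (x - y) z = bilin A x z - bilin A y z"
  by (simp add: bilin_def left_diff_distrib sum_subtractf)

lemma bilin_add_right: "bilin A z (x + y) = bilin A z x + bilin A z y"
  and bilin_diff_right: "bilin A z (x - y) = bilin A z x - bilin A z y"
  by (simp_all add: bilin_def matrix_vector_mult_def distrib_left right_diff_distrib sum.distrib sum_subtractf)

lemma bilin_transpose: "bilin (transpose A) x y = bilin A y x"
proof -
  have "bilin (transpose A) x y = (\<Sum>i\<in>UNIV. \<Sum>j\<in>UNIV. y $ j * (A $ j $ i * x $ i))"
    by (simp add: bilin_def matrix_vector_mult_def transpose_def sum_distrib_left mult_ac)
  also have "\<dots> = (\<Sum>j\<in>UNIV. \<Sum>i\<in>UNIV. y $ j * (A $ j $ i * x $ i))" by (rule sum.swap)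
  also have "\<dots> = bilin A y x" by (simp add: bilin_def matrix_vector_mult_def sum_distrib_left)
  finally show ?thesis .
qed

lemma bilin_mult_right: "bilin A x (C *v y) = bilin (A ** C) x y"
  by (simp add: bilin_def matrix_vector_mul_assoc)

lemma bilin_mult_left: "bilin A (C *v x) y = bilin (transpose C ** A) x y"
proof -
  have "bilin A (C *v x) y = bilin (transpose A) y (C *v x)" by (simp add: bilin_transpose)
  also have "\<dots> = bilin (transpose (transpose C ** A)) y x" by (simp add: bilin_mult_right matrix_transpose_mul)
  also have "\<dots> = bilin (transpose C ** A) x y" by (rule bilin_transpose)
  finally show ?thesis .
qed

lemma bilin_uminus_matrix: "bilin (- A) x y = - bilin A x y"
  by (simp add: bilin_def matrix_vector_mult_def sum_negf)

lemma rstar_diff: "rstar Q (x - y) = rstar Q x - rstar Q y"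
  and lstar_diff: "lstar Q (x - y) = lstar Q x - lstar Q y"
  and lstar_add: "lstar Q (x + y) = lstar Q x + lstar Q y"
  by (simp_all add: rstar_def lstar_def matrix_vector_mult_diff_distrib matrix_vector_right_distrib)

lemma euler_diff_left: "euler Q (x - y) z = euler Q x z - euler Q y z"
  and euler_diff_right: "euler Q z (x - y) = euler Q z x - euler Q z y"
  and euler_add_right: "euler Q z (x + y) = euler Q z x + euler Q z y"
  by (simp_all add: euler_def bilin_diff_left bilin_diff_right bilin_add_right)

lemma euler_rstar_lstar:
  assumes "rstar Q p = lstar Q i" shows "euler Q p x = euler Q x i"
proof -
  have "euler Q p x = bilin (transpose (euler_matrix Q)) x p" by (simp add: euler_def bilin_transpose)
  also have "\<dots> = (\<Sum>j\<in>UNIV. x $ j * rstar Q p $ j)" by (simp add: bilin_def rstar_def)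
  also have "\<dots> = euler Q x i" unfolding assms by (simp add: euler_def bilin_def lstar_def)
  finally show ?thesis .
qed

locale compatible =
  fixes Q :: "('v::finite, 'a) quiver" and \<Lambda> :: "int^'v^'v"
  assumes skew: "transpose \<Lambda> = - \<Lambda>"
    and compat: "- (\<Lambda> ** (euler_matrix Q - transpose (euler_matrix Q))) = mat 1"
begin

lemma star_diff_eq: "lstar Q e - rstar Q e = (euler_matrix Q - transpose (euler_matrix Q)) *v e"
  by (simp add: lstar_def rstar_def matrix_vector_mult_diff_rdistrib)

text \<open>The difference is B e with B = E - E^t, and -\<Lambda> is a left inverse of B.\<close>

lemma inj_star_diff: "lstar Q e - rstar Q e = lstar Q e' - rstar Q e' \<Longrightarrow> e = e'"
proof -
  assume eq: "lstar Q e - rstar Q e = lstar Q e' - rstar Q e'"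
  have inv: "- (\<Lambda> *v (lstar Q x - rstar Q x)) = x" for x
  proof -
    have "- (\<Lambda> *v (lstar Q x - rstar Q x)) = - (\<Lambda> ** (euler_matrix Q - transpose (euler_matrix Q))) *v x"
      unfolding star_diff_eq matrix_vector_mul_assoc by (simp add: vec_eq_iff matrix_vector_mult_def sum_negf)
    then show ?thesis unfolding compat by simp
  qed
  have "e = - (\<Lambda> *v (lstar Q e - rstar Q e))" by (rule inv[symmetric])
  also have "\<dots> = e'" unfolding eq by (rule inv)
  finally show "e = e'" .
qed

lemma skew_bilin: "bilin \<Lambda> x y = - bilin \<Lambda> y x"
  using bilin_transpose[of \<Lambda> y x] unfolding skew bilin_uminus_matrix by simp

text \<open>The transpose of the compatibility condition; its sign is absorbed by the skew symmetry
  of \<Lambda>.\<close>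

lemma compat': "transpose (euler_matrix Q - transpose (euler_matrix Q)) ** \<Lambda> = mat 1"
proof -
  let ?B = "euler_matrix Q - transpose (euler_matrix Q)"
  have "transpose (\<Lambda> ** ?B) = transpose ?B ** transpose \<Lambda>" by (rule matrix_transpose_mul)
  also have "\<dots> = - (transpose ?B ** \<Lambda>)"
    unfolding skew by (simp add: vec_eq_iff matrix_matrix_mult_def sum_negf)
  finally have "transpose ?B ** \<Lambda> = - transpose (\<Lambda> ** ?B)" by simp
  also have "\<dots> = transpose (- (\<Lambda> ** ?B))" by (simp add: vec_eq_iff transpose_def)
  finally show ?thesis unfolding compat by (simp add: transpose_mat)
qed

text \<open>Both sides are e^t B^t \<Lambda> E i, as B^t \<Lambda> = 1. This is how the Euler form
  appears in the powers of t that multiplication in the torus produces.\<close>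

lemma bilin_star_diff: "bilin \<Lambda> (lstar Q e - rstar Q e) (lstar Q i) = euler Q e i"
  unfolding star_diff_eq bilin_mult_left compat' by (simp add: bilin_def euler_def lstar_def)

text \<open>The exponent of the monomial is B e plus a vector independent of \<open>e\<close>, and
  its coefficient is a power of t, hence nonzero.\<close>

lemma inj_inj_term: "inj (inj_term Q m i)"
proof (rule injI)
  fix e e' assume "inj_term Q m i e = inj_term Q m i e'"
  then have eq: "- rstar Q e - lstar Q (m - i - e) = - rstar Q e' - lstar Q (m - i - e')"
    unfolding inj_term_def Xmon_def tscale_single by (rule single_eqD) (simp add: tvar_nonzero)
  have "lstar Q x - rstar Q x = (- rstar Q x - lstar Q (m - i - x)) + lstar Q (m - i)" for x
    by (simp add: lstar_diff)
  from this[of e] this[of e'] have "lstar Q e - rstar Q e = lstar Q e' - rstar Q e'" unfolding eq by (simp only:)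
  then show "e = e'" by (rule inj_star_diff)
qed

text \<open>Here too the exponent is B e up to a constant vector.\<close>

lemma inj_proj_term: "inj (proj_term Q m p)"
proof (rule injI)
  fix e e' assume "proj_term Q m p e = proj_term Q m p e'"
  then have eq: "rstar Q (p - e) - lstar Q (m - e) = rstar Q (p - e') - lstar Q (m - e')"
    unfolding proj_term_def Xmon_def tscale_single by (rule single_eqD) (simp add: tvar_nonzero)
  have "lstar Q x - rstar Q x = (rstar Q (p - x) - lstar Q (m - x)) + (lstar Q m - rstar Q p)" for x
    by (simp add: lstar_diff rstar_diff)
  from this[of e] this[of e'] have "lstar Q e - rstar Q e = lstar Q e' - rstar Q e'" unfolding eq by (simp only:)
  then show "e = e'" by (rule inj_star_diff)
qed

end

section \<open>The integrals as sums over dimension vectors\<close>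

definition dimension_box :: "('v::finite, 'a, 'b) rep \<Rightarrow> (int^'v) set" where
  "dimension_box M = {e. \<forall>v. 0 \<le> e $ v \<and> e $ v \<le> dimvec (vspace M) $ v}"

lemma finite_dimension_box: "finite (dimension_box M)"
proof (rule finite_subset)
  show "dimension_box M \<subseteq> (\<lambda>f. \<chi> v. f v) ` PiE UNIV (\<lambda>v. {0..dimvec (vspace M) $ v})"
  proof
    fix e assume "e \<in> dimension_box M"
    then have "(\<lambda>v. e $ v) \<in> PiE UNIV (\<lambda>v. {0..dimvec (vspace M) $ v})" by (auto simp: dimension_box_def)
    then have "(\<chi> v. e $ v) \<in> (\<lambda>f. \<chi> v. f v) ` PiE UNIV (\<lambda>v. {0..dimvec (vspace M) $ v})" by (rule imageI)
    then show "e \<in> (\<lambda>f. \<chi> v. f v) ` PiE UNIV (\<lambda>v. {0..dimvec (vspace M) $ v})" by simp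
  qed
qed (intro finite_imageI finite_PiE, simp_all)

lemma submodule_dimension_box:
  assumes M: "is_rep Q M" and N: "Defs.submodule Q M N"
  shows "dimvec N \<in> dimension_box M"
proof -
  have fM: "finite (basis M v)" for v using M by (simp add: is_rep_def)
  have "cfun.dim (N v) \<le> card (basis M v)" for v
    using N by (intro dim_le_card_cspace fM) (simp add: Defs.submodule_def)
  then show ?thesis by (simp add: dimension_box_def dimvec_vspace fM) (simp add: dimvec_def)
qed

context poincare
begin

lemma character_eq:
  "character \<Upsilon> Q M i = (\<Sum>e\<in>dimension_box M. tscale (to_fract (\<Upsilon> (Gr Q M e))) (inj_term Q (dimvec (vspace M)) i e))"
proof -
  have "motivic_integral \<Upsilon> (Gr Q M e) (\<lambda>_. inj_term Q (dimvec (vspace M)) i e)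
      = tscale (to_fract (\<Upsilon> (Gr Q M e))) (inj_term Q (dimvec (vspace M)) i e)" for e
    by (cases "Gr Q M e = {}") (simp_all add: motivic_integral_def Upsilon_empty tscale_0_left image_constant_conv)
  then show ?thesis unfolding character_def dimension_box_def by (simp only:)
qed

text \<open>For an empty Grassmannian \<open>r\<close> may be negative, but then both sides are 0;
  otherwise a submodule shows \<open>0 \<le> r\<close>, and \<open>nat r\<close> can be replaced by
  \<open>r\<close> in the exponent.\<close>

lemma Upsilon_total_space:
  assumes "linear_family (Gr Q M e) n S V Eq (nat r)" and "\<And>N. Defs.submodule Q M N \<Longrightarrow> dimvec N = e \<Longrightarrow> 0 \<le> r"
  shows "to_fract (\<Upsilon> (total_space (Gr Q M e) V - Gr Q M e)) = to_fract (\<Upsilon> (Gr Q M e)) * (tvar powi (2 * r) - 1)"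
proof (cases "(Gr Q M e :: ('c, 'i, nat) point set) = {}")
  case True
  then show ?thesis by (simp add: total_space_def Upsilon_empty)
next
  case False
  then have "0 \<le> r" using assms(2) by (auto simp: Gr_def)
  then have "tvar powi (2 * r) = tvar ^ (2 * nat r)" by (simp add: power_int_def nat_mult_distrib)
  then show ?thesis
    unfolding Upsilon_nonzero_vectors[OF assms(1)] by (simp add: to_fract_power tvar_def)
qed

end

locale quiver_data = compatible Q \<Lambda> + poincare \<Upsilon>
  for Q :: "('v::finite, 'a) quiver" and \<Lambda> and \<Upsilon> :: "('v \<times> nat \<times> nat, 'v, nat) point set \<Rightarrow> complex poly" +
  fixes M :: "('v, 'a, nat) rep"
  assumes arrows: "finite (arrows Q)" and M: "is_rep Q M"
begin

abbreviation "m \<equiv> dimvec (vspace M)"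

lemma finite_M: "finite (basis M v)"
  using M by (simp add: is_rep_def)

text \<open>The level sets are the bundles with fibres Hom(M/N, I) minus their zero sections, which
  are the Grassmannians themselves.\<close>

lemma integral_hom_inj_eq:
  assumes I: "injective_rep Q I"
  shows "integral_hom_inj \<Upsilon> Q M I = (\<Sum>e\<in>dimension_box M.
    tscale (to_fract (\<Upsilon> (Gr Q M e)) * (tvar powi (2 * (euler Q m (dimvec (vspace I)) - euler Q e (dimvec (vspace I)))) - 1))
      (inj_term Q m (dimvec (vspace I)) e))"
proof -
  let ?i = "dimvec (vspace I)"
  let ?Y = "{(f, N). f \<in> Hom Q M I \<and> f \<noteq> 0 \<and> Defs.submodule Q M N \<and> (\<forall>v. N v \<subseteq> hom_ker M f v)}"
  have level: "{y \<in> ?Y. dimvec (snd y) = e} = total_space (Gr Q M e) (Hom_vanishing Q M I) - Gr Q M e" for e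
    by (auto simp: total_space_def Gr_mem Hom_vanishing_def)
  have nonneg: "0 \<le> euler Q m ?i - euler Q e ?i" if "Defs.submodule Q M N" "dimvec N = e" for N e
    using dim_Hom_vanishing[OF arrows M I that(1)] unfolding that(2) by linarith
  have "integral_hom_inj \<Upsilon> Q M I = (\<Sum>e\<in>dimension_box M. tscale (to_fract (\<Upsilon> {y \<in> ?Y. dimvec (snd y) = e})) (inj_term Q m ?i e))"
    unfolding integral_hom_inj_def
  proof (rule motivic_integral_graded[where \<epsilon> = "\<lambda>y. dimvec (snd y)" and \<tau> = "inj_term Q m ?i"])
    show "inj_on (inj_term Q m ?i) (dimension_box M)" by (rule inj_on_subset[OF inj_inj_term subset_UNIV])
    fix y assume y: "y \<in> ?Y"
    obtain f N where fN: "y = (f, N)" by (cases y)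
    show "dimvec (snd y) \<in> dimension_box M" using y by (auto simp: fN intro: submodule_dimension_box[OF M])
    \<comment> \<open>Compared with m and i, the dimension vectors of kernel and cokernel both drop
      by that of the image, so their difference does not depend on \<open>f\<close>.\<close>
    have diff: "dimvec (hom_ker M f) - (?i - dimvec (hom_im M f)) = m - ?i"
      using dimvec_ker_im[OF finite_M, of f] by (simp add: algebra_simps)
    show "(case y of (f, N) \<Rightarrow> inj_term Q (dimvec (hom_ker M f)) (?i - dimvec (hom_im M f)) (dimvec N)) = inj_term Q m ?i (dimvec (snd y))"
      by (simp only: fN prod.case snd_conv inj_term_def diff)
  qed (rule Upsilon_empty finite_dimension_box)+
  then show ?thesis
    unfolding level by (simp only: Upsilon_total_space[OF linear_family_vanishing[OF arrows M I] nonneg])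
qed

lemma integral_hom_proj_eq:
  assumes P: "projective_rep Q P"
  shows "integral_hom_proj \<Upsilon> Q P M = (\<Sum>e\<in>dimension_box M.
    tscale (to_fract (\<Upsilon> (Gr Q M e)) * (tvar powi (2 * euler Q (dimvec (vspace P)) e) - 1))
      (proj_term Q m (dimvec (vspace P)) e))"
proof -
  let ?p = "dimvec (vspace P)"
  let ?Y = "{(h, N). h \<in> Hom Q P M \<and> h \<noteq> 0 \<and> Defs.submodule Q M N \<and> (\<forall>v. hom_im P h v \<subseteq> N v)}"
  have finP: "finite (basis P v)" for v using P by (simp add: projective_rep_def is_rep_def)
  have level: "{y \<in> ?Y. dimvec (snd y) = e} = total_space (Gr Q M e) (Hom_into Q P M) - Gr Q M e" for e
    by (auto simp: total_space_def Gr_mem Hom_into_def)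
  have nonneg: "0 \<le> euler Q ?p e" if "Defs.submodule Q M N" "dimvec N = e" for N e
    using dim_Hom_into[OF arrows M P that(1)] unfolding that(2) by linarith
  have "integral_hom_proj \<Upsilon> Q P M = (\<Sum>e\<in>dimension_box M. tscale (to_fract (\<Upsilon> {y \<in> ?Y. dimvec (snd y) = e})) (proj_term Q m ?p e))"
    unfolding integral_hom_proj_def
  proof (rule motivic_integral_graded[where \<epsilon> = "\<lambda>y. dimvec (snd y)" and \<tau> = "proj_term Q m ?p"])
    show "inj_on (proj_term Q m ?p) (dimension_box M)" by (rule inj_on_subset[OF inj_proj_term subset_UNIV])
    fix y assume y: "y \<in> ?Y"
    obtain h N where hN: "y = (h, N)" by (cases y)
    show "dimvec (snd y) \<in> dimension_box M" using y by (auto simp: hN intro: submodule_dimension_box[OF M])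
    \<comment> \<open>Kernel, cokernel and the submodule of the cokernel all drop by the image, so
      the differences p - e and m - e survive.\<close>
    have ker: "dimvec (hom_ker P h) - (dimvec N - dimvec (hom_im P h)) = ?p - dimvec N"
      using dimvec_ker_im[OF finP, of h] by (simp add: algebra_simps)
    have coker: "m - dimvec (hom_im P h) - (dimvec N - dimvec (hom_im P h)) = m - dimvec N" by simp
    show "(case y of (h, N) \<Rightarrow> proj_term Q (m - dimvec (hom_im P h)) (dimvec (hom_ker P h)) (dimvec N - dimvec (hom_im P h)))
        = proj_term Q m ?p (dimvec (snd y))"
      by (simp only: hN prod.case snd_conv proj_term_def ker coker)
  qed (rule Upsilon_empty finite_dimension_box)+
  then show ?thesis
    unfolding level by (simp only: Upsilon_total_space[OF linear_family_into[OF arrows M P] nonneg])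
qed

end

text \<open>The contribution of one \<open>e\<close>, with powers of t replaced by ring elements and
  the power coming from \<Lambda> kept as \<open>l\<close>. It serves both orders of multiplication,
  with \<open>a\<close> standing for t to the power <m, i> or -<m, i>.\<close>

lemma exchange_identity:
  fixes q :: "'r::comm_ring_1"
  assumes "r * s - s + a * (w * q) - a * q = (c - 1) * z" "x * y = l * z"
  shows "(c - 1) * (u * x * y) = l * (u * (r - 1) * s + a * (u * (w - 1) * q))"
proof -
  have "l * (u * (r - 1) * s + a * (u * (w - 1) * q)) = l * u * (r * s - s + a * (w * q) - a * q)"
    by (simp add: algebra_simps)
  also have "\<dots> = (c - 1) * (u * (l * z))" unfolding assms(1) by (simp add: mult_ac)
  finally show ?thesis unfolding assms(2)[symmetric] by (simp add: mult.assoc)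
qed

theorem theorem4p13:
  fixes Q :: "('v::finite, 'a) quiver"
    and M I P :: "('v, 'a, nat) rep"
    and \<Lambda> :: "int^'v^'v"
    and \<Upsilon> :: "(('v \<times> nat \<times> nat), 'v, nat) point set \<Rightarrow> complex poly"
    and m i :: "int^'v"
    and d :: nat
  assumes "acyclic_quiver Q"
    and "transpose \<Lambda> = - \<Lambda>"
    and "- (\<Lambda> ** (euler_matrix Q - transpose (euler_matrix Q))) = mat 1"
    and "virtual_poincare \<Upsilon>"
    and "is_rep Q M"
    and "injective_rep Q I"
    and "projective_rep Q P" and "iso_nakayama Q I P"
    and "m = dimvec (vspace M)" and "i = dimvec (vspace I)"
    and "d = cfun.dim (Hom Q M I)"
  shows
    "tscale (tvar ^ (2 * d) - 1) (tmult \<Lambda> (character \<Upsilon> Q M 0) (Xmon (lstar Q i))) =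
       tscale (tvar powi (bilin \<Lambda> (lstar Q i) (lstar Q m)))
         (integral_hom_inj \<Upsilon> Q M I
          + tscale (tvar powi (euler Q m i)) (integral_hom_proj \<Upsilon> Q P M)) \<and>
     tscale (tvar ^ (2 * d) - 1) (tmult \<Lambda> (Xmon (lstar Q i)) (character \<Upsilon> Q M 0)) =
       tscale (tvar powi (bilin \<Lambda> (lstar Q m) (lstar Q i)))
         (integral_hom_inj \<Upsilon> Q M I
          + tscale (tvar powi (- euler Q m i)) (integral_hom_proj \<Upsilon> Q P M))"
proof -
  have arrows: "finite (arrows Q)" using assms(1) by (simp add: acyclic_quiver_def)
  interpret quiver_data Q \<Lambda> \<Upsilon> M
    using assms(2-5) arrows by unfold_locales
  have I: "is_rep Q I" using assms(6) by (simp add: injective_rep_def)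
  define p where "p = dimvec (vspace P)"
  have star: "rstar Q p = lstar Q i"
    unfolding p_def assms(10) by (rule rstar_eq_lstar_nakayama[OF assms(1,7) I assms(8)])
  define a where "a = euler Q m i"
  have "a = int d" unfolding a_def assms(9-11) by (rule dim_Hom_injective[OF arrows assms(5,6), symmetric])
  then have d: "tvar ^ (2 * d) = tvar powi (2 * a)" by (simp add: power_int_def nat_mult_distrib)
  \<comment> \<open>In these terms the exponent of t at \<open>e\<close> is x for the character, x +
    b for the integral over Hom(M, I) and a - b + x for the one over Hom(P, M), the last by <p, y> =
    <y, i>. Both integrals share the monomial with exponent \<open>\<beta> e\<close>.\<close>
  define b where "b e = euler Q e i" for e
  define x where "x e = - euler Q e (m - e)" for e
  define u where "u e = to_fract (\<Upsilon> (Gr Q M e))" for e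
  define \<alpha> where "\<alpha> e = lstar Q e - rstar Q e - lstar Q m" for e
  let ?A = "dimension_box M" and ?i = "lstar Q i"
  define \<beta> where "\<beta> e = \<alpha> e + ?i" for e
  have character: "character \<Upsilon> Q M 0 = (\<Sum>e\<in>?A. Poly_Mapping.single (\<alpha> e) (u e * tvar powi x e))"
    unfolding character_eq by (simp add: inj_term_def Xmon_def tscale_single \<alpha>_def u_def x_def lstar_diff lstar_add euler_diff_right assms(9) algebra_simps)
  have injective: "integral_hom_inj \<Upsilon> Q M I = (\<Sum>e\<in>?A. Poly_Mapping.single (\<beta> e) (u e * (tvar powi (2 * (a - b e)) - 1) * tvar powi (x e + b e)))"
    unfolding integral_hom_inj_eq[OF assms(6)]
    by (simp add: inj_term_def Xmon_def tscale_single \<beta>_def \<alpha>_def u_def x_def a_def b_def lstar_diff lstar_add euler_diff_right euler_add_right assms(9,10) algebra_simps)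
  have projective: "integral_hom_proj \<Upsilon> Q P M = (\<Sum>e\<in>?A. Poly_Mapping.single (\<beta> e) (u e * (tvar powi (2 * b e) - 1) * tvar powi (a - b e + x e)))"
    unfolding integral_hom_proj_eq[OF assms(7)]
    by (simp add: proj_term_def Xmon_def tscale_single \<beta>_def \<alpha>_def u_def x_def a_def b_def lstar_diff rstar_diff euler_diff_left
        star[unfolded p_def] euler_rstar_lstar[OF star[unfolded p_def]] assms(9) lstar_add euler_diff_right euler_add_right algebra_simps)
  \<comment> \<open>The part B e of \<open>\<alpha> e\<close> contributes <e, i>; the part
    independent of \<open>e\<close> gives the common prefactor.\<close>
  have left: "bilin \<Lambda> (\<alpha> e) ?i = b e + bilin \<Lambda> ?i (lstar Q m)" for e
    unfolding \<alpha>_def bilin_diff_left[of \<Lambda> _ "lstar Q m"] bilin_star_diff b_def using skew_bilin[of "lstar Q m" ?i] by simp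
  have right: "bilin \<Lambda> ?i (\<alpha> e) = - b e + bilin \<Lambda> (lstar Q m) ?i" for e
    using left[of e] skew_bilin[of ?i "\<alpha> e"] skew_bilin[of "lstar Q m" ?i] by simp
  have t: "tvar powi (j + k) = tvar powi j * tvar powi k" for j k by (rule power_int_add) (simp add: tvar_nonzero)
  have "(tvar powi (2 * a) - 1) * (u e * tvar powi x e * tvar powi (b e + l)) =
      tvar powi l * (u e * (tvar powi (2 * (a - b e)) - 1) * tvar powi (x e + b e)
        + tvar powi a * (u e * (tvar powi (2 * b e) - 1) * tvar powi (a - b e + x e)))" for e l
  proof (rule exchange_identity)
    have 1: "tvar powi (2 * (a - b e)) * tvar powi (x e + b e) = tvar powi a * tvar powi (a - b e + x e)"
      unfolding t[symmetric] by (rule arg_cong[where f = "(powi) tvar"]) simp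
    have 2: "tvar powi a * (tvar powi (2 * b e) * tvar powi (a - b e + x e)) = tvar powi (2 * a) * tvar powi (x e + b e)"
      unfolding t[symmetric] by (rule arg_cong[where f = "(powi) tvar"]) simp
    show "tvar powi (2 * (a - b e)) * tvar powi (x e + b e) - tvar powi (x e + b e) + tvar powi a * (tvar powi (2 * b e) * tvar powi (a - b e + x e)) - tvar powi a * tvar powi (a - b e + x e) = (tvar powi (2 * a) - 1) * tvar powi (x e + b e)"
      unfolding 1 2 by (simp add: left_diff_distrib)
    show "tvar powi x e * tvar powi (b e + l) = tvar powi l * tvar powi (x e + b e)"
      unfolding t[symmetric] by (rule arg_cong[where f = "(powi) tvar"]) simp
  qed
  \<comment> \<open>In the opposite order \<open>b\<close> changes sign, and the identity is t^(-b)
    (t^(2a) - 1) = (t^(2(a-b)) - 1) t^b + t^(-a) (t^(2b) - 1) t^(a-b).\<close>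
  moreover have "(tvar powi (2 * a) - 1) * (u e * tvar powi x e * tvar powi (- b e + l)) =
      tvar powi l * (u e * (tvar powi (2 * (a - b e)) - 1) * tvar powi (x e + b e)
        + tvar powi (- a) * (u e * (tvar powi (2 * b e) - 1) * tvar powi (a - b e + x e)))" for e l
  proof (rule exchange_identity)
    have 1: "tvar powi (2 * (a - b e)) * tvar powi (x e + b e) = tvar powi (2 * a) * tvar powi (x e - b e)"
      unfolding t[symmetric] by (rule arg_cong[where f = "(powi) tvar"]) simp
    have 2: "tvar powi (- a) * (tvar powi (2 * b e) * tvar powi (a - b e + x e)) = tvar powi (x e + b e)"
      unfolding t[symmetric] by (rule arg_cong[where f = "(powi) tvar"]) simp
    have 3: "tvar powi (- a) * tvar powi (a - b e + x e) = tvar powi (x e - b e)"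
      unfolding t[symmetric] by (rule arg_cong[where f = "(powi) tvar"]) simp
    show "tvar powi (2 * (a - b e)) * tvar powi (x e + b e) - tvar powi (x e + b e) + tvar powi (- a) * (tvar powi (2 * b e) * tvar powi (a - b e + x e)) - tvar powi (- a) * tvar powi (a - b e + x e) = (tvar powi (2 * a) - 1) * tvar powi (x e - b e)"
      unfolding 1 2 3 by (simp add: left_diff_distrib)
    show "tvar powi x e * tvar powi (- b e + l) = tvar powi l * tvar powi (x e - b e)"
      unfolding t[symmetric] by (rule arg_cong[where f = "(powi) tvar"]) simp
  qed
  ultimately show ?thesis
    unfolding character injective projective tmult_sum_Xmon_right tmult_Xmon_left_sum left right d a_def[symmetric]
      tscale_sum tscale_add tscale_single sum.distrib[symmetric] single_add[symmetric] distrib_left[symmetric] \<beta>_def[symmetric]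
    by (simp only:)
qed

end
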